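(* Let $d\ge1$, $0<p<q\le\infty$, $\alpha>0$, and $\gamma\ge0$. Then $$\sup_{T\in\mathcal{T}'_n}\frac{\|(-\Delta)^{\alpha/2}T\|_q}{\|(-\Delta)^{(\alpha+\gamma)/2}T\|_p}\asymp\sigma_\Delta(n),$$ where $\sigma_\Delta(\cdot)$ is given as follows: (1) if $0<p\le1$ and $p<q\le\infty$, then $$\sigma_\Delta(t):=\begin{cases} t^{d(\frac1p-1)}, & \gamma>d(1-\frac1q)_+;\\ t^{d(\frac1p-1)}\ln^{\frac1{q_1}}(t+1), & 0<\gamma=d(1-\frac1q)_+;\\ t^{d(\frac1p-\frac1q)-\gamma}, & 0<\gamma<d(1-\frac1q)_+;\\ t^{d(\frac1p-\frac1q)}, & \gamma=0;\end{cases}$$ (2) if $1<p<q\le\infty$, then $$\sigma_\Delta(t):=\begin{cases}1, & \gamma\ge d(\frac1p-\frac1q),\ q<\infty;\\ 1, & \gamma>\frac dp,\ q=\infty;\\ \ln^{\frac1{p'}}(t+1), & \gamma=\frac dp,\ q=\infty;\\ t^{d(\frac1p-\frac1q)-\gamma}, & 0\le\gamma<d(\frac1p-\frac1q).\end{cases}$$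
   Context: $\mathbb{T}^d=\mathbb{R}^d/2\pi\mathbb{Z}^d$, $\|\cdot\|_p$ is the (quasi-)norm of $L_p(\mathbb{T}^d)$. $\mathcal{T}_n$ is the span of $e^{i(k,x)}$, $k\in\mathbb{Z}^d$, $|k|_\infty=\max_j|k_j|\le n$; $\mathcal{T}'_n=\{T\in\mathcal{T}_n: T\not\equiv0,\ \int_{\mathbb{T}^d}T(x)\,dx=0\}$. For $T(x)=\sum_{k}c_ke^{i(k,x)}$, $(-\Delta)^{\alpha/2}T(x)=\sum_k|k|^\alpha c_ke^{i(k,x)}$, $|k|$ being the Euclidean norm. $a_+=\max(a,0)$; $q_1=q$ if $q<\infty$, $q_1=1$ if $q=\infty$; $1/p+1/p'=1$; $1/q=0$ for $q=\infty$. $A\asymp B$ means $C^{-1}B\le A\le CB$ with $C>0$ independent of $n\in\mathbb{N}$. *)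

theory Defs
  imports "HOL-Analysis.Analysis" "HOL-Probability.Essential_Supremum"
begin

text \<open>
  Functions on the torus are represented by functions on \<open>real ^ 'd\<close> that are periodic with period
  $2\pi$ in each variable (trigonometric polynomials are so automatically); integrals over the
  torus are integrals over the fundamental cube with unnormalized Lebesgue measure. The dimension
  $d \ge 1$ is \<open>CARD('d)\<close>.
\<close>

abbreviation torus :: "(real ^ 'd) measure" where
  "torus \<equiv> lebesgue_on (cbox 0 (\<chi> j. 2 * pi))"

text \<open>
  The (quasi-)norm of $L_p$ for $0 < p \le \infty$. Being real-valued it is meaningful only for
  functions in $L_p$ (outside it Isabelle's conventions give 0); below it is applied to
  trigonometric polynomials only.
\<close>

definition Lp_norm :: "ereal \<Rightarrow> (real ^ 'd \<Rightarrow> complex) \<Rightarrow> real" where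
  "Lp_norm p f =
     (if p = \<infinity> then real_of_ereal (esssup torus (\<lambda>x. ereal (norm (f x))))
      else (LINT x|torus. norm (f x) powr real_of_ereal p) powr (1 / real_of_ereal p))"

definition real_vec :: "int ^ 'd \<Rightarrow> real ^ 'd" where
  "real_vec k = (\<chi> j. real_of_int (k $ j))"

definition expi :: "int ^ 'd \<Rightarrow> real ^ 'd \<Rightarrow> complex" where
  "expi k x = exp (\<i> * complex_of_real (real_vec k \<bullet> x))"

definition freqs :: "nat \<Rightarrow> (int ^ 'd) set" where
  "freqs n = {k. infnorm (real_vec k) \<le> real n}"

definition trig_polys :: "nat \<Rightarrow> (real ^ 'd \<Rightarrow> complex) set" where
  "trig_polys n = {T. \<exists>c. T = (\<lambda>x. \<Sum>k\<in>freqs n. c k * expi k x)}"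

definition trig_polys' :: "nat \<Rightarrow> (real ^ 'd \<Rightarrow> complex) set" where
  "trig_polys' n = {T \<in> trig_polys n. T \<noteq> (\<lambda>_. 0) \<and> (LINT x|torus. T x) = 0}"

text \<open>
  The coefficients in the (unique) representation of a trigonometric polynomial as a finite
  linear combination of exponentials; see \<open>trig_coeff_eq\<close> below.
\<close>

definition trig_coeff :: "(real ^ 'd \<Rightarrow> complex) \<Rightarrow> int ^ 'd \<Rightarrow> complex" where
  "trig_coeff T = (THE c. finite {k. c k \<noteq> 0} \<and> T = (\<lambda>x. \<Sum>k | c k \<noteq> 0. c k * expi k x))"

text \<open>
  \<open>frac_lap s\<close> is $(-\Delta)^{s/2}$, i.e. the Fourier multiplier with symbol $|k|^s$, for $s > 0$;
  recall that \<open>0 powr s = 0\<close>.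
\<close>

definition frac_lap :: "real \<Rightarrow> (real ^ 'd \<Rightarrow> complex) \<Rightarrow> real ^ 'd \<Rightarrow> complex" where
  "frac_lap s T = (\<lambda>x. \<Sum>k | trig_coeff T k \<noteq> 0.
     complex_of_real (norm (real_vec k) powr s) * trig_coeff T k * expi k x)"

text \<open>\<open>1 / q\<close>, which is 0 for \<open>q = \<infinity>\<close>.\<close>

definition recip :: "ereal \<Rightarrow> real" where
  "recip q = (if q = \<infinity> then 0 else 1 / real_of_ereal q)"

definition q1 :: "ereal \<Rightarrow> real" where
  "q1 q = (if q = \<infinity> then 1 else real_of_ereal q)"

text \<open>In the branch \<open>\<gamma> = d / p\<close>, \<open>q = \<infinity>\<close> the exponent \<open>1 - 1 / p\<close> is $1/p'$.\<close>

definition sigma_lap :: "nat \<Rightarrow> real \<Rightarrow> ereal \<Rightarrow> real \<Rightarrow> real \<Rightarrow> real" where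
  "sigma_lap d p q \<gamma> t =
     (if p \<le> 1 then
        (let c = real d * max (1 - recip q) 0 in
         if \<gamma> > c then t powr (real d * (1 / p - 1))
         else if 0 < \<gamma> \<and> \<gamma> = c then t powr (real d * (1 / p - 1)) * ln (t + 1) powr (1 / q1 q)
         else if 0 < \<gamma> \<and> \<gamma> < c then t powr (real d * (1 / p - recip q) - \<gamma>)
         else t powr (real d * (1 / p - recip q)))
      else
        (if q < \<infinity> \<and> \<gamma> \<ge> real d * (1 / p - recip q) then 1
         else if q = \<infinity> \<and> \<gamma> > real d / p then 1
         else if q = \<infinity> \<and> \<gamma> = real d / p then ln (t + 1) powr (1 - 1 / p)
         else t powr (real d * (1 / p - recip q) - \<gamma>)))"

text \<open>
  Two-sided comparison with a constant independent of $n \in \{1, 2, \dots\}$. The left-hand side is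
  extended-real valued since it will be a supremum; the upper bound includes its finiteness.
\<close>

definition asymp_equiv_const :: "(nat \<Rightarrow> ereal) \<Rightarrow> (nat \<Rightarrow> real) \<Rightarrow> bool" where
  "asymp_equiv_const A B \<longleftrightarrow>
     (\<exists>C>0. \<forall>n\<ge>1. ereal (inverse C * B n) \<le> A n \<and> A n \<le> ereal (C * B n))"

lemma expi_add: "expi k (x + y) = expi k x * expi k y"
  by (simp add: expi_def inner_add_right algebra_simps exp_add)

lemma expi_distinct:
  assumes "k \<noteq> l"
  obtains y where "expi k y \<noteq> expi l y"
proof -
  from assms obtain j where j: "k $ j \<noteq> l $ j" by (auto simp: vec_eq_iff)
  define m where "m = k $ j - l $ j"
  have m: "m \<noteq> 0" using j by (simp add: m_def)
  define y where "y = axis j (pi / real_of_int m)"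
  have e: "expi h y = exp (\<i> * complex_of_real (real_of_int (h $ j) * (pi / real_of_int m)))" for h
    by (simp add: expi_def y_def inner_axis real_vec_def)
  have "real_of_int (k $ j) * (pi / real_of_int m) = real_of_int (l $ j) * (pi / real_of_int m) + pi"
    using m by (simp add: m_def field_simps)
  then have "expi k y = - expi l y"
    by (simp only: e of_real_add distrib_left exp_add) (simp add: exp_pi_i')
  moreover have "expi l y \<noteq> 0" by (simp add: expi_def)
  ultimately show ?thesis using that[of y] by auto
qed

lemma expi_independent:
  assumes "finite S" "\<And>x. (\<Sum>k\<in>S. c k * expi k x) = 0" "k \<in> S"
  shows "c k = 0"
  using assms
proof (induction S arbitrary: c k rule: finite_induct)
  case empty
  then show ?case by simp
next
  case (insert l S)
  have *: "c h = 0" if h: "h \<in> S" for h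
  proof -
    from h insert.hyps have "h \<noteq> l" by auto
    then obtain y where y: "expi h y \<noteq> expi l y" by (rule expi_distinct)
    have "(\<Sum>h\<in>S. (c h * (expi h y - expi l y)) * expi h x) = 0" for x
    proof -
      have "(\<Sum>h\<in>S. (c h * (expi h y - expi l y)) * expi h x)
          = (\<Sum>h\<in>insert l S. (c h * (expi h y - expi l y)) * expi h x)"
        using insert.hyps by simp
      also have "\<dots> = (\<Sum>h\<in>insert l S. c h * expi h (x + y))
                    - expi l y * (\<Sum>h\<in>insert l S. c h * expi h x)"
        unfolding sum_distrib_left sum_subtractf[symmetric]
        by (intro sum.cong) (auto simp: expi_add algebra_simps)
      finally show ?thesis by (simp only: insert.prems(1)) simp
    qed
    from insert.IH[OF this h] y show ?thesis by simp
  qed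
  have "c l * expi l 0 = 0"
    using insert.prems(1)[of 0] insert.hyps * by simp
  then have "c l = 0" by (simp add: expi_def)
  with * insert.prems(2) show ?case by auto
qed

lemma trig_coeff_eq:
  fixes c :: "int ^ 'd \<Rightarrow> complex"
  assumes S: "finite S"
  shows "trig_coeff (\<lambda>x. \<Sum>k\<in>S. c k * expi k x) = (\<lambda>k. if k \<in> S then c k else 0)"
  unfolding trig_coeff_def
proof (rule the_equality)
  let ?c = "\<lambda>k. if k \<in> S then c k else 0"
  have fin: "finite {k. ?c k \<noteq> 0}" by (rule finite_subset[OF _ S]) auto
  have "(\<Sum>k | ?c k \<noteq> 0. ?c k * expi k x) = (\<Sum>k\<in>S. c k * expi k x)" for x
    by (rule sum.mono_neutral_cong_left) (use S in \<open>auto split: if_splits\<close>)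
  with fin show "finite {k. ?c k \<noteq> 0} \<and>
      (\<lambda>x. \<Sum>k\<in>S. c k * expi k x) = (\<lambda>x. \<Sum>k | ?c k \<noteq> 0. ?c k * expi k x)"
    by auto
next
  fix b :: "int ^ 'd \<Rightarrow> complex"
  assume b: "finite {k. b k \<noteq> 0} \<and>
    (\<lambda>x. \<Sum>k\<in>S. c k * expi k x) = (\<lambda>x. \<Sum>k | b k \<noteq> 0. b k * expi k x)"
  let ?c = "\<lambda>k. if k \<in> S then c k else 0"
  define U where "U = S \<union> {k. b k \<noteq> 0}"
  have U: "finite U" using S b by (simp add: U_def)
  have "(\<Sum>k\<in>U. (?c k - b k) * expi k x) = 0" for x
  proof -
    have "(\<Sum>k\<in>U. ?c k * expi k x) = (\<Sum>k\<in>S. c k * expi k x)"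
      by (rule sum.mono_neutral_cong_right) (use U in \<open>auto simp: U_def\<close>)
    moreover have "(\<Sum>k\<in>U. b k * expi k x) = (\<Sum>k | b k \<noteq> 0. b k * expi k x)"
      by (rule sum.mono_neutral_right) (use U in \<open>auto simp: U_def\<close>)
    moreover have "(\<Sum>k\<in>S. c k * expi k x) = (\<Sum>k | b k \<noteq> 0. b k * expi k x)"
      using fun_cong[OF conjunct2[OF b], of x] .
    ultimately show ?thesis by (simp add: left_diff_distrib sum_subtractf del: if_distrib)
  qed
  from expi_independent[OF U this] have "?c k = b k" if "k \<in> U" for k
    using that by fastforce
  moreover have "?c k = b k" if "k \<notin> U" for k
    using that by (simp add: U_def)
  ultimately show "b = ?c" by metis
qed

lemma frac_lap_eq:
  assumes S: "finite S"
  shows "frac_lap s (\<lambda>x. \<Sum>k\<in>S. c k * expi k x) =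
    (\<lambda>x. \<Sum>k\<in>S. complex_of_real (norm (real_vec k) powr s) * c k * expi k x)"
  unfolding frac_lap_def trig_coeff_eq[OF S]
  by (rule ext, rule sum.mono_neutral_cong_left) (use S in \<open>auto split: if_splits\<close>)

lemma finite_freqs: "finite (freqs n :: (int ^ 'd) set)"
proof -
  let ?B = "PiE (UNIV :: 'd set) (\<lambda>_. {- int n..int n})"
  have "freqs n \<subseteq> (\<lambda>f. \<chi> j. f j) ` ?B"
  proof
    fix k :: "int ^ 'd" assume k: "k \<in> freqs n"
    have "k $ j \<in> {- int n..int n}" for j
      using component_le_infnorm_cart[of "real_vec k" j] k
      by (auto simp: freqs_def real_vec_def)
    then have "($) k \<in> ?B" by auto
    then show "k \<in> (\<lambda>f. \<chi> j. f j) ` ?B" by (rule rev_image_eqI) simp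
  qed
  moreover have "finite ?B" by (intro finite_PiE) auto
  ultimately show ?thesis by (meson finite_imageI finite_subset)
qed

end

theory Submission
  imports Defs "HOL-Probability.Characteristic_Functions"
begin

text \<open>
  Substituting \<open>S = (-\<Delta>)\<^bsup>(\<alpha>+\<gamma>)/2\<^esup> T\<close> the quotient becomes \<open>\<parallel>I S\<parallel>\<^sub>q / \<parallel>S\<parallel>\<^sub>p\<close> with the Riesz potential
  \<open>I = (-\<Delta>)\<^bsup>-\<gamma>/2\<^esup>\<close>, which is the integral of \<open>t\<^bsup>\<gamma>/2-1\<^esup> H\<^sub>t S\<close> over the heat semigroup \<open>H\<^sub>t\<close> up to a constant.
  The heat kernel is the periodized Gaussian, hence \<open>|H\<^sub>t S| \<le> h + H\<^sub>t(|S| 1\<^bsub>|S|>h\<^esub>)\<close> for every height \<open>h\<close>;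
  together with the smoothing bound \<open>L\<^sub>1 \<rightarrow> L\<^sub>\<infinity>\<close> and a suitable choice of \<open>h\<close> this estimates the
  level sets of \<open>I S\<close>, and integrating over the levels gives all critical cases, the others following
  from them by Nikolskii's inequality, which also reduces \<open>p < 1\<close> to \<open>p = 1\<close>.

  The lower bounds come from differences of two translates of a power of the Fejer kernel: their
  potentials are large at the origin, and where a power \<open>1/q\<close> of the logarithm is lost there, the
  upper bounds already obtained are used by duality.
\<close>

text \<open>The heat kernel enters only through its symbol, positivity, unit mass and a bound of
  order \<open>t powr (- d / 2)\<close> for its periodization, so one level set estimate serves
  \<open>p = 1\<close> and \<open>p > 1\<close>. At \<open>p = 1\<close>, however, it only says that
  the level sets have measure of order \<open>l powr (- q)\<close>, where
  \<open>\<gamma> = d * (1 - 1 / q)\<close>. The q-th moment is then an integral of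
  \<open>1 / l\<close> up to the height \<open>n powr (d - \<gamma>)\<close> which a polynomial of
  degree \<open>n\<close> allows; it is of order \<open>ln n\<close>, and its root is the origin of
  the exponent \<open>1 / q\<close>. For \<open>p > 1\<close> the cut height grows with the level,
  and the same integral converges. The obstacle to lower bounds is the zero mean: for
  \<open>p < 1\<close> the quasi-norm of the kernel tends to 0 while its mean stays of order 1, so
  subtracting the mean would spoil the kernel, whereas subtracting a translate does not. At
  \<open>\<gamma> = d / p\<close>, \<open>q = \<infinity>\<close> with \<open>p > 1\<close> the
  difference is moreover replaced by its own potential of order
  \<open>d * (1 - 1 / p)\<close>.\<close>

section \<open>Periodization and integration over a period cube\<close>

abbreviation d2pi :: "int ^ 'd \<Rightarrow> real ^ 'd" where
  "d2pi m \<equiv> (2 * pi) *\<^sub>R real_vec m"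

text \<open>Half-open, so that its lattice translates partition the space exactly; it differs from
  the closed cube of \<open>torus\<close> only by faces of measure zero
  (\<open>AE_mem_period_cube_iff\<close>).\<close>

definition period_cube :: "(real ^ 'd) set" where
  "period_cube = {x. \<forall>j. 0 \<le> x $ j \<and> x $ j < 2 * pi}"

definition periodic :: "(real ^ 'd \<Rightarrow> 'a) \<Rightarrow> bool" where
  "periodic g \<longleftrightarrow> (\<forall>x m. g (x + d2pi m) = g x)"

lemma period_cube_measurable [measurable]: "period_cube \<in> sets borel"
  unfolding period_cube_def by measurable

lemma period_cube_translate_unique: "\<exists>!m. x + d2pi m \<in> period_cube"
proof (rule ex_ex1I)
  let ?m = "\<chi> j. - \<lfloor>x $ j / (2 * pi)\<rfloor>"
  show "\<exists>m. x + d2pi m \<in> period_cube"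
  proof
    show "x + d2pi ?m \<in> period_cube"
      unfolding period_cube_def real_vec_def
    proof (simp, intro allI conjI)
      fix j
      have a: "of_int \<lfloor>x $ j / (2 * pi)\<rfloor> \<le> x $ j / (2 * pi)" "x $ j / (2 * pi) < of_int \<lfloor>x $ j / (2 * pi)\<rfloor> + 1"
        by linarith+
      have p: "2 * pi > 0" by simp
      from a(1) p show "2 * pi * real_of_int \<lfloor>x $ j / (2 * pi)\<rfloor> \<le> x $ j"
        by (metis pos_le_divide_eq mult.commute)
      from a(2) p have "x $ j < (of_int \<lfloor>x $ j / (2 * pi)\<rfloor> + 1) * (2 * pi)"
        by (metis pos_divide_less_eq)
      then show "x $ j - 2 * pi * real_of_int \<lfloor>x $ j / (2 * pi)\<rfloor> < 2 * pi"
        by (simp add: algebra_simps)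
    qed
  qed
next
  fix m l assume m: "x + d2pi m \<in> period_cube" and l: "x + d2pi l \<in> period_cube"
  have "m $ j = l $ j" for j
  proof -
    have "0 \<le> x $ j + 2 * pi * real_of_int (m $ j)" "x $ j + 2 * pi * real_of_int (m $ j) < 2 * pi"
      "0 \<le> x $ j + 2 * pi * real_of_int (l $ j)" "x $ j + 2 * pi * real_of_int (l $ j) < 2 * pi"
      using m l by (auto simp: period_cube_def real_vec_def)
    then have "2 * pi * (real_of_int (m $ j) - real_of_int (l $ j)) < 2 * pi * 1"
      "2 * pi * (real_of_int (l $ j) - real_of_int (m $ j)) < 2 * pi * 1"
      by (simp_all add: algebra_simps)
    then have "real_of_int (m $ j) - real_of_int (l $ j) < 1" "real_of_int (l $ j) - real_of_int (m $ j) < 1"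
      by (subst (asm) mult_less_cancel_left_pos; simp)+
    then show ?thesis by linarith
  qed
  then show "m = l" by (simp add: vec_eq_iff)
qed

text \<open>The partition of space by translated cubes, written as an integral over counting measure
  so that Tonelli's theorem can exchange it with integrals over space.\<close>

lemma nn_integral_indicator_translates:
  "(\<integral>\<^sup>+m. indicator period_cube (x + d2pi m) \<partial>count_space UNIV) = 1"
proof -
  obtain m where m: "x + d2pi m \<in> period_cube" and u: "\<And>l. x + d2pi l \<in> period_cube \<Longrightarrow> l = m"
    using period_cube_translate_unique[of x] by auto
  have "(\<lambda>l. indicator period_cube (x + d2pi l)) = (indicator {m} :: _ \<Rightarrow> ennreal)"
  proof
    fix l show "indicator period_cube (x + d2pi l) = (indicator {m} l :: ennreal)"
    proof (cases "l = m")
      case True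
      then show ?thesis using m by (simp only: indicator_simps singletonI)
    next
      case False
      then have "x + d2pi l \<notin> period_cube" using u by blast
      then show ?thesis using False by (simp only: indicator_simps singleton_iff not_False_eq_True)
    qed
  qed
  then show ?thesis by simp
qed

lemma nn_integral_lborel_shift:
  fixes f :: "'a::euclidean_space \<Rightarrow> ennreal"
  assumes [measurable]: "f \<in> borel_measurable borel"
  shows "(\<integral>\<^sup>+x. f (a + x) \<partial>lborel) = (\<integral>\<^sup>+x. f x \<partial>lborel)"
proof -
  have "(\<integral>\<^sup>+x. f x \<partial>lborel) = (\<integral>\<^sup>+x. f x \<partial>distr lborel borel ((+) a))"
    by (simp add: lborel_distr_plus)
  also have "\<dots> = (\<integral>\<^sup>+x. f (a + x) \<partial>lborel)"
    by (subst nn_integral_distr) auto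
  finally show ?thesis ..
qed

text \<open>The partition of unity by translated cubes is inserted and each piece is moved back to
  the cube, where \<open>g\<close> does not notice the translation while \<open>u\<close> becomes
  periodized. Everything is nonnegative, so the exchanges are free of summability
  conditions.\<close>

lemma nn_integral_tile:
  fixes u g :: "real ^ 'd \<Rightarrow> ennreal"
  assumes [measurable]: "u \<in> borel_measurable borel" "g \<in> borel_measurable borel"
    and g: "periodic g"
  shows "(\<integral>\<^sup>+y. u y * g y \<partial>lborel)
    = (\<integral>\<^sup>+y. (\<integral>\<^sup>+m. u (y + d2pi m) \<partial>count_space UNIV) * g y * indicator period_cube y \<partial>lborel)"
proof -
  have "(\<integral>\<^sup>+y. u y * g y \<partial>lborel)
      = (\<integral>\<^sup>+y. (\<integral>\<^sup>+m. u y * g y * indicator period_cube (y + d2pi m) \<partial>count_space UNIV) \<partial>lborel)"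
    by (simp add: nn_integral_cmult nn_integral_indicator_translates)
  also have "\<dots> = (\<integral>\<^sup>+m. (\<integral>\<^sup>+y. u y * g y * indicator period_cube (y + d2pi m) \<partial>lborel) \<partial>count_space UNIV)"
    by (rule nn_integral_count_space_nn_integral) auto
  also have "\<dots> = (\<integral>\<^sup>+m. (\<integral>\<^sup>+y. u (y - d2pi m) * g y * indicator period_cube y \<partial>lborel) \<partial>count_space UNIV)"
  proof (rule nn_integral_cong)
    fix m :: "int ^ 'd"
    have "(\<integral>\<^sup>+y. u y * g y * indicator period_cube (y + d2pi m) \<partial>lborel) =
      (\<integral>\<^sup>+y. (\<lambda>y. u (y - d2pi m) * g y * indicator period_cube y) (d2pi m + y) \<partial>lborel)"
      using g by (auto intro!: nn_integral_cong simp: periodic_def add.commute)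
    also have "\<dots> = (\<integral>\<^sup>+y. u (y - d2pi m) * g y * indicator period_cube y \<partial>lborel)"
      by (rule nn_integral_lborel_shift) measurable
    finally show "(\<integral>\<^sup>+y. u y * g y * indicator period_cube (y + d2pi m) \<partial>lborel) =
      (\<integral>\<^sup>+y. u (y - d2pi m) * g y * indicator period_cube y \<partial>lborel)" .
  qed
  also have "\<dots> = (\<integral>\<^sup>+m. (\<integral>\<^sup>+y. u (y + d2pi m) * g y * indicator period_cube y \<partial>lborel) \<partial>count_space UNIV)"
  proof (rule nn_integral_bij_count_space[symmetric, of uminus UNIV UNIV "\<lambda>m. (\<integral>\<^sup>+y. u (y - d2pi m) * g y * indicator period_cube y \<partial>lborel)", THEN trans])
    show "bij (uminus :: int ^ 'd \<Rightarrow> int ^ 'd)" by (rule bij_uminus)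
    have "real_vec (- m) = - real_vec m" for m :: "int ^ 'd"
      by (simp add: real_vec_def vec_eq_iff)
    then show "(\<integral>\<^sup>+m. (\<integral>\<^sup>+y. u (y - d2pi (- m)) * g y * indicator period_cube y \<partial>lborel) \<partial>count_space UNIV) =
      (\<integral>\<^sup>+m. (\<integral>\<^sup>+y. u (y + d2pi m) * g y * indicator period_cube y \<partial>lborel) \<partial>count_space UNIV)"
      by simp
  qed
  also have "\<dots> = (\<integral>\<^sup>+y. (\<integral>\<^sup>+m. u (y + d2pi m) * g y * indicator period_cube y \<partial>count_space UNIV) \<partial>lborel)"
    by (rule nn_integral_count_space_nn_integral[symmetric]) auto
  also have "\<dots> = (\<integral>\<^sup>+y. (\<integral>\<^sup>+m. u (y + d2pi m) \<partial>count_space UNIV) * g y * indicator period_cube y \<partial>lborel)"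
    by (intro nn_integral_cong) (simp add: nn_integral_multc mult.assoc)
  finally show ?thesis .
qed

abbreviation cube_measure :: "(real ^ 'd) measure" where "cube_measure \<equiv> restrict_space lborel period_cube"

lemma nn_integral_cube:
  "(\<integral>\<^sup>+x. f x \<partial>cube_measure) = (\<integral>\<^sup>+x. f x * indicator period_cube x \<partial>lborel)"
  by (rule nn_integral_restrict_space) simp

text \<open>Integration over a shifted cube is tiling with \<open>u\<close> the indicator of that
  cube, whose periodization is identically 1.\<close>

lemma nn_integral_cube_shift:
  fixes g :: "real ^ 'd \<Rightarrow> ennreal"
  assumes [measurable]: "g \<in> borel_measurable borel" and g: "periodic g"
  shows "(\<integral>\<^sup>+x. g (a + x) \<partial>cube_measure) = (\<integral>\<^sup>+x. g x \<partial>cube_measure)"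
proof -
  have "(\<integral>\<^sup>+x. g (a + x) \<partial>cube_measure) = (\<integral>\<^sup>+x. (\<lambda>y. indicator period_cube (y - a) * g y) (a + x) \<partial>lborel)"
    unfolding nn_integral_cube by (intro nn_integral_cong) (auto simp: mult.commute)
  also have "\<dots> = (\<integral>\<^sup>+y. indicator period_cube (y - a) * g y \<partial>lborel)"
    by (rule nn_integral_lborel_shift) measurable
  also have "\<dots> = (\<integral>\<^sup>+y. (\<integral>\<^sup>+m. indicator period_cube (y + d2pi m - a) \<partial>count_space UNIV) * g y * indicator period_cube y \<partial>lborel)"
    by (rule nn_integral_tile[OF _ _ g]) measurable
  also have "\<dots> = (\<integral>\<^sup>+y. g y * indicator period_cube y \<partial>lborel)"
  proof (rule nn_integral_cong)
    fix y
    have "(\<integral>\<^sup>+m. indicator period_cube (y + d2pi m - a) \<partial>count_space UNIV) = (1::ennreal)"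
      using nn_integral_indicator_translates[of "y - a"] by (simp add: algebra_simps)
    then show "(\<integral>\<^sup>+m. indicator period_cube (y + d2pi m - a) \<partial>count_space UNIV) * g y * indicator period_cube y = g y * indicator period_cube y"
      by simp
  qed
  finally show ?thesis by (simp add: nn_integral_cube)
qed

lemma AE_lborel_cart_neq: "AE x in lborel. (x :: real ^ 'd) $ j \<noteq> a"
proof -
  have "negligible {x :: real^'d. axis j 1 \<bullet> x = a}"
    by (rule negligible_hyperplane) (auto simp: axis_eq_0_iff)
  moreover have "{x :: real^'d. x $ j = a} \<in> sets lborel"
    by simp
  ultimately have "{x :: real^'d. x $ j = a} \<in> null_sets lborel"
    by (simp add: inner_axis' negligible_iff_null_sets null_sets_completion_iff)
  then show ?thesis by (rule AE_I') auto
qed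

lemma AE_mem_period_cube_iff: "AE x in lborel. x \<in> period_cube \<longleftrightarrow> x \<in> cbox 0 (\<chi> j :: 'd::finite. 2 * pi)"
proof -
  have "AE x in lborel. \<forall>j. (x :: real ^ 'd) $ j \<noteq> 2 * pi"
    unfolding AE_all_countable by (intro allI AE_lborel_cart_neq)
  then show ?thesis
    by eventually_elim (auto simp: period_cube_def mem_box_cart order_less_le)
qed

lemma emeasure_period_cube: "emeasure lborel (period_cube :: (real ^ 'd) set) = ennreal ((2 * pi) ^ CARD('d))"
proof -
  have "emeasure lborel (period_cube :: (real ^ 'd) set) = emeasure lborel (cbox 0 (\<chi> j :: 'd. 2 * pi))"
    by (rule emeasure_eq_AE[OF AE_mem_period_cube_iff]) auto
  also have "\<dots> = ennreal (measure lborel (cbox 0 (\<chi> j :: 'd. 2 * pi)))"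
    by (rule emeasure_eq_ennreal_measure) (simp add: emeasure_lborel_cbox_eq)
  also have "measure lborel (cbox 0 (\<chi> j :: 'd. 2 * pi)) = (2 * pi) ^ CARD('d)"
    using content_cbox_cart[of 0 "\<chi> j :: 'd. 2 * pi"] by (simp add: interval_ne_empty_cart)
  finally show ?thesis .
qed

lemma finite_measure_cube: "finite_measure cube_measure"
  by (rule finite_measureI) (simp add: emeasure_restrict_space space_restrict_space emeasure_period_cube)

interpretation cube_measure: finite_measure cube_measure by (rule finite_measure_cube)

lemma measure_cube [simp]: "measure cube_measure (period_cube :: (real ^ 'd) set) = (2 * pi) ^ CARD('d)"
  by (simp add: measure_def emeasure_restrict_space space_restrict_space emeasure_period_cube)

lemma measurable_cube_measure: "f \<in> borel_measurable borel \<Longrightarrow> f \<in> borel_measurable cube_measure"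
  by (rule measurable_restrict_space1) simp

section \<open>Norms and integrals over the torus in terms of the cube\<close>

text \<open>\<open>torus\<close> carries the completed Lebesgue measure, while the estimates below
  use Tonelli's theorem for Borel functions; for these the two integrals agree.\<close>

lemma lebesgue_integral_torus:
  fixes f :: "real ^ 'd \<Rightarrow> 'b::{banach, second_countable_topology}"
  assumes [measurable]: "f \<in> borel_measurable borel"
  shows "(LINT x|torus. f x) = (LINT x|cube_measure. f x)"
proof -
  have "(LINT x|torus. f x) = (LINT x|lebesgue. indicator (cbox 0 (\<chi> j. 2 * pi)) x *\<^sub>R f x)"
    by (subst integral_restrict_space) auto
  also have "\<dots> = (LINT x|lborel. indicator (cbox 0 (\<chi> j. 2 * pi)) x *\<^sub>R f x)"
    by (rule integral_completion) measurable
  also have "\<dots> = (LINT x|lborel. indicator period_cube x *\<^sub>R f x)"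
    by (rule integral_cong_AE, measurable) (use AE_mem_period_cube_iff in eventually_elim, auto simp: indicator_def)
  also have "\<dots> = (LINT x|cube_measure. f x)"
    by (subst integral_restrict_space) auto
  finally show ?thesis .
qed

lemma integral_cube_shift:
  fixes f :: "real ^ 'd \<Rightarrow> real"
  assumes [measurable]: "f \<in> borel_measurable borel" and p: "periodic f" and b: "\<And>x. \<bar>f x\<bar> \<le> B"
  shows "(LINT x|cube_measure. f (a + x)) = (LINT x|cube_measure. f x)"
proof -
  note [measurable] = measurable_cube_measure
  have i: "integrable cube_measure f" "integrable cube_measure (\<lambda>x. f (a + x))"
    by (rule cube_measure.integrable_const_bound[where B = B]; use b in \<open>auto intro!: measurable_cube_measure\<close>)+
  \<comment> \<open>Adding \<open>B\<close> makes the integrand nonnegative, which reduces the claim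
    to \<open>nn_integral_cube_shift\<close>.\<close>
  have n: "0 \<le> f x + B" for x using b[of x] by linarith
  have "(LINT x|cube_measure. f (a + x) + B) = enn2real (\<integral>\<^sup>+x. ennreal (f (a + x) + B) \<partial>cube_measure)"
    using n by (intro integral_eq_nn_integral) (auto intro!: measurable_cube_measure)
  also have "\<dots> = enn2real (\<integral>\<^sup>+x. ennreal (f x + B) \<partial>cube_measure)"
    using nn_integral_cube_shift[of "\<lambda>x. ennreal (f x + B)" a] p by (simp add: periodic_def)
  also have "\<dots> = (LINT x|cube_measure. f x + B)"
    using n by (intro integral_eq_nn_integral[symmetric]) (auto intro!: measurable_cube_measure)
  finally show ?thesis using i by simp
qed

text \<open>The set where \<open>f\<close> is at most \<open>e\<close> is closed; as it contains
  almost every point of the open cube, it contains the closure, and periodicity carries the bound to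
  all of space.\<close>

lemma periodic_continuous_le_esssup:
  fixes f :: "real ^ 'd \<Rightarrow> real"
  assumes c: "continuous_on UNIV f" and p: "periodic f"
    and e: "AE x in torus. f x \<le> e"
  shows "f x \<le> e"
proof -
  let ?b = "\<chi> j::'d. 2 * pi"
  have cl: "closed {x. f x \<le> e}"
    using c by (intro closed_Collect_le) auto
  have "AE x in lebesgue. x \<in> cbox 0 ?b \<longrightarrow> f x \<le> e"
    using e by (subst (asm) AE_restrict_space_iff) auto
  then have "AE x\<in>box 0 ?b in lebesgue. x \<in> {x. f x \<le> e}"
    by eventually_elim (use box_subset_cbox[of 0 ?b] in auto)
  then have "box 0 ?b \<subseteq> {x. f x \<le> e}"
    using mem_closed_if_AE_lebesgue_open[OF open_box cl] by blast
  then have "closure (box 0 ?b) \<subseteq> {x. f x \<le> e}"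
    using cl by (rule closure_minimal)
  moreover have "closure (box 0 ?b) = cbox 0 ?b"
    by (rule closure_box) (auto simp: interval_ne_empty_cart)
  moreover obtain m where "x + d2pi m \<in> period_cube" using period_cube_translate_unique by blast
  then have "x + d2pi m \<in> cbox 0 ?b" by (auto simp: period_cube_def mem_box_cart less_imp_le)
  ultimately have "f (x + d2pi m) \<le> e" by blast
  then show ?thesis using p by (simp add: periodic_def)
qed

text \<open>For continuous periodic functions the essential supremum is a true supremum. Its
  finiteness has to come first, because \<open>real_of_ereal\<close> sends both infinite values to
  0.\<close>

lemma Lp_norm_infinity:
  fixes f :: "real ^ 'd \<Rightarrow> complex"
  assumes c: "continuous_on UNIV f" and p: "periodic f"
  shows "norm (f x) \<le> Lp_norm \<infinity> f"
    and "(\<And>x. norm (f x) \<le> B) \<Longrightarrow> Lp_norm \<infinity> f \<le> B"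
proof -
  let ?f = "\<lambda>x. ereal (norm (f x))"
  let ?e = "esssup torus ?f"
  have cn: "continuous_on UNIV (\<lambda>x. norm (f x))" using c by (intro continuous_intros)
  have mb: "?f \<in> borel_measurable borel"
    using cn by (intro borel_measurable_ereal borel_measurable_continuous_onI)
  have m: "?f \<in> borel_measurable torus"
    using mb by (intro measurable_restrict_space1 measurable_completion) simp
  have "compact ((\<lambda>x. norm (f x)) ` cbox 0 (\<chi> j. 2 * pi))"
    by (intro compact_continuous_image compact_cbox continuous_on_subset[OF cn]) auto
  then obtain B0 where B0: "norm (f x) \<le> B0" if "x \<in> cbox 0 (\<chi> j. 2 * pi)" for x
    by (metis bounded_imp_bdd_above compact_imp_bounded bdd_above.E imageI)
  have ub: "?e \<le> ereal B0"
    by (rule esssup_I[OF m], rule AE_I2) (use B0 in \<open>auto simp: space_restrict_space\<close>)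
  have *: "ereal (norm (f x)) \<le> ?e" for x
  proof (cases ?e)
    case (real r)
    have "AE x in torus. norm (f x) \<le> r"
      using esssup_AE[of ?f torus] by eventually_elim (simp add: real)
    then have "norm (f x) \<le> r"
      by (rule periodic_continuous_le_esssup[OF cn, rotated]) (use p in \<open>simp add: periodic_def\<close>)
    then show ?thesis by (simp add: real)
  next
    case PInf then show ?thesis by simp
  next
    case MInf
    have "AE x in torus. norm (f x) \<le> -1"
      using esssup_AE[of ?f torus] by eventually_elim (simp add: MInf)
    then have "norm (f x) \<le> -1"
      by (rule periodic_continuous_le_esssup[OF cn, rotated]) (use p in \<open>simp add: periodic_def\<close>)
    then show ?thesis by (smt (verit) norm_ge_zero)
  qed
  have fin: "\<bar>?e\<bar> \<noteq> \<infinity>" using *[of 0] ub by auto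
  show "norm (f x) \<le> Lp_norm \<infinity> f"
    using *[of x] fin by (simp add: Lp_norm_def) (metis ereal_less_eq(3) ereal_real')
  assume B: "\<And>x. norm (f x) \<le> B"
  have "?e \<le> ereal B" by (rule esssup_I[OF m]) (use B in auto)
  then show "Lp_norm \<infinity> f \<le> B"
    using fin by (simp add: Lp_norm_def) (metis ereal_less_eq(3) ereal_real')
qed

lemma Lp_norm_finite:
  assumes "0 < p" "f \<in> borel_measurable borel"
  shows "Lp_norm (ereal p) f = (LINT x|cube_measure. norm (f x) powr p) powr (1 / p)"
  using assms by (simp add: Lp_norm_def lebesgue_integral_torus)

subsection \<open>Trigonometric polynomials\<close>

text \<open>Only the values of \<open>c\<close> on \<open>freqs n\<close> matter, so operators such
  as \<open>heat\<close> and \<open>potential\<close> can act on coefficient functions without any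
  support condition.\<close>

definition tpoly :: "nat \<Rightarrow> (int ^ 'd \<Rightarrow> complex) \<Rightarrow> real ^ 'd \<Rightarrow> complex" where
  "tpoly n c = (\<lambda>x. \<Sum>k\<in>freqs n. c k * expi k x)"

lemma norm_expi [simp]: "norm (expi k x) = 1"
  by (simp add: expi_def)

lemma real_vec_0 [simp]: "real_vec 0 = 0"
  and real_vec_add: "real_vec (k + l) = real_vec k + real_vec l"
  and real_vec_uminus: "real_vec (- k) = - real_vec k"
  by (simp_all add: real_vec_def vec_eq_iff)

lemma real_vec_nth [simp]: "real_vec k $ j = real_of_int (k $ j)"
  by (simp add: real_vec_def)

lemma real_vec_eq_0_iff [simp]: "real_vec k = 0 \<longleftrightarrow> k = 0"
  by (simp add: vec_eq_iff)

lemma expi_0 [simp]: "expi 0 x = 1" "expi k 0 = 1"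
  by (simp_all add: expi_def)

lemma expi_freq_add: "expi (k + l) x = expi k x * expi l x"
  by (simp add: expi_def real_vec_add inner_add_left algebra_simps exp_add)

lemma cnj_expi: "cnj (expi k x) = expi (- k) x"
  by (simp add: expi_def real_vec_uminus exp_cnj)

lemma expi_2pi: "expi k (d2pi m) = 1"
proof -
  define N where "N = (\<Sum>j\<in>UNIV. k $ j * m $ j)"
  have "real_vec k \<bullet> d2pi m = 2 * real_of_int N * pi"
    by (simp add: N_def inner_vec_def sum_distrib_left mult_ac)
  then have "expi k (d2pi m) = exp ((2 * of_int N * of_real pi) * \<i>)"
    by (simp add: expi_def mult_ac)
  then show ?thesis using exp_integer_2pi[of "of_int N"] by simp
qed

lemma periodic_expi: "periodic (expi k)"
  by (simp add: periodic_def expi_add expi_2pi)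

lemma continuous_on_expi [continuous_intros]:
  "continuous_on A f \<Longrightarrow> continuous_on A (\<lambda>x. expi k (f x))"
  unfolding expi_def by (intro continuous_intros)

lemma borel_measurable_expi [measurable]: "expi k \<in> borel_measurable borel"
  by (intro borel_measurable_continuous_onI continuous_intros)

lemma periodic_tpoly: "periodic (tpoly n c)"
  by (simp add: periodic_def tpoly_def expi_add expi_2pi)

lemma continuous_on_tpoly: "continuous_on A (tpoly n c)"
  unfolding tpoly_def by (intro continuous_intros)

lemma borel_measurable_tpoly [measurable]: "tpoly n c \<in> borel_measurable borel"
  by (intro borel_measurable_continuous_onI continuous_on_tpoly)

lemma norm_tpoly_le: "norm (tpoly n c x) \<le> (\<Sum>k\<in>freqs n. norm (c k))"
  unfolding tpoly_def by (rule order_trans[OF norm_sum]) (simp add: norm_mult)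

lemma integrable_cube_bounded:
  fixes f :: "real ^ 'd \<Rightarrow> 'b::{banach, second_countable_topology}"
  assumes "f \<in> borel_measurable borel" "\<And>x. norm (f x) \<le> B"
  shows "integrable cube_measure f"
  by (rule cube_measure.integrable_const_bound[where B = B]) (use assms in \<open>auto intro!: measurable_cube_measure\<close>)

text \<open>Translation by \<open>y\<close> multiplies the integral by \<open>expi k y\<close>, and
  for nonzero \<open>k\<close> some \<open>y\<close> makes this factor different from 1.\<close>

lemma integral_expi:
  "(LINT x|cube_measure. expi k x) = (if k = 0 then complex_of_real ((2 * pi) ^ CARD('d)) else 0)"
  for k :: "int ^ 'd"
proof (cases "k = 0")
  case True
  then show ?thesis by (simp add: space_restrict_space scaleR_conv_of_real)
next
  case False
  then obtain y where y: "expi k y \<noteq> 1" using expi_distinct[of k 0] by auto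
  have i: "integrable cube_measure (expi k)" by (rule integrable_cube_bounded[where B = 1]) auto
  have i': "integrable cube_measure (\<lambda>x. expi k (y + x))"
    by (rule integrable_cube_bounded[where B = 1]) auto
  \<comment> \<open>\<open>integral_cube_shift\<close> concerns real functions, hence the real and
    imaginary parts are treated separately.\<close>
  have "Re (LINT x|cube_measure. expi k (y + x)) = Re (LINT x|cube_measure. expi k x)"
    using integral_cube_shift[of "\<lambda>x. Re (expi k x)" 1 y] periodic_expi[of k] i i'
      abs_Re_le_cmod[of "expi k _"] by (simp add: periodic_def)
  moreover have "Im (LINT x|cube_measure. expi k (y + x)) = Im (LINT x|cube_measure. expi k x)"
    using integral_cube_shift[of "\<lambda>x. Im (expi k x)" 1 y] periodic_expi[of k] i i'
      abs_Im_le_cmod[of "expi k _"] by (simp add: periodic_def)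
  ultimately have "(LINT x|cube_measure. expi k (y + x)) = (LINT x|cube_measure. expi k x)"
    by (rule complex_eqI)
  then have "expi k y * (LINT x|cube_measure. expi k x) = (LINT x|cube_measure. expi k x)"
    by (simp add: expi_add)
  then show ?thesis using y False by simp
qed

subsection \<open>The heat kernel\<close>

lemma Basis_cart: "(Basis :: (real ^ 'd) set) = range (\<lambda>j. axis j 1)"
  by (auto simp: Basis_vec_def)

lemma inj_axis_1: "inj (\<lambda>j :: 'd::finite. axis j (1 :: real))"
  by (auto simp: inj_on_def axis_eq_axis)

lemma nn_integral_cart_prod:
  fixes f :: "'d::finite \<Rightarrow> real \<Rightarrow> ennreal"
  assumes [measurable]: "\<And>j. f j \<in> borel_measurable borel"
  shows "(\<integral>\<^sup>+x. (\<Prod>j\<in>UNIV. f j (x $ j)) \<partial>lborel) = (\<Prod>j\<in>UNIV. \<integral>\<^sup>+y. f j y \<partial>lborel)"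
proof -
  have "(\<integral>\<^sup>+x. (\<Prod>b\<in>Basis. f (axis_index b) ((x :: real ^ 'd) \<bullet> b)) \<partial>lborel)
      = (\<Prod>b\<in>(Basis :: (real ^ 'd) set). \<integral>\<^sup>+y. f (axis_index b) y \<partial>lborel)"
    by (rule nn_integral_lborel_prod) auto
  then show ?thesis
    by (simp add: Basis_cart prod.reindex inj_axis_1 inner_axis)
qed

lemma integral_cart_prod:
  fixes f :: "'d::finite \<Rightarrow> real \<Rightarrow> complex"
  assumes i: "\<And>j. integrable lborel (f j)"
  shows "integrable lborel (\<lambda>x. \<Prod>j\<in>UNIV. f j (x $ j))"
    and "(LINT x|lborel. (\<Prod>j\<in>UNIV. f j (x $ j))) = (\<Prod>j\<in>UNIV. LINT y|lborel. f j y)"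
proof -
  interpret product_sigma_finite "\<lambda>_ :: real ^ 'd. lborel :: real measure" ..
  have [measurable]: "f j \<in> borel_measurable borel" for j
    using borel_measurable_integrable[OF i] by simp
  let ?P = "\<Pi>\<^sub>M b\<in>(Basis :: (real ^ 'd) set). lborel"
  let ?v = "\<lambda>g. \<Sum>b\<in>(Basis :: (real ^ 'd) set). g b *\<^sub>R b"
  have m: "?v \<in> ?P \<rightarrow>\<^sub>M borel" by measurable
  have mf: "(\<lambda>x :: real ^ 'd. \<Prod>j\<in>UNIV. f j (x $ j)) \<in> borel_measurable borel" by measurable
  have v: "?v g $ j = g (axis j 1)" for g j
  proof -
    have "?v g $ j = (\<Sum>b\<in>(Basis :: (real ^ 'd) set). g b *\<^sub>R b) \<bullet> axis j 1"
      by (simp add: cart_eq_inner_axis)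
    also have "\<dots> = g (axis j 1)"
      by (subst inner_sum_left_Basis) (auto simp: Basis_cart)
    finally show ?thesis .
  qed
  have eq: "(\<Prod>j\<in>UNIV. f j (?v g $ j)) = (\<Prod>b\<in>(Basis :: (real ^ 'd) set). f (axis_index b) (g b))" for g
    unfolding v by (simp add: Basis_cart prod.reindex inj_axis_1)
  show "integrable lborel (\<lambda>x :: real ^ 'd. \<Prod>j\<in>UNIV. f j (x $ j))"
    unfolding lborel_eq[where 'a = "real ^ 'd"]
    by (subst integrable_distr_eq[OF m mf]) (unfold eq, rule product_integrable_prod, use i in auto)
  have "(LINT x|lborel. (\<Prod>j\<in>UNIV. f j ((x :: real ^ 'd) $ j))) = (LINT g|?P. (\<Prod>b\<in>Basis. f (axis_index b) (g b)))"
    unfolding lborel_eq[where 'a = "real ^ 'd"]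
    by (subst integral_distr[OF m mf]) (simp only: eq)
  also have "\<dots> = (\<Prod>b\<in>(Basis :: (real ^ 'd) set). LINT y|lborel. f (axis_index b) y)"
    by (rule product_integral_prod) (use i in auto)
  also have "\<dots> = (\<Prod>j\<in>UNIV. LINT y|lborel. f j y)"
    by (simp add: Basis_cart prod.reindex inj_axis_1)
  finally show "(LINT x|lborel. (\<Prod>j\<in>UNIV. f j ((x :: real ^ 'd) $ j))) = (\<Prod>j\<in>UNIV. LINT y|lborel. f j y)" .
qed

lemma normal_density_char:
  assumes s: "\<sigma> > 0"
  shows "(LINT y|lborel. complex_of_real (normal_density 0 \<sigma> y) * exp (\<i> * complex_of_real (k * y)))
    = complex_of_real (exp (- ((\<sigma> * k)\<^sup>2 / 2)))"
proof -
  have "(LINT y|lborel. complex_of_real (normal_density 0 \<sigma> y) * exp (\<i> * complex_of_real (k * y)))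
     = \<bar>\<sigma>\<bar> *\<^sub>R (LINT z|lborel. complex_of_real (normal_density 0 \<sigma> (0 + \<sigma> * z)) * exp (\<i> * complex_of_real (k * (0 + \<sigma> * z))))"
    using s by (intro lborel_integral_real_affine) simp
  also have "\<dots> = (LINT z|lborel. \<sigma> *\<^sub>R (complex_of_real (normal_density 0 \<sigma> (0 + \<sigma> * z)) * exp (\<i> * complex_of_real (k * (0 + \<sigma> * z)))))"
    using s by simp
  also have "\<dots> = (LINT z|lborel. std_normal_density z *\<^sub>R exp (\<i> * complex_of_real (\<sigma> * k * z)))"
    by (rule Bochner_Integration.integral_cong)
      (use s in \<open>simp_all add: normal_density_def scaleR_conv_of_real real_sqrt_mult power_mult_distrib field_simps\<close>)
  also have "\<dots> = char std_normal_distribution (\<sigma> * k)"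
    unfolding char_def by (subst integral_density) (auto simp: mult_ac)
  finally show ?thesis by (simp add: char_std_normal_distribution)
qed

text \<open>Each coordinate has variance \<open>2 * t\<close>, so that the Fourier transform is
  \<open>exp (- t * |k|\<^sup>2)\<close> and the generator is the plain Laplacian.\<close>

definition heat_kernel :: "real \<Rightarrow> real ^ 'd \<Rightarrow> real" where
  "heat_kernel t y = (\<Prod>j\<in>UNIV. normal_density 0 (sqrt (2 * t)) (y $ j))"

lemma heat_kernel_nonneg: "0 \<le> heat_kernel t y"
  by (simp add: heat_kernel_def prod_nonneg)

lemma borel_measurable_heat_kernel [measurable (raw)]:
  assumes [measurable]: "f \<in> borel_measurable M" and g: "g \<in> borel_measurable M"
  shows "(\<lambda>x. heat_kernel (f x) (g x)) \<in> borel_measurable M"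
proof -
  have [measurable]: "(\<lambda>x. g x $ j) \<in> borel_measurable M" for j
    by (rule measurable_compose[OF g]) measurable
  show ?thesis
    unfolding heat_kernel_def normal_density_def by (intro borel_measurable_prod) measurable
qed

lemma nn_integral_heat_kernel:
  assumes t: "t > 0"
  shows "(\<integral>\<^sup>+y. heat_kernel t (y :: real ^ 'd) \<partial>lborel) = 1"
proof -
  have "(\<integral>\<^sup>+y. ennreal (normal_density 0 (sqrt (2 * t)) y) \<partial>lborel) = 1"
    using t by (subst nn_integral_eq_integral) auto
  then show ?thesis
    using nn_integral_cart_prod[of "\<lambda>_ :: 'd. \<lambda>y. ennreal (normal_density 0 (sqrt (2 * t)) y)"]
    by (simp add: heat_kernel_def prod_ennreal)
qed

text \<open>The transform is taken over the whole space, where \<open>expi k\<close> is bounded: the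
  heat flow of a polynomial becomes a convolution in space, and the periodized kernel is met only
  inside nonnegative integrals.\<close>

lemma heat_kernel_expi:
  fixes k :: "int ^ 'd"
  assumes t: "t > 0"
  shows "integrable lborel (\<lambda>y. complex_of_real (heat_kernel t y) * expi k y)"
    and "(LINT y|lborel. complex_of_real (heat_kernel t y) * expi k y)
      = complex_of_real (exp (- t * (norm (real_vec k))\<^sup>2))"
proof -
  let ?f = "\<lambda>j y. complex_of_real (normal_density 0 (sqrt (2 * t)) y) * exp (\<i> * complex_of_real (real_of_int (k $ j) * y))"
  have i: "integrable lborel (?f j)" for j
  proof (rule Bochner_Integration.integrable_bound)
    show "integrable lborel (normal_density 0 (sqrt (2 * t)))" using t by simp
  qed (auto simp: norm_mult)
  have eq: "(\<Prod>j\<in>UNIV. ?f j (y $ j)) = complex_of_real (heat_kernel t y) * expi k y" for y :: "real ^ 'd"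
    by (simp add: heat_kernel_def expi_def prod.distrib exp_sum[symmetric] inner_vec_def sum_distrib_left)
  show "integrable lborel (\<lambda>y. complex_of_real (heat_kernel t y) * expi k y)"
    using integral_cart_prod(1)[of ?f, OF i] by (simp only: eq)
  have "(LINT y|lborel. complex_of_real (heat_kernel t y) * expi k y) = (\<Prod>j\<in>UNIV. LINT y|lborel. ?f j y)"
    using integral_cart_prod(2)[of ?f, OF i] by (simp only: eq)
  also have "\<dots> = (\<Prod>j\<in>UNIV. complex_of_real (exp (- ((sqrt (2 * t) * real_of_int (k $ j))\<^sup>2 / 2))))"
    by (intro prod.cong refl normal_density_char) (use t in simp)
  also have "\<dots> = complex_of_real (exp (\<Sum>j\<in>UNIV. - (t * (real_of_int (k $ j))\<^sup>2)))"
    using t by (simp add: exp_sum power_mult_distrib)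
  also have "(\<Sum>j\<in>UNIV. - (t * (real_of_int (k $ j))\<^sup>2)) = - t * (norm (real_vec k))\<^sup>2"
    by (simp add: norm_vec_def L2_set_def sum_nonneg sum_distrib_left sum_negf)
  finally show "(LINT y|lborel. complex_of_real (heat_kernel t y) * expi k y)
      = complex_of_real (exp (- t * (norm (real_vec k))\<^sup>2))" .
qed

text \<open>By \<open>(y + z)\<^sup>2 \<le> 2 * y\<^sup>2 + 2 * t\<close>: doubling the time halves
  the exponent, which pays for the factor 2, and the rest costs
  \<open>exp (1 / 4) \<le> sqrt 2\<close>. The other factor \<open>sqrt 2\<close> is the ratio of
  the normalizing constants.\<close>

lemma normal_density_doubling:
  assumes t: "t > 0" and z: "z\<^sup>2 \<le> t"
  shows "normal_density 0 (sqrt (2 * t)) y \<le> 2 * normal_density 0 (sqrt (2 * (2 * t))) (y + z)"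
proof -
  have "(y + z)\<^sup>2 \<le> 2 * y\<^sup>2 + 2 * z\<^sup>2"
    using zero_le_power2[of "y - z"] by (simp add: power2_eq_square algebra_simps)
  then have "(y + z)\<^sup>2 \<le> 2 * y\<^sup>2 + 2 * t" using z by linarith
  then have "(y + z)\<^sup>2 / (8 * t) \<le> y\<^sup>2 / (4 * t) + 1 / 4"
    using t by (simp add: field_simps)
  then have "exp (- (y\<^sup>2 / (4 * t))) \<le> exp (1 / 4 - (y + z)\<^sup>2 / (8 * t))" by simp
  also have "\<dots> = exp (1 / 4) * exp (- ((y + z)\<^sup>2 / (8 * t)))"
    by (simp add: mult_exp_exp)
  also have "\<dots> \<le> sqrt 2 * exp (- ((y + z)\<^sup>2 / (8 * t)))"
  proof (rule mult_right_mono)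
    have "exp (1 / 4 :: real) ^ 2 = exp (1 / 2)" by (simp flip: exp_of_nat_mult)
    also have "exp (1 / 2 :: real) \<le> 1 + 1 / 2 + (1 / 2)\<^sup>2" by (rule exp_bound) auto
    finally show "exp (1 / 4) \<le> sqrt 2" by (intro real_le_rsqrt) (simp add: power2_eq_square)
  qed simp
  finally have e: "exp (- (y\<^sup>2 / (4 * t))) \<le> sqrt 2 * exp (- ((y + z)\<^sup>2 / (8 * t)))" .
  have "normal_density 0 (sqrt (2 * t)) y = exp (- (y\<^sup>2 / (4 * t))) / sqrt (4 * pi * t)"
    using t by (simp add: normal_density_def field_simps)
  also have "\<dots> \<le> sqrt 2 * exp (- ((y + z)\<^sup>2 / (8 * t))) / sqrt (4 * pi * t)"
    using e t by (intro divide_right_mono) auto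
  also have "\<dots> = 2 * (exp (- ((y + z)\<^sup>2 / (8 * t))) / (sqrt 2 * sqrt (4 * pi * t)))"
    using t by (simp add: field_simps)
  also have "sqrt 2 * sqrt (4 * pi * t) = sqrt (8 * pi * t)"
    by (simp flip: real_sqrt_mult)
  also have "exp (- ((y + z)\<^sup>2 / (8 * t))) / sqrt (8 * pi * t) = normal_density 0 (sqrt (2 * (2 * t))) (y + z)"
    using t by (simp add: normal_density_def field_simps)
  finally show ?thesis .
qed

lemma heat_kernel_doubling:
  fixes y z :: "real ^ 'd"
  assumes "t > 0" "\<And>j. (z $ j)\<^sup>2 \<le> t"
  shows "heat_kernel t y \<le> 2 ^ CARD('d) * heat_kernel (2 * t) (y + z)"
proof -
  have "heat_kernel t y \<le> (\<Prod>j\<in>UNIV. 2 * normal_density 0 (sqrt (2 * (2 * t))) (y $ j + z $ j))"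
    unfolding heat_kernel_def
    by (intro prod_mono conjI normal_density_nonneg normal_density_doubling assms)
  then show ?thesis by (simp add: prod.distrib heat_kernel_def)
qed

text \<open>By \<open>heat_kernel_doubling\<close> each value of the kernel is dominated by an average of the wider
  kernel over a small cube; these cubes are disjoint modulo the lattice.\<close>

lemma heat_kernel_lattice_sum:
  fixes y :: "real ^ 'd"
  assumes t: "0 < t" "t \<le> 1"
  shows "(\<integral>\<^sup>+m. heat_kernel t (y + d2pi m) \<partial>count_space UNIV) \<le> ennreal (2 ^ CARD('d) * t powr (- real CARD('d) / 2))"
    (is "?L \<le> _")
proof -
  let ?d = "CARD('d)"
  define B where "B = {z :: real ^ 'd. \<forall>j. 0 \<le> z $ j \<and> z $ j < sqrt t}"
  have [measurable]: "B \<in> sets borel" unfolding B_def by measurable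
  have st: "0 < sqrt t" "sqrt t \<le> 1" using t by auto
  have "indicator B z = (\<Prod>j\<in>UNIV. indicator {0..<sqrt t} (z $ j) :: ennreal)" for z
    by (cases "z \<in> B") (auto simp: B_def indicator_def)
  then have eB: "emeasure lborel B = ennreal (sqrt t ^ ?d)"
    using nn_integral_cart_prod[of "\<lambda>_ :: 'd. indicator {0..<sqrt t}"] st
    by (simp add: nn_integral_indicator[symmetric] ennreal_power del: nn_integral_indicator) (simp add: ennreal_power)
  \<comment> \<open>Here \<open>t \<le> 1\<close> enters: the small cube has to fit into the period
    cube.\<close>
  have BQ: "B \<subseteq> period_cube"
  proof
    fix x assume "x \<in> B"
    then have "0 \<le> x $ j" "x $ j < sqrt t" for j by (auto simp: B_def)
    moreover have "sqrt t < 2 * pi" using st pi_gt3 by linarith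
    ultimately show "x \<in> period_cube" unfolding period_cube_def using less_trans by blast
  qed
  have *: "ennreal (sqrt t ^ ?d) * heat_kernel t w
      \<le> ennreal (2 ^ ?d) * (\<integral>\<^sup>+z. ennreal (heat_kernel (2 * t) (w + z)) * indicator period_cube z \<partial>lborel)" for w :: "real ^ 'd"
  proof -
    have "ennreal (sqrt t ^ ?d) * heat_kernel t w = (\<integral>\<^sup>+z. ennreal (heat_kernel t w) * indicator B z \<partial>lborel)"
      by (subst nn_integral_cmult, simp, subst nn_integral_indicator, simp) (simp add: eB mult.commute)
    also have "\<dots> \<le> (\<integral>\<^sup>+z. ennreal (2 ^ ?d) * (ennreal (heat_kernel (2 * t) (w + z)) * indicator period_cube z) \<partial>lborel)"
    proof (rule nn_integral_mono)
      fix z :: "real ^ 'd"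
      show "ennreal (heat_kernel t w) * indicator B z \<le> ennreal (2 ^ ?d) * (ennreal (heat_kernel (2 * t) (w + z)) * indicator period_cube z)"
      proof (cases "z \<in> B")
        case True
        have "(z $ j)\<^sup>2 \<le> t" for j
        proof -
          have "(z $ j)\<^sup>2 \<le> (sqrt t)\<^sup>2"
            using True by (intro power_mono) (auto simp: B_def less_imp_le)
          then show ?thesis using t by simp
        qed
        from heat_kernel_doubling[OF t(1) this, of w] True BQ show ?thesis
          by (auto simp: ennreal_mult'[symmetric] heat_kernel_nonneg intro!: ennreal_leI)
      qed simp
    qed
    also have "\<dots> = ennreal (2 ^ ?d) * (\<integral>\<^sup>+z. ennreal (heat_kernel (2 * t) (w + z)) * indicator period_cube z \<partial>lborel)"
      by (rule nn_integral_cmult) measurable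
    finally show ?thesis .
  qed
  have "ennreal (sqrt t ^ ?d) * ?L = (\<integral>\<^sup>+m. ennreal (sqrt t ^ ?d) * heat_kernel t (y + d2pi m) \<partial>count_space UNIV)"
    by (simp add: nn_integral_cmult)
  also have "\<dots> \<le> (\<integral>\<^sup>+m. ennreal (2 ^ ?d) * (\<integral>\<^sup>+z. ennreal (heat_kernel (2 * t) (y + d2pi m + z)) * indicator period_cube z \<partial>lborel) \<partial>count_space UNIV)"
    by (intro nn_integral_mono *)
  also have "\<dots> = ennreal (2 ^ ?d) * (\<integral>\<^sup>+m. (\<integral>\<^sup>+z. ennreal (heat_kernel (2 * t) (y + d2pi m + z)) * indicator period_cube z \<partial>lborel) \<partial>count_space UNIV)"
    by (simp add: nn_integral_cmult)
  also have "(\<integral>\<^sup>+m. (\<integral>\<^sup>+z. ennreal (heat_kernel (2 * t) (y + d2pi m + z)) * indicator period_cube z \<partial>lborel) \<partial>count_space UNIV)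
      = (\<integral>\<^sup>+z. (\<integral>\<^sup>+m. ennreal (heat_kernel (2 * t) (y + d2pi m + z)) * indicator period_cube z \<partial>count_space UNIV) \<partial>lborel)"
    by (rule nn_integral_count_space_nn_integral[symmetric]) auto
  \<comment> \<open>Tiling is now read backwards, with the constant 1 as periodic factor: the
    lattice sum over the cube becomes one integral over space, the mass of a heat kernel.\<close>
  also have "\<dots> = (\<integral>\<^sup>+z. (\<integral>\<^sup>+m. heat_kernel (2 * t) (y + (z + d2pi m)) \<partial>count_space UNIV) * 1 * indicator period_cube z \<partial>lborel)"
    by (intro nn_integral_cong) (simp add: nn_integral_multc add_ac)
  also have "\<dots> = (\<integral>\<^sup>+z. ennreal (heat_kernel (2 * t) (y + z)) * 1 \<partial>lborel)"
    by (rule nn_integral_tile[symmetric]) (auto simp: periodic_def)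
  also have "\<dots> = (\<integral>\<^sup>+z. heat_kernel (2 * t) (z :: real ^ 'd) \<partial>lborel)"
    using nn_integral_lborel_shift[of "\<lambda>z. ennreal (heat_kernel (2 * t) z)" y] by simp
  also have "\<dots> = 1" using t by (intro nn_integral_heat_kernel) simp
  finally have **: "ennreal (sqrt t ^ ?d) * ?L \<le> ennreal (2 ^ ?d)" by simp
  have p: "sqrt t ^ ?d = t powr (real ?d / 2)"
    using t by (simp add: powr_half_sqrt[symmetric] powr_powr flip: powr_realpow)
  have "?L = ennreal (t powr (- real ?d / 2)) * (ennreal (sqrt t ^ ?d) * ?L)"
    using t by (simp add: p mult.assoc[symmetric] ennreal_mult'[symmetric] powr_add[symmetric])
  also have "\<dots> \<le> ennreal (t powr (- real ?d / 2)) * ennreal (2 ^ ?d)"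
    by (intro mult_left_mono **) simp
  finally show ?thesis by (simp add: ennreal_mult'[symmetric] mult.commute)
qed

text \<open>Tiling replaces the Gaussian by its periodization, which
  \<open>heat_kernel_lattice_sum\<close> bounds uniformly; this is the smoothing from L_1 to
  L_infinity.\<close>

lemma heat_kernel_periodic_le:
  fixes g :: "real ^ 'd \<Rightarrow> ennreal"
  assumes t: "0 < t" "t \<le> 1" and [measurable]: "g \<in> borel_measurable borel" and g: "periodic g"
  shows "(\<integral>\<^sup>+y. heat_kernel t y * g (x + y) \<partial>lborel)
    \<le> ennreal (2 ^ CARD('d) * t powr (- real CARD('d) / 2)) * (\<integral>\<^sup>+y. g y \<partial>cube_measure)"
proof -
  have "(\<integral>\<^sup>+y. heat_kernel t y * g (x + y) \<partial>lborel)
      = (\<integral>\<^sup>+y. (\<lambda>y. heat_kernel t (y - x) * g y) (x + y) \<partial>lborel)" by simp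
  also have "\<dots> = (\<integral>\<^sup>+y. heat_kernel t (y - x) * g y \<partial>lborel)"
    by (rule nn_integral_lborel_shift) measurable
  also have "\<dots> = (\<integral>\<^sup>+y. (\<integral>\<^sup>+m. heat_kernel t (y + d2pi m - x) \<partial>count_space UNIV) * g y * indicator period_cube y \<partial>lborel)"
    by (rule nn_integral_tile[OF _ _ g]) measurable
  also have "\<dots> \<le> (\<integral>\<^sup>+y. ennreal (2 ^ CARD('d) * t powr (- real CARD('d) / 2)) * g y * indicator period_cube y \<partial>lborel)"
  proof (intro nn_integral_mono mult_right_mono)
    fix y
    show "(\<integral>\<^sup>+m. heat_kernel t (y + d2pi m - x) \<partial>count_space UNIV) \<le> ennreal (2 ^ CARD('d) * t powr (- real CARD('d) / 2))"
      using heat_kernel_lattice_sum[OF t, of "y - x"] by (simp add: algebra_simps)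
  qed auto
  also have "\<dots> = ennreal (2 ^ CARD('d) * t powr (- real CARD('d) / 2)) * (\<integral>\<^sup>+y. g y \<partial>cube_measure)"
    by (simp add: nn_integral_cube mult.assoc nn_integral_cmult)
  finally show ?thesis .
qed

text \<open>Tonelli: by translation invariance the inner integral of \<open>g\<close> over the cube
  is a constant, and the kernel has mass 1.\<close>

lemma heat_kernel_mass:
  fixes g :: "real ^ 'd \<Rightarrow> ennreal"
  assumes t: "0 < t" and [measurable]: "g \<in> borel_measurable borel" and g: "periodic g"
  shows "(\<integral>\<^sup>+x. (\<integral>\<^sup>+y. heat_kernel t y * g (x + y) \<partial>lborel) \<partial>cube_measure) = (\<integral>\<^sup>+x. g x \<partial>cube_measure)"
proof -
  have "(\<integral>\<^sup>+x. (\<integral>\<^sup>+y. heat_kernel t y * g (x + y) \<partial>lborel) \<partial>cube_measure)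
      = (\<integral>\<^sup>+x. (\<integral>\<^sup>+y. heat_kernel t y * (g (x + y) * indicator period_cube x) \<partial>lborel) \<partial>lborel)"
    unfolding nn_integral_cube
    by (intro nn_integral_cong, subst nn_integral_multc[symmetric]) (auto simp: mult.assoc)
  also have "\<dots> = (\<integral>\<^sup>+y. (\<integral>\<^sup>+x. heat_kernel t y * (g (x + y) * indicator period_cube x) \<partial>lborel) \<partial>lborel)"
    by (rule lborel_pair.Fubini'[symmetric]) measurable
  also have "\<dots> = (\<integral>\<^sup>+y. heat_kernel t y * (\<integral>\<^sup>+x. g (y + x) \<partial>cube_measure) \<partial>lborel)"
    by (intro nn_integral_cong, subst nn_integral_cmult) (auto simp: nn_integral_cube add.commute)
  also have "\<dots> = (\<integral>\<^sup>+y. heat_kernel t (y :: real ^ 'd) * (\<integral>\<^sup>+x. g x \<partial>cube_measure) \<partial>lborel)"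
    by (simp add: nn_integral_cube_shift[OF _ g])
  also have "\<dots> = (\<integral>\<^sup>+x. g x \<partial>cube_measure)"
    by (simp add: nn_integral_multc nn_integral_heat_kernel[OF t])
  finally show ?thesis .
qed

definition heat :: "real \<Rightarrow> (int ^ 'd \<Rightarrow> complex) \<Rightarrow> int ^ 'd \<Rightarrow> complex" where
  "heat t c k = complex_of_real (exp (- t * (norm (real_vec k))\<^sup>2)) * c k"

text \<open>Positivity of the kernel gives \<open>|H\<^sub>t S| \<le> H\<^sub>t |S|\<close>
  pointwise. The right-hand side makes sense for every nonnegative function, so it can be cut at a
  height, which the coefficient form does not allow.\<close>

lemma norm_tpoly_heat_le:
  fixes c :: "int ^ 'd \<Rightarrow> complex"
  assumes t: "0 < t"
  shows "ennreal (norm (tpoly n (heat t c) x))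
    \<le> (\<integral>\<^sup>+y. heat_kernel t y * ennreal (norm (tpoly n c (x + y))) \<partial>lborel)"
proof -
  let ?f = "\<lambda>y. complex_of_real (heat_kernel t y) * tpoly n c (x + y)"
  have eq: "?f = (\<lambda>y. \<Sum>k\<in>freqs n. c k * expi k x * (complex_of_real (heat_kernel t y) * expi k y))"
    by (auto simp: tpoly_def sum_distrib_left expi_add mult_ac)
  have i: "integrable lborel ?f"
    unfolding eq by (intro Bochner_Integration.integrable_sum integrable_mult_right heat_kernel_expi(1)[OF t])
  have "tpoly n (heat t c) x = (LINT y|lborel. ?f y)"
    unfolding eq
    by (subst Bochner_Integration.integral_sum)
      (intro integrable_mult_right heat_kernel_expi(1)[OF t],
        simp only: integral_mult_right_zero heat_kernel_expi(2)[OF t], simp add: tpoly_def heat_def mult_ac)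
  also have "ennreal (norm \<dots>) \<le> (\<integral>\<^sup>+y. norm (?f y) \<partial>lborel)"
    by (rule integral_norm_bound_ennreal[OF i])
  also have "\<dots> = (\<integral>\<^sup>+y. heat_kernel t y * ennreal (norm (tpoly n c (x + y))) \<partial>lborel)"
    by (intro nn_integral_cong) (simp add: norm_mult heat_kernel_nonneg ennreal_mult)
  finally show ?thesis .
qed

subsection \<open>Parseval and Nikolskii inequalities\<close>

lemma freqs_iff: "k \<in> freqs n \<longleftrightarrow> (\<forall>j. \<bar>k $ j\<bar> \<le> int n)"
proof -
  have "real_of_int \<bar>k $ j\<bar> \<le> real n \<longleftrightarrow> \<bar>k $ j\<bar> \<le> int n" for j
    by (metis of_int_le_iff of_int_of_nat_eq)
  then show ?thesis
    by (auto simp: freqs_def infnorm_Max Basis_cart inner_axis simp flip: of_int_abs)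
qed

lemma freqs_eq_image: "freqs n = (\<lambda>f. \<chi> j. f j) ` (PiE (UNIV :: 'd::finite set) (\<lambda>_. {- int n..int n}))"
proof (intro subset_antisym subsetI)
  fix k :: "int ^ 'd" assume "k \<in> freqs n"
  then have "($) k \<in> PiE (UNIV :: 'd::finite set) (\<lambda>_. {- int n..int n})"
    by (auto simp: freqs_iff abs_le_iff) (metis minus_le_iff)
  then show "k \<in> (\<lambda>f. \<chi> j. f j) ` (PiE UNIV (\<lambda>_. {- int n..int n}))"
    by (rule rev_image_eqI) simp
qed (auto simp: freqs_iff PiE_iff abs_le_iff, metis minus_le_iff)

lemma inj_vec_lambda: "inj_on (\<lambda>f. \<chi> j. f j) A"
  by (auto simp: inj_on_def vec_eq_iff)

text \<open>The frequency set is a cube, so sums of product functions factor; this serves both the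
  Gaussian sums and the products of Fejer kernels.\<close>

lemma sum_freqs_prod:
  fixes f :: "'d::finite \<Rightarrow> int \<Rightarrow> 'a::comm_semiring_1"
  shows "(\<Sum>k\<in>freqs n. \<Prod>j\<in>UNIV. f j (k $ j)) = (\<Prod>j\<in>UNIV. \<Sum>i=- int n..int n. f j i)"
  by (simp add: freqs_eq_image sum.reindex inj_vec_lambda prod_sum_PiE)

lemma card_freqs: "card (freqs n :: (int ^ 'd) set) = (2 * n + 1) ^ CARD('d)"
  by (simp add: freqs_eq_image card_image inj_vec_lambda card_PiE nat_add_distrib nat_mult_distrib)

lemma freqs_add: "k \<in> freqs n \<Longrightarrow> l \<in> freqs m \<Longrightarrow> k + l \<in> freqs (n + m)"
  by (auto simp: freqs_iff) (meson abs_triangle_ineq add_mono order_trans)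

lemma tpoly_mult:
  obtains e where "\<And>x. tpoly n c x * tpoly m b x = tpoly (n + m) e x"
proof
  let ?S = "freqs n \<times> freqs m"
  define e where "e k = (\<Sum>p\<in>{p\<in>?S. fst p + snd p = k}. c (fst p) * b (snd p))" for k
  fix x
  have "tpoly n c x * tpoly m b x = (\<Sum>p\<in>?S. c (fst p) * b (snd p) * expi (fst p + snd p) x)"
    unfolding tpoly_def sum_product sum.cartesian_product by (intro sum.cong) (auto simp: expi_freq_add)
  also have "\<dots> = (\<Sum>k\<in>freqs (n + m). \<Sum>p\<in>{p\<in>?S. fst p + snd p = k}. c (fst p) * b (snd p) * expi (fst p + snd p) x)"
    by (rule sum.group[symmetric]) (auto simp: finite_freqs intro: freqs_add)
  also have "\<dots> = tpoly (n + m) e x"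
    unfolding tpoly_def e_def sum_distrib_right by (intro sum.cong refl) auto
  finally show "tpoly n c x * tpoly m b x = tpoly (n + m) e x" .
qed

text \<open>For Nikolskii's inequality with large exponents: the p-integral of \<open>T\<close> is
  the \<open>p / m\<close>-integral of \<open>T ^ m\<close>, whose degree is only \<open>m\<close>
  times as large.\<close>

lemma tpoly_power: "\<exists>e. \<forall>x. tpoly n c x ^ Suc m = tpoly (Suc m * n) e x"
proof (induction m)
  case 0
  then show ?case by auto
next
  case (Suc m)
  then obtain e where e: "\<And>x. tpoly n c x ^ Suc m = tpoly (Suc m * n) e x" by blast
  obtain e' where "\<And>x. tpoly n c x * tpoly (Suc m * n) e x = tpoly (n + Suc m * n) e' x"
    using tpoly_mult[of n c "Suc m * n" e] by blast
  with e show ?case by (intro exI[of _ e']) (metis mult_Suc power_Suc)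
qed

text \<open>The p-th power of the quasi-norm. As a plain integral it allows pointwise comparison for
  every positive \<open>p\<close>, also below 1, where the norm has no triangle inequality.\<close>

definition pint :: "real \<Rightarrow> (real ^ 'd \<Rightarrow> complex) \<Rightarrow> real" where
  "pint p f = (LINT x|cube_measure. norm (f x) powr p)"

lemma pint_nonneg: "0 \<le> pint p f"
  by (simp add: pint_def)

lemma integrable_pint:
  assumes "p > 0"
  shows "integrable cube_measure (\<lambda>x. norm (tpoly n c x) powr p)"
  by (rule integrable_cube_bounded[where B = "(\<Sum>k\<in>freqs n. norm (c k)) powr p"])
    (use assms in \<open>auto intro!: powr_mono2 norm_tpoly_le\<close>)

lemma ennreal_pint:
  assumes "p > 0"
  shows "ennreal (pint p (tpoly n c)) = (\<integral>\<^sup>+x. norm (tpoly n c x) powr p \<partial>cube_measure)"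
  unfolding pint_def by (rule nn_integral_eq_integral[symmetric]) (use assms integrable_pint in auto)

lemma Lp_norm_tpoly: "p > 0 \<Longrightarrow> Lp_norm (ereal p) (tpoly n c) = pint p (tpoly n c) powr (1 / p)"
  by (simp add: Lp_norm_finite pint_def)

lemma pint_eq_Lp_norm: "p > 0 \<Longrightarrow> pint p (tpoly n c) = Lp_norm (ereal p) (tpoly n c) powr p"
  by (simp add: Lp_norm_tpoly powr_powr pint_nonneg)

lemma Lp_norm_nonneg_tpoly: "p > 0 \<Longrightarrow> 0 \<le> Lp_norm (ereal p) (tpoly n c)"
  by (simp add: Lp_norm_tpoly)

lemma pint_mono_sup:
  assumes "0 < p" "p \<le> q" and M: "\<And>x. norm (tpoly n c x) \<le> M"
  shows "pint q (tpoly n c) \<le> M powr (q - p) * pint p (tpoly n c)"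
proof -
  have "pint q (tpoly n c) \<le> (LINT x|cube_measure. M powr (q - p) * norm (tpoly n c x) powr p)"
    unfolding pint_def
  proof (rule integral_mono)
    fix x
    have "norm (tpoly n c x) powr q = norm (tpoly n c x) powr (q - p) * norm (tpoly n c x) powr p"
      using assms by (simp flip: powr_add)
    also have "\<dots> \<le> M powr (q - p) * norm (tpoly n c x) powr p"
      using assms by (intro mult_right_mono powr_mono2) auto
    finally show "norm (tpoly n c x) powr q \<le> M powr (q - p) * norm (tpoly n c x) powr p" .
  qed (use assms in \<open>auto intro!: integrable_pint integrable_mult_right\<close>)
  then show ?thesis by (simp add: pint_def)
qed

lemma inner_product_tpoly:
  fixes c b :: "int ^ 'd \<Rightarrow> complex"
  shows "(LINT x|cube_measure. tpoly n c x * cnj (tpoly n b x)) = (2 * pi) ^ CARD('d) * (\<Sum>k\<in>freqs n. c k * cnj (b k))"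
proof -
  have i: "integrable cube_measure (\<lambda>x. expi (k - l) x)" for k l :: "int ^ 'd"
    by (rule integrable_cube_bounded[where B = 1]) auto
  have "(LINT x|cube_measure. tpoly n c x * cnj (tpoly n b x))
      = (LINT x|cube_measure. (\<Sum>k\<in>freqs n. \<Sum>l\<in>freqs n. c k * cnj (b l) * expi (k - l) x))"
    by (simp add: tpoly_def sum_product cnj_expi diff_conv_add_uminus expi_freq_add mult_ac
        del: add_uminus_conv_diff)
  also have "\<dots> = (\<Sum>k\<in>freqs n. \<Sum>l\<in>freqs n. c k * cnj (b l) * (LINT x|cube_measure. expi (k - l) x))"
    by (simp add: i)
  also have "\<dots> = (\<Sum>k\<in>freqs n. \<Sum>l\<in>freqs n. if k = l then (2 * pi) ^ CARD('d) * (c k * cnj (b k)) else 0)"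
    by (intro sum.cong refl) (simp add: integral_expi mult_ac)
  also have "\<dots> = (2 * pi) ^ CARD('d) * (\<Sum>k\<in>freqs n. c k * cnj (b k))"
    by (simp add: finite_freqs sum_distrib_left)
  finally show ?thesis .
qed

lemma parseval:
  fixes c :: "int ^ 'd \<Rightarrow> complex"
  shows "pint 2 (tpoly n c) = (2 * pi) ^ CARD('d) * (\<Sum>k\<in>freqs n. (norm (c k))\<^sup>2)"
proof -
  have "complex_of_real (pint 2 (tpoly n c)) = (LINT x|cube_measure. complex_of_real (norm (tpoly n c x) powr 2))"
    by (simp only: pint_def integral_complex_of_real)
  also have "\<dots> = (LINT x|cube_measure. tpoly n c x * cnj (tpoly n c x))"
    by (intro Bochner_Integration.integral_cong refl) (simp add: complex_norm_square[symmetric])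
  also have "\<dots> = complex_of_real ((2 * pi) ^ CARD('d) * (\<Sum>k\<in>freqs n. (norm (c k))\<^sup>2))"
    by (simp add: inner_product_tpoly complex_norm_square del: of_real_power)
  finally show ?thesis by (simp only: of_real_eq_iff)
qed

text \<open>Pairing with a single exponential isolates the coefficient; the factor is the total mass
  of the unnormalized measure.\<close>

lemma coeff_le_pint:
  fixes c :: "int ^ 'd \<Rightarrow> complex"
  assumes k: "k \<in> freqs n"
  shows "(2 * pi) ^ CARD('d) * norm (c k) \<le> pint 1 (tpoly n c)"
proof -
  let ?b = "\<lambda>l. if l = k then 1 else 0"
  have b: "tpoly n ?b x = expi k x" for x
    using k by (simp add: tpoly_def finite_freqs if_distrib[of "\<lambda>a. a * _"] cong: if_cong)
  have "(LINT x|cube_measure. tpoly n c x * cnj (tpoly n ?b x)) = (2 * pi) ^ CARD('d) * c k"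
    using k unfolding inner_product_tpoly by (simp add: finite_freqs if_distrib cong: if_cong)
  then have "(2 * pi) ^ CARD('d) * norm (c k) = norm (LINT x|cube_measure. tpoly n c x * cnj (expi k x))"
    by (simp add: b norm_mult norm_power)
  also have "\<dots> \<le> (LINT x|cube_measure. norm (tpoly n c x * cnj (expi k x)))"
    by (rule integral_norm_bound)
  finally show ?thesis by (simp add: pint_def norm_mult)
qed

lemma tpoly_bounded_obtains_sup:
  obtains M where "0 \<le> M" "\<And>x. norm (tpoly n c x) \<le> M" "\<And>B. (\<And>x. norm (tpoly n c x) \<le> B) \<Longrightarrow> M \<le> B"
proof
  let ?M = "Lp_norm \<infinity> (tpoly n c)"
  note * = Lp_norm_infinity[OF continuous_on_tpoly periodic_tpoly]
  show "norm (tpoly n c x) \<le> ?M" for x by (rule *(1))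
  show "0 \<le> ?M" using *(1) norm_ge_zero order_trans by blast
  show "?M \<le> B" if "\<And>x. norm (tpoly n c x) \<le> B" for B using that by (rule *(2))
qed

text \<open>For \<open>p \<le> 2\<close> this is Cauchy--Schwarz, Parseval and \<open>|T|\<^sup>2 \<le> \<parallel>T\<parallel>\<^sub>\<infinity>\<^bsup>2-p\<^esup> |T|\<^bsup>p\<^esup>\<close>.\<close>

lemma nikolskii_aux:
  fixes c :: "int ^ 'd \<Rightarrow> complex"
  assumes p: "0 < p" "p \<le> 2"
  shows "norm (tpoly n c x) powr p \<le> real (card (freqs n :: (int ^ 'd) set)) * pint p (tpoly n c)"
proof -
  let ?T = "tpoly n c" and ?N = "real (card (freqs n :: (int ^ 'd) set))"
  obtain M where M: "0 \<le> M" "\<And>x. norm (?T x) \<le> M" "\<And>B. (\<And>x. norm (?T x) \<le> B) \<Longrightarrow> M \<le> B"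
    using tpoly_bounded_obtains_sup[of n c] by blast
  have one: "1 \<le> (2 * pi) ^ CARD('d)"
    using pi_gt3 by (intro one_le_power) linarith
  have sq: "(norm (?T x))\<^sup>2 \<le> ?N * pint 2 ?T" for x
  proof -
    have "(norm (?T x))\<^sup>2 \<le> (\<Sum>k\<in>freqs n. norm (c k) * 1)\<^sup>2"
      using norm_tpoly_le by (intro power_mono) auto
    also have "\<dots> \<le> (\<Sum>k\<in>freqs n. (norm (c k))\<^sup>2) * (\<Sum>k\<in>(freqs n :: (int ^ 'd) set). 1\<^sup>2)"
      by (rule Cauchy_Schwarz_ineq_sum)
    also have "\<dots> = ?N * (1 * (\<Sum>k\<in>freqs n. (norm (c k))\<^sup>2))" by simp
    also have "\<dots> \<le> ?N * pint 2 ?T"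
      unfolding parseval using one by (intro mult_left_mono mult_right_mono sum_nonneg) auto
    finally show ?thesis .
  qed
  have "M \<le> sqrt (?N * pint 2 ?T)"
    by (rule M(3)) (use sq in \<open>simp add: real_le_rsqrt\<close>)
  then have "M\<^sup>2 \<le> ?N * pint 2 ?T"
    using M(1) by (metis pint_nonneg mult_nonneg_nonneg of_nat_0_le_iff real_sqrt_le_iff real_sqrt_unique)
  also have "\<dots> \<le> ?N * (M powr (2 - p) * pint p ?T)"
    using p M by (intro mult_left_mono pint_mono_sup) auto
  finally have *: "M\<^sup>2 \<le> ?N * (M powr (2 - p) * pint p ?T)" .
  \<comment> \<open>The inequality just proved has \<open>M\<close> on both sides; as
    \<open>M\<close> is finite, the power \<open>M powr (2 - p)\<close> can be divided out unless
    \<open>M\<close> is zero.\<close>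
  have "M powr p \<le> ?N * pint p ?T"
  proof (cases "M = 0")
    case True
    then show ?thesis by (simp add: pint_nonneg)
  next
    case False
    then have "0 < M" using M(1) by simp
    then have "M powr p = M powr (p - 2) * M\<^sup>2" by (simp flip: powr_add powr_numeral)
    also have "\<dots> \<le> M powr (p - 2) * (?N * (M powr (2 - p) * pint p ?T))"
      using * by (intro mult_left_mono) auto
    also have "\<dots> = ?N * pint p ?T" using \<open>0 < M\<close> by (simp add: powr_diff)
    finally show ?thesis .
  qed
  moreover have "norm (?T x) powr p \<le> M powr p" using p M by (intro powr_mono2) auto
  ultimately show ?thesis by linarith
qed

text \<open>The case of exponents up to 2 is applied to a power \<open>T ^ m\<close> with
  \<open>p / m \<le> 2\<close>: the degree grows by the factor \<open>m\<close>, which only affects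
  the constant.\<close>

lemma nikolskii_infinity:
  assumes p: "0 < p"
  obtains C where "0 < C"
    "\<And>n c x. 1 \<le> n \<Longrightarrow> norm (tpoly n c (x :: real ^ 'd)) \<le> C * real n powr (CARD('d) / p) * Lp_norm (ereal p) (tpoly n c)"
proof -
  let ?d = "CARD('d)"
  have "p / 2 \<le> real (Suc (nat \<lceil>p / 2\<rceil>))" by linarith
  then have "p / real (Suc (nat \<lceil>p / 2\<rceil>)) \<le> 2" by (simp add: field_simps)
  then obtain m where m: "p / real (Suc m) \<le> 2" by blast
  let ?m = "Suc m"
  \<comment> \<open>The 3 comes from \<open>2 * k + 1 \<le> 3 * k\<close>, a bound for the number of
    frequencies per coordinate, used at the degree \<open>k = ?m * n\<close>.\<close>
  define R where "R = 3 * real ?m"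
  have R: "0 < R" by (simp add: R_def)
  show thesis
  proof
    show "0 < R powr (?d / p)" using R by simp
    fix n :: nat and c :: "int ^ 'd \<Rightarrow> complex" and x :: "real ^ 'd" assume n: "1 \<le> n"
    obtain e where e: "\<And>x. tpoly n c x ^ ?m = tpoly (?m * n) e x" using tpoly_power by blast
    have e': "norm (tpoly (?m * n) e x) powr (p / ?m) = norm (tpoly n c x) powr p" for x
    proof (cases "norm (tpoly n c x) = 0")
      case False
      then have "norm (tpoly (?m * n) e x) = norm (tpoly n c x) powr ?m"
        by (subst powr_realpow) (simp_all add: e[symmetric] norm_power del: power_Suc mult_Suc)
      then show ?thesis by (simp add: powr_powr)
    qed (simp add: e[symmetric] del: mult_Suc)
    have "norm (tpoly n c x) powr p \<le> real (card (freqs (?m * n) :: (int ^ 'd) set)) * pint p (tpoly n c)"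
      using nikolskii_aux[of "p / ?m" "?m * n" e x] p m by (simp only: e' pint_def zero_less_divide_iff of_nat_0_less_iff zero_less_Suc simp_thms)
    also have "\<dots> \<le> (R * real n) ^ ?d * pint p (tpoly n c)"
    proof (intro mult_right_mono pint_nonneg)
      have *: "2 * k + 1 \<le> 3 * k" if "1 \<le> k" for k :: nat using that by simp
      have "1 \<le> ?m * n" using n by simp
      from *[OF this] have "(2 * (?m * n) + 1) ^ ?d \<le> (3 * (?m * n)) ^ ?d" by (rule power_mono) simp
      then have "real ((2 * (?m * n) + 1) ^ ?d) \<le> real ((3 * (?m * n)) ^ ?d)" by (simp only: of_nat_le_iff)
      also have "\<dots> = (R * real n) ^ ?d" by (simp only: R_def of_nat_power of_nat_mult of_nat_numeral mult.assoc)
      finally show "real (card (freqs (?m * n) :: (int ^ 'd) set)) \<le> (R * real n) ^ ?d"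
        unfolding card_freqs .
    qed
    finally have *: "norm (tpoly n c x) powr p \<le> (R * real n) ^ ?d * pint p (tpoly n c)" .
    have "norm (tpoly n c x) = (norm (tpoly n c x) powr p) powr (1 / p)"
      using p by (simp add: powr_powr)
    also have "\<dots> \<le> ((R * real n) ^ ?d * pint p (tpoly n c)) powr (1 / p)"
      using p * by (intro powr_mono2) auto
    also have "\<dots> = ((R * real n) powr real ?d) powr (1 / p) * Lp_norm (ereal p) (tpoly n c)"
      using n p R by (subst powr_mult) (auto simp: Lp_norm_tpoly pint_nonneg powr_realpow)
    also have "\<dots> = R powr (?d / p) * real n powr (?d / p) * Lp_norm (ereal p) (tpoly n c)"
      using n R by (simp add: powr_powr powr_mult)
    finally show "norm (tpoly n c x) \<le> R powr (?d / p) * real n powr (?d / p) * Lp_norm (ereal p) (tpoly n c)" .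
  qed
qed

text \<open>The sup bound of \<open>nikolskii_infinity\<close> is inserted for the excess power
  \<open>r - p\<close> in \<open>pint_mono_sup\<close>.\<close>

lemma nikolskii:
  assumes p: "0 < p" "ereal p < q"
  obtains C where "0 < C"
    "\<And>n c. 1 \<le> n \<Longrightarrow> Lp_norm q (tpoly n c :: real ^ 'd \<Rightarrow> complex)
      \<le> C * real n powr (CARD('d) * (1 / p - recip q)) * Lp_norm (ereal p) (tpoly n c)"
proof -
  obtain C where C: "0 < C"
    "\<And>n c x. 1 \<le> n \<Longrightarrow> norm (tpoly n c (x :: real ^ 'd)) \<le> C * real n powr (CARD('d) / p) * Lp_norm (ereal p) (tpoly n c)"
    using nikolskii_infinity[OF p(1)] by blast
  show ?thesis
  proof (cases q)
    case PInf
    show ?thesis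
    proof
      show "0 < C" by fact
      show "Lp_norm q (tpoly n c :: real ^ 'd \<Rightarrow> complex)
          \<le> C * real n powr (CARD('d) * (1 / p - recip q)) * Lp_norm (ereal p) (tpoly n c)" if "1 \<le> n" for n c
        unfolding PInf by (rule Lp_norm_infinity(2)[OF continuous_on_tpoly periodic_tpoly])
          (use C(2)[OF that] in \<open>simp add: recip_def\<close>)
    qed
  next
    case (real r)
    then have r: "p < r" "0 < r" using p by auto
    show ?thesis
    proof
      show "0 < C powr (1 - p / r)" using C by simp
      fix n :: nat and c :: "int ^ 'd \<Rightarrow> complex" assume n: "1 \<le> n"
      let ?T = "tpoly n c" and ?L = "Lp_norm (ereal p) (tpoly n c)"
      have L: "0 \<le> ?L" using p by (rule_tac Lp_norm_nonneg_tpoly) auto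
      have "Lp_norm q ?T = pint r ?T powr (1 / r)" using r by (simp add: real Lp_norm_tpoly)
      also have "\<dots> \<le> ((C * real n powr (CARD('d) / p) * ?L) powr (r - p) * ?L powr p) powr (1 / r)"
        using r p C(2)[OF n] pint_mono_sup[of p r n c] pint_eq_Lp_norm[of p n c]
        by (intro powr_mono2) (auto simp: pint_nonneg)
      also have "\<dots> = C powr ((r - p) / r) * real n powr (CARD('d) * (r - p) / (p * r)) * (?L powr ((r - p) / r) * ?L powr (p / r))"
        using C(1) L by (simp add: powr_mult powr_powr mult_ac)
      also have "?L powr ((r - p) / r) * ?L powr (p / r) = ?L"
        using r L by (simp flip: powr_add add_divide_distrib)
      also have "(r - p) / r = 1 - p / r" using r by (simp add: field_simps)
      also have "CARD('d) * (r - p) / (p * r) = CARD('d) * (1 / p - recip q)"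
        using r p by (simp add: real recip_def field_simps)
      finally show "Lp_norm q ?T \<le> C powr (1 - p / r) * real n powr (CARD('d) * (1 / p - recip q)) * ?L" .
    qed
  qed (use p in auto)
qed

text \<open>The integrand is cut at the height \<open>?s\<close> of the larger norm: below, it is at
  most \<open>?s powr r\<close>, above, at most \<open>?s powr (r - q)\<close> times the q-th power.
  This gives the volume plus 1 in the constant.\<close>

lemma pint_mono_exponent:
  assumes "0 < r" "r \<le> q"
  shows "Lp_norm (ereal r) (tpoly n c :: real ^ 'd \<Rightarrow> complex)
    \<le> ((2 * pi) ^ CARD('d) + 1) powr (1 / r) * Lp_norm (ereal q) (tpoly n c)"
proof -
  let ?T = "tpoly n c :: real ^ 'd \<Rightarrow> complex" and ?s = "Lp_norm (ereal q) (tpoly n c :: real ^ 'd \<Rightarrow> complex)"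
  have q: "0 < q" using assms by simp
  have "pint r ?T \<le> ((2 * pi) ^ CARD('d) + 1) * ?s powr r"
  proof (cases "?s = 0")
    case True
    then have "pint q ?T = 0" using q by (simp add: pint_eq_Lp_norm)
    then have "AE x in cube_measure. norm (?T x) powr q = 0"
      unfolding pint_def using integrable_pint[OF q, of n c] by (subst (asm) integral_nonneg_eq_0_iff_AE) auto
    then have "pint r ?T = (LINT x|(cube_measure :: (real ^ 'd) measure). 0)"
      unfolding pint_def
      by (intro integral_cong_AE) (auto intro!: measurable_cube_measure elim!: eventually_mono)
    then show ?thesis by simp
  next
    case False
    then have s: "0 < ?s" using Lp_norm_nonneg_tpoly[OF q, of n c] by simp
    have "pint r ?T \<le> (LINT x|cube_measure. ?s powr r + ?s powr (r - q) * norm (?T x) powr q)"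
      unfolding pint_def
    proof (rule integral_mono)
      fix x
      show "norm (?T x) powr r \<le> ?s powr r + ?s powr (r - q) * norm (?T x) powr q"
      proof (cases "norm (?T x) \<le> ?s")
        case True
        then have "norm (?T x) powr r \<le> ?s powr r" using assms by (intro powr_mono2) auto
        then show ?thesis by (simp add: add_increasing2)
      next
        case False
        then have "norm (?T x) powr r = norm (?T x) powr (r - q) * norm (?T x) powr q" by (simp flip: powr_add)
        also have "\<dots> \<le> ?s powr (r - q) * norm (?T x) powr q"
          using False s assms by (intro mult_right_mono powr_mono2') auto
        finally show ?thesis by (simp add: add_increasing)
      qed
    qed (use assms q in \<open>auto intro!: integrable_pint Bochner_Integration.integrable_add integrable_mult_right cube_measure.integrable_const\<close>)
    also have "\<dots> = (2 * pi) ^ CARD('d) * ?s powr r + ?s powr (r - q) * pint q ?T"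
      using q integrable_pint[OF q, of n c] by (simp add: pint_def space_restrict_space)
    also have "?s powr (r - q) * pint q ?T = ?s powr r"
      using q s by (simp add: pint_eq_Lp_norm flip: powr_add)
    finally show ?thesis by (simp add: algebra_simps)
  qed
  then have "pint r ?T powr (1 / r) \<le> (((2 * pi) ^ CARD('d) + 1) * ?s powr r) powr (1 / r)"
    using assms by (intro powr_mono2) (auto simp: pint_nonneg)
  then show ?thesis
    using assms q Lp_norm_nonneg_tpoly[OF q, of n c] by (simp add: Lp_norm_tpoly[of r] powr_mult powr_powr)
qed

subsection \<open>Heat semigroup estimates\<close>

text \<open>Values above height \<open>h\<close> are kept whole, not reduced by \<open>h\<close>;
  the type \<open>ennreal\<close> spares integrability conditions.\<close>

definition tail :: "real \<Rightarrow> (real ^ 'd \<Rightarrow> complex) \<Rightarrow> real ^ 'd \<Rightarrow> ennreal" where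
  "tail h f y = ennreal (norm (f y)) * indicator {h<..} (norm (f y))"

definition heat_tail :: "real \<Rightarrow> real \<Rightarrow> nat \<Rightarrow> (int ^ 'd \<Rightarrow> complex) \<Rightarrow> real ^ 'd \<Rightarrow> ennreal" where
  "heat_tail h t n c x = (\<integral>\<^sup>+y. ennreal (heat_kernel t y) * tail h (tpoly n c) (x + y) \<partial>lborel)"

lemma borel_measurable_tail [measurable (raw)]:
  assumes [measurable]: "f \<in> borel_measurable M" "g \<in> borel_measurable M"
  shows "(\<lambda>x. tail (f x) (tpoly n c) (g x)) \<in> borel_measurable M"
  unfolding tail_def greaterThan_def by measurable

lemma borel_measurable_heat_tail [measurable (raw)]:
  assumes [measurable]: "f \<in> borel_measurable M" "g \<in> borel_measurable M"
  shows "(\<lambda>x. heat_tail h (f x) n c (g x)) \<in> borel_measurable M"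
  unfolding heat_tail_def by measurable

lemma borel_measurable_tpoly_heat [measurable (raw)]:
  assumes [measurable]: "f \<in> borel_measurable M" "g \<in> borel_measurable M"
  shows "(\<lambda>x. tpoly n (heat (f x) c) (g x)) \<in> borel_measurable M"
  unfolding tpoly_def heat_def by measurable

lemma periodic_tail: "periodic (tail h (tpoly n c))"
  using periodic_tpoly[of n c] by (simp add: periodic_def tail_def)

lemma norm_tpoly_heat_split:
  assumes t: "0 < t" and h: "0 \<le> h"
  shows "ennreal (norm (tpoly n (heat t c) x)) \<le> ennreal h + heat_tail h t n c x"
proof -
  have "ennreal (norm (tpoly n (heat t c) x))
      \<le> (\<integral>\<^sup>+y. ennreal (heat_kernel t y) * ennreal (norm (tpoly n c (x + y))) \<partial>lborel)"
    by (rule norm_tpoly_heat_le[OF t])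
  also have "\<dots> \<le> (\<integral>\<^sup>+y. ennreal (heat_kernel t y) * ennreal h
      + ennreal (heat_kernel t y) * tail h (tpoly n c) (x + y) \<partial>lborel)"
    unfolding distrib_left[symmetric]
    using h by (intro nn_integral_mono mult_left_mono) (auto simp: tail_def indicator_def intro!: ennreal_leI)
  also have "\<dots> = ennreal h + heat_tail h t n c x"
    unfolding heat_tail_def
    by (subst nn_integral_add) (auto simp: nn_integral_multc nn_integral_heat_kernel[OF t])
  finally show ?thesis .
qed

lemma heat_tail_mass:
  assumes t: "0 < t"
  shows "(\<integral>\<^sup>+x. heat_tail h t n c x \<partial>cube_measure) = (\<integral>\<^sup>+x. tail h (tpoly n c) x \<partial>cube_measure)"
  unfolding heat_tail_def by (rule heat_kernel_mass[OF t _ periodic_tail]) measurable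

lemma heat_tail_le:
  fixes c :: "int ^ 'd \<Rightarrow> complex"
  assumes t: "0 < t" "t \<le> 1"
  shows "heat_tail h t n c x \<le> ennreal (2 ^ CARD('d) * t powr (- real CARD('d) / 2)) * (\<integral>\<^sup>+x. tail h (tpoly n c) x \<partial>cube_measure)"
  unfolding heat_tail_def by (rule heat_kernel_periodic_le[OF t _ periodic_tail]) measurable

text \<open>A cut at height \<open>M\<close> leaves no tail.\<close>

lemma norm_tpoly_heat_le_sup:
  assumes t: "0 < t" and M: "\<And>x. norm (tpoly n c x) \<le> M"
  shows "norm (tpoly n (heat t c) x) \<le> M"
proof -
  have M0: "0 \<le> M" using M norm_ge_zero order_trans by blast
  have "tail M (tpoly n c) y = 0" for y
    using M[of y] by (simp add: tail_def indicator_def)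
  then have "heat_tail M t n c x = 0" by (simp add: heat_tail_def)
  then have "ennreal (norm (tpoly n (heat t c) x)) \<le> ennreal M"
    using norm_tpoly_heat_split[OF t M0, of n c x] by simp
  then show ?thesis using M0 by simp
qed

text \<open>As \<open>1 \<le> p\<close>, the factor \<open>norm (f y) powr (1 - p)\<close> decreases
  above height \<open>h\<close>: Chebyshev's inequality in pointwise form.\<close>

lemma tail_le_powr:
  assumes "1 \<le> p" "0 < h"
  shows "tail h f y \<le> ennreal (h powr (1 - p) * norm (f y) powr p)"
proof (cases "norm (f y) > h")
  case True
  have "norm (f y) = norm (f y) powr (1 - p) * norm (f y) powr p"
    using True assms by (simp flip: powr_add)
  also have "\<dots> \<le> h powr (1 - p) * norm (f y) powr p"
    using True assms by (intro mult_right_mono powr_mono2') auto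
  finally show ?thesis using True by (auto simp: tail_def intro: ennreal_leI)
qed (simp add: tail_def)

lemma nn_integral_tail_le:
  assumes "1 \<le> p" "0 < h"
  shows "(\<integral>\<^sup>+x. tail h (tpoly n c) x \<partial>cube_measure) \<le> ennreal (h powr (1 - p) * pint p (tpoly n c))"
proof -
  have p: "0 < p" using assms by simp
  have "(\<integral>\<^sup>+x. tail h (tpoly n c) x \<partial>cube_measure) \<le> (\<integral>\<^sup>+x. ennreal (h powr (1 - p)) * ennreal (norm (tpoly n c x) powr p) \<partial>cube_measure)"
    using tail_le_powr[OF assms, of "tpoly n c"] by (intro nn_integral_mono) (simp add: ennreal_mult)
  also have "\<dots> = ennreal (h powr (1 - p)) * ennreal (pint p (tpoly n c))"
    unfolding ennreal_pint[OF p]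
    by (rule nn_integral_cmult) (intro measurable_cube_measure measurable_compose[OF _ measurable_ennreal], measurable)
  finally show ?thesis by (simp add: ennreal_mult' pint_nonneg)
qed

text \<open>The smoothing from L_p follows from the one from L_1 by a single cut at
  \<open>h = t powr (- d / (2 * p)) * ?L\<close>, the height at which the tail contributes a
  multiple of \<open>h\<close> itself.\<close>

lemma norm_tpoly_heat_le_Lp:
  fixes c :: "int ^ 'd \<Rightarrow> complex"
  assumes p: "1 \<le> p" and t: "0 < t" "t \<le> 1" and n: "1 \<le> n"
  shows "norm (tpoly n (heat t c) x) \<le> (1 + 2 ^ CARD('d)) * t powr (- real CARD('d) / (2 * p)) * Lp_norm (ereal p) (tpoly n c)"
proof -
  let ?d = "real CARD('d)" and ?L = "Lp_norm (ereal p) (tpoly n c)"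
  have p0: "0 < p" using p by simp
  have L0: "0 \<le> ?L" by (rule Lp_norm_nonneg_tpoly[OF p0])
  show ?thesis
  proof (cases "?L = 0")
    \<comment> \<open>The cut height would be 0; here Nikolskii's inequality shows that the
      polynomial vanishes.\<close>
    case True
    obtain C where "0 < C" and C: "\<And>n c x. 1 \<le> n \<Longrightarrow> norm (tpoly n c (x :: real ^ 'd)) \<le> C * real n powr (CARD('d) / p) * Lp_norm (ereal p) (tpoly n c)"
      using nikolskii_infinity[OF p0] by blast
    from C[OF n, of c] have "norm (tpoly n c x) \<le> 0" for x by (simp add: True)
    from norm_tpoly_heat_le_sup[OF t(1) this] show ?thesis by (simp add: True)
  next
    case False
    then have L: "0 < ?L" using L0 by simp
    define h where "h = t powr (- ?d / (2 * p)) * ?L"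
    have h: "0 < h" using L t by (simp add: h_def)
    have "ennreal (norm (tpoly n (heat t c) x)) \<le> ennreal h + heat_tail h t n c x"
      by (intro norm_tpoly_heat_split t less_imp_le h)
    also have "\<dots> \<le> ennreal h + ennreal (2 ^ CARD('d) * t powr (- ?d / 2)) * ennreal (h powr (1 - p) * pint p (tpoly n c))"
      by (intro add_left_mono order_trans[OF heat_tail_le[OF t]] mult_left_mono nn_integral_tail_le p h) simp
    also have "\<dots> = ennreal (h + 2 ^ CARD('d) * (t powr (- ?d / 2) * (h powr (1 - p) * pint p (tpoly n c))))"
      using h by (subst ennreal_plus) (simp_all only: ennreal_mult'[symmetric] mult.assoc mult_nonneg_nonneg powr_ge_zero pint_nonneg zero_le_power zero_le_numeral less_imp_le)
    also have "t powr (- ?d / 2) * (h powr (1 - p) * pint p (tpoly n c)) = h"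
    proof -
      have "t powr (- ?d / 2) * (h powr (1 - p) * pint p (tpoly n c))
          = (t powr (- ?d / 2) * t powr (- ?d / (2 * p) * (1 - p))) * (?L powr (1 - p) * ?L powr p)"
        using L t unfolding h_def pint_eq_Lp_norm[OF p0] by (subst powr_mult) (simp_all only: powr_powr mult_ac powr_ge_zero less_imp_le)
      also have "t powr (- ?d / 2) * t powr (- ?d / (2 * p) * (1 - p)) = t powr (- ?d / (2 * p))"
      proof -
        have "- ?d / 2 + - ?d / (2 * p) * (1 - p) = - ?d / (2 * p)" using p0 by (simp add: field_simps)
        then show ?thesis by (simp only: powr_add[symmetric])
      qed
      also have "?L powr (1 - p) * ?L powr p = ?L" using L by (simp flip: powr_add)
      finally show ?thesis by (simp add: h_def)
    qed
    finally have "norm (tpoly n (heat t c) x) \<le> h + 2 ^ CARD('d) * h"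
      using h by (subst (asm) ennreal_le_iff) auto
    then show ?thesis by (simp add: h_def algebra_simps)
  qed
qed

text \<open>For nonzero \<open>k\<close>,
  \<open>t * |k|\<^sup>2 \<ge> (t - 1) + |k|\<^sup>2\<close>, which splits off the decay
  \<open>exp (1 - t)\<close>. The remaining sum is a product of one-dimensional sums, each at most 4
  by comparison with two geometric series, uniformly in \<open>n\<close>.\<close>

lemma sum_exp_freqs_le:
  fixes t :: real
  assumes t: "1 \<le> t"
  shows "(\<Sum>k\<in>freqs n - {0 :: int ^ 'd}. exp (- t * (norm (real_vec k))\<^sup>2)) \<le> 4 ^ CARD('d) * exp (1 - t)"
proof -
  have geo: "(\<Sum>i=- int n..int n. exp (- (real_of_int i)\<^sup>2)) \<le> 4"
  proof -
    let ?g = "\<lambda>i. exp (- \<bar>real_of_int i\<bar>)"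
    have e: "exp (- 1 :: real) \<le> 1 / 2"
      using exp_ge_add_one_self[of 1] by (simp add: exp_minus field_simps)
    have s: "(\<Sum>i\<le>n. exp (- real i)) \<le> 2"
    proof -
      have "(\<Sum>i\<le>n. exp (- real i)) = (\<Sum>i\<le>n. exp (- 1) ^ i)"
        by (simp flip: exp_of_nat_mult)
      also have "\<dots> \<le> (\<Sum>i\<le>n. (1 / 2) ^ i)" using e by (intro sum_mono power_mono) auto
      also have "\<dots> = 2 - (1 / 2) ^ n" by (induction n) simp_all
      also have "\<dots> \<le> 2" by simp
      finally show ?thesis .
    qed
    have "(\<Sum>i=- int n..int n. exp (- (real_of_int i)\<^sup>2)) \<le> (\<Sum>i=- int n..int n. ?g i)"
    proof (intro sum_mono)
      fix i :: int
      have "\<bar>i\<bar> \<le> i\<^sup>2" by (metis abs_of_nonneg power2_eq_square self_le_ge2_pow abs_ge_zero abs_mult_self_eq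
          mult_le_cancel_left1 int_one_le_iff_zero_less zero_less_abs_iff abs_0 mult_zero_left order_refl mult.commute linorder_not_less)
      then have "\<bar>real_of_int i\<bar> \<le> (real_of_int i)\<^sup>2"
        by (metis of_int_abs of_int_le_iff of_int_power)
      then show "exp (- (real_of_int i)\<^sup>2) \<le> ?g i" by simp
    qed
    also have "\<dots> \<le> (\<Sum>i\<in>(\<lambda>i. int i) ` {..n} \<union> (\<lambda>i. - int i) ` {..n}. ?g i)"
    proof (intro sum_mono2)
      show "{- int n..int n} \<subseteq> (\<lambda>i. int i) ` {..n} \<union> (\<lambda>i. - int i) ` {..n}"
      proof
        fix i assume "i \<in> {- int n..int n}"
        then show "i \<in> (\<lambda>i. int i) ` {..n} \<union> (\<lambda>i. - int i) ` {..n}"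
          by (cases "0 \<le> i") (auto simp: image_iff intro: bexI[of _ "nat i"] bexI[of _ "nat (- i)"])
      qed
    qed auto
    also have "\<dots> \<le> (\<Sum>i\<in>(\<lambda>i. int i) ` {..n}. ?g i) + (\<Sum>i\<in>(\<lambda>i. - int i) ` {..n}. ?g i)"
      by (subst sum.union_inter[symmetric]) (auto intro: sum_nonneg)
    also have "\<dots> = (\<Sum>i\<le>n. exp (- real i)) + (\<Sum>i\<le>n. exp (- real i))"
      by (simp add: sum.reindex inj_on_def)
    finally show ?thesis using s by linarith
  qed
  have "(\<Sum>k\<in>freqs n - {0 :: int ^ 'd}. exp (- t * (norm (real_vec k))\<^sup>2))
      \<le> (\<Sum>k\<in>freqs n - {0 :: int ^ 'd}. exp (1 - t) * exp (- (norm (real_vec k))\<^sup>2))"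
  proof (intro sum_mono)
    fix k :: "int ^ 'd" assume "k \<in> freqs n - {0}"
    then obtain j where "k $ j \<noteq> 0" by (auto simp: vec_eq_iff)
    then have "1 \<le> \<bar>real_vec k $ j\<bar>" by simp
    also have "\<dots> \<le> norm (real_vec k)" by (rule component_le_norm_cart)
    finally have "1 \<le> (norm (real_vec k))\<^sup>2" by simp
    then have "(t - 1) * 1 \<le> (t - 1) * (norm (real_vec k))\<^sup>2" using t by (intro mult_left_mono) auto
    then have "- t * (norm (real_vec k))\<^sup>2 \<le> (1 - t) + - (norm (real_vec k))\<^sup>2" by (simp add: algebra_simps)
    then have "exp (- t * (norm (real_vec k))\<^sup>2) \<le> exp ((1 - t) + - (norm (real_vec k))\<^sup>2)" by (simp only: exp_le_cancel_iff)
    then show "exp (- t * (norm (real_vec k))\<^sup>2) \<le> exp (1 - t) * exp (- (norm (real_vec k))\<^sup>2)" by (simp only: exp_add)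
  qed
  also have "\<dots> \<le> (\<Sum>k\<in>(freqs n :: (int ^ 'd) set). exp (1 - t) * exp (- (norm (real_vec k))\<^sup>2))"
    by (intro sum_mono2) (auto simp: finite_freqs)
  also have "\<dots> = exp (1 - t) * (\<Sum>k\<in>(freqs n :: (int ^ 'd) set). \<Prod>j\<in>UNIV. exp (- (real_of_int (k $ j))\<^sup>2))"
    by (simp add: sum_distrib_left norm_vec_def L2_set_def sum_nonneg exp_sum[symmetric] sum_negf)
  also have "\<dots> = exp (1 - t) * (\<Prod>j\<in>(UNIV :: 'd set). \<Sum>i=- int n..int n. exp (- (real_of_int i)\<^sup>2))"
    by (subst sum_freqs_prod) simp
  also have "\<dots> \<le> exp (1 - t) * 4 ^ CARD('d)"
    using geo by (auto intro!: mult_left_mono power_mono sum_nonneg)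
  finally show ?thesis by (simp add: mult.commute)
qed

text \<open>With zero mean only frequencies of norm at least 1 remain, and each coefficient is
  bounded by the L_1 norm. This makes the times above 1 harmless in the potential integral.\<close>

lemma norm_tpoly_heat_decay:
  fixes c :: "int ^ 'd \<Rightarrow> complex"
  assumes t: "1 \<le> t" and c: "c 0 = 0"
  shows "norm (tpoly n (heat t c) x) \<le> 4 ^ CARD('d) * exp (1 - t) * pint 1 (tpoly n c)"
proof -
  have one: "1 \<le> (2 * pi) ^ CARD('d)"
    using pi_gt3 by (intro one_le_power) linarith
  have "norm (tpoly n (heat t c) x) \<le> (\<Sum>k\<in>freqs n. norm (heat t c k))" by (rule norm_tpoly_le)
  also have "\<dots> = (\<Sum>k\<in>freqs n - {0}. exp (- t * (norm (real_vec k))\<^sup>2) * norm (c k))"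
    by (rule sum.mono_neutral_cong_right) (auto simp: finite_freqs heat_def c norm_mult)
  also have "\<dots> \<le> (\<Sum>k\<in>freqs n - {0 :: int ^ 'd}. exp (- t * (norm (real_vec k))\<^sup>2) * pint 1 (tpoly n c))"
  proof (intro sum_mono mult_left_mono)
    fix k assume "k \<in> freqs n - {0 :: int ^ 'd}"
    then have "(2 * pi) ^ CARD('d) * norm (c k) \<le> pint 1 (tpoly n c)" by (intro coeff_le_pint) auto
    moreover have "1 * norm (c k) \<le> (2 * pi) ^ CARD('d) * norm (c k)" using one by (intro mult_right_mono) auto
    ultimately show "norm (c k) \<le> pint 1 (tpoly n c)" by linarith
  qed auto
  also have "\<dots> \<le> 4 ^ CARD('d) * exp (1 - t) * pint 1 (tpoly n c)"
    unfolding sum_distrib_right[symmetric] by (intro mult_right_mono sum_exp_freqs_le t pint_nonneg)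
  finally show ?thesis .
qed

subsection \<open>Riesz potentials as integrals of the heat semigroup\<close>

text \<open>At \<open>k = 0\<close> the convention \<open>0 powr a = 0\<close> gives the value 0,
  also for \<open>\<gamma> = 0\<close>; the mean is thus removed automatically.\<close>

definition potential :: "real \<Rightarrow> (int ^ 'd \<Rightarrow> complex) \<Rightarrow> int ^ 'd \<Rightarrow> complex" where
  "potential \<gamma> c k = complex_of_real (norm (real_vec k) powr (- \<gamma>)) * c k"

text \<open>The substitution of \<open>a * t\<close> for \<open>t\<close> in Euler's integral. With
  \<open>a = |k|\<^sup>2\<close> and \<open>s = \<gamma> / 2\<close> it expresses the symbol
  \<open>|k| powr (- \<gamma>)\<close> through the heat symbols.\<close>

lemma has_bochner_integral_Gamma:
  fixes a s :: real
  assumes a: "0 < a" and s: "0 < s"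
  shows "has_bochner_integral lborel (\<lambda>t. indicator {0..} t * t powr (s - 1) * exp (- t * a)) (Gamma s * a powr (- s))"
proof (rule has_bochner_integral_nn_integral)
  let ?J = "\<integral>\<^sup>+t. ennreal (indicator {0..} t * t powr (s - 1) * exp (- t * a)) \<partial>lborel"
  have "ennreal (Gamma s) = (\<integral>\<^sup>+t. ennreal (indicator {0..} t * t powr (s - 1) / exp t) \<partial>lborel)"
    by (rule Gamma_conv_nn_integral_real[OF s])
  also have "\<dots> = ennreal \<bar>a\<bar> * (\<integral>\<^sup>+t. ennreal (indicator {0..} (0 + a * t) * (0 + a * t) powr (s - 1) / exp (0 + a * t)) \<partial>lborel)"
    using a by (intro nn_integral_real_affine) auto
  also have "\<dots> = (\<integral>\<^sup>+t. ennreal (a powr s) * ennreal (indicator {0..} t * t powr (s - 1) * exp (- t * a)) \<partial>lborel)"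
    using a
    by (subst nn_integral_cmult[symmetric])
      (auto intro!: nn_integral_cong simp: ennreal_mult'[symmetric] indicator_def powr_mult powr_diff exp_minus field_simps zero_le_mult_iff)
  also have "\<dots> = ennreal (a powr s) * (\<integral>\<^sup>+t. ennreal (indicator {0..} t * t powr (s - 1) * exp (- t * a)) \<partial>lborel)"
    by (rule nn_integral_cmult) measurable
  finally have "ennreal (a powr (- s)) * ennreal (Gamma s) = ennreal (a powr (- s)) * ennreal (a powr s) * ?J"
    by (simp add: mult.assoc)
  also have "ennreal (a powr (- s)) * ennreal (a powr s) = 1"
    using a by (simp add: ennreal_mult'[symmetric] powr_add[symmetric])
  finally have "?J = ennreal (a powr (- s)) * ennreal (Gamma s)" by (simp only: mult_1)
  also have "\<dots> = ennreal (Gamma s * a powr (- s))"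
    by (subst ennreal_mult'[symmetric]) (simp_all add: mult.commute)
  finally show "?J = ennreal (Gamma s * a powr (- s))" .
qed (use s in \<open>auto intro!: less_imp_le[OF Gamma_real_pos]\<close>)

lemma norm_tpoly_potential_le:
  fixes c :: "int ^ 'd \<Rightarrow> complex"
  assumes c: "c 0 = 0" and g: "0 < \<gamma>"
  shows "ennreal (Gamma (\<gamma> / 2) * norm (tpoly n (potential \<gamma> c) x))
    \<le> (\<integral>\<^sup>+t. ennreal (indicator {0..} t * t powr (\<gamma> / 2 - 1)) * ennreal (norm (tpoly n (heat t c) x)) \<partial>lborel)"
proof -
  let ?w = "\<lambda>t. indicator {0..} t * t powr (\<gamma> / 2 - 1)"
  have w: "0 \<le> ?w t" for t :: real by simp
  have G: "0 < Gamma (\<gamma> / 2)" using g by (intro Gamma_real_pos) auto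
  let ?e = "\<lambda>k t. complex_of_real (?w t * exp (- t * (norm (real_vec k))\<^sup>2)) * (c k * expi k x)"
  \<comment> \<open>At the zero frequency the time integral would diverge; \<open>c 0 = 0\<close>
    removes that term.\<close>
  have hb: "has_bochner_integral lborel (?e k) (Gamma (\<gamma> / 2) * (potential \<gamma> c k * expi k x))" for k
  proof (cases "k = 0")
    case False
    then have a: "0 < (norm (real_vec k))\<^sup>2" by simp
    have "has_bochner_integral lborel (\<lambda>t. complex_of_real (?w t * exp (- t * (norm (real_vec k))\<^sup>2)))
        (complex_of_real (Gamma (\<gamma> / 2) * (norm (real_vec k))\<^sup>2 powr (- (\<gamma> / 2))))"
      by (intro has_bochner_integral_of_real has_bochner_integral_Gamma a) (use g in simp)
    also have "(norm (real_vec k))\<^sup>2 powr (- (\<gamma> / 2)) = norm (real_vec k) powr (- \<gamma>)"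
      using False by (simp add: powr_powr flip: powr_numeral)
    finally have *: "has_bochner_integral lborel (\<lambda>t. complex_of_real (?w t * exp (- t * (norm (real_vec k))\<^sup>2)))
        (complex_of_real (Gamma (\<gamma> / 2) * norm (real_vec k) powr (- \<gamma>)))" .
    have "has_bochner_integral lborel (?e k)
        (complex_of_real (Gamma (\<gamma> / 2) * norm (real_vec k) powr (- \<gamma>)) * (c k * expi k x))"
      by (intro has_bochner_integral_mult_left *)
    then show ?thesis by (simp only: potential_def of_real_mult mult.assoc)
  qed (simp add: c potential_def has_bochner_integral_zero)
  have "has_bochner_integral lborel (\<lambda>t. \<Sum>k\<in>freqs n. ?e k t) (\<Sum>k\<in>freqs n. Gamma (\<gamma> / 2) * (potential \<gamma> c k * expi k x))"
    by (intro has_bochner_integral_sum hb)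
  also have "(\<lambda>t. \<Sum>k\<in>freqs n. ?e k t) = (\<lambda>t. ?w t *\<^sub>R tpoly n (heat t c) x)"
    by (auto simp: tpoly_def heat_def scaleR_conv_of_real sum_distrib_left mult_ac)
  also have "(\<Sum>k\<in>freqs n. Gamma (\<gamma> / 2) * (potential \<gamma> c k * expi k x)) = Gamma (\<gamma> / 2) * tpoly n (potential \<gamma> c) x"
    by (simp add: tpoly_def sum_distrib_left)
  finally have i: "integrable lborel (\<lambda>t. ?w t *\<^sub>R tpoly n (heat t c) x)"
    and v: "(LINT t|lborel. ?w t *\<^sub>R tpoly n (heat t c) x) = Gamma (\<gamma> / 2) * tpoly n (potential \<gamma> c) x"
    by (auto simp: has_bochner_integral_iff)
  have "ennreal (Gamma (\<gamma> / 2) * norm (tpoly n (potential \<gamma> c) x)) = ennreal (norm (LINT t|lborel. ?w t *\<^sub>R tpoly n (heat t c) x))"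
    using G by (simp add: v norm_mult)
  also have "\<dots> \<le> (\<integral>\<^sup>+t. norm (?w t *\<^sub>R tpoly n (heat t c) x) \<partial>lborel)"
    by (rule integral_norm_bound_ennreal[OF i])
  also have "\<dots> = (\<integral>\<^sup>+t. ennreal (?w t) * ennreal (norm (tpoly n (heat t c) x)) \<partial>lborel)"
    using w by (intro nn_integral_cong) (simp add: ennreal_mult'[symmetric])
  finally show ?thesis .
qed

text \<open>Only times up to 1, where the bound of the lattice sum is available, and with the norm
  inside, so that estimates are pointwise in \<open>t\<close>. The extended value postpones the
  question of finiteness.\<close>

definition heat_int :: "real \<Rightarrow> nat \<Rightarrow> (int ^ 'd \<Rightarrow> complex) \<Rightarrow> real ^ 'd \<Rightarrow> ennreal" where
  "heat_int \<gamma> n c x = (\<integral>\<^sup>+t. ennreal (indicator {0<..1} t * t powr (\<gamma> / 2 - 1)) * ennreal (norm (tpoly n (heat t c) x)) \<partial>lborel)"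

lemma borel_measurable_heat_int [measurable]: "heat_int \<gamma> n c \<in> borel_measurable borel"
  unfolding heat_int_def by measurable

text \<open>For times up to 1 the weight \<open>t powr (\<gamma> / 2 - 1)\<close> decreases in
  \<open>\<gamma>\<close>; estimates at a critical order thus extend to all larger orders.\<close>

lemma heat_int_antimono:
  assumes "\<delta> \<le> \<gamma>"
  shows "heat_int \<gamma> n c x \<le> heat_int \<delta> n c x"
  unfolding heat_int_def
  using assms by (intro nn_integral_mono mult_right_mono ennreal_leI) (auto simp: indicator_def intro: powr_mono')

text \<open>Beyond time 1 the flow is at most a multiple of \<open>exp (1 - t)\<close> times the L_1
  norm, which integrates against the weight to a finite constant.\<close>

lemma norm_tpoly_potential_le_heat_int:
  assumes g: "0 < \<gamma>"
  obtains C where "0 < C" "\<And>n c x. c 0 = 0 \<Longrightarrow> ennreal (norm (tpoly n (potential \<gamma> c) (x :: real ^ 'd)))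
    \<le> ennreal C * (heat_int \<gamma> n c x + ennreal (pint 1 (tpoly n c)))"
proof
  let ?G = "Gamma (\<gamma> / 2)"
  have G: "0 < ?G" using g by (intro Gamma_real_pos) auto
  define K where "K = max 1 (4 ^ CARD('d) * exp 1 * ?G)"
  have K: "1 \<le> K" "4 ^ CARD('d) * exp 1 * ?G \<le> K" by (auto simp: K_def)
  show "0 < K / ?G" using K G by simp
  fix n :: nat and c :: "int ^ 'd \<Rightarrow> complex" and x :: "real ^ 'd" assume c: "c 0 = 0"
  let ?u = "\<lambda>t. ennreal (norm (tpoly n (heat t c) x))" and ?P = "pint 1 (tpoly n c)"
  let ?w = "\<lambda>t :: real. t powr (\<gamma> / 2 - 1)"
  have "ennreal (?G * norm (tpoly n (potential \<gamma> c) x)) \<le> (\<integral>\<^sup>+t. ennreal (indicator {0..} t * ?w t) * ?u t \<partial>lborel)"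
    by (rule norm_tpoly_potential_le[where c = c, OF c g])
  \<comment> \<open>The decaying majorant is extended down to time 0, so that its integral is
    exactly \<open>Gamma (\<gamma> / 2)\<close>.\<close>
  also have "\<dots> \<le> (\<integral>\<^sup>+t. ennreal (indicator {0<..1} t * ?w t) * ?u t
      + ennreal (4 ^ CARD('d) * exp 1 * ?P) * ennreal (indicator {0..} t * ?w t * exp (- t * 1)) \<partial>lborel)"
  proof (rule nn_integral_mono)
    fix t :: real
    show "ennreal (indicator {0..} t * ?w t) * ?u t \<le> ennreal (indicator {0<..1} t * ?w t) * ?u t
        + ennreal (4 ^ CARD('d) * exp 1 * ?P) * ennreal (indicator {0..} t * ?w t * exp (- t * 1))"
    proof (cases "t \<le> 1")
      case True
      then show ?thesis by (cases "t = 0") (auto simp: indicator_def)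
    next
      case False
      then have "?w t * norm (tpoly n (heat t c) x) \<le> ?w t * (4 ^ CARD('d) * exp (1 - t) * ?P)"
        using norm_tpoly_heat_decay[where c = c and t = t and n = n and x = x, OF _ c] by (intro mult_left_mono) auto
      also have "\<dots> = 4 ^ CARD('d) * exp 1 * ?P * (?w t * exp (- t * 1))"
        by (simp add: exp_diff exp_minus field_simps)
      finally have "ennreal (?w t) * ?u t \<le> ennreal (4 ^ CARD('d) * exp 1 * ?P) * ennreal (?w t * exp (- t * 1))"
        by (simp add: ennreal_mult'[symmetric] pint_nonneg ennreal_leI)
      then show ?thesis using False by (simp add: add_increasing)
    qed
  qed
  also have "\<dots> = heat_int \<gamma> n c x + ennreal (4 ^ CARD('d) * exp 1 * ?P) * (\<integral>\<^sup>+t. ennreal (indicator {0..} t * ?w t * exp (- t * 1)) \<partial>lborel)"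
    unfolding heat_int_def by (subst nn_integral_add) (auto simp: nn_integral_cmult)
  also have "(\<integral>\<^sup>+t. ennreal (indicator {0..} t * ?w t * exp (- t * 1)) \<partial>lborel) = ennreal ?G"
    using has_bochner_integral_Gamma[of 1 "\<gamma> / 2"] g
    by (subst nn_integral_eq_integral) (auto simp: has_bochner_integral_iff)
  also have "ennreal (4 ^ CARD('d) * exp 1 * ?P) * ennreal ?G = ennreal (4 ^ CARD('d) * exp 1 * ?G) * ennreal ?P"
    using G by (simp add: ennreal_mult'[symmetric] pint_nonneg mult_ac)
  also have "heat_int \<gamma> n c x + ennreal (4 ^ CARD('d) * exp 1 * ?G) * ennreal ?P \<le> ennreal K * (heat_int \<gamma> n c x + ennreal ?P)"
    unfolding distrib_left
  proof (intro add_mono mult_right_mono ennreal_leI)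
    have "1 * heat_int \<gamma> n c x \<le> ennreal K * heat_int \<gamma> n c x"
      using K by (intro mult_right_mono) auto
    then show "heat_int \<gamma> n c x \<le> ennreal K * heat_int \<gamma> n c x" by simp
  qed (use K in auto)
  finally have *: "ennreal (?G * norm (tpoly n (potential \<gamma> c) x)) \<le> ennreal K * (heat_int \<gamma> n c x + ennreal ?P)" .
  have "ennreal (norm (tpoly n (potential \<gamma> c) x)) = ennreal (1 / ?G) * ennreal (?G * norm (tpoly n (potential \<gamma> c) x))"
    using G by (simp add: ennreal_mult'[symmetric])
  also have "\<dots> \<le> ennreal (1 / ?G) * (ennreal K * (heat_int \<gamma> n c x + ennreal ?P))"
    by (intro mult_left_mono *) simp
  also have "\<dots> = ennreal (K / ?G) * (heat_int \<gamma> n c x + ennreal ?P)"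
    using G K by (simp add: mult.assoc[symmetric] ennreal_mult'[symmetric])
  finally show "ennreal (norm (tpoly n (potential \<gamma> c) x)) \<le> ennreal (K / ?G) * (heat_int \<gamma> n c x + ennreal ?P)" .
qed

subsection \<open>Level sets of the heat integral\<close>

lemma nn_integral_powr_from_0:
  fixes a b :: real
  assumes a: "0 < a" and b: "0 \<le> b"
  shows "(\<integral>\<^sup>+t. ennreal (indicator {0<..<b} t * t powr (a - 1)) \<partial>lborel) = ennreal (b powr a / a)"
proof -
  have "((\<lambda>t. t powr (a - 1)) has_integral (b powr (a - 1 + 1) / (a - 1 + 1))) {0..b}"
    using a b by (intro has_integral_powr_from_0) auto
  from nn_integral_has_integral_lebesgue[OF _ this]
  have "(\<integral>\<^sup>+t. ennreal (indicator {0..b} t * t powr (a - 1)) \<partial>lborel) = ennreal (b powr a / a)" by simp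
  moreover have "(\<integral>\<^sup>+t. ennreal (indicator {0<..<b} t * t powr (a - 1)) \<partial>lborel)
      = (\<integral>\<^sup>+t. ennreal (indicator {0..b} t * t powr (a - 1)) \<partial>lborel)"
    by (rule nn_integral_cong_AE) (use AE_lborel_singleton[of 0] AE_lborel_singleton[of b] in eventually_elim, auto simp: indicator_def)
  ultimately show ?thesis by simp
qed

lemma nn_integral_powr_to_infinity:
  fixes a b :: real
  assumes a: "0 < a" and b: "0 < b"
  shows "(\<integral>\<^sup>+t. ennreal (indicator {b<..} t * t powr (- a - 1)) \<partial>lborel) = ennreal (b powr (- a) / a)"
proof -
  have "((\<lambda>t. t powr (- a - 1)) has_integral (- (b powr (- a - 1 + 1)) / (- a - 1 + 1))) {b..}"
    using a b by (intro has_integral_powr_to_inf) auto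
  from nn_integral_has_integral_lebesgue[OF _ this]
  have "(\<integral>\<^sup>+t. ennreal (indicator {b..} t * t powr (- a - 1)) \<partial>lborel) = ennreal (b powr (- a) / a)" by simp
  moreover have "(\<integral>\<^sup>+t. ennreal (indicator {b<..} t * t powr (- a - 1)) \<partial>lborel)
      = (\<integral>\<^sup>+t. ennreal (indicator {b..} t * t powr (- a - 1)) \<partial>lborel)"
    by (rule nn_integral_cong_AE) (use AE_lborel_singleton[of b] in eventually_elim, auto simp: indicator_def)
  ultimately show ?thesis by simp
qed

lemma nn_integral_inverse:
  fixes a b :: real
  assumes b: "0 < a" "a \<le> b"
  shows "(\<integral>\<^sup>+t. ennreal (indicator {a<..b} t * t powr (- 1)) \<partial>lborel) = ennreal (ln b - ln a)"
proof -
  have "(\<integral>\<^sup>+t. ennreal (inverse t) * indicator {a..b} t \<partial>lborel) = ennreal (ln b - ln a)"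
    by (rule nn_integral_FTC_Icc) (use b in \<open>auto intro!: derivative_eq_intros simp: divide_inverse\<close>)
  moreover have "(\<integral>\<^sup>+t. ennreal (indicator {a<..b} t * t powr (- 1)) \<partial>lborel)
      = (\<integral>\<^sup>+t. ennreal (inverse t) * indicator {a..b} t \<partial>lborel)"
    by (rule nn_integral_cong_AE) (use AE_lborel_singleton[of a] in eventually_elim,
        use b in \<open>auto simp: indicator_def powr_minus\<close>)
  ultimately show ?thesis by simp
qed

lemma nn_integral_cube_swap:
  fixes F :: "real \<Rightarrow> real ^ 'd \<Rightarrow> ennreal"
  assumes [measurable]: "case_prod F \<in> borel_measurable (borel \<Otimes>\<^sub>M borel)"
  shows "(\<integral>\<^sup>+l. (\<integral>\<^sup>+x. F l x \<partial>cube_measure) \<partial>lborel) = (\<integral>\<^sup>+x. (\<integral>\<^sup>+l. F l x \<partial>lborel) \<partial>cube_measure)"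
proof -
  have "(\<integral>\<^sup>+l. (\<integral>\<^sup>+x. F l x * indicator period_cube x \<partial>lborel) \<partial>lborel) = (\<integral>\<^sup>+x. (\<integral>\<^sup>+l. F l x * indicator period_cube x \<partial>lborel) \<partial>lborel)"
    by (rule lborel_pair.Fubini') measurable
  then show ?thesis by (simp add: nn_integral_cube nn_integral_multc)
qed

lemma layer_cake:
  fixes f :: "real ^ 'd \<Rightarrow> real"
  assumes [measurable]: "f \<in> borel_measurable borel" and f: "\<And>x. 0 \<le> f x" and a: "0 < a"
  shows "(\<integral>\<^sup>+x. ennreal (f x powr a) \<partial>cube_measure)
    = (\<integral>\<^sup>+l. ennreal (indicator {0<..} l * (a * l powr (a - 1))) * emeasure cube_measure {x \<in> space cube_measure. l < f x} \<partial>lborel)"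
proof -
  have "(\<integral>\<^sup>+x. ennreal (f x powr a) \<partial>cube_measure)
      = (\<integral>\<^sup>+x. (\<integral>\<^sup>+l. ennreal (indicator {0<..} l * (a * l powr (a - 1))) * indicator {x. l < f x} x \<partial>lborel) \<partial>cube_measure)"
  proof (rule nn_integral_cong)
    fix x
    have "(\<integral>\<^sup>+l. ennreal (indicator {0<..} l * (a * l powr (a - 1))) * indicator {x. l < f x} x \<partial>lborel)
        = (\<integral>\<^sup>+l. ennreal a * ennreal (indicator {0<..<f x} l * l powr (a - 1)) \<partial>lborel)"
      using a by (intro nn_integral_cong) (auto simp: indicator_def ennreal_mult')
    also have "\<dots> = ennreal a * ennreal (f x powr a / a)"
      using a f by (subst nn_integral_cmult) (auto simp: nn_integral_powr_from_0)
    also have "\<dots> = ennreal (f x powr a)" using a by (simp add: ennreal_mult'[symmetric])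
    finally show "ennreal (f x powr a) = (\<integral>\<^sup>+l. ennreal (indicator {0<..} l * (a * l powr (a - 1))) * indicator {x. l < f x} x \<partial>lborel)" ..
  qed
  also have "\<dots> = (\<integral>\<^sup>+l. (\<integral>\<^sup>+x. ennreal (indicator {0<..} l * (a * l powr (a - 1))) * indicator {x. l < f x} x \<partial>cube_measure) \<partial>lborel)"
    by (rule nn_integral_cube_swap[symmetric]) measurable
  also have "\<dots> = (\<integral>\<^sup>+l. ennreal (indicator {0<..} l * (a * l powr (a - 1))) * emeasure cube_measure {x \<in> space cube_measure. l < f x} \<partial>lborel)"
  proof (rule nn_integral_cong)
    fix l
    have [measurable]: "f \<in> borel_measurable cube_measure" by (rule measurable_cube_measure) measurable
    have m: "{x \<in> space cube_measure. l < f x} \<in> sets cube_measure" by measurable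
    have "(\<integral>\<^sup>+x. indicator {x. l < f x} x \<partial>cube_measure) = (\<integral>\<^sup>+x. indicator {x \<in> space cube_measure. l < f x} x \<partial>cube_measure)"
      by (intro nn_integral_cong) (auto simp: indicator_def)
    then have "(\<integral>\<^sup>+x. indicator {x. l < f x} x \<partial>cube_measure) = emeasure cube_measure {x \<in> space cube_measure. l < f x}"
      using nn_integral_indicator[OF m] by simp
    moreover have "(\<integral>\<^sup>+x. ennreal (indicator {0<..} l * (a * l powr (a - 1))) * indicator {x. l < f x} x \<partial>cube_measure)
        = ennreal (indicator {0<..} l * (a * l powr (a - 1))) * (\<integral>\<^sup>+x. indicator {x. l < f x} x \<partial>cube_measure)"
      by (rule nn_integral_cmult) (intro measurable_cube_measure, measurable)
    ultimately show "(\<integral>\<^sup>+x. ennreal (indicator {0<..} l * (a * l powr (a - 1))) * indicator {x. l < f x} x \<partial>cube_measure)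
        = ennreal (indicator {0<..} l * (a * l powr (a - 1))) * emeasure cube_measure {x \<in> space cube_measure. l < f x}" by simp
  qed
  finally show ?thesis .
qed

text \<open>\<open>enn2real\<close> sends an infinite value to 0;
  \<open>ennreal_heat_int_real\<close> shows that this does not happen for
  \<open>\<gamma> > 0\<close>.\<close>

definition heat_int_real :: "real \<Rightarrow> nat \<Rightarrow> (int ^ 'd \<Rightarrow> complex) \<Rightarrow> real ^ 'd \<Rightarrow> real" where
  "heat_int_real \<gamma> n c x = enn2real (heat_int \<gamma> n c x)"

lemma heat_int_real_nonneg: "0 \<le> heat_int_real \<gamma> n c x"
  by (simp add: heat_int_real_def)

lemma borel_measurable_heat_int_real [measurable]: "heat_int_real \<gamma> n c \<in> borel_measurable borel"
  unfolding heat_int_real_def by measurable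

lemma nn_integral_weight:
  assumes "0 < \<gamma>" "0 \<le> b"
  shows "(\<integral>\<^sup>+t. ennreal (indicator {0<..b} t * t powr (\<gamma> / 2 - 1)) \<partial>lborel) = ennreal (2 / \<gamma> * b powr (\<gamma> / 2))"
proof -
  have "(\<integral>\<^sup>+t. ennreal (indicator {0<..b} t * t powr (\<gamma> / 2 - 1)) \<partial>lborel)
      = (\<integral>\<^sup>+t. ennreal (indicator {0<..<b} t * t powr (\<gamma> / 2 - 1)) \<partial>lborel)"
    by (rule nn_integral_cong_AE) (use AE_lborel_singleton[of b] in eventually_elim, auto simp: indicator_def)
  then show ?thesis using nn_integral_powr_from_0[of "\<gamma> / 2" b] assms by (simp add: mult.commute)
qed

lemma ennreal_heat_int_real:
  assumes g: "0 < \<gamma>"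
  shows "ennreal (heat_int_real \<gamma> n c x) = heat_int \<gamma> n c x"
proof -
  define M where "M = (\<Sum>k\<in>freqs n. norm (c k))"
  have M: "0 \<le> M" "\<And>x. norm (tpoly n c x) \<le> M"
    by (simp_all add: M_def sum_nonneg norm_tpoly_le)
  have "heat_int \<gamma> n c x \<le> (\<integral>\<^sup>+t. ennreal (indicator {0<..1} t * t powr (\<gamma> / 2 - 1)) * ennreal M \<partial>lborel)"
    unfolding heat_int_def
  proof (rule nn_integral_mono)
    fix t :: real
    show "ennreal (indicator {0<..1} t * t powr (\<gamma> / 2 - 1)) * ennreal (norm (tpoly n (heat t c) x))
        \<le> ennreal (indicator {0<..1} t * t powr (\<gamma> / 2 - 1)) * ennreal M"
      using norm_tpoly_heat_le_sup[of t n c M x] M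
      by (cases "t \<in> {0<..1}") (auto intro!: mult_left_mono ennreal_leI)
  qed
  also have "\<dots> = ennreal (2 / \<gamma> * 1 powr (\<gamma> / 2)) * ennreal M"
    by (subst nn_integral_multc) (use g nn_integral_weight[OF g, of 1] in auto)
  also have "\<dots> < \<infinity>" by (simp add: ennreal_mult_less_top)
  finally show ?thesis by (simp add: heat_int_real_def)
qed

lemma heat_int_real_antimono:
  assumes "0 < \<delta>" "\<delta> \<le> \<gamma>"
  shows "heat_int_real \<gamma> n c x \<le> heat_int_real \<delta> n c x"
proof -
  have "ennreal (heat_int_real \<gamma> n c x) \<le> ennreal (heat_int_real \<delta> n c x)"
    using assms heat_int_antimono[OF assms(2), of n c x] by (simp add: ennreal_heat_int_real)
  then show ?thesis by (subst (asm) ennreal_le_iff) (rule heat_int_real_nonneg)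
qed

text \<open>Where \<open>heat_int\<close> exceeds \<open>l\<close>: the times \<open>t > \<tau>\<close> contribute at most \<open>l / 3\<close> by the
  smoothing estimate, the part of \<open>T\<close> below height \<open>\<kappa> l\<^bsup>q/p\<^esup>\<close> contributes at most \<open>l / 3\<close> over
  \<open>t \<le> \<tau>\<close>, and the remainder is controlled in \<open>L\<^sub>1\<close>.\<close>

lemma heat_int_real_level_set:
  assumes p: "1 \<le> p" "p < q" and g: "\<gamma> = real CARD('d) * (1 / p - 1 / q)"
  obtains \<kappa> where "0 < \<kappa>" "\<And>n (c :: int ^ 'd \<Rightarrow> complex) l. 1 \<le> n \<Longrightarrow> Lp_norm (ereal p) (tpoly n c) \<le> 1 \<Longrightarrow> 0 < l \<Longrightarrow>
    ennreal (\<kappa> * l powr (q / p)) * emeasure cube_measure {x \<in> space cube_measure. l < heat_int_real \<gamma> n c x}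
      \<le> (\<integral>\<^sup>+x. tail (\<kappa> * l powr (q / p)) (tpoly n c) x \<partial>cube_measure)"
proof
  let ?d = "real CARD('d)"
  define K :: real where "K = 1 + 2 ^ CARD('d)"
  \<comment> \<open>With the smoothing from L_p the integrand is of order
    \<open>t powr (- \<rho> - 1)\<close>, because
    \<open>\<gamma> / 2 - d / (2 * p) = - \<rho>\<close>.\<close>
  define \<rho> where "\<rho> = ?d / (2 * q)"
  have K: "0 < K" unfolding K_def by (intro add_pos_pos) auto
  have \<rho>: "0 < \<rho>" using p by (simp add: \<rho>_def)
  have gpos: "0 < \<gamma>" using p unfolding g by (auto simp: field_simps)
  \<comment> \<open>Chosen so that the contribution of the low part,
    \<open>2 / \<gamma> * \<tau> powr (\<gamma> / 2) * h\<close>, is exactly \<open>l / 3\<close>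
    for the \<open>\<tau>\<close> defined below.\<close>
  define \<kappa> where "\<kappa> = \<gamma> / 6 * (\<rho> / (3 * K)) powr (q / p - 1)"
  show \<kappa>: "0 < \<kappa>" using gpos \<rho> K by (simp add: \<kappa>_def)
  fix n :: nat and c :: "int ^ 'd \<Rightarrow> complex" and l :: real
  assume n: "1 \<le> n" and L: "Lp_norm (ereal p) (tpoly n c) \<le> 1" and l: "0 < l"
  \<comment> \<open>The time beyond which the smoothing estimate integrates to exactly
    \<open>l / 3\<close>.\<close>
  define \<tau> where "\<tau> = (\<rho> * l / (3 * K)) powr (- 1 / \<rho>)"
  have \<tau>: "0 < \<tau>" using \<rho> l K by (simp add: \<tau>_def)
  define h where "h = \<kappa> * l powr (q / p)"
  have h: "0 < h" using \<kappa> l by (simp add: h_def)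
  have t1: "K * (\<tau> powr (- \<rho>) / \<rho>) = l / 3"
    using \<rho> l K by (simp add: \<tau>_def powr_powr)
  have t2: "2 / \<gamma> * \<tau> powr (\<gamma> / 2) * h = l / 3"
  proof -
    have e: "- 1 / \<rho> * (\<gamma> / 2) = - (q / p - 1)"
      using p by (simp add: \<rho>_def g field_simps)
    have "\<tau> powr (\<gamma> / 2) = (\<rho> * l / (3 * K)) powr (- (q / p - 1))"
      by (simp only: \<tau>_def powr_powr e)
    also have "\<rho> * l / (3 * K) = \<rho> / (3 * K) * l" by simp
    also have "(\<rho> / (3 * K) * l) powr (- (q / p - 1)) = (\<rho> / (3 * K)) powr (- (q / p - 1)) * l powr (- (q / p - 1))"
      by (rule powr_mult)
    finally have "2 / \<gamma> * \<tau> powr (\<gamma> / 2) * h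
        = 2 / \<gamma> * (\<gamma> / 6) * ((\<rho> / (3 * K)) powr (- (q / p - 1)) * (\<rho> / (3 * K)) powr (q / p - 1)) * (l powr (- (q / p - 1)) * l powr (q / p))"
      by (simp add: h_def \<kappa>_def mult_ac)
    also have "(\<rho> / (3 * K)) powr (- (q / p - 1)) * (\<rho> / (3 * K)) powr (q / p - 1) = 1"
      using \<rho> K by (simp flip: powr_add)
    also have "l powr (- (q / p - 1)) * l powr (q / p) = l" using l by (simp flip: powr_add)
    finally show ?thesis using gpos by simp
  qed
  let ?w = "\<lambda>t :: real. t powr (\<gamma> / 2 - 1)"
  define R where "R x = (\<integral>\<^sup>+t. ennreal (indicator {0<..\<tau>} t * ?w t) * heat_tail h t n c x \<partial>lborel)" for x
  have hi: "ennreal (heat_int_real \<gamma> n c x) \<le> ennreal (l / 3) + ennreal (l / 3) + R x" for x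
  proof -
    have "ennreal (heat_int_real \<gamma> n c x) = (\<integral>\<^sup>+t. ennreal (indicator {0<..1} t * ?w t) * ennreal (norm (tpoly n (heat t c) x)) \<partial>lborel)"
      by (simp add: ennreal_heat_int_real[OF gpos] heat_int_def)
    also have "\<dots> \<le> (\<integral>\<^sup>+t. ennreal K * ennreal (indicator {\<tau><..} t * t powr (- \<rho> - 1))
        + (ennreal (indicator {0<..\<tau>} t * ?w t) * ennreal h + ennreal (indicator {0<..\<tau>} t * ?w t) * heat_tail h t n c x) \<partial>lborel)"
    proof (rule nn_integral_mono)
      fix t :: real
      show "ennreal (indicator {0<..1} t * ?w t) * ennreal (norm (tpoly n (heat t c) x))
        \<le> ennreal K * ennreal (indicator {\<tau><..} t * t powr (- \<rho> - 1))
        + (ennreal (indicator {0<..\<tau>} t * ?w t) * ennreal h + ennreal (indicator {0<..\<tau>} t * ?w t) * heat_tail h t n c x)"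
      proof (cases "t \<in> {0<..1}")
        case t: True
        show ?thesis
        proof (cases "t \<le> \<tau>")
          case True
          have "ennreal (?w t) * ennreal (norm (tpoly n (heat t c) x)) \<le> ennreal (?w t) * (ennreal h + heat_tail h t n c x)"
            using t h by (intro mult_left_mono norm_tpoly_heat_split) auto
          then show ?thesis using True t by (simp add: distrib_left)
        next
          case False
          have "norm (tpoly n (heat t c) x) \<le> K * t powr (- ?d / (2 * p)) * Lp_norm (ereal p) (tpoly n c)"
            unfolding K_def using t n p by (intro norm_tpoly_heat_le_Lp) auto
          also have "\<dots> \<le> K * t powr (- ?d / (2 * p)) * 1" using L K by (intro mult_left_mono) auto
          finally have "?w t * norm (tpoly n (heat t c) x) \<le> ?w t * (K * t powr (- ?d / (2 * p)))"
            by (intro mult_left_mono) auto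
          also have "\<dots> = K * (?w t * t powr (- ?d / (2 * p)))" by simp
          also have "?w t * t powr (- ?d / (2 * p)) = t powr (- \<rho> - 1)"
          proof -
            have "\<gamma> / 2 - 1 + - ?d / (2 * p) = - \<rho> - 1" using p by (simp add: g \<rho>_def field_simps)
            then show ?thesis by (simp only: powr_add[symmetric])
          qed
          finally show ?thesis using False t K by (simp add: ennreal_mult'[symmetric] ennreal_leI)
        qed
      qed simp
    qed
    also have "\<dots> = ennreal K * ennreal (\<tau> powr (- \<rho>) / \<rho>) + (ennreal (2 / \<gamma> * \<tau> powr (\<gamma> / 2)) * ennreal h + R x)"
      unfolding R_def
      by (subst nn_integral_add, measurable, subst nn_integral_add, measurable)
        (use \<rho> \<tau> gpos in \<open>simp add: nn_integral_cmult nn_integral_multc nn_integral_powr_to_infinity nn_integral_weight less_imp_le\<close>)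
    also have "\<dots> = ennreal (l / 3) + ennreal (l / 3) + R x"
    proof -
      have "ennreal K * ennreal (\<tau> powr (- \<rho>) / \<rho>) = ennreal (l / 3)"
        using K by (subst ennreal_mult'[symmetric]) (simp_all only: t1 less_imp_le)
      moreover have "ennreal (2 / \<gamma> * \<tau> powr (\<gamma> / 2)) * ennreal h = ennreal (l / 3)"
        using h by (subst ennreal_mult''[symmetric]) (simp_all only: t2 less_imp_le)
      ultimately show ?thesis by (simp only: add.assoc)
    qed
    finally show ?thesis .
  qed
  let ?E = "{x \<in> space cube_measure. l < heat_int_real \<gamma> n c x}"
  have [measurable]: "heat_int_real \<gamma> n c \<in> borel_measurable cube_measure" by (rule measurable_cube_measure) measurable
  \<comment> \<open>Chebyshev: where the heat integral exceeds \<open>l\<close>, the remainder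
    \<open>R\<close> is at least \<open>l / 3\<close>, and its integral is known because the heat
    flow preserves mass.\<close>
  have "ennreal (l / 3) * emeasure cube_measure ?E = (\<integral>\<^sup>+x. ennreal (l / 3) * indicator ?E x \<partial>cube_measure)"
    by (rule nn_integral_cmult_indicator[symmetric]) measurable
  also have "\<dots> \<le> (\<integral>\<^sup>+x. R x \<partial>cube_measure)"
  proof (rule nn_integral_mono)
    fix x
    show "ennreal (l / 3) * indicator ?E x \<le> R x"
    proof (cases "x \<in> ?E")
      case True
      then have "ennreal l \<le> ennreal (heat_int_real \<gamma> n c x)" by (simp add: ennreal_leI)
      also have "\<dots> \<le> ennreal (2 * l / 3) + R x" using hi[of x] l by (simp flip: ennreal_plus)
      finally have "ennreal (2 * l / 3) + ennreal (l / 3) \<le> ennreal (2 * l / 3) + R x"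
        using l by (simp flip: ennreal_plus)
      then show ?thesis using True by (simp add: ennreal_add_left_cancel_le)
    qed simp
  qed
  also have "\<dots> = (\<integral>\<^sup>+t. (\<integral>\<^sup>+x. ennreal (indicator {0<..\<tau>} t * ?w t) * heat_tail h t n c x \<partial>cube_measure) \<partial>lborel)"
    unfolding R_def by (rule nn_integral_cube_swap[symmetric]) measurable
  also have "\<dots> = (\<integral>\<^sup>+t. ennreal (indicator {0<..\<tau>} t * ?w t) * (\<integral>\<^sup>+x. tail h (tpoly n c) x \<partial>cube_measure) \<partial>lborel)"
  proof (rule nn_integral_cong)
    fix t :: real
    have "(\<integral>\<^sup>+x. ennreal (indicator {0<..\<tau>} t * ?w t) * heat_tail h t n c x \<partial>cube_measure)
        = ennreal (indicator {0<..\<tau>} t * ?w t) * (\<integral>\<^sup>+x. heat_tail h t n c x \<partial>cube_measure)"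
      by (rule nn_integral_cmult) (intro measurable_cube_measure, measurable)
    then show "(\<integral>\<^sup>+x. ennreal (indicator {0<..\<tau>} t * ?w t) * heat_tail h t n c x \<partial>cube_measure)
        = ennreal (indicator {0<..\<tau>} t * ?w t) * (\<integral>\<^sup>+x. tail h (tpoly n c) x \<partial>cube_measure)"
      by (cases "t \<in> {0<..\<tau>}") (auto simp: heat_tail_mass)
  qed
  also have "\<dots> = ennreal (2 / \<gamma> * \<tau> powr (\<gamma> / 2)) * (\<integral>\<^sup>+x. tail h (tpoly n c) x \<partial>cube_measure)"
    using \<tau> gpos by (simp add: nn_integral_multc nn_integral_weight less_imp_le)
  finally have *: "ennreal (l / 3) * emeasure cube_measure ?E \<le> ennreal (2 / \<gamma> * \<tau> powr (\<gamma> / 2)) * (\<integral>\<^sup>+x. tail h (tpoly n c) x \<partial>cube_measure)" .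
  \<comment> \<open>As \<open>X * h = l / 3\<close>, dividing by \<open>X\<close> turns the weight
    \<open>l / 3\<close> into the cut height \<open>h\<close>.\<close>
  define X where "X = 2 / \<gamma> * \<tau> powr (\<gamma> / 2)"
  have X: "0 < X" using gpos \<tau> by (simp add: X_def)
  have eq: "h = 1 / X * (l / 3)"
    using t2 X unfolding X_def[symmetric] by (simp add: field_simps)
  have "ennreal h * emeasure cube_measure ?E = ennreal (1 / X) * (ennreal (l / 3) * emeasure cube_measure ?E)"
    using X by (subst eq, subst ennreal_mult') (auto simp: mult.assoc)
  also have "\<dots> \<le> ennreal (1 / X) * (ennreal X * (\<integral>\<^sup>+x. tail h (tpoly n c) x \<partial>cube_measure))"
    by (intro mult_left_mono *[folded X_def]) simp
  also have "\<dots> = ennreal (1 / X * X) * (\<integral>\<^sup>+x. tail h (tpoly n c) x \<partial>cube_measure)"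
    using X by (subst ennreal_mult') (auto simp: mult.assoc)
  also have "1 / X * X = 1"
    using X by simp
  finally show "ennreal (\<kappa> * l powr (q / p)) * emeasure cube_measure ?E \<le> (\<integral>\<^sup>+x. tail (\<kappa> * l powr (q / p)) (tpoly n c) x \<partial>cube_measure)"
    by (simp add: h_def)
qed

lemma pint_le_1: "0 < p \<Longrightarrow> Lp_norm (ereal p) (tpoly n c) \<le> 1 \<Longrightarrow> pint p (tpoly n c) \<le> 1"
  by (simp add: pint_eq_Lp_norm powr_le1 Lp_norm_nonneg_tpoly)

lemma powr_less_iff_base:
  fixes x y a :: real
  assumes "0 < a" "0 \<le> x" "0 \<le> y"
  shows "x < y \<longleftrightarrow> x powr a < y powr a"
  using assms powr_less_mono2[of a x y] powr_mono2[of a y x] by linarith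

text \<open>The level set bound, whose right-hand side is still an integral of a tail, is put into
  the layer-cake formula and the integrations are exchanged: at a point of value \<open>s\<close>
  the levels run up to \<open>(s / \<kappa>) powr (p / q)\<close> and yield a multiple of
  \<open>s powr p\<close>. The integral converges at level 0 because \<open>p > 1\<close>; for
  \<open>p = 1\<close> it would diverge.\<close>

lemma heat_int_real_strong:
  assumes p: "1 < p" "p < q" and g: "\<gamma> = real CARD('d) * (1 / p - 1 / q)"
  obtains C where "0 < C" "\<And>n (c :: int ^ 'd \<Rightarrow> complex). 1 \<le> n \<Longrightarrow> Lp_norm (ereal p) (tpoly n c) \<le> 1 \<Longrightarrow>
    (\<integral>\<^sup>+x. ennreal (heat_int_real \<gamma> n c x powr q) \<partial>cube_measure) \<le> ennreal C"
proof -
  have p1: "1 \<le> p" using p by simp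
  obtain \<kappa> where \<kappa>: "0 < \<kappa>" and lev: "\<And>n (c :: int ^ 'd \<Rightarrow> complex) l. 1 \<le> n \<Longrightarrow> Lp_norm (ereal p) (tpoly n c) \<le> 1 \<Longrightarrow> 0 < l \<Longrightarrow>
    ennreal (\<kappa> * l powr (q / p)) * emeasure cube_measure {x \<in> space cube_measure. l < heat_int_real \<gamma> n c x}
      \<le> (\<integral>\<^sup>+x. tail (\<kappa> * l powr (q / p)) (tpoly n c) x \<partial>cube_measure)"
    using heat_int_real_level_set[OF p1 p(2) g] by blast
  \<comment> \<open>What is left of the power of \<open>l\<close> in the layer-cake formula after
    division by the cut height \<open>\<kappa> * l powr (q / p)\<close>.\<close>
  define a where "a = q - q / p"
  have a: "0 < a" using p by (simp add: a_def field_simps)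
  have pa: "p / q * a = p - 1" using p by (simp add: a_def field_simps)
  define C where "C = q / \<kappa> * (\<kappa> powr (1 - p) / a)"
  have C: "0 < C" using p \<kappa> a by (simp add: C_def)
  show thesis
  proof (rule that[OF C])
    fix n :: nat and c :: "int ^ 'd \<Rightarrow> complex"
    assume n: "1 \<le> n" and L: "Lp_norm (ereal p) (tpoly n c) \<le> 1"
    let ?S = "tpoly n c"
    have "(\<integral>\<^sup>+x. ennreal (heat_int_real \<gamma> n c x powr q) \<partial>cube_measure)
      = (\<integral>\<^sup>+l. ennreal (indicator {0<..} l * (q * l powr (q - 1))) * emeasure cube_measure {x \<in> space cube_measure. l < heat_int_real \<gamma> n c x} \<partial>lborel)"
      using p by (intro layer_cake heat_int_real_nonneg) auto
    also have "\<dots> \<le> (\<integral>\<^sup>+l. (\<integral>\<^sup>+x. ennreal (indicator {0<..} l * (q / \<kappa> * l powr (a - 1))) * tail (\<kappa> * l powr (q / p)) ?S x \<partial>cube_measure) \<partial>lborel)"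
    proof (rule nn_integral_mono)
      fix l :: real
      have eq: "(\<integral>\<^sup>+x. ennreal (indicator {0<..} l * (q / \<kappa> * l powr (a - 1))) * tail (\<kappa> * l powr (q / p)) ?S x \<partial>cube_measure)
        = ennreal (indicator {0<..} l * (q / \<kappa> * l powr (a - 1))) * (\<integral>\<^sup>+x. tail (\<kappa> * l powr (q / p)) ?S x \<partial>cube_measure)"
        by (rule nn_integral_cmult) (intro measurable_cube_measure, measurable)
      show "ennreal (indicator {0<..} l * (q * l powr (q - 1))) * emeasure cube_measure {x \<in> space cube_measure. l < heat_int_real \<gamma> n c x}
        \<le> (\<integral>\<^sup>+x. ennreal (indicator {0<..} l * (q / \<kappa> * l powr (a - 1))) * tail (\<kappa> * l powr (q / p)) ?S x \<partial>cube_measure)"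
      proof (cases "0 < l")
        case True
        have "q * l powr (q - 1) = q / \<kappa> * l powr (a - 1) * (\<kappa> * l powr (q / p))"
        proof -
          have "a - 1 + q / p = q - 1" by (simp add: a_def)
          then have "l powr (a - 1) * l powr (q / p) = l powr (q - 1)" by (simp only: powr_add[symmetric])
          then show ?thesis using \<kappa> by simp
        qed
        then have "ennreal (q * l powr (q - 1)) = ennreal (q / \<kappa> * l powr (a - 1)) * ennreal (\<kappa> * l powr (q / p))"
          using p \<kappa> by (simp only:) (rule ennreal_mult', simp)
        then have "ennreal (q * l powr (q - 1)) * emeasure cube_measure {x \<in> space cube_measure. l < heat_int_real \<gamma> n c x}
          = ennreal (q / \<kappa> * l powr (a - 1)) * (ennreal (\<kappa> * l powr (q / p)) * emeasure cube_measure {x \<in> space cube_measure. l < heat_int_real \<gamma> n c x})"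
          by (simp only: mult.assoc)
        also have "\<dots> \<le> ennreal (q / \<kappa> * l powr (a - 1)) * (\<integral>\<^sup>+x. tail (\<kappa> * l powr (q / p)) ?S x \<partial>cube_measure)"
          by (intro mult_left_mono lev n L True) simp
        finally show ?thesis unfolding eq using True by simp
      qed simp
    qed
    also have "\<dots> = (\<integral>\<^sup>+x. (\<integral>\<^sup>+l. ennreal (indicator {0<..} l * (q / \<kappa> * l powr (a - 1))) * tail (\<kappa> * l powr (q / p)) ?S x \<partial>lborel) \<partial>cube_measure)"
      by (rule nn_integral_cube_swap) measurable
    also have "\<dots> = (\<integral>\<^sup>+x. ennreal C * ennreal (norm (?S x) powr p) \<partial>cube_measure)"
    proof (rule nn_integral_cong)
      fix x
      define s where "s = norm (?S x)"
      have s0: "0 \<le> s" by (simp add: s_def)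
      show "(\<integral>\<^sup>+l. ennreal (indicator {0<..} l * (q / \<kappa> * l powr (a - 1))) * tail (\<kappa> * l powr (q / p)) ?S x \<partial>lborel)
        = ennreal C * ennreal (norm (?S x) powr p)"
      proof (cases "s = 0")
        case True
        then show ?thesis by (simp add: tail_def s_def)
      next
        case False
        then have s: "0 < s" using s0 by simp
        have iff: "\<kappa> * l powr (q / p) < s \<longleftrightarrow> l < (s / \<kappa>) powr (p / q)" if "0 < l" for l
        proof -
          have "\<kappa> * l powr (q / p) < s \<longleftrightarrow> l powr (q / p) < s / \<kappa>"
            using \<kappa> by (simp add: field_simps)
          also have "\<dots> \<longleftrightarrow> (l powr (q / p)) powr (p / q) < (s / \<kappa>) powr (p / q)"
            using p that s \<kappa> by (intro powr_less_iff_base) auto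
          also have "(l powr (q / p)) powr (p / q) = l" using p that by (simp add: powr_powr)
          finally show ?thesis .
        qed
        have "(\<integral>\<^sup>+l. ennreal (indicator {0<..} l * (q / \<kappa> * l powr (a - 1))) * tail (\<kappa> * l powr (q / p)) ?S x \<partial>lborel)
          = (\<integral>\<^sup>+l. ennreal (q / \<kappa> * s) * ennreal (indicator {0<..<(s / \<kappa>) powr (p / q)} l * l powr (a - 1)) \<partial>lborel)"
        proof (rule nn_integral_cong)
          fix l :: real
          show "ennreal (indicator {0<..} l * (q / \<kappa> * l powr (a - 1))) * tail (\<kappa> * l powr (q / p)) ?S x
            = ennreal (q / \<kappa> * s) * ennreal (indicator {0<..<(s / \<kappa>) powr (p / q)} l * l powr (a - 1))"
          proof (cases "0 < l \<and> l < (s / \<kappa>) powr (p / q)")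
            case True
            then show ?thesis using iff[of l] p \<kappa> s
              by (simp add: tail_def s_def[symmetric] ennreal_mult'[symmetric] ennreal_mult''[symmetric] mult_ac)
          next
            case False
            then show ?thesis using iff[of l]
              by (cases "0 < l") (auto simp: tail_def s_def[symmetric] indicator_def)
          qed
        qed
        also have "\<dots> = ennreal (q / \<kappa> * s) * ennreal (((s / \<kappa>) powr (p / q)) powr a / a)"
          using a by (subst nn_integral_cmult) (auto simp: nn_integral_powr_from_0)
        also have "((s / \<kappa>) powr (p / q)) powr a = s powr (p - 1) * \<kappa> powr (1 - p)"
        proof -
          have "((s / \<kappa>) powr (p / q)) powr a = (s / \<kappa>) powr (p - 1)" by (simp only: powr_powr pa)
          also have "\<dots> = s powr (p - 1) / \<kappa> powr (p - 1)" by (rule powr_divide)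
          also have "\<dots> = s powr (p - 1) * \<kappa> powr (1 - p)" using powr_minus_divide[of \<kappa> "p - 1"] by simp
          finally show ?thesis .
        qed
        also have "ennreal (q / \<kappa> * s) * ennreal (s powr (p - 1) * \<kappa> powr (1 - p) / a) = ennreal (C * (s * s powr (p - 1)))"
          using p \<kappa> s a by (subst ennreal_mult'[symmetric]) (auto simp: C_def)
        also have "s * s powr (p - 1) = s powr p" using s by (simp add: powr_diff)
        finally show ?thesis using C by (simp add: s_def ennreal_mult')
      qed
    qed
    also have "\<dots> = ennreal C * ennreal (pint p ?S)"
      using p by (subst ennreal_pint, simp)
        (rule nn_integral_cmult, intro measurable_cube_measure measurable_compose[OF _ measurable_ennreal], measurable)
    also have "\<dots> \<le> ennreal C * ennreal 1"
      using p L by (intro mult_left_mono ennreal_leI pint_le_1) auto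
    finally show "(\<integral>\<^sup>+x. ennreal (heat_int_real \<gamma> n c x powr q) \<partial>cube_measure) \<le> ennreal C" by simp
  qed
qed

text \<open>For L_1 data the level sets are only known to have measure of order
  \<open>l powr (- q)\<close>. The integral over the levels is therefore left open and stopped at an
  upper bound \<open>M\<close>; the comparison of \<open>a\<close> with \<open>q\<close> decides
  whether it is bounded, logarithmic or a power of \<open>M\<close>.\<close>

lemma heat_int_real_moment:
  assumes q: "1 < q" and g: "\<gamma> = real CARD('d) * (1 - 1 / q)" and a: "0 < a"
  obtains A where "0 < A" "\<And>n (c :: int ^ 'd \<Rightarrow> complex) M. 1 \<le> n \<Longrightarrow> Lp_norm 1 (tpoly n c) \<le> 1 \<Longrightarrow>
    (\<And>x. heat_int_real \<gamma> n c x \<le> M) \<Longrightarrow>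
    (\<integral>\<^sup>+x. ennreal (heat_int_real \<gamma> n c x powr a) \<partial>cube_measure)
      \<le> ennreal A * (1 + (\<integral>\<^sup>+l. ennreal (indicator {1<..M} l * l powr (a - q - 1)) \<partial>lborel))"
proof -
  have g': "\<gamma> = real CARD('d) * (1 / 1 - 1 / q)" by (simp add: g)
  obtain \<kappa> where \<kappa>: "0 < \<kappa>" and lev: "\<And>n (c :: int ^ 'd \<Rightarrow> complex) l. 1 \<le> n \<Longrightarrow> Lp_norm (ereal 1) (tpoly n c) \<le> 1 \<Longrightarrow> 0 < l \<Longrightarrow>
    ennreal (\<kappa> * l powr (q / 1)) * emeasure cube_measure {x \<in> space cube_measure. l < heat_int_real \<gamma> n c x}
      \<le> (\<integral>\<^sup>+x. tail (\<kappa> * l powr (q / 1)) (tpoly n c) x \<partial>cube_measure)"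
    using heat_int_real_level_set[OF order_refl q g'] by blast
  define A where "A = max ((2 * pi) ^ CARD('d)) (a / \<kappa>)"
  have A: "(2 * pi) ^ CARD('d) \<le> A" "a / \<kappa> \<le> A" by (auto simp: A_def)
  have A0: "0 < A" using \<kappa> a by (simp add: A_def less_max_iff_disj)
  show thesis
  proof (rule that[OF A0])
    fix n :: nat and c :: "int ^ 'd \<Rightarrow> complex" and M
    assume n: "1 \<le> n" and L: "Lp_norm 1 (tpoly n c) \<le> 1" and M: "\<And>x. heat_int_real \<gamma> n c x \<le> M"
    let ?e = "\<lambda>l. emeasure cube_measure {x \<in> space cube_measure. l < heat_int_real \<gamma> n c x}"
    have e1: "?e l \<le> ennreal ((2 * pi) ^ CARD('d))" for l
    proof -
      have "?e l \<le> emeasure cube_measure (space cube_measure :: (real ^ 'd) set)"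
        by (rule emeasure_space)
      also have "\<dots> = ennreal ((2 * pi) ^ CARD('d))"
        by (simp add: emeasure_restrict_space space_restrict_space emeasure_period_cube)
      finally show ?thesis .
    qed
    have e2: "?e l \<le> ennreal (1 / \<kappa> * l powr (- q))" if l: "0 < l" for l
    proof -
      have h: "0 < \<kappa> * l powr q" using \<kappa> l by simp
      have "ennreal (\<kappa> * l powr q) * ?e l \<le> (\<integral>\<^sup>+x. tail (\<kappa> * l powr q) (tpoly n c) x \<partial>cube_measure)"
        using lev[OF n _ l, of c] L by (simp add: one_ereal_def)
      also have "\<dots> \<le> ennreal ((\<kappa> * l powr q) powr (1 - 1) * pint 1 (tpoly n c))"
        by (rule nn_integral_tail_le[OF order_refl h])
      also have "\<dots> \<le> ennreal 1"
        using pint_le_1[of 1 n c] L h by (intro ennreal_leI) (simp add: one_ereal_def)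
      finally have *: "ennreal (\<kappa> * l powr q) * ?e l \<le> ennreal 1" .
      have "?e l = ennreal (1 / (\<kappa> * l powr q)) * (ennreal (\<kappa> * l powr q) * ?e l)"
        using h by (simp only: mult.assoc[symmetric]) (subst ennreal_mult'[symmetric], auto)
      also have "\<dots> \<le> ennreal (1 / (\<kappa> * l powr q)) * ennreal 1"
        by (intro mult_left_mono *) simp
      finally show ?thesis by (simp add: powr_minus field_simps)
    qed
    have e3: "?e l = 0" if "M \<le> l" for l
    proof -
      have "{x \<in> space cube_measure. l < heat_int_real \<gamma> n c x} = {}"
        using M that by (auto simp: not_less intro: order_trans)
      then show ?thesis by (simp only: emeasure_empty)
    qed
    have "(\<integral>\<^sup>+x. ennreal (heat_int_real \<gamma> n c x powr a) \<partial>cube_measure) = (\<integral>\<^sup>+l. ennreal (indicator {0<..} l * (a * l powr (a - 1))) * ?e l \<partial>lborel)"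
      by (intro layer_cake heat_int_real_nonneg a) auto
    also have "\<dots> \<le> (\<integral>\<^sup>+l. ennreal ((2 * pi) ^ CARD('d) * a) * ennreal (indicator {0<..1} l * l powr ((2 * a) / 2 - 1))
        + ennreal (a / \<kappa>) * ennreal (indicator {1<..M} l * l powr (a - q - 1)) \<partial>lborel)"
    proof (rule nn_integral_mono)
      fix l :: real
      consider "l \<le> 0" | "0 < l" "l \<le> 1" | "1 < l" "l \<le> M" | "M < l" "1 < l" by linarith
      then show "ennreal (indicator {0<..} l * (a * l powr (a - 1))) * ?e l
        \<le> ennreal ((2 * pi) ^ CARD('d) * a) * ennreal (indicator {0<..1} l * l powr ((2 * a) / 2 - 1))
        + ennreal (a / \<kappa>) * ennreal (indicator {1<..M} l * l powr (a - q - 1))"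
      proof cases
        case 2
        have "ennreal (a * l powr (a - 1)) * ?e l \<le> ennreal (a * l powr (a - 1)) * ennreal ((2 * pi) ^ CARD('d))"
          by (intro mult_left_mono e1) simp
        also have "\<dots> = ennreal ((2 * pi) ^ CARD('d) * a) * ennreal (l powr (a - 1))"
          using a by (subst (1 2) ennreal_mult'[symmetric]) (auto simp: mult_ac)
        finally show ?thesis using 2 by simp
      next
        case 3
        have "ennreal (a * l powr (a - 1)) * ?e l \<le> ennreal (a * l powr (a - 1)) * ennreal (1 / \<kappa> * l powr (- q))"
          using 3 by (intro mult_left_mono e2) auto
        also have "\<dots> = ennreal (a / \<kappa> * (l powr (a - 1) * l powr (- q)))"
          using a \<kappa> by (subst ennreal_mult'[symmetric]) (auto simp: mult_ac)
        also have "l powr (a - 1) * l powr (- q) = l powr (a - q - 1)"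
          by (simp add: powr_add[symmetric] algebra_simps)
        also have "ennreal (a / \<kappa> * l powr (a - q - 1)) = ennreal (a / \<kappa>) * ennreal (l powr (a - q - 1))"
          using a \<kappa> by (intro ennreal_mult') simp
        finally show ?thesis using 3 by simp
      next
        case 4
        then have "?e l = 0" by (intro e3) simp
        then show ?thesis by (simp only: mult_zero_right zero_le)
      qed simp
    qed
    also have "\<dots> = ennreal ((2 * pi) ^ CARD('d) * a) * ennreal (2 / (2 * a) * 1 powr ((2 * a) / 2))
        + ennreal (a / \<kappa>) * (\<integral>\<^sup>+l. ennreal (indicator {1<..M} l * l powr (a - q - 1)) \<partial>lborel)"
    proof -
      have w: "(\<integral>\<^sup>+l. ennreal (indicator {0<..1} l * l powr ((2 * a) / 2 - 1)) \<partial>lborel) = ennreal (2 / (2 * a) * 1 powr ((2 * a) / 2))"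
        by (rule nn_integral_weight) (use a in auto)
      show ?thesis
        by (subst nn_integral_add, measurable, subst nn_integral_cmult, measurable, subst nn_integral_cmult, measurable)
          (simp only: w)
    qed
    also have "ennreal ((2 * pi) ^ CARD('d) * a) * ennreal (2 / (2 * a) * 1 powr ((2 * a) / 2)) = ennreal ((2 * pi) ^ CARD('d)) * 1"
      using a by (subst ennreal_mult'[symmetric]) auto
    also have "ennreal ((2 * pi) ^ CARD('d)) * 1 + ennreal (a / \<kappa>) * (\<integral>\<^sup>+l. ennreal (indicator {1<..M} l * l powr (a - q - 1)) \<partial>lborel)
      \<le> ennreal A * (1 + (\<integral>\<^sup>+l. ennreal (indicator {1<..M} l * l powr (a - q - 1)) \<partial>lborel))"
      unfolding distrib_left by (intro add_mono mult_right_mono ennreal_leI A) auto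
    finally show "(\<integral>\<^sup>+x. ennreal (heat_int_real \<gamma> n c x powr a) \<partial>cube_measure)
      \<le> ennreal A * (1 + (\<integral>\<^sup>+l. ennreal (indicator {1<..M} l * l powr (a - q - 1)) \<partial>lborel))" .
  qed
qed

lemma ln_Suc_pos: "1 \<le> n \<Longrightarrow> 0 < ln (real n + 1)" "1 \<le> n \<Longrightarrow> ln 2 \<le> ln (real n + 1)" "1 \<le> n \<Longrightarrow> ln (real n) \<le> ln (real n + 1)"
  by (auto intro: ln_gt_zero)

text \<open>The time integral is divided at \<open>n powr (- 2)\<close>, the scale at which the heat
  flow starts to act on frequencies of size \<open>n\<close>: before it, Nikolskii's inequality
  bounds the polynomial itself, after it, the smoothing estimate is used. For
  \<open>\<gamma> > d / p\<close> the smoothing estimate alone is integrable at 0.\<close>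

lemma heat_int_real_sup:
  assumes p: "1 \<le> p" and g: "0 < \<gamma>"
  obtains C where "0 < C" "\<And>n (c :: int ^ 'd \<Rightarrow> complex) x. 1 \<le> n \<Longrightarrow> Lp_norm (ereal p) (tpoly n c) \<le> 1 \<Longrightarrow>
    heat_int_real \<gamma> n c x \<le> C * (if \<gamma> > CARD('d) / p then 1 else if \<gamma> = CARD('d) / p then ln (real n + 1) else real n powr (CARD('d) / p - \<gamma>))"
proof -
  let ?d = "real CARD('d)"
  have p0: "0 < p" using p by simp
  define K :: real where "K = 1 + 2 ^ CARD('d)"
  have K: "0 < K" unfolding K_def by (intro add_pos_pos) auto
  let ?w = "\<lambda>t :: real. t powr (\<gamma> / 2 - 1)"
  \<comment> \<open>The smoothed integrand is of order \<open>t powr (e - 1)\<close>, so the sign of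
    \<open>e\<close> separates the three cases.\<close>
  define e where "e = (\<gamma> - ?d / p) / 2"
  have smooth: "?w t * norm (tpoly n (heat t c) x) \<le> K * t powr (e - 1)"
    if "1 \<le> n" "Lp_norm (ereal p) (tpoly n c) \<le> 1" "0 < t" "t \<le> 1" for n and c :: "int ^ 'd \<Rightarrow> complex" and x and t
  proof -
    have "norm (tpoly n (heat t c) x) \<le> K * t powr (- ?d / (2 * p)) * Lp_norm (ereal p) (tpoly n c)"
      unfolding K_def using that p by (intro norm_tpoly_heat_le_Lp) auto
    also have "\<dots> \<le> K * t powr (- ?d / (2 * p)) * 1" using that K by (intro mult_left_mono) auto
    finally have "?w t * norm (tpoly n (heat t c) x) \<le> ?w t * (K * t powr (- ?d / (2 * p)))"
      by (intro mult_left_mono) auto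
    also have "\<dots> = K * (?w t * t powr (- ?d / (2 * p)))" by simp
    also have "?w t * t powr (- ?d / (2 * p)) = t powr (e - 1)"
    proof -
      have "\<gamma> / 2 - 1 + - ?d / (2 * p) = e - 1" using p0 by (simp add: e_def field_simps)
      then show ?thesis by (simp only: powr_add[symmetric])
    qed
    finally show ?thesis .
  qed
  obtain N where N: "0 < N"
    "\<And>n c x. 1 \<le> n \<Longrightarrow> norm (tpoly n c (x :: real ^ 'd)) \<le> N * real n powr (CARD('d) / p) * Lp_norm (ereal p) (tpoly n c)"
    using nikolskii_infinity[OF p0] by blast
  have split: "ennreal (heat_int_real \<gamma> n c x) \<le> ennreal (2 * N / \<gamma> * real n powr (?d / p - \<gamma>))
      + ennreal K * (\<integral>\<^sup>+t. ennreal (indicator {real n powr (- 2)<..1} t * t powr (e - 1)) \<partial>lborel)"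
    if n: "1 \<le> n" and L: "Lp_norm (ereal p) (tpoly n c) \<le> 1" for n and c :: "int ^ 'd \<Rightarrow> complex" and x
  proof -
    define b where "b = real n powr (- 2)"
    have b: "0 < b" using n by (simp add: b_def)
    have sup: "norm (tpoly n c x) \<le> N * real n powr (?d / p)" for x
    proof -
      have "norm (tpoly n c x) \<le> N * real n powr (?d / p) * Lp_norm (ereal p) (tpoly n c)" by (rule N(2)[OF n])
      also have "\<dots> \<le> N * real n powr (?d / p) * 1" using L N(1) by (intro mult_left_mono) auto
      finally show ?thesis by simp
    qed
    have "ennreal (heat_int_real \<gamma> n c x) = (\<integral>\<^sup>+t. ennreal (indicator {0<..1} t * ?w t) * ennreal (norm (tpoly n (heat t c) x)) \<partial>lborel)"
      by (simp add: ennreal_heat_int_real[OF g] heat_int_def)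
    also have "\<dots> \<le> (\<integral>\<^sup>+t. ennreal (indicator {0<..b} t * ?w t) * ennreal (N * real n powr (?d / p))
        + ennreal K * ennreal (indicator {b<..1} t * t powr (e - 1)) \<partial>lborel)"
    proof (rule nn_integral_mono)
      fix t :: real
      consider "t \<le> 0 \<or> 1 < t" | "0 < t" "t \<le> 1" "t \<le> b" | "0 < t" "t \<le> 1" "b < t" by linarith
      then show "ennreal (indicator {0<..1} t * ?w t) * ennreal (norm (tpoly n (heat t c) x))
        \<le> ennreal (indicator {0<..b} t * ?w t) * ennreal (N * real n powr (?d / p))
        + ennreal K * ennreal (indicator {b<..1} t * t powr (e - 1))"
      proof cases
        case 2
        then show ?thesis
          using norm_tpoly_heat_le_sup[where c = c and x = x and t = t, OF _ sup] by (auto intro!: mult_left_mono ennreal_leI)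
      next
        case 3
        then show ?thesis
          using smooth[OF n L, of t x] K by (simp add: ennreal_mult'[symmetric] ennreal_leI)
      qed auto
    qed
    also have "\<dots> = ennreal (2 / \<gamma> * b powr (\<gamma> / 2)) * ennreal (N * real n powr (?d / p))
        + ennreal K * (\<integral>\<^sup>+t. ennreal (indicator {b<..1} t * t powr (e - 1)) \<partial>lborel)"
      using b g by (subst nn_integral_add, measurable) (simp add: nn_integral_cmult nn_integral_multc nn_integral_weight less_imp_le)
    also have "ennreal (2 / \<gamma> * b powr (\<gamma> / 2)) * ennreal (N * real n powr (?d / p)) = ennreal (2 * N / \<gamma> * real n powr (?d / p - \<gamma>))"
    proof -
      have "2 / \<gamma> * b powr (\<gamma> / 2) * (N * real n powr (?d / p)) = 2 * N / \<gamma> * (real n powr (- \<gamma>) * real n powr (?d / p))"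
        by (simp add: b_def powr_powr)
      also have "real n powr (- \<gamma>) * real n powr (?d / p) = real n powr (?d / p - \<gamma>)"
        by (simp flip: powr_add)
      finally show ?thesis using N g by (subst ennreal_mult'[symmetric]) auto
    qed
    finally show ?thesis by (simp only: b_def)
  qed
  consider "\<gamma> > ?d / p" | "\<gamma> = ?d / p" | "\<gamma> < ?d / p" by linarith
  then show thesis
  proof cases
    case 1
    then have e: "0 < e" by (simp add: e_def)
    show thesis
    proof (rule that)
      show "0 < K / e" using K e by simp
      fix n :: nat and c :: "int ^ 'd \<Rightarrow> complex" and x
      assume n: "1 \<le> n" and L: "Lp_norm (ereal p) (tpoly n c) \<le> 1"
      have "ennreal (heat_int_real \<gamma> n c x) = (\<integral>\<^sup>+t. ennreal (indicator {0<..1} t * ?w t) * ennreal (norm (tpoly n (heat t c) x)) \<partial>lborel)"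
        by (simp add: ennreal_heat_int_real[OF g] heat_int_def)
      also have "\<dots> \<le> (\<integral>\<^sup>+t. ennreal K * ennreal (indicator {0<..1} t * t powr ((2 * e) / 2 - 1)) \<partial>lborel)"
        using smooth[OF n L, of _ x] K
        by (intro nn_integral_mono) (auto simp: indicator_def ennreal_mult'[symmetric] intro!: ennreal_leI)
      also have "\<dots> = ennreal (K / e)"
        using e K nn_integral_weight[of "2 * e" 1] by (subst nn_integral_cmult) (auto simp: ennreal_mult'[symmetric])
      finally have "heat_int_real \<gamma> n c x \<le> K / e" using K e by (subst (asm) ennreal_le_iff) auto
      then show "heat_int_real \<gamma> n c x \<le> K / e * (if \<gamma> > ?d / p then 1 else if \<gamma> = ?d / p then ln (real n + 1) else real n powr (?d / p - \<gamma>))"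
        using 1 by simp
    qed
  next
    case 2
    then have e: "e = 0" by (simp add: e_def)
    show thesis
    proof (rule that)
      show "0 < 2 * N / \<gamma> / ln 2 + K * 2" using K N g by (intro add_pos_pos) auto
      fix n :: nat and c :: "int ^ 'd \<Rightarrow> complex" and x
      assume n: "1 \<le> n" and L: "Lp_norm (ereal p) (tpoly n c) \<le> 1"
      have b: "real n powr (- 2) \<le> 1" using n by (simp add: powr_minus field_simps powr_numeral)
      have b0: "0 < real n powr (- 2)" using n by simp
      have "ennreal (heat_int_real \<gamma> n c x) \<le> ennreal (2 * N / \<gamma> * real n powr (?d / p - \<gamma>)) + ennreal K * ennreal (ln 1 - ln (real n powr (- 2)))"
        using split[OF n L, of x] nn_integral_inverse[OF b0 b] by (simp add: e)
      also have "\<dots> = ennreal (2 * N / \<gamma> + K * (2 * ln (real n)))"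
      proof -
        have "real n powr (?d / p - \<gamma>) = 1" using n 2 by simp
        moreover have "ln 1 - ln (real n powr (- 2)) = 2 * ln (real n)" using n by (simp add: ln_powr)
        moreover have "ennreal K * ennreal (2 * ln (real n)) = ennreal (K * (2 * ln (real n)))"
          using K by (intro ennreal_mult'[symmetric]) simp
        moreover have "0 \<le> 2 * N / \<gamma>" "0 \<le> K * (2 * ln (real n))" using N g K n by auto
        ultimately show ?thesis by (simp only: ennreal_plus mult_1_right)
      qed
      finally have "heat_int_real \<gamma> n c x \<le> 2 * N / \<gamma> + K * (2 * ln (real n))"
        using N g K n by (subst (asm) ennreal_le_iff) (auto intro!: add_nonneg_nonneg)
      \<comment> \<open>The constant term is absorbed by \<open>ln 2 \<le> ln (n + 1)\<close>, the
        reason for the shift by 1 in the logarithm.\<close>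
      also have "\<dots> \<le> 2 * N / \<gamma> * (ln (real n + 1) / ln 2) + K * (2 * ln (real n + 1))"
      proof (intro add_mono mult_left_mono)
        have "2 * N / \<gamma> * 1 \<le> 2 * N / \<gamma> * (ln (real n + 1) / ln 2)"
          using ln_Suc_pos(2)[OF n] N g by (intro mult_left_mono) auto
        then show "2 * N / \<gamma> \<le> 2 * N / \<gamma> * (ln (real n + 1) / ln 2)" by simp
      qed (use n K in auto)
      finally show "heat_int_real \<gamma> n c x \<le> (2 * N / \<gamma> / ln 2 + K * 2) * (if \<gamma> > ?d / p then 1 else if \<gamma> = ?d / p then ln (real n + 1) else real n powr (?d / p - \<gamma>))"
        using 2 by (simp add: algebra_simps)
    qed
  next
    case 3
    then have e: "e < 0" using p0 by (simp add: e_def)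
    show thesis
    proof (rule that)
      show "0 < 2 * N / \<gamma> + K / (- e)" using K N g e by (intro add_pos_pos divide_pos_pos mult_pos_pos) auto
      fix n :: nat and c :: "int ^ 'd \<Rightarrow> complex" and x
      assume n: "1 \<le> n" and L: "Lp_norm (ereal p) (tpoly n c) \<le> 1"
      have "(\<integral>\<^sup>+t. ennreal (indicator {real n powr (- 2)<..1} t * t powr (e - 1)) \<partial>lborel)
          \<le> (\<integral>\<^sup>+t. ennreal (indicator {real n powr (- 2)<..} t * t powr (- (- e) - 1)) \<partial>lborel)"
        by (intro nn_integral_mono) (auto simp: indicator_def)
      also have "\<dots> = ennreal ((real n powr (- 2)) powr (- (- e)) / (- e))"
        using e n by (intro nn_integral_powr_to_infinity) auto
      also have "(real n powr (- 2)) powr (- (- e)) = real n powr (?d / p - \<gamma>)"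
      proof -
        have "- 2 * (- (- e)) = ?d / p - \<gamma>" by (simp add: e_def field_simps)
        then show ?thesis by (simp only: powr_powr)
      qed
      finally have "ennreal (heat_int_real \<gamma> n c x) \<le> ennreal (2 * N / \<gamma> * real n powr (?d / p - \<gamma>)) + ennreal K * ennreal (real n powr (?d / p - \<gamma>) / (- e))"
        using split[OF n L, of x] by (meson add_left_mono mult_left_mono order_trans zero_le)
      also have "\<dots> = ennreal (2 * N / \<gamma> * real n powr (?d / p - \<gamma>) + K * (real n powr (?d / p - \<gamma>) / (- e)))"
      proof -
        have "0 \<le> real n powr (?d / p - \<gamma>) / (- e)" using e by (intro divide_nonneg_pos) auto
        then show ?thesis using N g K by (simp only: ennreal_mult'[symmetric] ennreal_plus mult_nonneg_nonneg less_imp_le divide_nonneg_pos powr_ge_zero zero_le_numeral)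
      qed
      finally have "heat_int_real \<gamma> n c x \<le> 2 * N / \<gamma> * real n powr (?d / p - \<gamma>) + K * (real n powr (?d / p - \<gamma>) / (- e))"
        using N g K e by (subst (asm) ennreal_le_iff) (auto intro!: add_nonneg_nonneg mult_nonneg_nonneg divide_nonneg_pos simp del: minus_divide_right divide_minus_right)
      also have "\<dots> = (2 * N / \<gamma> + K / (- e)) * real n powr (?d / p - \<gamma>)" by (simp add: algebra_simps)
      finally show "heat_int_real \<gamma> n c x \<le> (2 * N / \<gamma> + K / (- e)) * (if \<gamma> > ?d / p then 1 else if \<gamma> = ?d / p then ln (real n + 1) else real n powr (?d / p - \<gamma>))"
        using 3 by simp
    qed
  qed
qed

text \<open>At the endpoint \<open>\<gamma> = d/p\<close>, \<open>q = \<infinity>\<close> one cuts at the height \<open>\<omega> t\<^bsup>-d/(2p)\<^esup>\<close>, which depends on the time; the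
  choice \<open>\<omega> = ln\<^bsup>-1/p\<^esup>\<close> balances the two contributions \<open>\<omega> ln n\<close> and \<open>\<omega>\<^bsup>1-p\<^esup>\<close>.\<close>

lemma heat_int_real_endpoint:
  assumes p: "1 < p" and g: "\<gamma> = real CARD('d) / p"
  obtains C where "0 < C" "\<And>n (c :: int ^ 'd \<Rightarrow> complex) x. 1 \<le> n \<Longrightarrow> Lp_norm (ereal p) (tpoly n c) \<le> 1 \<Longrightarrow>
    heat_int_real \<gamma> n c x \<le> C * ln (real n + 1) powr (1 - 1 / p)"
proof -
  let ?d = "real CARD('d)"
  have p0: "0 < p" using p by simp
  have gpos: "0 < \<gamma>" using p by (simp add: g)
  let ?w = "\<lambda>t :: real. t powr (\<gamma> / 2 - 1)"
  \<comment> \<open>The tail term carries the weight \<open>t powr (- r - 1)\<close>, which combines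
    \<open>\<gamma> / 2 - 1\<close> with the exponent \<open>- d / 2\<close> of the smoothing from
    L_1.\<close>
  define r where "r = ?d / 2 * (1 - 1 / p)"
  have r: "0 < r" using p by (simp add: r_def)
  obtain N where N: "0 < N"
    "\<And>n c x. 1 \<le> n \<Longrightarrow> norm (tpoly n c (x :: real ^ 'd)) \<le> N * real n powr (CARD('d) / p) * Lp_norm (ereal p) (tpoly n c)"
    using nikolskii_infinity[OF p0] by blast
  define C where "C = 2 * N / \<gamma> / ln 2 powr (1 - 1 / p) + 2 + 2 ^ CARD('d) / r"
  have C: "0 < C" unfolding C_def using N gpos r by (intro add_pos_pos divide_pos_pos mult_pos_pos) auto
  show thesis
  proof (rule that[OF C])
    fix n :: nat and c :: "int ^ 'd \<Rightarrow> complex" and x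
    assume n: "1 \<le> n" and L: "Lp_norm (ereal p) (tpoly n c) \<le> 1"
    let ?S = "tpoly n c"
    define b where "b = real n powr (- 2)"
    have b: "0 < b" "b \<le> 1" using n by (auto simp: b_def powr_minus field_simps powr_numeral)
    define \<Lambda> where "\<Lambda> = ln (real n + 1)"
    have \<Lambda>: "0 < \<Lambda>" using ln_Suc_pos(1)[OF n] by (simp add: \<Lambda>_def)
    define \<omega> where "\<omega> = \<Lambda> powr (- 1 / p)"
    have \<omega>: "0 < \<omega>" using \<Lambda> by (simp add: \<omega>_def)
    define h where "h t = \<omega> * t powr (- ?d / (2 * p))" for t
    have h0: "0 \<le> h t" for t using \<omega> by (simp add: h_def)
    have sup: "norm (?S x) \<le> N * real n powr (?d / p)" for x
    proof -
      have "norm (?S x) \<le> N * real n powr (?d / p) * Lp_norm (ereal p) ?S" by (rule N(2)[OF n])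
      also have "\<dots> \<le> N * real n powr (?d / p) * 1" using L N(1) by (intro mult_left_mono) auto
      finally show ?thesis by simp
    qed
    have [measurable]: "h \<in> borel_measurable borel" unfolding h_def by measurable
    have "ennreal (heat_int_real \<gamma> n c x) = (\<integral>\<^sup>+t. ennreal (indicator {0<..1} t * ?w t) * ennreal (norm (tpoly n (heat t c) x)) \<partial>lborel)"
      by (simp add: ennreal_heat_int_real[OF gpos] heat_int_def)
    also have "\<dots> \<le> (\<integral>\<^sup>+t. ennreal (indicator {0<..b} t * ?w t) * ennreal (N * real n powr (?d / p))
        + (ennreal \<omega> * ennreal (indicator {b<..1} t * t powr (- 1))
        + (\<integral>\<^sup>+y. ennreal (indicator {0<..} t * (2 ^ CARD('d) * t powr (- r - 1))) * tail (h t) ?S y \<partial>cube_measure)) \<partial>lborel)"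
    proof (rule nn_integral_mono)
      fix t :: real
      have tl: "(\<integral>\<^sup>+y. ennreal (indicator {0<..} t * (2 ^ CARD('d) * t powr (- r - 1))) * tail (h t) ?S y \<partial>cube_measure)
        = ennreal (indicator {0<..} t * (2 ^ CARD('d) * t powr (- r - 1))) * (\<integral>\<^sup>+y. tail (h t) ?S y \<partial>cube_measure)"
        by (rule nn_integral_cmult) (intro measurable_cube_measure, measurable)
      consider "t \<le> 0 \<or> 1 < t" | "0 < t" "t \<le> 1" "t \<le> b" | "0 < t" "t \<le> 1" "b < t" by linarith
      then show "ennreal (indicator {0<..1} t * ?w t) * ennreal (norm (tpoly n (heat t c) x))
        \<le> ennreal (indicator {0<..b} t * ?w t) * ennreal (N * real n powr (?d / p))
        + (ennreal \<omega> * ennreal (indicator {b<..1} t * t powr (- 1))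
        + (\<integral>\<^sup>+y. ennreal (indicator {0<..} t * (2 ^ CARD('d) * t powr (- r - 1))) * tail (h t) ?S y \<partial>cube_measure))"
      proof cases
        case 2
        have "ennreal (?w t) * ennreal (norm (tpoly n (heat t c) x)) \<le> ennreal (?w t) * ennreal (N * real n powr (?d / p))"
          using norm_tpoly_heat_le_sup[where c = c and x = x and t = t, OF 2(1) sup] by (auto intro!: mult_left_mono ennreal_leI)
        then show ?thesis using 2 by (simp add: add_increasing2)
      next
        case 3
        have "ennreal (norm (tpoly n (heat t c) x)) \<le> ennreal (h t) + heat_tail (h t) t n c x"
          by (intro norm_tpoly_heat_split h0 3)
        also have "\<dots> \<le> ennreal (h t) + ennreal (2 ^ CARD('d) * t powr (- ?d / 2)) * (\<integral>\<^sup>+x. tail (h t) ?S x \<partial>cube_measure)"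
          by (intro add_left_mono heat_tail_le 3)
        finally have "ennreal (?w t) * ennreal (norm (tpoly n (heat t c) x))
          \<le> ennreal (?w t) * (ennreal (h t) + ennreal (2 ^ CARD('d) * t powr (- ?d / 2)) * (\<integral>\<^sup>+x. tail (h t) ?S x \<partial>cube_measure))"
          by (intro mult_left_mono) auto
        also have "\<dots> = ennreal (?w t * h t) + ennreal (?w t * (2 ^ CARD('d) * t powr (- ?d / 2))) * (\<integral>\<^sup>+x. tail (h t) ?S x \<partial>cube_measure)"
        proof -
          have "ennreal (?w t * h t) = ennreal (?w t) * ennreal (h t)"
            "ennreal (?w t * (2 ^ CARD('d) * t powr (- ?d / 2))) = ennreal (?w t) * ennreal (2 ^ CARD('d) * t powr (- ?d / 2))"
            by (rule ennreal_mult', simp)+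
          then show ?thesis by (simp only: distrib_left mult.assoc)
        qed
        also have "?w t * h t = \<omega> * t powr (- 1)"
        proof -
          have "\<gamma> / 2 - 1 + - ?d / (2 * p) = - 1" using p by (simp add: g)
          then have "?w t * t powr (- ?d / (2 * p)) = t powr (- 1)" by (simp only: powr_add[symmetric])
          then show ?thesis by (simp only: h_def mult.left_commute[of _ \<omega>])
        qed
        also have "?w t * (2 ^ CARD('d) * t powr (- ?d / 2)) = 2 ^ CARD('d) * t powr (- r - 1)"
        proof -
          have "\<gamma> / 2 - 1 + - ?d / 2 = - r - 1" using p by (simp add: g r_def field_simps)
          then have "?w t * t powr (- ?d / 2) = t powr (- r - 1)" by (simp only: powr_add[symmetric])
          then show ?thesis by simp
        qed
        also have "ennreal (\<omega> * t powr (- 1)) = ennreal \<omega> * ennreal (t powr (- 1))"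
          using \<omega> by (intro ennreal_mult') simp
        finally show ?thesis unfolding tl using 3 by simp
      qed auto
    qed
    also have "\<dots> = ennreal (2 / \<gamma> * b powr (\<gamma> / 2)) * ennreal (N * real n powr (?d / p))
        + (ennreal \<omega> * ennreal (ln 1 - ln b)
        + (\<integral>\<^sup>+t. (\<integral>\<^sup>+y. ennreal (indicator {0<..} t * (2 ^ CARD('d) * t powr (- r - 1))) * tail (h t) ?S y \<partial>cube_measure) \<partial>lborel))"
    proof -
      have m: "(\<lambda>t. \<integral>\<^sup>+y. ennreal (indicator {0<..} t * (2 ^ CARD('d) * t powr (- r - 1))) * tail (h t) ?S y \<partial>cube_measure) \<in> borel_measurable lborel"
        unfolding nn_integral_cube by measurable
      have mA: "(\<lambda>t. ennreal (indicator {0<..b} t * ?w t) * ennreal (N * real n powr (?d / p))) \<in> borel_measurable lborel"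
        and mB: "(\<lambda>t. ennreal \<omega> * ennreal (indicator {b<..1} t * t powr (- 1))) \<in> borel_measurable lborel"
        by measurable
      have vA: "(\<integral>\<^sup>+t. ennreal (indicator {0<..b} t * ?w t) * ennreal (N * real n powr (?d / p)) \<partial>lborel)
          = ennreal (2 / \<gamma> * b powr (\<gamma> / 2)) * ennreal (N * real n powr (?d / p))"
        by (subst nn_integral_multc, measurable, subst nn_integral_weight[OF gpos less_imp_le[OF b(1)]], rule refl)
      have vB: "(\<integral>\<^sup>+t. ennreal \<omega> * ennreal (indicator {b<..1} t * t powr (- 1)) \<partial>lborel) = ennreal \<omega> * ennreal (ln 1 - ln b)"
        by (subst nn_integral_cmult, measurable, subst nn_integral_inverse[OF b], rule refl)
      show ?thesis
        by (subst nn_integral_add[OF mA borel_measurable_add[OF mB m]], subst nn_integral_add[OF mB m])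
          (simp only: vA vB)
    qed
    \<comment> \<open>After the exchange, the times with \<open>h t < s\<close> at a point of value
      \<open>s\<close> are those above a threshold; the time integral is a convergent power
      integral, a multiple of \<open>\<omega> powr (1 - p) * s powr p\<close>.\<close>
    also have "(\<integral>\<^sup>+t. (\<integral>\<^sup>+y. ennreal (indicator {0<..} t * (2 ^ CARD('d) * t powr (- r - 1))) * tail (h t) ?S y \<partial>cube_measure) \<partial>lborel)
      = (\<integral>\<^sup>+y. (\<integral>\<^sup>+t. ennreal (indicator {0<..} t * (2 ^ CARD('d) * t powr (- r - 1))) * tail (h t) ?S y \<partial>lborel) \<partial>cube_measure)"
      by (rule nn_integral_cube_swap) measurable
    also have "\<dots> = (\<integral>\<^sup>+y. ennreal (2 ^ CARD('d) / r * \<omega> powr (1 - p)) * ennreal (norm (?S y) powr p) \<partial>cube_measure)"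
    proof (rule nn_integral_cong)
      fix y
      define s where "s = norm (?S y)"
      have s0: "0 \<le> s" by (simp add: s_def)
      show "(\<integral>\<^sup>+t. ennreal (indicator {0<..} t * (2 ^ CARD('d) * t powr (- r - 1))) * tail (h t) ?S y \<partial>lborel)
        = ennreal (2 ^ CARD('d) / r * \<omega> powr (1 - p)) * ennreal (norm (?S y) powr p)"
      proof (cases "s = 0")
        case True
        then show ?thesis by (simp add: tail_def s_def)
      next
        case False
        then have s: "0 < s" using s0 by simp
        \<comment> \<open>The time at which the decreasing cut height \<open>h\<close> equals
          \<open>s\<close>.\<close>
        define \<theta> where "\<theta> = (\<omega> / s) powr (2 * p / ?d)"
        have \<theta>: "0 < \<theta>" using \<omega> s by (simp add: \<theta>_def)
        have iff: "h t < s \<longleftrightarrow> \<theta> < t" if "0 < t" for t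
        proof -
          have "h t < s \<longleftrightarrow> \<omega> / s < t powr (?d / (2 * p))"
            using s that by (simp add: h_def powr_minus field_simps)
          also have "\<dots> \<longleftrightarrow> (\<omega> / s) powr (2 * p / ?d) < (t powr (?d / (2 * p))) powr (2 * p / ?d)"
            using p that s \<omega> by (intro powr_less_iff_base) auto
          also have "(t powr (?d / (2 * p))) powr (2 * p / ?d) = t" using p that by (simp add: powr_powr)
          finally show ?thesis by (simp add: \<theta>_def)
        qed
        have "(\<integral>\<^sup>+t. ennreal (indicator {0<..} t * (2 ^ CARD('d) * t powr (- r - 1))) * tail (h t) ?S y \<partial>lborel)
          = (\<integral>\<^sup>+t. ennreal (2 ^ CARD('d) * s) * ennreal (indicator {\<theta><..} t * t powr (- r - 1)) \<partial>lborel)"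
        proof (rule nn_integral_cong)
          fix t :: real
          show "ennreal (indicator {0<..} t * (2 ^ CARD('d) * t powr (- r - 1))) * tail (h t) ?S y
            = ennreal (2 ^ CARD('d) * s) * ennreal (indicator {\<theta><..} t * t powr (- r - 1))"
          proof (cases "\<theta> < t")
            case True
            then have "0 < t" using \<theta> by simp
            with True show ?thesis using iff[of t] s
              by (simp add: tail_def s_def[symmetric] ennreal_mult'[symmetric] ennreal_mult''[symmetric] mult_ac)
          next
            case False
            then show ?thesis using iff[of t] by (auto simp: tail_def s_def[symmetric] indicator_def)
          qed
        qed
        also have "\<dots> = ennreal (2 ^ CARD('d) * s) * ennreal (\<theta> powr (- r) / r)"
          using r \<theta> by (subst nn_integral_cmult) (auto simp: nn_integral_powr_to_infinity)
        also have "\<theta> powr (- r) = s powr (p - 1) * \<omega> powr (1 - p)"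
        proof -
          have "2 * p / ?d * (- r) = 1 - p" using p by (simp add: r_def field_simps)
          then have "\<theta> powr (- r) = (\<omega> / s) powr (1 - p)" by (simp only: \<theta>_def powr_powr)
          also have "\<dots> = \<omega> powr (1 - p) / s powr (1 - p)" by (rule powr_divide)
          also have "\<dots> = \<omega> powr (1 - p) * s powr (p - 1)" using powr_minus_divide[of s "p - 1"] s by simp
          finally show ?thesis by (simp add: mult.commute)
        qed
        also have "ennreal (2 ^ CARD('d) * s) * ennreal (s powr (p - 1) * \<omega> powr (1 - p) / r) = ennreal (2 ^ CARD('d) / r * \<omega> powr (1 - p) * (s * s powr (p - 1)))"
          using s r by (subst ennreal_mult'[symmetric]) auto
        also have "s * s powr (p - 1) = s powr p" using s by (simp add: powr_diff)
        also have "ennreal (2 ^ CARD('d) / r * \<omega> powr (1 - p) * s powr p) = ennreal (2 ^ CARD('d) / r * \<omega> powr (1 - p)) * ennreal (s powr p)"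
          using r by (intro ennreal_mult') simp
        finally show ?thesis unfolding s_def .
      qed
    qed
    also have "\<dots> = ennreal (2 ^ CARD('d) / r * \<omega> powr (1 - p)) * ennreal (pint p ?S)"
      using p by (subst ennreal_pint, simp)
        (rule nn_integral_cmult, intro measurable_cube_measure measurable_compose[OF _ measurable_ennreal], measurable)
    finally have "ennreal (heat_int_real \<gamma> n c x) \<le> ennreal (2 / \<gamma> * b powr (\<gamma> / 2)) * ennreal (N * real n powr (?d / p))
        + (ennreal \<omega> * ennreal (ln 1 - ln b) + ennreal (2 ^ CARD('d) / r * \<omega> powr (1 - p)) * ennreal (pint p ?S))" .
    also have "\<dots> \<le> ennreal (2 * N / \<gamma>) + (ennreal (2 * \<Lambda> powr (1 - 1 / p)) + ennreal (2 ^ CARD('d) / r * \<Lambda> powr (1 - 1 / p)))"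
    proof (intro add_mono)
      have "b powr (\<gamma> / 2) * real n powr (?d / p) = 1"
        using n by (simp add: b_def powr_powr g flip: powr_add)
      then have e: "2 / \<gamma> * b powr (\<gamma> / 2) * (N * real n powr (?d / p)) = 2 * N / \<gamma>" by (simp add: mult_ac)
      have "ennreal (2 / \<gamma> * b powr (\<gamma> / 2)) * ennreal (N * real n powr (?d / p)) = ennreal (2 / \<gamma> * b powr (\<gamma> / 2) * (N * real n powr (?d / p)))"
        using gpos by (intro ennreal_mult'[symmetric]) simp
      then show "ennreal (2 / \<gamma> * b powr (\<gamma> / 2)) * ennreal (N * real n powr (?d / p)) \<le> ennreal (2 * N / \<gamma>)"
        by (simp only: e order_refl)
      have "\<omega> * (ln 1 - ln b) = 2 * (\<omega> * ln (real n))" using n by (simp add: b_def ln_powr)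
      also have "\<dots> \<le> 2 * (\<omega> * \<Lambda>)" using \<omega> n by (auto simp: \<Lambda>_def)
      also have "\<omega> * \<Lambda> = \<Lambda> powr (1 - 1 / p)" using \<Lambda> by (simp add: \<omega>_def powr_diff powr_minus_divide)
      finally show "ennreal \<omega> * ennreal (ln 1 - ln b) \<le> ennreal (2 * \<Lambda> powr (1 - 1 / p))"
        using \<omega> by (subst ennreal_mult'[symmetric]) (auto intro: ennreal_leI)
      have "- 1 / p * (1 - p) = 1 - 1 / p" using p by (simp add: field_simps)
      then have "\<omega> powr (1 - p) = \<Lambda> powr (1 - 1 / p)" by (simp only: \<omega>_def powr_powr)
      then have "2 ^ CARD('d) / r * \<omega> powr (1 - p) * pint p ?S \<le> 2 ^ CARD('d) / r * \<Lambda> powr (1 - 1 / p) * 1"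
        using r pint_le_1[OF p0 L] by (intro mult_mono) (auto simp: pint_nonneg)
      then show "ennreal (2 ^ CARD('d) / r * \<omega> powr (1 - p)) * ennreal (pint p ?S) \<le> ennreal (2 ^ CARD('d) / r * \<Lambda> powr (1 - 1 / p))"
        using r by (subst ennreal_mult'[symmetric]) (auto intro: ennreal_leI)
    qed
    also have "\<dots> = ennreal (2 * N / \<gamma> + (2 * \<Lambda> powr (1 - 1 / p) + 2 ^ CARD('d) / r * \<Lambda> powr (1 - 1 / p)))"
      using N gpos r by (subst ennreal_plus[symmetric], simp, simp, subst ennreal_plus[symmetric]) auto
    finally have "heat_int_real \<gamma> n c x \<le> 2 * N / \<gamma> + (2 * \<Lambda> powr (1 - 1 / p) + 2 ^ CARD('d) / r * \<Lambda> powr (1 - 1 / p))"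
      using N gpos r by (subst (asm) ennreal_le_iff) (auto intro!: add_nonneg_nonneg)
    also have "\<dots> \<le> 2 * N / \<gamma> * (\<Lambda> powr (1 - 1 / p) / ln 2 powr (1 - 1 / p)) + (2 * \<Lambda> powr (1 - 1 / p) + 2 ^ CARD('d) / r * \<Lambda> powr (1 - 1 / p))"
    proof (intro add_right_mono)
      have "ln 2 powr (1 - 1 / p) \<le> \<Lambda> powr (1 - 1 / p)"
        using ln_Suc_pos(2)[OF n] p by (intro powr_mono2) (auto simp: \<Lambda>_def)
      then have "2 * N / \<gamma> * 1 \<le> 2 * N / \<gamma> * (\<Lambda> powr (1 - 1 / p) / ln 2 powr (1 - 1 / p))"
        using N gpos by (intro mult_left_mono) auto
      then show "2 * N / \<gamma> \<le> 2 * N / \<gamma> * (\<Lambda> powr (1 - 1 / p) / ln 2 powr (1 - 1 / p))" by simp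
    qed
    also have "\<dots> = C * \<Lambda> powr (1 - 1 / p)" by (simp add: C_def algebra_simps)
    finally show "heat_int_real \<gamma> n c x \<le> C * ln (real n + 1) powr (1 - 1 / p)" by (simp only: \<Lambda>_def)
  qed
qed

subsection \<open>Upper bounds\<close>

lemma tpoly_scale: "tpoly n (\<lambda>k. a * c k) x = a * tpoly n c x"
  by (simp add: tpoly_def sum_distrib_left mult_ac)

lemma potential_scale: "potential \<gamma> (\<lambda>k. a * c k) = (\<lambda>k. a * potential \<gamma> c k)"
  by (auto simp: potential_def)

lemma potential_zero_exponent: "c 0 = 0 \<Longrightarrow> potential 0 c = c"
  by (auto simp: potential_def)

lemma Lp_norm_scale_le:
  assumes q: "0 < q"
  shows "Lp_norm q (tpoly n (\<lambda>k. a * c k)) \<le> norm a * Lp_norm q (tpoly n c)"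
proof (cases q)
  case (real r)
  then have r: "0 < r" using q by simp
  have "pint r (tpoly n (\<lambda>k. a * c k)) = norm a powr r * pint r (tpoly n c)"
    by (simp add: pint_def tpoly_scale norm_mult powr_mult)
  then show ?thesis using r by (simp add: real Lp_norm_tpoly powr_mult powr_powr pint_nonneg)
next
  case PInf
  show ?thesis unfolding PInf
    by (rule Lp_norm_infinity(2)[OF continuous_on_tpoly periodic_tpoly])
      (auto simp: tpoly_scale norm_mult intro!: mult_left_mono Lp_norm_infinity(1) continuous_on_tpoly periodic_tpoly)
qed (use q in auto)

lemma Lp_norm_nonneg:
  assumes q: "0 < q"
  shows "0 \<le> Lp_norm q (tpoly n c)"
proof (cases q)
  case PInf
  have "norm (tpoly n c 0) \<le> Lp_norm q (tpoly n c)"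
    unfolding PInf by (rule Lp_norm_infinity(1)[OF continuous_on_tpoly periodic_tpoly])
  then show ?thesis using norm_ge_zero order_trans by blast
qed (use q Lp_norm_nonneg_tpoly in auto)

text \<open>Homogeneity. If the norm on the right is zero, scaling by every positive
  \<open>A\<close> forces the left-hand side to be 0, which replaces an argument that the polynomial
  vanishes.\<close>

lemma upper_by_normalization:
  fixes c :: "int ^ 'd \<Rightarrow> complex"
  assumes p: "0 < p" and q: "0 < q" and n: "1 \<le> n" and c: "c 0 = 0"
    and H: "\<And>c :: int ^ 'd \<Rightarrow> complex. c 0 = 0 \<Longrightarrow> Lp_norm (ereal p) (tpoly n c) \<le> 1 \<Longrightarrow> Lp_norm q (tpoly n (potential \<gamma> c)) \<le> K"
  shows "Lp_norm q (tpoly n (potential \<gamma> c)) \<le> K * Lp_norm (ereal p) (tpoly n c)"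
proof -
  let ?L = "Lp_norm (ereal p) (tpoly n c)" and ?X = "Lp_norm q (tpoly n (potential \<gamma> c))"
  have L0: "0 \<le> ?L" by (rule Lp_norm_nonneg_tpoly[OF p])
  have scaled: "?X \<le> A * K" if A: "0 < A" and le: "?L \<le> A" for A
  proof -
    let ?c = "\<lambda>k. complex_of_real (1 / A) * c k"
    have "Lp_norm (ereal p) (tpoly n ?c) \<le> norm (complex_of_real (1 / A)) * ?L"
      using p by (intro Lp_norm_scale_le) simp
    also have "\<dots> \<le> 1" using A le by (simp add: norm_divide)
    finally have "Lp_norm q (tpoly n (potential \<gamma> ?c)) \<le> K" by (rule H[of ?c, rotated]) (simp add: c)
    have "(\<lambda>k. complex_of_real A * potential \<gamma> ?c k) = potential \<gamma> c"
      using A by (simp only: potential_scale mult.assoc[symmetric]) simp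
    then have "?X = Lp_norm q (tpoly n (\<lambda>k. complex_of_real A * potential \<gamma> ?c k))" by simp
    also have "\<dots> \<le> norm (complex_of_real A) * Lp_norm q (tpoly n (potential \<gamma> ?c))"
      by (rule Lp_norm_scale_le[OF q])
    also have "\<dots> \<le> A * K" using A \<open>Lp_norm q (tpoly n (potential \<gamma> ?c)) \<le> K\<close> by simp
    finally show ?thesis .
  qed
  show ?thesis
  proof (cases "?L = 0")
    case False
    then show ?thesis using scaled[of ?L] L0 by (simp add: mult.commute)
  next
    case True
    have "?X \<le> 0"
    proof (rule ccontr)
      assume "\<not> ?X \<le> 0"
      then have X: "0 < ?X" by simp
      have K: "0 < K" using scaled[of 1] X True by simp
      \<comment> \<open>The scale \<open>?X / (2 * K)\<close> makes the bound half of
        \<open>?X\<close> itself.\<close>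
      have "?X \<le> ?X / (2 * K) * K" using X K True by (intro scaled) auto
      then show False using X K by simp
    qed
    then show ?thesis by (simp add: True)
  qed
qed

lemma pint_1_le:
  assumes p: "1 \<le> p" and L: "Lp_norm (ereal p) (tpoly n c :: real ^ 'd \<Rightarrow> complex) \<le> 1"
  shows "pint 1 (tpoly n c :: real ^ 'd \<Rightarrow> complex) \<le> (2 * pi) ^ CARD('d) + 1"
proof -
  have "pint 1 (tpoly n c) = Lp_norm (ereal 1) (tpoly n c)"
    by (subst Lp_norm_tpoly) (simp_all add: pint_nonneg)
  also have "\<dots> \<le> ((2 * pi) ^ CARD('d) + 1) powr (1 / 1) * Lp_norm (ereal p) (tpoly n c)"
    by (rule pint_mono_exponent) (use p in auto)
  also have "\<dots> \<le> ((2 * pi) ^ CARD('d) + 1) powr (1 / 1) * 1"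
    using L by (intro mult_left_mono) auto
  finally show ?thesis by (simp add: add_nonneg_nonneg)
qed

lemma norm_tpoly_potential_le_heat_int_real:
  assumes p: "1 \<le> p" and g: "0 < \<gamma>"
  obtains C where "0 < C" "\<And>n c x. c 0 = 0 \<Longrightarrow> Lp_norm (ereal p) (tpoly n c) \<le> 1 \<Longrightarrow>
    norm (tpoly n (potential \<gamma> c) (x :: real ^ 'd)) \<le> C * (heat_int_real \<gamma> n c x + 1)"
proof -
  obtain C where C: "0 < C" "\<And>n c x. c 0 = 0 \<Longrightarrow> ennreal (norm (tpoly n (potential \<gamma> c) (x :: real ^ 'd)))
    \<le> ennreal C * (heat_int \<gamma> n c x + ennreal (pint 1 (tpoly n c)))"
    using norm_tpoly_potential_le_heat_int[OF g] by blast
  let ?B = "(2 * pi) ^ CARD('d) + 1"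
  have B: "1 \<le> ?B" by simp
  then have B0: "0 < ?B" by linarith
  show thesis
  proof (rule that)
    show "0 < C * ?B" by (intro mult_pos_pos C(1) B0)
    fix n :: nat and c :: "int ^ 'd \<Rightarrow> complex" and x
    assume c: "c 0 = 0" and L: "Lp_norm (ereal p) (tpoly n c) \<le> 1"
    have "ennreal (norm (tpoly n (potential \<gamma> c) x)) \<le> ennreal C * (ennreal (heat_int_real \<gamma> n c x) + ennreal (pint 1 (tpoly n c)))"
      using C(2)[where c = c, OF c] by (simp add: ennreal_heat_int_real[OF g])
    also have "\<dots> = ennreal (C * (heat_int_real \<gamma> n c x + pint 1 (tpoly n c)))"
      using C(1) by (subst ennreal_mult') (simp_all add: heat_int_real_nonneg pint_nonneg)
    finally have "norm (tpoly n (potential \<gamma> c) x) \<le> C * (heat_int_real \<gamma> n c x + pint 1 (tpoly n c))"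
      using C(1) by (subst (asm) ennreal_le_iff) (simp_all add: heat_int_real_nonneg pint_nonneg)
    also have "\<dots> \<le> C * (?B * heat_int_real \<gamma> n c x + ?B * 1)"
    proof (intro mult_left_mono add_mono)
      show "heat_int_real \<gamma> n c x \<le> ?B * heat_int_real \<gamma> n c x"
        using mult_right_mono[OF B heat_int_real_nonneg] by simp
      show "pint 1 (tpoly n c) \<le> ?B * 1" using pint_1_le[OF p L] by simp
    qed (use C in auto)
    finally show "norm (tpoly n (potential \<gamma> c) x) \<le> C * ?B * (heat_int_real \<gamma> n c x + 1)"
      by (simp add: algebra_simps)
  qed
qed

text \<open>The estimate \<open>h + 1 \<le> 2 * max h 1\<close> stands in for the triangle
  inequality, so exponents \<open>q < 1\<close> are included.\<close>

lemma Lp_norm_potential_le_moment: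
  assumes p: "1 \<le> p" and g: "0 < \<gamma>" and q: "0 < q"
  obtains A where "0 < A" "\<And>n (c :: int ^ 'd \<Rightarrow> complex) X. c 0 = 0 \<Longrightarrow> Lp_norm (ereal p) (tpoly n c) \<le> 1 \<Longrightarrow> 0 \<le> X \<Longrightarrow>
    (\<integral>\<^sup>+x. ennreal (heat_int_real \<gamma> n c x powr q) \<partial>cube_measure) \<le> ennreal X \<Longrightarrow>
    Lp_norm (ereal q) (tpoly n (potential \<gamma> c)) \<le> A * (X + 1) powr (1 / q)"
proof -
  obtain C where C: "0 < C" "\<And>n c x. c 0 = 0 \<Longrightarrow> Lp_norm (ereal p) (tpoly n c) \<le> 1 \<Longrightarrow>
    norm (tpoly n (potential \<gamma> c) (x :: real ^ 'd)) \<le> C * (heat_int_real \<gamma> n c x + 1)"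
    using norm_tpoly_potential_le_heat_int_real[OF p g] by blast
  let ?B = "(2 * pi) ^ CARD('d) + 1"
  define A where "A = ((2 * C) powr q * ?B) powr (1 / q)"
  have B: "1 \<le> ?B" by simp
  then have B0: "0 < ?B" by linarith
  have "0 < (2 * C) powr q * ?B" using C(1) by (intro mult_pos_pos B0) simp
  then have A: "0 < A" unfolding A_def powr_gt_zero by (rule less_imp_neq[THEN not_sym])
  show thesis
  proof (rule that[OF A])
    fix n :: nat and c :: "int ^ 'd \<Rightarrow> complex" and X :: real
    assume c: "c 0 = 0" and L: "Lp_norm (ereal p) (tpoly n c) \<le> 1" and X: "0 \<le> X"
      and H: "(\<integral>\<^sup>+x. ennreal (heat_int_real \<gamma> n c x powr q) \<partial>cube_measure) \<le> ennreal X"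
    let ?U = "tpoly n (potential \<gamma> c)"
    have [measurable]: "heat_int_real \<gamma> n c \<in> borel_measurable cube_measure" by (rule measurable_cube_measure) measurable
    have "ennreal (pint q ?U) = (\<integral>\<^sup>+x. norm (?U x) powr q \<partial>cube_measure)" by (rule ennreal_pint[OF q])
    also have "\<dots> \<le> (\<integral>\<^sup>+x. ennreal ((2 * C) powr q) * (ennreal (heat_int_real \<gamma> n c x powr q) + 1) \<partial>cube_measure)"
    proof (rule nn_integral_mono)
      fix x
      let ?h = "heat_int_real \<gamma> n c x"
      have h: "0 \<le> ?h" by (rule heat_int_real_nonneg)
      have "norm (?U x) \<le> C * (?h + 1)" by (rule C(2)[where c = c, OF c L])
      also have "\<dots> \<le> C * (2 * max ?h 1)" using C(1) by (intro mult_left_mono) auto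
      finally have "norm (?U x) powr q \<le> (2 * C * max ?h 1) powr q" using q by (intro powr_mono2) (auto simp: mult_ac)
      also have "\<dots> = (2 * C) powr q * max ?h 1 powr q" by (rule powr_mult)
      also have "\<dots> \<le> (2 * C) powr q * (?h powr q + 1)"
        by (intro mult_left_mono) (auto simp: max_def)
      finally have "ennreal (norm (?U x) powr q) \<le> ennreal ((2 * C) powr q * (?h powr q + 1))" by (rule ennreal_leI)
      also have "\<dots> = ennreal ((2 * C) powr q) * (ennreal (?h powr q) + 1)"
        by (subst ennreal_mult') auto
      finally show "ennreal (norm (?U x) powr q) \<le> ennreal ((2 * C) powr q) * (ennreal (?h powr q) + 1)" .
    qed
    also have "\<dots> = ennreal ((2 * C) powr q) * ((\<integral>\<^sup>+x. ennreal (heat_int_real \<gamma> n c x powr q) \<partial>cube_measure) + ennreal ((2 * pi) ^ CARD('d)))"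
      by (subst nn_integral_cmult, measurable, subst nn_integral_add, measurable)
        (simp add: emeasure_restrict_space space_restrict_space emeasure_period_cube)
    also have "\<dots> \<le> ennreal ((2 * C) powr q) * (ennreal X + ennreal ((2 * pi) ^ CARD('d)))"
      by (intro mult_left_mono add_right_mono H) simp
    also have "\<dots> = ennreal ((2 * C) powr q * (X + (2 * pi) ^ CARD('d)))"
      using X by (subst ennreal_mult') auto
    finally have "pint q ?U \<le> (2 * C) powr q * (X + (2 * pi) ^ CARD('d))"
      using X by (subst (asm) ennreal_le_iff) auto
    also have "\<dots> \<le> (2 * C) powr q * (?B * (X + 1))"
      using X by (intro mult_left_mono) (auto simp: algebra_simps)
    finally have "pint q ?U powr (1 / q) \<le> ((2 * C) powr q * ?B * (X + 1)) powr (1 / q)"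
      using q by (intro powr_mono2) (auto simp: pint_nonneg mult_ac)
    also have "\<dots> = A * (X + 1) powr (1 / q)" unfolding A_def by (rule powr_mult)
    finally show "Lp_norm (ereal q) ?U \<le> A * (X + 1) powr (1 / q)" using q by (simp add: Lp_norm_tpoly)
  qed
qed

text \<open>At the critical order \<open>\<delta>\<close> this is the Hardy-Littlewood-Sobolev
  inequality, contained in \<open>heat_int_real_strong\<close>; larger orders follow by
  \<open>heat_int_real_antimono\<close>.\<close>

lemma upper_sobolev:
  assumes p: "1 < p" "p < q" and g: "real CARD('d) * (1 / p - 1 / q) \<le> \<gamma>"
  obtains C where "0 < C" "\<And>n (c :: int ^ 'd \<Rightarrow> complex). 1 \<le> n \<Longrightarrow> c 0 = 0 \<Longrightarrow>
    Lp_norm (ereal q) (tpoly n (potential \<gamma> c)) \<le> C * Lp_norm (ereal p) (tpoly n c)"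
proof -
  define \<delta> where "\<delta> = real CARD('d) * (1 / p - 1 / q)"
  have \<delta>: "0 < \<delta>" "\<delta> \<le> \<gamma>" using p g by (auto simp: \<delta>_def field_simps)
  have g0: "0 < \<gamma>" and q0: "0 < q" and p1: "1 \<le> p" using \<delta> p by auto
  obtain X where X: "0 < X" "\<And>n (c :: int ^ 'd \<Rightarrow> complex). 1 \<le> n \<Longrightarrow> Lp_norm (ereal p) (tpoly n c) \<le> 1 \<Longrightarrow>
    (\<integral>\<^sup>+x. ennreal (heat_int_real \<delta> n c x powr q) \<partial>cube_measure) \<le> ennreal X"
    using heat_int_real_strong[OF p \<delta>_def] by blast
  obtain A where A: "0 < A" "\<And>n (c :: int ^ 'd \<Rightarrow> complex) X. c 0 = 0 \<Longrightarrow> Lp_norm (ereal p) (tpoly n c) \<le> 1 \<Longrightarrow> 0 \<le> X \<Longrightarrow>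
    (\<integral>\<^sup>+x. ennreal (heat_int_real \<gamma> n c x powr q) \<partial>cube_measure) \<le> ennreal X \<Longrightarrow>
    Lp_norm (ereal q) (tpoly n (potential \<gamma> c)) \<le> A * (X + 1) powr (1 / q)"
    using Lp_norm_potential_le_moment[OF p1 g0 q0] by blast
  show thesis
  proof (rule that)
    show "0 < A * (X + 1) powr (1 / q)" using A X by simp
    fix n :: nat and c :: "int ^ 'd \<Rightarrow> complex" assume n: "1 \<le> n" and c: "c 0 = 0"
    show "Lp_norm (ereal q) (tpoly n (potential \<gamma> c)) \<le> A * (X + 1) powr (1 / q) * Lp_norm (ereal p) (tpoly n c)"
    proof (rule upper_by_normalization[where c = c, OF _ _ n c])
      fix c :: "int ^ 'd \<Rightarrow> complex" assume c: "c 0 = 0" and L: "Lp_norm (ereal p) (tpoly n c) \<le> 1"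
      have "(\<integral>\<^sup>+x. ennreal (heat_int_real \<gamma> n c x powr q) \<partial>cube_measure) \<le> (\<integral>\<^sup>+x. ennreal (heat_int_real \<delta> n c x powr q) \<partial>cube_measure)"
        using q0 by (intro nn_integral_mono ennreal_leI powr_mono2 heat_int_real_antimono \<delta> heat_int_real_nonneg) auto
      also have "\<dots> \<le> ennreal X" by (rule X(2)[OF n L])
      finally show "Lp_norm (ereal q) (tpoly n (potential \<gamma> c)) \<le> A * (X + 1) powr (1 / q)"
        using X(1) by (intro A(2) c L) auto
    qed (use p in auto)
  qed
qed

text \<open>The additive constant left by the large times is absorbed because \<open>s\<close> is
  bounded below.\<close>

lemma upper_infinity_of_bound:
  fixes s :: "nat \<Rightarrow> real"
  assumes p: "1 \<le> p" and g: "0 < \<gamma>" and C1: "0 < C1"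
    and bnd: "\<And>n (c :: int ^ 'd \<Rightarrow> complex) x. 1 \<le> n \<Longrightarrow> Lp_norm (ereal p) (tpoly n c) \<le> 1 \<Longrightarrow> heat_int_real \<gamma> n c x \<le> C1 * s n"
    and l: "0 < l" and s: "\<And>n. 1 \<le> n \<Longrightarrow> l \<le> s n"
  obtains C where "0 < C" "\<And>n (c :: int ^ 'd \<Rightarrow> complex). 1 \<le> n \<Longrightarrow> c 0 = 0 \<Longrightarrow>
    Lp_norm \<infinity> (tpoly n (potential \<gamma> c)) \<le> C * s n * Lp_norm (ereal p) (tpoly n c)"
proof -
  obtain C2 where C2: "0 < C2" "\<And>n c x. c 0 = 0 \<Longrightarrow> Lp_norm (ereal p) (tpoly n c) \<le> 1 \<Longrightarrow>
    norm (tpoly n (potential \<gamma> c) (x :: real ^ 'd)) \<le> C2 * (heat_int_real \<gamma> n c x + 1)"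
    using norm_tpoly_potential_le_heat_int_real[OF p g] by blast
  show thesis
  proof (rule that)
    show "0 < C2 * (C1 + 1 / l)" using C1 C2 l by (intro mult_pos_pos add_pos_pos) auto
    fix n :: nat and c :: "int ^ 'd \<Rightarrow> complex" assume n: "1 \<le> n" and c: "c 0 = 0"
    show "Lp_norm \<infinity> (tpoly n (potential \<gamma> c)) \<le> C2 * (C1 + 1 / l) * s n * Lp_norm (ereal p) (tpoly n c)"
    proof (rule upper_by_normalization[where c = c, OF _ _ n c])
      fix c :: "int ^ 'd \<Rightarrow> complex" assume c: "c 0 = 0" and L: "Lp_norm (ereal p) (tpoly n c) \<le> 1"
      show "Lp_norm \<infinity> (tpoly n (potential \<gamma> c)) \<le> C2 * (C1 + 1 / l) * s n"
      proof (rule Lp_norm_infinity(2)[OF continuous_on_tpoly periodic_tpoly])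
        fix x
        have "norm (tpoly n (potential \<gamma> c) x) \<le> C2 * (heat_int_real \<gamma> n c x + 1)" by (rule C2(2)[where c = c, OF c L])
        also have "\<dots> \<le> C2 * (C1 * s n + 1 / l * s n)"
          using C2(1) bnd[OF n L, of x] s[OF n] l by (intro mult_left_mono add_mono) (auto simp: field_simps)
        finally show "norm (tpoly n (potential \<gamma> c) x) \<le> C2 * (C1 + 1 / l) * s n"
          by (simp add: algebra_simps)
      qed
    qed (use p in auto)
  qed
qed

lemma upper_infinity:
  assumes p: "1 \<le> p" and g: "0 < \<gamma>"
  obtains C where "0 < C" "\<And>n (c :: int ^ 'd \<Rightarrow> complex). 1 \<le> n \<Longrightarrow> c 0 = 0 \<Longrightarrow>
    Lp_norm \<infinity> (tpoly n (potential \<gamma> c)) \<le> C * (if \<gamma> > CARD('d) / p then 1 else if \<gamma> = CARD('d) / p then ln (real n + 1)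
      else real n powr (CARD('d) / p - \<gamma>)) * Lp_norm (ereal p) (tpoly n c)"
proof -
  let ?s = "\<lambda>n. if \<gamma> > CARD('d) / p then 1 else if \<gamma> = CARD('d) / p then ln (real n + 1)
      else real n powr (CARD('d) / p - \<gamma>)"
  obtain C1 where C1: "0 < C1" "\<And>n (c :: int ^ 'd \<Rightarrow> complex) x. 1 \<le> n \<Longrightarrow> Lp_norm (ereal p) (tpoly n c) \<le> 1 \<Longrightarrow>
    heat_int_real \<gamma> n c x \<le> C1 * ?s n"
    by (rule heat_int_real_sup[where 'd = 'd, OF p g]) (rule that)
  have s: "ln 2 \<le> ?s n" if n: "1 \<le> n" for n
  proof -
    have l2: "ln 2 \<le> (1 :: real)" using ln_2_less_1 by simp
    have "1 \<le> real n powr (CARD('d) / p - \<gamma>)" if "\<not> \<gamma> > CARD('d) / p"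
      using n that by (intro ge_one_powr_ge_zero) auto
    with l2 ln_Suc_pos(2)[OF n] show ?thesis by auto
  qed
  have l: "0 < ln (2 :: real)" by simp
  show thesis by (rule upper_infinity_of_bound[where 'd = 'd and s = ?s, OF p g C1 l s]) (assumption+, rule that)
qed

lemma upper_endpoint:
  assumes p: "1 < p" and g: "\<gamma> = real CARD('d) / p"
  obtains C where "0 < C" "\<And>n (c :: int ^ 'd \<Rightarrow> complex). 1 \<le> n \<Longrightarrow> c 0 = 0 \<Longrightarrow>
    Lp_norm \<infinity> (tpoly n (potential \<gamma> c)) \<le> C * ln (real n + 1) powr (1 - 1 / p) * Lp_norm (ereal p) (tpoly n c)"
proof -
  have p1: "1 \<le> p" and g0: "0 < \<gamma>" using p g by auto
  let ?s = "\<lambda>n. ln (real n + 1) powr (1 - 1 / p)"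
  obtain C1 where C1: "0 < C1" "\<And>n (c :: int ^ 'd \<Rightarrow> complex) x. 1 \<le> n \<Longrightarrow> Lp_norm (ereal p) (tpoly n c) \<le> 1 \<Longrightarrow>
    heat_int_real \<gamma> n c x \<le> C1 * ?s n"
    by (rule heat_int_real_endpoint[where 'd = 'd, OF p g]) (rule that)
  have l: "0 < ln (2 :: real) powr (1 - 1 / p)" by simp
  have s: "ln 2 powr (1 - 1 / p) \<le> ?s n" if n: "1 \<le> n" for n
    using ln_Suc_pos(2)[OF n] p by (intro powr_mono2) auto
  show thesis by (rule upper_infinity_of_bound[where 'd = 'd and s = ?s, OF p1 g0 C1 l s]) (assumption+, rule that)
qed

text \<open>Two factors: the potential is bounded from L_p to the exponent \<open>q0\<close> with
  \<open>1 / q0 = 1 / p - \<gamma> / d\<close>, and Nikolskii's inequality leads from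
  \<open>q0\<close> to \<open>q\<close>. The upper bound on \<open>\<gamma>\<close> says that
  \<open>q0\<close> lies below \<open>q\<close>.\<close>

lemma upper_subcritical:
  assumes p: "1 < p" "ereal p < q" and g: "0 \<le> \<gamma>" "\<gamma> < real CARD('d) * (1 / p - recip q)"
  obtains C where "0 < C" "\<And>n (c :: int ^ 'd \<Rightarrow> complex). 1 \<le> n \<Longrightarrow> c 0 = 0 \<Longrightarrow>
    Lp_norm q (tpoly n (potential \<gamma> c)) \<le> C * real n powr (CARD('d) * (1 / p - recip q) - \<gamma>) * Lp_norm (ereal p) (tpoly n c)"
proof -
  have p0: "0 < p" using p by simp
  show thesis
  proof (cases "\<gamma> = 0")
    case True
    obtain C where "0 < C"
      "\<And>n c. 1 \<le> n \<Longrightarrow> Lp_norm q (tpoly n c :: real ^ 'd \<Rightarrow> complex)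
        \<le> C * real n powr (CARD('d) * (1 / p - recip q)) * Lp_norm (ereal p) (tpoly n c)"
      using nikolskii[OF p0 p(2)] by blast
    then show thesis using that[of C] by (simp add: True potential_zero_exponent)
  next
    case False
    then have g0: "0 < \<gamma>" using g by simp
    have r: "0 \<le> recip q" using p p0 by (cases q) (auto simp: recip_def)
    define u where "u = 1 / p - \<gamma> / real CARD('d)"
    have u: "recip q < u" "u < 1 / p" using g g0 by (auto simp: u_def field_simps)
    define q0 where "q0 = 1 / u"
    have u0: "0 < u" using u r by simp
    have q0: "p < q0" "0 < q0" using u u0 p0 by (auto simp: q0_def field_simps)
    have g': "real CARD('d) * (1 / p - 1 / q0) \<le> \<gamma>" by (simp add: q0_def u_def)
    have lt: "ereal q0 < q"
    proof (cases q)
      case (real r)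
      then have "1 / r < u" "0 < r" using u p p0 by (auto simp: recip_def)
      then show ?thesis using u0 by (simp add: real q0_def field_simps)
    qed (use p in auto)
    obtain C1 where C1: "0 < C1" "\<And>n (c :: int ^ 'd \<Rightarrow> complex). 1 \<le> n \<Longrightarrow> c 0 = 0 \<Longrightarrow>
        Lp_norm (ereal q0) (tpoly n (potential \<gamma> c)) \<le> C1 * Lp_norm (ereal p) (tpoly n c)"
      using upper_sobolev[OF p(1) q0(1) g'] by blast
    obtain C2 where C2: "0 < C2"
      "\<And>n c. 1 \<le> n \<Longrightarrow> Lp_norm q (tpoly n c :: real ^ 'd \<Rightarrow> complex)
        \<le> C2 * real n powr (CARD('d) * (1 / q0 - recip q)) * Lp_norm (ereal q0) (tpoly n c)"
      using nikolskii[OF q0(2) lt] by blast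
    show thesis
    proof (rule that)
      show "0 < C2 * C1" using C1 C2 by simp
      fix n :: nat and c :: "int ^ 'd \<Rightarrow> complex" assume n: "1 \<le> n" and c: "c 0 = 0"
      have e: "CARD('d) * (1 / q0 - recip q) = CARD('d) * (1 / p - recip q) - \<gamma>"
        by (simp add: q0_def u_def right_diff_distrib)
      have "Lp_norm q (tpoly n (potential \<gamma> c)) \<le> C2 * real n powr (CARD('d) * (1 / q0 - recip q)) * Lp_norm (ereal q0) (tpoly n (potential \<gamma> c))"
        by (rule C2(2)[OF n])
      also have "\<dots> \<le> C2 * real n powr (CARD('d) * (1 / q0 - recip q)) * (C1 * Lp_norm (ereal p) (tpoly n c))"
        using C2(1) by (intro mult_left_mono C1(2) n c) auto
      finally show "Lp_norm q (tpoly n (potential \<gamma> c)) \<le> C2 * C1 * real n powr (CARD('d) * (1 / p - recip q) - \<gamma>) * Lp_norm (ereal p) (tpoly n c)"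
        unfolding e by (simp add: mult_ac)
    qed
  qed
qed

text \<open>With the weak exponent \<open>q\<close> given by
  \<open>\<gamma> = d * (1 - 1 / q)\<close>, the cases are \<open>r < q\<close>,
  \<open>r = q\<close> and \<open>r > q\<close>: the level integral of
  \<open>heat_int_real_moment\<close> is bounded, logarithmic, or of order
  \<open>M powr (r - q)\<close>, where \<open>M\<close> is of order
  \<open>n powr (d - \<gamma>)\<close> by the sup bound.\<close>

lemma upper_from_L1:
  fixes r \<gamma> :: real
  assumes r: "0 < r" and g: "0 < \<gamma>"
  defines "c0 \<equiv> real CARD('d) * max (1 - 1 / r) 0"
  obtains C where "0 < C" "\<And>n (c :: int ^ 'd \<Rightarrow> complex). 1 \<le> n \<Longrightarrow> c 0 = 0 \<Longrightarrow>
    Lp_norm (ereal r) (tpoly n (potential \<gamma> c)) \<le> C * (if \<gamma> > c0 then 1 else if \<gamma> = c0 then ln (real n + 1) powr (1 / r)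
      else real n powr (c0 - \<gamma>)) * Lp_norm 1 (tpoly n c)"
proof -
  let ?d = "real CARD('d)"
  define s where "s n = (if \<gamma> > c0 then 1 else if \<gamma> = c0 then ln (real n + 1) powr (1 / r) else real n powr (c0 - \<gamma>))" for n
  obtain A where A: "0 < A" "\<And>n (c :: int ^ 'd \<Rightarrow> complex) X. c 0 = 0 \<Longrightarrow> Lp_norm (ereal 1) (tpoly n c) \<le> 1 \<Longrightarrow> 0 \<le> X \<Longrightarrow>
    (\<integral>\<^sup>+x. ennreal (heat_int_real \<gamma> n c x powr r) \<partial>cube_measure) \<le> ennreal X \<Longrightarrow>
    Lp_norm (ereal r) (tpoly n (potential \<gamma> c)) \<le> A * (X + 1) powr (1 / r)"
    using Lp_norm_potential_le_moment[OF order_refl g r] by blast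
  have moment: "\<exists>X. (\<forall>n\<ge>1. 0 \<le> X n) \<and> (\<exists>K>0. \<forall>n\<ge>1. (X n + 1) powr (1 / r) \<le> K * s n) \<and>
      (\<forall>n\<ge>1. \<forall>c :: int ^ 'd \<Rightarrow> complex. Lp_norm 1 (tpoly n c) \<le> 1 \<longrightarrow> (\<integral>\<^sup>+x. ennreal (heat_int_real \<gamma> n c x powr r) \<partial>cube_measure) \<le> ennreal (X n))"
  proof (cases "\<gamma> > c0")
    case True
    \<comment> \<open>Orders of at least \<open>d\<close> have no finite weak exponent; the order is
      lowered where necessary to one strictly between \<open>c0\<close> and
      \<open>d\<close>.\<close>
    define \<gamma>' where "\<gamma>' = min \<gamma> ((c0 + ?d) / 2)"
    have c0d: "0 \<le> c0" "c0 < ?d" using r by (auto simp: c0_def max_def)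
    have g': "0 < \<gamma>'" "\<gamma>' \<le> \<gamma>" "c0 < \<gamma>'" "\<gamma>' < ?d" using True c0d g by (auto simp: \<gamma>'_def min_def)
    define q where "q = ?d / (?d - \<gamma>')"
    have q: "1 < q" using g' by (simp add: q_def)
    have gq: "\<gamma>' = ?d * (1 - 1 / q)" using g' by (simp add: q_def field_simps)
    have rq: "r < q"
    proof -
      have "?d * (1 - 1 / r) \<le> c0" unfolding c0_def by (intro mult_left_mono) auto
      then have "?d * (1 - 1 / r) < ?d * (1 - 1 / q)" using g'(3) gq by linarith
      then have "1 / q < 1 / r" by (subst (asm) mult_less_cancel_left_pos) auto
      then show ?thesis using r q by (simp add: field_simps)
    qed
    obtain A' where A': "0 < A'" "\<And>n (c :: int ^ 'd \<Rightarrow> complex) M. 1 \<le> n \<Longrightarrow> Lp_norm 1 (tpoly n c) \<le> 1 \<Longrightarrow>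
      (\<And>x. heat_int_real \<gamma>' n c x \<le> M) \<Longrightarrow>
      (\<integral>\<^sup>+x. ennreal (heat_int_real \<gamma>' n c x powr r) \<partial>cube_measure)
        \<le> ennreal A' * (1 + (\<integral>\<^sup>+l. ennreal (indicator {1<..M} l * l powr (r - q - 1)) \<partial>lborel))"
      using heat_int_real_moment[OF q gq r] by blast
    obtain C where C: "0 < C" "\<And>n (c :: int ^ 'd \<Rightarrow> complex) x. 1 \<le> n \<Longrightarrow> Lp_norm (ereal 1) (tpoly n c) \<le> 1 \<Longrightarrow>
      heat_int_real \<gamma>' n c x \<le> C * (if \<gamma>' > CARD('d) / 1 then 1 else if \<gamma>' = CARD('d) / 1 then ln (real n + 1) else real n powr (CARD('d) / 1 - \<gamma>'))"
      using heat_int_real_sup[OF order_refl g'(1)] by blast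
    define X where "X = A' * (1 + 1 / (q - r))"
    have X: "0 \<le> X" using A' rq by (simp add: X_def)
    have "(\<integral>\<^sup>+x. ennreal (heat_int_real \<gamma> n c x powr r) \<partial>cube_measure) \<le> ennreal X"
      if n: "1 \<le> n" and L: "Lp_norm 1 (tpoly n c) \<le> 1" for n :: nat and c :: "int ^ 'd \<Rightarrow> complex"
    proof -
      let ?M = "C * (if \<gamma>' > CARD('d) / 1 then 1 else if \<gamma>' = CARD('d) / 1 then ln (real n + 1) else real n powr (CARD('d) / 1 - \<gamma>'))"
      have M: "heat_int_real \<gamma>' n c x \<le> ?M" for x using C(2)[OF n, of c x] L by (simp only: one_ereal_def)
      have "(\<integral>\<^sup>+x. ennreal (heat_int_real \<gamma> n c x powr r) \<partial>cube_measure) \<le> (\<integral>\<^sup>+x. ennreal (heat_int_real \<gamma>' n c x powr r) \<partial>cube_measure)"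
        using r by (intro nn_integral_mono ennreal_leI powr_mono2 heat_int_real_antimono g' heat_int_real_nonneg) auto
      also have "\<dots> \<le> ennreal A' * (1 + (\<integral>\<^sup>+l. ennreal (indicator {1<..?M} l * l powr (r - q - 1)) \<partial>lborel))"
        by (rule A'(2)[OF n L M])
      also have "\<dots> \<le> ennreal A' * (1 + (\<integral>\<^sup>+l. ennreal (indicator {1<..} l * l powr (- (q - r) - 1)) \<partial>lborel))"
        by (intro mult_left_mono add_left_mono nn_integral_mono) (auto simp: indicator_def)
      also have "(\<integral>\<^sup>+l. ennreal (indicator {1<..} l * l powr (- (q - r) - 1)) \<partial>lborel) = ennreal (1 powr (- (q - r)) / (q - r))"
        using rq by (intro nn_integral_powr_to_infinity) auto
      also have "ennreal A' * (1 + ennreal (1 powr (- (q - r)) / (q - r))) = ennreal X"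
        using A' rq by (simp add: X_def ennreal_mult' flip: ennreal_1 ennreal_plus)
      finally show ?thesis .
    qed
    then show ?thesis using X True by (intro exI[of _ "\<lambda>_. X"]) (auto simp: s_def intro!: exI[of _ "(X + 1) powr (1 / r)"])
  next
    case False
    then have gc: "\<gamma> \<le> c0" by simp
    \<comment> \<open>A positive \<open>\<gamma>\<close> not above \<open>c0\<close> makes
      \<open>c0\<close> positive.\<close>
    then have r1: "1 < r" using g r by (auto simp: c0_def max_def split: if_splits)
    then have c0: "c0 = ?d * (1 - 1 / r)" by (simp add: c0_def)
    have gd: "\<gamma> < ?d" using gc r1 by (simp add: c0 algebra_simps) (smt (verit) divide_pos_pos of_nat_0_less_iff zero_less_card_finite)
    define q where "q = ?d / (?d - \<gamma>)"
    have q: "1 < q" using g gd by (simp add: q_def)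
    have gq: "\<gamma> = ?d * (1 - 1 / q)" using gd by (simp add: q_def field_simps)
    have dq: "?d - \<gamma> = ?d / q" using gd by (simp add: q_def)
    obtain A' where A': "0 < A'" "\<And>n (c :: int ^ 'd \<Rightarrow> complex) M. 1 \<le> n \<Longrightarrow> Lp_norm 1 (tpoly n c) \<le> 1 \<Longrightarrow>
      (\<And>x. heat_int_real \<gamma> n c x \<le> M) \<Longrightarrow>
      (\<integral>\<^sup>+x. ennreal (heat_int_real \<gamma> n c x powr r) \<partial>cube_measure)
        \<le> ennreal A' * (1 + (\<integral>\<^sup>+l. ennreal (indicator {1<..M} l * l powr (r - q - 1)) \<partial>lborel))"
      using heat_int_real_moment[OF q gq r] by blast
    obtain C' where C': "0 < C'" "\<And>n (c :: int ^ 'd \<Rightarrow> complex) x. 1 \<le> n \<Longrightarrow> Lp_norm (ereal 1) (tpoly n c) \<le> 1 \<Longrightarrow>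
      heat_int_real \<gamma> n c x \<le> C' * (if \<gamma> > CARD('d) / 1 then 1 else if \<gamma> = CARD('d) / 1 then ln (real n + 1) else real n powr (CARD('d) / 1 - \<gamma>))"
      using heat_int_real_sup[OF order_refl g] by blast
    define C where "C = max C' 1"
    have C: "1 \<le> C" "C' \<le> C" by (auto simp: C_def)
    define M where "M n = C * real n powr (?d - \<gamma>)" for n
    have M1: "1 \<le> M n" if n: "1 \<le> n" for n
    proof -
      have "1 \<le> real n powr (?d - \<gamma>)" using n gd by (intro ge_one_powr_ge_zero) auto
      then have "1 * 1 \<le> C * real n powr (?d - \<gamma>)" using C by (intro mult_mono) auto
      then show ?thesis by (simp add: M_def)
    qed
    have M: "heat_int_real \<gamma> n c x \<le> M n" if n: "1 \<le> n" and L: "Lp_norm 1 (tpoly n c) \<le> 1" for n :: nat and c :: "int ^ 'd \<Rightarrow> complex" and x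
    proof -
      have "heat_int_real \<gamma> n c x \<le> C' * real n powr (?d - \<gamma>)" using C'(2)[OF n, of c x] L gd by (simp add: one_ereal_def)
      also have "\<dots> \<le> M n" unfolding M_def using C by (intro mult_right_mono) auto
      finally show ?thesis .
    qed
    show ?thesis
    proof (cases "\<gamma> = c0")
      case True
      then have "1 / q = 1 / r" using gq c0 by (simp add: True)
      then have qr: "q = r" using q r by (simp add: field_simps)
      define X where "X n = A' * (1 + ln (M n))" for n
      have X: "0 \<le> X n" if "1 \<le> n" for n using M1[OF that] A' by (simp add: X_def)
      have "(\<integral>\<^sup>+x. ennreal (heat_int_real \<gamma> n c x powr r) \<partial>cube_measure) \<le> ennreal (X n)"
        if n: "1 \<le> n" and L: "Lp_norm 1 (tpoly n c) \<le> 1" for n :: nat and c :: "int ^ 'd \<Rightarrow> complex"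
      proof -
        have "(\<integral>\<^sup>+x. ennreal (heat_int_real \<gamma> n c x powr r) \<partial>cube_measure)
          \<le> ennreal A' * (1 + (\<integral>\<^sup>+l. ennreal (indicator {1<..M n} l * l powr (r - q - 1)) \<partial>lborel))"
          by (rule A'(2)[OF n L M[OF n L]])
        also have "(\<integral>\<^sup>+l. ennreal (indicator {1<..M n} l * l powr (r - q - 1)) \<partial>lborel) = ennreal (ln (M n) - ln 1)"
          using nn_integral_inverse[of 1 "M n"] M1[OF n] by (simp add: qr)
        also have "ennreal A' * (1 + ennreal (ln (M n) - ln 1)) = ennreal (X n)"
          using A' M1[OF n] by (simp add: X_def ennreal_mult' flip: ennreal_1 ennreal_plus)
        finally show ?thesis .
      qed
      moreover have "\<exists>K>0. \<forall>n\<ge>1. (X n + 1) powr (1 / r) \<le> K * s n"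
      proof -
        define B where "B = (A' * (1 + ln C) + 1) / ln 2 + A' * (?d - \<gamma>)"
        have B0: "0 < A' * (1 + ln C) + 1" using A' C by (intro add_nonneg_pos mult_nonneg_nonneg) auto
        have B: "0 < B" unfolding B_def using B0 A' gd by (intro add_pos_nonneg) auto
        have "(X n + 1) powr (1 / r) \<le> B powr (1 / r) * s n" if n: "1 \<le> n" for n
        proof -
          have "X n + 1 = (A' * (1 + ln C) + 1) * 1 + A' * (?d - \<gamma>) * ln (real n)"
            using n C by (simp add: X_def M_def ln_mult ln_powr algebra_simps)
          also have "\<dots> \<le> (A' * (1 + ln C) + 1) * (ln (real n + 1) / ln 2) + A' * (?d - \<gamma>) * ln (real n + 1)"
            using B0 A' gd ln_Suc_pos[OF n] n by (intro add_mono mult_left_mono) auto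
          also have "\<dots> = B * ln (real n + 1)" by (simp add: B_def algebra_simps)
          finally have "(X n + 1) powr (1 / r) \<le> (B * ln (real n + 1)) powr (1 / r)"
            using r X[OF n] by (intro powr_mono2) auto
          then show ?thesis by (simp add: s_def True powr_mult)
        qed
        then show ?thesis using B by (intro exI[of _ "B powr (1 / r)"]) auto
      qed
      ultimately show ?thesis using X by blast
    next
      case False
      then have lt: "\<gamma> < c0" using gc by simp
      then have "?d * (1 - 1 / q) < ?d * (1 - 1 / r)" using gq c0 by simp
      then have "1 / r < 1 / q" by (subst (asm) mult_less_cancel_left_pos) auto
      then have qr: "q < r" using q r by (simp add: field_simps)
      define X where "X n = A' * (1 + M n powr (r - q) / (r - q))" for n
      have X: "0 \<le> X n" if "1 \<le> n" for n using qr A' by (simp add: X_def)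
      have "(\<integral>\<^sup>+x. ennreal (heat_int_real \<gamma> n c x powr r) \<partial>cube_measure) \<le> ennreal (X n)"
        if n: "1 \<le> n" and L: "Lp_norm 1 (tpoly n c) \<le> 1" for n :: nat and c :: "int ^ 'd \<Rightarrow> complex"
      proof -
        have "(\<integral>\<^sup>+x. ennreal (heat_int_real \<gamma> n c x powr r) \<partial>cube_measure)
          \<le> ennreal A' * (1 + (\<integral>\<^sup>+l. ennreal (indicator {1<..M n} l * l powr (r - q - 1)) \<partial>lborel))"
          by (rule A'(2)[OF n L M[OF n L]])
        also have "\<dots> \<le> ennreal A' * (1 + (\<integral>\<^sup>+l. ennreal (indicator {0<..M n} l * l powr ((2 * (r - q)) / 2 - 1)) \<partial>lborel))"
          by (intro mult_left_mono add_left_mono nn_integral_mono) (auto simp: indicator_def)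
        also have "(\<integral>\<^sup>+l. ennreal (indicator {0<..M n} l * l powr ((2 * (r - q)) / 2 - 1)) \<partial>lborel)
            = ennreal (2 / (2 * (r - q)) * M n powr (2 * (r - q) / 2))"
          using qr M1[OF n] by (intro nn_integral_weight) auto
        also have "2 / (2 * (r - q)) * M n powr (2 * (r - q) / 2) = M n powr (r - q) / (r - q)"
        proof -
          have "2 * (r - q) / 2 = r - q" by simp
          moreover have "2 / (2 * (r - q)) = 1 / (r - q)" using qr by (simp add: field_simps)
          ultimately show ?thesis by (simp only:) simp
        qed
        also have "ennreal A' * (1 + ennreal (M n powr (r - q) / (r - q))) = ennreal (X n)"
          using A' qr by (simp add: X_def ennreal_mult' flip: ennreal_1 ennreal_plus)
        finally show ?thesis .
      qed
      moreover have "\<exists>K>0. \<forall>n\<ge>1. (X n + 1) powr (1 / r) \<le> K * s n"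
      proof -
        define B where "B = (A' * (1 + 1 / (r - q)) + 1) * C powr (r - q)"
        have B: "0 < B" unfolding B_def using A' qr C by (intro mult_pos_pos add_pos_pos) auto
        have "(X n + 1) powr (1 / r) \<le> B powr (1 / r) * s n" if n: "1 \<le> n" for n
        proof -
          have m: "1 \<le> M n powr (r - q)" using M1[OF n] qr by (intro ge_one_powr_ge_zero) auto
          have "X n + 1 = A' / (r - q) * M n powr (r - q) + (A' + 1) * 1" by (simp add: X_def algebra_simps)
          also have "\<dots> \<le> A' / (r - q) * M n powr (r - q) + (A' + 1) * M n powr (r - q)"
            using m A' by (intro add_left_mono mult_left_mono) auto
          also have "\<dots> = (A' * (1 + 1 / (r - q)) + 1) * M n powr (r - q)" by (simp add: algebra_simps)
          also have "M n powr (r - q) = C powr (r - q) * real n powr ((?d - \<gamma>) * (r - q))"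
            using C by (simp add: M_def powr_mult powr_powr)
          finally have "(X n + 1) powr (1 / r) \<le> (B * real n powr ((?d - \<gamma>) * (r - q))) powr (1 / r)"
            using r X[OF n] by (intro powr_mono2) (auto simp: B_def mult.assoc)
          also have "\<dots> = B powr (1 / r) * real n powr ((?d - \<gamma>) * (r - q) * (1 / r))"
            by (simp only: powr_mult powr_powr)
          \<comment> \<open>By \<open>(d - \<gamma>) * q = d\<close>, the definition of
            \<open>q\<close>.\<close>
          also have "(?d - \<gamma>) * (r - q) * (1 / r) = c0 - \<gamma>"
          proof -
            have "(?d - \<gamma>) * (r - q) * (1 / r) = (?d - \<gamma>) - (?d - \<gamma>) * q / r" using r by (simp add: field_simps)
            also have "(?d - \<gamma>) * q = ?d" using dq q by simp
            finally show ?thesis by (simp add: c0 algebra_simps)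
          qed
          finally show ?thesis using lt by (simp add: s_def)
        qed
        then show ?thesis using B by (intro exI[of _ "B powr (1 / r)"]) auto
      qed
      ultimately show ?thesis using X by blast
    qed
  qed
  then obtain X K where X: "\<And>n. 1 \<le> n \<Longrightarrow> 0 \<le> X n" and K: "0 < K" "\<And>n. 1 \<le> n \<Longrightarrow> (X n + 1) powr (1 / r) \<le> K * s n"
    and XH: "\<And>n (c :: int ^ 'd \<Rightarrow> complex). 1 \<le> n \<Longrightarrow> Lp_norm 1 (tpoly n c) \<le> 1 \<Longrightarrow> (\<integral>\<^sup>+x. ennreal (heat_int_real \<gamma> n c x powr r) \<partial>cube_measure) \<le> ennreal (X n)"
    by (metis One_nat_def)
  show thesis
  proof (rule that)
    show "0 < A * K" using A K by simp
    fix n :: nat and c :: "int ^ 'd \<Rightarrow> complex" assume n: "1 \<le> n" and c: "c 0 = 0"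
    have "Lp_norm (ereal r) (tpoly n (potential \<gamma> c)) \<le> A * K * s n * Lp_norm (ereal 1) (tpoly n c)"
    proof (rule upper_by_normalization[where c = c, OF _ _ n c])
      fix c :: "int ^ 'd \<Rightarrow> complex" assume c: "c 0 = 0" and L: "Lp_norm (ereal 1) (tpoly n c) \<le> 1"
      have "Lp_norm (ereal r) (tpoly n (potential \<gamma> c)) \<le> A * (X n + 1) powr (1 / r)"
        using L by (intro A(2) c X n XH) (simp_all add: one_ereal_def)
      also have "\<dots> \<le> A * (K * s n)" using A(1) by (intro mult_left_mono K(2) n) auto
      finally show "Lp_norm (ereal r) (tpoly n (potential \<gamma> c)) \<le> A * K * s n" by (simp add: mult.assoc)
    qed (use r in auto)
    then show "Lp_norm (ereal r) (tpoly n (potential \<gamma> c)) \<le> A * K * (if \<gamma> > c0 then 1 else if \<gamma> = c0 then ln (real n + 1) powr (1 / r)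
      else real n powr (c0 - \<gamma>)) * Lp_norm 1 (tpoly n c)"
      unfolding s_def by (simp only: one_ereal_def)
  qed
qed

text \<open>For \<open>p \<le> 1\<close> and \<open>\<gamma> > 0\<close> the rate is a product:
  \<open>n powr (d * (1 / p - 1))\<close> is the price of passing from L_p to L_1, and the other
  factor is the bound from L_1. For \<open>\<gamma> = 0\<close> Nikolskii's inequality applies
  directly.\<close>

lemma upper_bound:
  fixes p \<gamma> :: real and q :: ereal
  assumes p: "0 < p" and pq: "ereal p < q" and g: "0 \<le> \<gamma>"
  obtains C where "0 < C" "\<And>n (c :: int ^ 'd \<Rightarrow> complex). 1 \<le> n \<Longrightarrow> c 0 = 0 \<Longrightarrow>
    Lp_norm q (tpoly n (potential \<gamma> c)) \<le> C * sigma_lap CARD('d) p q \<gamma> (real n) * Lp_norm (ereal p) (tpoly n c)"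
proof (cases "p \<le> 1")
  case False
  then have p1: "1 < p" and p1': "1 \<le> p" by auto
  show thesis
  proof (cases q)
    case PInf
    have r0: "recip q = 0" by (simp add: PInf recip_def)
    consider "\<gamma> > CARD('d) / p" | "\<gamma> = CARD('d) / p" | "\<gamma> < CARD('d) / p" by linarith
    then show thesis
    proof cases
      case 1
      have "0 \<le> real CARD('d) / p" using p by simp
      then have g0: "0 < \<gamma>" using 1 by linarith
      obtain C where "0 < C" "\<And>n (c :: int ^ 'd \<Rightarrow> complex). 1 \<le> n \<Longrightarrow> c 0 = 0 \<Longrightarrow>
        Lp_norm \<infinity> (tpoly n (potential \<gamma> c)) \<le> C * (if \<gamma> > CARD('d) / p then 1 else if \<gamma> = CARD('d) / p then ln (real n + 1)
          else real n powr (CARD('d) / p - \<gamma>)) * Lp_norm (ereal p) (tpoly n c)"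
        using upper_infinity[OF p1' g0] by blast
      then show thesis using that[of C] False 1 by (simp add: PInf sigma_lap_def)
    next
      case 2
      obtain C where "0 < C" "\<And>n (c :: int ^ 'd \<Rightarrow> complex). 1 \<le> n \<Longrightarrow> c 0 = 0 \<Longrightarrow>
        Lp_norm \<infinity> (tpoly n (potential \<gamma> c)) \<le> C * ln (real n + 1) powr (1 - 1 / p) * Lp_norm (ereal p) (tpoly n c)"
        using upper_endpoint[OF p1 2] by blast
      then show thesis using that[of C] False 2 by (simp add: PInf sigma_lap_def)
    next
      case 3
      then have lt: "\<gamma> < real CARD('d) * (1 / p - recip q)" by (simp add: r0)
      obtain C where "0 < C" "\<And>n (c :: int ^ 'd \<Rightarrow> complex). 1 \<le> n \<Longrightarrow> c 0 = 0 \<Longrightarrow>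
        Lp_norm q (tpoly n (potential \<gamma> c)) \<le> C * real n powr (CARD('d) * (1 / p - recip q) - \<gamma>) * Lp_norm (ereal p) (tpoly n c)"
        using upper_subcritical[OF p1 pq g lt] by blast
      then show thesis using that[of C] False 3 by (simp add: PInf sigma_lap_def)
    qed
  next
    case (real r)
    then have pr: "p < r" using pq by simp
    have rr: "recip q = 1 / r" by (simp add: real recip_def)
    show thesis
    proof (cases "real CARD('d) * (1 / p - 1 / r) \<le> \<gamma>")
      case True
      obtain C where "0 < C" "\<And>n (c :: int ^ 'd \<Rightarrow> complex). 1 \<le> n \<Longrightarrow> c 0 = 0 \<Longrightarrow>
        Lp_norm (ereal r) (tpoly n (potential \<gamma> c)) \<le> C * Lp_norm (ereal p) (tpoly n c)"
        using upper_sobolev[OF p1 pr True] by blast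
      then show thesis using that[of C] False True rr[unfolded real] by (simp add: real sigma_lap_def)
    next
      case F: False
      then have lt: "\<gamma> < real CARD('d) * (1 / p - recip q)" by (simp add: rr)
      obtain C where "0 < C" "\<And>n (c :: int ^ 'd \<Rightarrow> complex). 1 \<le> n \<Longrightarrow> c 0 = 0 \<Longrightarrow>
        Lp_norm q (tpoly n (potential \<gamma> c)) \<le> C * real n powr (CARD('d) * (1 / p - recip q) - \<gamma>) * Lp_norm (ereal p) (tpoly n c)"
        using upper_subcritical[OF p1 pq g lt] by blast
      then show thesis using that[of C] False lt by (simp add: real sigma_lap_def not_le)
    qed
  qed (use pq in auto)
next
  case p1: True
  have q0: "0 < q" using p pq by (metis ereal_less(2) less_trans)
  show thesis
  proof (cases "\<gamma> = 0")
    case True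
    have nc: "\<not> real CARD('d) * max (1 - recip q) 0 < 0" by (simp add: not_less)
    obtain C where "0 < C"
      "\<And>n c. 1 \<le> n \<Longrightarrow> Lp_norm q (tpoly n c :: real ^ 'd \<Rightarrow> complex)
        \<le> C * real n powr (CARD('d) * (1 / p - recip q)) * Lp_norm (ereal p) (tpoly n c)"
      using nikolskii[OF p pq] by blast
    then show thesis using that[of C] nc p1 by (simp add: True sigma_lap_def potential_zero_exponent)
  next
    case False
    then have g0: "0 < \<gamma>" using g by simp
    define c0 where "c0 = real CARD('d) * max (1 - recip q) 0"
    define s where "s n = (if \<gamma> > c0 then 1 else if \<gamma> = c0 then ln (real n + 1) powr (1 / q1 q) else real n powr (c0 - \<gamma>))" for n
    have "\<exists>C>0. \<forall>n\<ge>1. \<forall>c :: int ^ 'd \<Rightarrow> complex. c 0 = 0 \<longrightarrow> Lp_norm q (tpoly n (potential \<gamma> c)) \<le> C * s n * Lp_norm 1 (tpoly n c)"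
    proof (cases q)
      case PInf
      obtain C where C: "0 < C" "\<And>n (c :: int ^ 'd \<Rightarrow> complex). 1 \<le> n \<Longrightarrow> c 0 = 0 \<Longrightarrow>
        Lp_norm \<infinity> (tpoly n (potential \<gamma> c)) \<le> C * (if \<gamma> > CARD('d) / 1 then 1 else if \<gamma> = CARD('d) / 1 then ln (real n + 1)
          else real n powr (CARD('d) / 1 - \<gamma>)) * Lp_norm (ereal 1) (tpoly n c)"
        using upper_infinity[OF order_refl g0] by blast
      have c0: "c0 = CARD('d)" by (simp add: c0_def PInf recip_def)
      have seq: "s n = (if \<gamma> > CARD('d) / 1 then 1 else if \<gamma> = CARD('d) / 1 then ln (real n + 1)
          else real n powr (CARD('d) / 1 - \<gamma>))" if "1 \<le> n" for n
        using ln_Suc_pos(1)[OF that] by (simp add: s_def c0 q1_def PInf)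
      show ?thesis
      proof (intro exI conjI allI impI)
        show "0 < C" by fact
        fix n :: nat and c :: "int ^ 'd \<Rightarrow> complex" assume n: "1 \<le> n" and c: "c 0 = 0"
        show "Lp_norm q (tpoly n (potential \<gamma> c)) \<le> C * s n * Lp_norm 1 (tpoly n c)"
          using C(2)[where c = c, OF n c] unfolding PInf seq[OF n] one_ereal_def .
      qed
    next
      case (real r)
      then have r: "0 < r" using q0 by simp
      obtain C where C: "0 < C" "\<And>n (c :: int ^ 'd \<Rightarrow> complex). 1 \<le> n \<Longrightarrow> c 0 = 0 \<Longrightarrow>
        Lp_norm (ereal r) (tpoly n (potential \<gamma> c)) \<le> C * (if \<gamma> > real CARD('d) * max (1 - 1 / r) 0 then 1
          else if \<gamma> = real CARD('d) * max (1 - 1 / r) 0 then ln (real n + 1) powr (1 / r)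
          else real n powr (real CARD('d) * max (1 - 1 / r) 0 - \<gamma>)) * Lp_norm 1 (tpoly n c)"
        using upper_from_L1[OF r g0] by blast
      have e: "c0 = real CARD('d) * max (1 - 1 / r) 0" "q1 q = r" by (simp_all add: c0_def real recip_def q1_def)
      note e = e(1) e(2)[unfolded real]
      show ?thesis
      proof (intro exI conjI allI impI)
        show "0 < C" by fact
        fix n :: nat and c :: "int ^ 'd \<Rightarrow> complex" assume n: "1 \<le> n" and c: "c 0 = 0"
        show "Lp_norm q (tpoly n (potential \<gamma> c)) \<le> C * s n * Lp_norm 1 (tpoly n c)"
          using C(2)[where c = c, OF n c] unfolding s_def e real .
      qed
    qed (use q0 in auto)
    then obtain C1 where C1: "0 < C1" "\<And>n (c :: int ^ 'd \<Rightarrow> complex). 1 \<le> n \<Longrightarrow> c 0 = 0 \<Longrightarrow>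
      Lp_norm q (tpoly n (potential \<gamma> c)) \<le> C1 * s n * Lp_norm 1 (tpoly n c)" by blast
    have "\<exists>C>0. \<forall>n\<ge>1. \<forall>c :: int ^ 'd \<Rightarrow> complex. Lp_norm 1 (tpoly n c) \<le> C * real n powr (CARD('d) * (1 / p - 1)) * Lp_norm (ereal p) (tpoly n c)"
    proof (cases "p = 1")
      case True
      then show ?thesis by (intro exI[of _ 1]) (simp add: one_ereal_def)
    next
      case False
      then have "ereal p < 1" using p1 by (simp add: one_ereal_def)
      from nikolskii[OF p this] obtain C where "0 < C"
        "\<And>n c. 1 \<le> n \<Longrightarrow> Lp_norm 1 (tpoly n c :: real ^ 'd \<Rightarrow> complex)
          \<le> C * real n powr (CARD('d) * (1 / p - recip 1)) * Lp_norm (ereal p) (tpoly n c)"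
        by blast
      moreover have "recip 1 = 1" by (simp add: recip_def one_ereal_def)
      ultimately show ?thesis by auto
    qed
    then obtain C2 where C2: "0 < C2" "\<And>n (c :: int ^ 'd \<Rightarrow> complex). 1 \<le> n \<Longrightarrow>
      Lp_norm 1 (tpoly n c) \<le> C2 * real n powr (CARD('d) * (1 / p - 1)) * Lp_norm (ereal p) (tpoly n c)" by blast
    show thesis
    proof (rule that)
      show "0 < C1 * C2" using C1 C2 by simp
      fix n :: nat and c :: "int ^ 'd \<Rightarrow> complex" assume n: "1 \<le> n" and c: "c 0 = 0"
      have s: "0 \<le> s n" by (simp add: s_def)
      \<comment> \<open>Below \<open>c0\<close> the factorization uses that \<open>c0\<close> is
        positive, so that the maximum in its definition is \<open>1 - recip q\<close>.\<close>
      have sig: "sigma_lap CARD('d) p q \<gamma> (real n) = real n powr (CARD('d) * (1 / p - 1)) * s n"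
      proof -
        consider "\<gamma> > c0" | "\<gamma> = c0" | "\<gamma> < c0" by linarith
        then show ?thesis
        proof cases
          case 3
          then have "0 < max (1 - recip q) 0" using g0 unfolding c0_def
            by (smt (verit) mult_nonneg_nonpos of_nat_0_le_iff)
          then have "max (1 - recip q) 0 = 1 - recip q" by (auto simp: max_def split: if_splits)
          then have c0: "c0 = CARD('d) * (1 - recip q)" by (simp add: c0_def)
          have "sigma_lap CARD('d) p q \<gamma> (real n) = real n powr (CARD('d) * (1 / p - recip q) - \<gamma>)"
            using 3 g0 p1 by (simp add: sigma_lap_def c0_def[symmetric] Let_def)
          also have "CARD('d) * (1 / p - recip q) - \<gamma> = CARD('d) * (1 / p - 1) + (c0 - \<gamma>)"
            by (simp add: c0 algebra_simps)
          finally show ?thesis using 3 by (simp add: s_def powr_add)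
        qed (use g0 p1 in \<open>simp_all add: sigma_lap_def c0_def[symmetric] Let_def s_def\<close>)
      qed
      have "Lp_norm q (tpoly n (potential \<gamma> c)) \<le> C1 * s n * Lp_norm 1 (tpoly n c)" using n c by (rule C1(2))
      also have "\<dots> \<le> C1 * s n * (C2 * real n powr (CARD('d) * (1 / p - 1)) * Lp_norm (ereal p) (tpoly n c))"
        using C1(1) s n by (intro mult_left_mono C2(2)) auto
      finally show "Lp_norm q (tpoly n (potential \<gamma> c)) \<le> C1 * C2 * sigma_lap CARD('d) p q \<gamma> (real n) * Lp_norm (ereal p) (tpoly n c)"
        unfolding sig by (simp add: mult_ac)
    qed
  qed
qed

subsection \<open>Lattice sums\<close>

lemma card_vec_PiE:
  "card ((\<lambda>f. \<chi> j. f j) ` PiE (UNIV :: 'd::finite set) A) = (\<Prod>j\<in>UNIV. card (A j))"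
  by (simp add: card_image inj_vec_lambda card_PiE)

lemma norm_real_vec_le:
  fixes k :: "int ^ 'd"
  assumes "\<And>j. \<bar>k $ j\<bar> \<le> K"
  shows "norm (real_vec k) \<le> real CARD('d) * real_of_int K"
proof -
  have "norm (real_vec k) \<le> (\<Sum>j\<in>UNIV. \<bar>real_vec k $ j\<bar>)" by (rule norm_le_l1_cart)
  also have "\<dots> \<le> (\<Sum>j\<in>(UNIV :: 'd set). real_of_int K)"
    by (intro sum_mono) (simp add: assms flip: of_int_abs)
  finally show ?thesis by simp
qed

text \<open>The positive points of the box with odd \<open>j0\<close>-coordinate make up at least
  half of \<open>(2 * I + 1) ^ d\<close>, and their norms do not exceed
  \<open>d * (2 * I + 1)\<close>. The parity is that of the frequencies occurring in the extremal
  polynomials.\<close>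

lemma lattice_sum_power:
  fixes j0 :: "'d::finite" and s :: real
  assumes s: "0 \<le> s"
  shows "real CARD('d) powr (- s) / 2 * real (2 * I + 1) powr (real CARD('d) - s)
    \<le> (\<Sum>k | odd (k $ j0) \<and> (\<forall>j. \<bar>k $ j\<bar> \<le> int (2 * I + 1)). norm (real_vec (k :: int ^ 'd)) powr (- s))"
proof -
  let ?d = "CARD('d)" and ?K = "2 * I + 1"
  define A where "A j = (if j = j0 then (\<lambda>i. 2 * int i + 1) ` {..I} else {1..int ?K})" for j
  define B where "B = (\<lambda>f. \<chi> j. f j) ` PiE (UNIV :: 'd set) A"
  have cA: "card (A j) = (if j = j0 then I + 1 else ?K)" for j
    by (simp add: A_def card_image inj_on_def nat_add_distrib nat_mult_distrib)
  have "card B = (\<Prod>j\<in>UNIV. card (A j))" unfolding B_def by (rule card_vec_PiE)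
  also have "\<dots> = (I + 1) * ?K ^ (?d - 1)"
    unfolding cA by (subst prod.remove[of _ j0]) (simp_all add: card_Diff_singleton)
  finally have cB: "real (card B) = real (I + 1) * real ?K ^ (?d - 1)" by (simp add: algebra_simps)
  let ?T = "{k :: int ^ 'd. odd (k $ j0) \<and> (\<forall>j. \<bar>k $ j\<bar> \<le> int ?K)}"
  have fT: "finite ?T" by (rule finite_subset[OF _ finite_freqs[of ?K]]) (auto simp: freqs_iff)
  have A1: "1 \<le> i \<and> i \<le> int ?K" if "i \<in> A j" for i j
    using that by (auto simp: A_def split: if_splits)
  have BT: "B \<subseteq> ?T"
  proof
    fix k assume "k \<in> B"
    then obtain f where f: "f \<in> PiE UNIV A" "k = (\<chi> j. f j)" by (auto simp: B_def)
    then have kA: "k $ j \<in> A j" for j by (auto simp: PiE_iff)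
    have "\<bar>k $ j\<bar> \<le> int ?K" for j using A1[OF kA[of j]] by simp
    moreover have "odd (k $ j0)" using kA[of j0] by (auto simp: A_def)
    ultimately show "k \<in> ?T" by simp
  qed
  have K0: "0 < real ?d * real ?K" by simp
  have gen: "a powr (- s) / 2 * b powr (D - s) = b powr D / 2 * (a * b) powr (- s)" for a b D :: real
    using powr_add[of b D "- s"] by (simp add: powr_mult)
  have "real ?d powr (- s) / 2 * real ?K powr (real ?d - s) = real ?K powr real ?d / 2 * (real ?d * real ?K) powr (- s)"
    by (rule gen)
  also have "real ?K powr real ?d = real ?K * real ?K ^ (?d - 1)"
    by (subst powr_realpow) (simp_all flip: power_Suc)
  also have "real ?K * real ?K ^ (?d - 1) / 2 * (real ?d * real ?K) powr (- s) \<le> real (card B) * (real ?d * real ?K) powr (- s)"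
    unfolding cB by (intro mult_right_mono) (auto simp: field_simps)
  also have "\<dots> = (\<Sum>k\<in>B. (real ?d * real ?K) powr (- s))" by simp
  also have "\<dots> \<le> (\<Sum>k\<in>B. norm (real_vec k) powr (- s))"
  proof (intro sum_mono)
    fix k assume "k \<in> B"
    then have k: "odd (k $ j0)" "\<And>j. \<bar>k $ j\<bar> \<le> int ?K" using BT by auto
    then have "k \<noteq> 0" by auto
    then have "0 < norm (real_vec k)" by simp
    moreover have "norm (real_vec k) \<le> real ?d * real ?K" using norm_real_vec_le[OF k(2)] by simp
    ultimately show "(real ?d * real ?K) powr (- s) \<le> norm (real_vec k) powr (- s)"
      using s by (intro powr_mono2') auto
  qed
  also have "\<dots> \<le> (\<Sum>k\<in>?T. norm (real_vec k) powr (- s))"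
    by (intro sum_mono2 fT BT) auto
  finally show ?thesis .
qed

text \<open>Points are sorted by the value \<open>2 * i + 1\<close> of the odd coordinate, the
  others being positive and at most that large: layer \<open>i\<close> has
  \<open>(2 * i + 1) ^ (d - 1)\<close> points of norm at most \<open>d * (2 * i + 1)\<close>, so it
  contributes a multiple of \<open>1 / (i + 1)\<close>, and the layers add up to a harmonic
  sum.\<close>

lemma lattice_sum_log:
  fixes j0 :: "'d::finite"
  shows "real CARD('d) powr (- real CARD('d)) / 2 * ln (real I + 2)
    \<le> (\<Sum>k | odd (k $ j0) \<and> (\<forall>j. \<bar>k $ j\<bar> \<le> int (2 * I + 1)). norm (real_vec (k :: int ^ 'd)) powr (- real CARD('d)))"
proof -
  let ?d = "CARD('d)" and ?K = "2 * I + 1"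
  let ?T = "{k :: int ^ 'd. odd (k $ j0) \<and> (\<forall>j. \<bar>k $ j\<bar> \<le> int ?K)}"
  have fT: "finite ?T" by (rule finite_subset[OF _ finite_freqs[of ?K]]) (auto simp: freqs_iff)
  define A where "A i j = (if j = j0 then {2 * int i + 1} else {1..2 * int i + 1})" for i :: nat and j
  define B where "B i = (\<lambda>f. \<chi> j. f j) ` PiE (UNIV :: 'd set) (A i)" for i
  have kA: "k $ j \<in> A i j" if "k \<in> B i" for k i j
    using that by (auto simp: B_def PiE_iff)
  have kA': "\<bar>k $ j\<bar> \<le> 2 * int i + 1" if "k \<in> B i" for k i j
    using kA[OF that, of j] by (auto simp: A_def split: if_splits)
  have k0: "k $ j0 = 2 * int i + 1" if "k \<in> B i" for k i
    using kA[OF that, of j0] by (simp add: A_def)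
  have BT: "B i \<subseteq> ?T" if "i \<le> I" for i
  proof
    fix k assume k: "k \<in> B i"
    have "\<bar>k $ j\<bar> \<le> int ?K" for j using kA'[OF k, of j] that by linarith
    then show "k \<in> ?T" using k0[OF k] by simp
  qed
  have fB: "finite (B i)" if "i \<le> I" for i using BT[OF that] fT by (rule finite_subset)
  have cB: "real (card (B i)) = (2 * real i + 1) ^ (?d - 1)" for i
  proof -
    have "card (B i) = (\<Prod>j\<in>UNIV. card (A i j))" unfolding B_def by (rule card_vec_PiE)
    also have "\<dots> = (\<Prod>j\<in>UNIV - {j0}. card (A i j))"
      by (subst prod.remove[of _ j0]) (simp_all add: A_def)
    also have "\<dots> = (\<Prod>j\<in>UNIV - {j0}. 2 * i + 1)" by (intro prod.cong) (auto simp: A_def)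
    also have "\<dots> = (2 * i + 1) ^ (?d - 1)" by (simp add: card_Diff_singleton)
    finally show ?thesis by (simp add: add.commute)
  qed
  have layer: "real ?d powr (- real ?d) / 2 * (1 / real (Suc i)) \<le> (\<Sum>k\<in>B i. norm (real_vec k) powr (- real ?d))"
    if i: "i \<le> I" for i
  proof -
    let ?k = "2 * real i + 1"
    have k: "0 < ?k" by simp
    have d1: "0 < ?d" by simp
    have e: "?k * ?k ^ (?d - 1) = ?k ^ ?d" using d1 by (metis Suc_pred' power_Suc)
    have "(real ?d * ?k) powr (- real ?d) = real ?d powr (- real ?d) * ?k powr (- real ?d)" by (rule powr_mult)
    also have "?k powr (- real ?d) = 1 / ?k ^ ?d" using k by (simp add: powr_minus powr_realpow field_simps)
    finally have e2: "?k ^ (?d - 1) * (real ?d * ?k) powr (- real ?d) = real ?d powr (- real ?d) * (1 / ?k)"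
      using k by (simp add: e[symmetric])
    have "real ?d powr (- real ?d) / 2 * (1 / real (Suc i)) = real ?d powr (- real ?d) * (1 / (2 * real i + 2))"
      by (simp add: field_simps)
    also have "\<dots> \<le> real ?d powr (- real ?d) * (1 / ?k)" by (intro mult_left_mono divide_left_mono) auto
    also have "\<dots> = (\<Sum>k\<in>B i. (real ?d * ?k) powr (- real ?d))" by (simp only: sum_constant cB e2)
    also have "\<dots> \<le> (\<Sum>k\<in>B i. norm (real_vec k) powr (- real ?d))"
    proof (intro sum_mono)
      fix k assume k: "k \<in> B i"
      then have "k \<noteq> 0" using k0[OF k] by auto
      then have "0 < norm (real_vec k)" by simp
      moreover have "norm (real_vec k) \<le> real ?d * ?k" using norm_real_vec_le[OF kA'[OF k]] by simp
      ultimately show "(real ?d * ?k) powr (- real ?d) \<le> norm (real_vec k) powr (- real ?d)"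
        by (intro powr_mono2') auto
    qed
    finally show ?thesis .
  qed
  have "ln (real I + 2) \<le> harm (Suc I)" using ln_le_harm[of "Suc I"] by (simp add: add.commute)
  also have "harm (Suc I) = (\<Sum>i\<le>I. 1 / real (Suc i))"
    by (induction I) (simp_all add: harm_Suc harm_def divide_inverse del: of_nat_Suc)
  finally have "real ?d powr (- real ?d) / 2 * ln (real I + 2) \<le> real ?d powr (- real ?d) / 2 * (\<Sum>i\<le>I. 1 / real (Suc i))"
    by (intro mult_left_mono) auto
  also have "\<dots> = (\<Sum>i\<le>I. real ?d powr (- real ?d) / 2 * (1 / real (Suc i)))" by (rule sum_distrib_left)
  also have "\<dots> \<le> (\<Sum>i\<le>I. \<Sum>k\<in>B i. norm (real_vec k) powr (- real ?d))" by (intro sum_mono layer) simp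
  also have "\<dots> = (\<Sum>k\<in>(\<Union>i\<in>{..I}. B i). norm (real_vec k) powr (- real ?d))"
  proof (rule sum.UNION_disjoint[symmetric])
    show "\<forall>i\<in>{..I}. \<forall>j\<in>{..I}. i \<noteq> j \<longrightarrow> B i \<inter> B j = {}"
    proof (intro ballI impI)
      fix i j :: nat assume "i \<noteq> j"
      then have "k \<notin> B j" if "k \<in> B i" for k using k0[OF that] k0[of k j] by auto
      then show "B i \<inter> B j = {}" by blast
    qed
  qed (use fB in auto)
  also have "\<dots> \<le> (\<Sum>k\<in>?T. norm (real_vec k) powr (- real ?d))"
    by (intro sum_mono2 fT) (use BT in auto)
  finally show ?thesis .
qed

subsection \<open>Powers of the Fejer kernel\<close>

text \<open>The one-sided sum differs from the symmetric kernel by a phase, which the modulus in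
  \<open>fejer\<close> removes.\<close>

definition dirichlet :: "nat \<Rightarrow> real \<Rightarrow> complex" where
  "dirichlet m y = (\<Sum>a<m. exp (\<i> * complex_of_real (real a * y)))"

definition fejer :: "nat \<Rightarrow> real \<Rightarrow> real" where
  "fejer m y = (norm (dirichlet m y))\<^sup>2 / real m"

text \<open>The Fourier coefficients of \<open>fejer m y ^ r\<close>.\<close>

primrec fcoef :: "nat \<Rightarrow> nat \<Rightarrow> int \<Rightarrow> real" where
  "fcoef m 0 k = (if k = 0 then 1 else 0)"
| "fcoef m (Suc r) k = (\<Sum>a<m. \<Sum>b<m. fcoef m r (k - int a + int b)) / real m"

lemma fejer_nonneg: "0 \<le> fejer m y"
  by (simp add: fejer_def)

lemma borel_measurable_fejer [measurable]: "fejer m \<in> borel_measurable borel"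
  unfolding fejer_def dirichlet_def by measurable

lemma fcoef_nonneg: "0 \<le> fcoef m r k"
  by (induction r arbitrary: k) (auto intro!: divide_nonneg_nonneg sum_nonneg)

text \<open>The index set is left arbitrary because the induction step shifts it by
  \<open>a - b\<close>; each further power widens the frequency range by at most
  \<open>m\<close>.\<close>

lemma fejer_power_expansion:
  assumes "finite K" "{- int (r * m)..int (r * m)} \<subseteq> K"
  shows "complex_of_real (fejer m y ^ r) = (\<Sum>k\<in>K. complex_of_real (fcoef m r k) * exp (\<i> * complex_of_real (real_of_int k * y)))"
  using assms
proof (induction r arbitrary: K)
  case 0
  then have "(\<Sum>k\<in>K. complex_of_real (fcoef m 0 k) * exp (\<i> * complex_of_real (real_of_int k * y)))
    = (\<Sum>k\<in>{0}. complex_of_real (fcoef m 0 k) * exp (\<i> * complex_of_real (real_of_int k * y)))"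
    by (intro sum.mono_neutral_right) auto
  then show ?case by simp
next
  case (Suc r)
  let ?e = "\<lambda>k :: int. exp (\<i> * complex_of_real (real_of_int k * y))"
  have shift: "(\<Sum>k\<in>K. complex_of_real (fcoef m r (k - int a + int b)) * ?e k) = ?e (int a - int b) * complex_of_real (fejer m y ^ r)"
    if ab: "a < m" "b < m" for a b
  proof -
    let ?g = "\<lambda>k :: int. k - int a + int b"
    have inj: "inj_on ?g K" by (auto simp: inj_on_def)
    have sub: "{- int (r * m)..int (r * m)} \<subseteq> ?g ` K"
    proof
      fix l assume l: "l \<in> {- int (r * m)..int (r * m)}"
      have "l + int a - int b \<in> K"
        using l ab Suc.prems(2) by (intro subsetD[OF Suc.prems(2)]) (auto simp: algebra_simps)
      then show "l \<in> ?g ` K" by (intro image_eqI[of _ _ "l + int a - int b"]) auto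
    qed
    have "(\<Sum>k\<in>K. complex_of_real (fcoef m r (?g k)) * ?e k)
      = (\<Sum>k\<in>K. ?e (int a - int b) * (complex_of_real (fcoef m r (?g k)) * ?e (?g k)))"
      by (intro sum.cong refl) (simp add: exp_add[symmetric] algebra_simps)
    also have "\<dots> = ?e (int a - int b) * (\<Sum>l\<in>?g ` K. complex_of_real (fcoef m r l) * ?e l)"
      by (simp add: sum.reindex[OF inj] sum_distrib_left)
    also have "(\<Sum>l\<in>?g ` K. complex_of_real (fcoef m r l) * ?e l) = complex_of_real (fejer m y ^ r)"
      using Suc.prems(1) sub by (intro Suc.IH[symmetric]) auto
    finally show ?thesis .
  qed
  have D: "complex_of_real ((norm (dirichlet m y))\<^sup>2) = (\<Sum>a<m. \<Sum>b<m. ?e (int a - int b))"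
  proof -
    have "complex_of_real ((norm (dirichlet m y))\<^sup>2) = dirichlet m y * cnj (dirichlet m y)"
      by (rule complex_norm_square)
    also have "\<dots> = (\<Sum>a<m. \<Sum>b<m. ?e (int a - int b))"
      by (simp add: dirichlet_def sum_product exp_cnj exp_add[symmetric] algebra_simps)
    finally show ?thesis .
  qed
  have "(\<Sum>k\<in>K. complex_of_real (fcoef m (Suc r) k) * ?e k)
    = (\<Sum>k\<in>K. \<Sum>a<m. \<Sum>b<m. complex_of_real (fcoef m r (k - int a + int b)) * ?e k) / complex_of_real (real m)"
    by (simp add: sum_divide_distrib sum_distrib_right)
  also have "(\<Sum>k\<in>K. \<Sum>a<m. \<Sum>b<m. complex_of_real (fcoef m r (k - int a + int b)) * ?e k)
    = (\<Sum>a<m. \<Sum>k\<in>K. \<Sum>b<m. complex_of_real (fcoef m r (k - int a + int b)) * ?e k)"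
    by (rule sum.swap)
  also have "\<dots> = (\<Sum>a<m. \<Sum>b<m. \<Sum>k\<in>K. complex_of_real (fcoef m r (k - int a + int b)) * ?e k)"
    by (intro sum.cong refl sum.swap)
  also have "\<dots> = (\<Sum>a<m. \<Sum>b<m. ?e (int a - int b) * complex_of_real (fejer m y ^ r))"
    by (intro sum.cong refl shift) auto
  also have "\<dots> = complex_of_real ((norm (dirichlet m y))\<^sup>2) * complex_of_real (fejer m y ^ r)"
    by (simp only: D sum_distrib_right)
  finally show ?case
    by (simp add: fejer_def)
qed

text \<open>Each further Fejer factor averages the old coefficients over \<open>m * m\<close>
  shifts, divided by \<open>m\<close>. Halving the window keeps a fixed proportion of the shifts
  inside the old one, so the order grows by the factor \<open>m\<close>. For the first power the
  coefficients are triangular, at least 1/2 on the half window.\<close>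

lemma fcoef_lower:
  "\<exists>\<kappa> c. 0 < \<kappa> \<and> \<kappa> \<le> 1 / 2 \<and> 0 < c \<and> (\<forall>m\<ge>1. \<forall>k. real_of_int \<bar>k\<bar> \<le> \<kappa> * real m \<longrightarrow> c * real m ^ r \<le> fcoef m (Suc r) k)"
proof (induction r)
  case 0
  have "1 / 2 * real m ^ 0 \<le> fcoef m (Suc 0) k" if m: "1 \<le> m" and k: "real_of_int \<bar>k\<bar> \<le> 1 / 2 * real m" for m k
  proof -
    let ?P = "{a \<in> {..<m}. 0 \<le> int a - k \<and> int a - k < int m}"
    have inner: "(\<Sum>b<m. fcoef m 0 (k - int a + int b)) = (if 0 \<le> int a - k \<and> int a - k < int m then 1 else 0)" for a
    proof -
      have "(\<Sum>b<m. fcoef m 0 (k - int a + int b)) = (\<Sum>b<m. if int b = int a - k then 1 else 0)"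
        by (intro sum.cong) auto
      also have "\<dots> = real (card {b \<in> {..<m}. int b = int a - k})"
        by (simp add: sum.If_cases Int_def conj_commute)
      also have "{b \<in> {..<m}. int b = int a - k} = (if 0 \<le> int a - k \<and> int a - k < int m then {nat (int a - k)} else {})"
        by auto
      finally show ?thesis by simp
    qed
    have "real m - real_of_int \<bar>k\<bar> \<le> real (card ?P)"
    proof (cases "0 \<le> k")
      case True
      have "{nat k..<m} \<subseteq> ?P" using True by auto
      then have "card {nat k..<m} \<le> card ?P" by (intro card_mono) auto
      then show ?thesis using True by simp
    next
      case False
      have "{..<m - nat (- k)} \<subseteq> ?P" using False by auto
      then have "card {..<m - nat (- k)} \<le> card ?P" by (intro card_mono) auto
      then show ?thesis using False by simp
    qed
    then have "real m / 2 \<le> real (card ?P)" using k by simp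
    moreover have "fcoef m (Suc 0) k = real (card ?P) / real m"
      unfolding fcoef.simps(2) inner by (simp add: sum.If_cases Int_def conj_commute)
    ultimately show ?thesis using m by (simp add: field_simps)
  qed
  then show ?case by (intro exI[of _ "1 / 2"]) auto
next
  case (Suc r)
  then obtain \<kappa> c where \<kappa>: "0 < \<kappa>" "\<kappa> \<le> 1 / 2" and c: "0 < c"
    and IH: "\<And>m k. 1 \<le> m \<Longrightarrow> real_of_int \<bar>k\<bar> \<le> \<kappa> * real m \<Longrightarrow> c * real m ^ r \<le> fcoef m (Suc r) k" by blast
  have "c * \<kappa> / 2 * real m ^ Suc r \<le> fcoef m (Suc (Suc r)) k"
    if m: "1 \<le> m" and k: "real_of_int \<bar>k\<bar> \<le> \<kappa> / 2 * real m" for m k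
  proof -
    \<comment> \<open>The number of \<open>b\<close> kept for each \<open>a\<close>: differences up
      to \<open>L - 1\<close> move \<open>k\<close> by at most \<open>\<kappa> * m / 2\<close>, so
      that it stays in the window of the induction hypothesis.\<close>
    define L where "L = nat \<lfloor>\<kappa> * real m / 2\<rfloor> + 1"
    have x0: "0 \<le> \<kappa> * real m / 2" using \<kappa> by simp
    have L1: "real L - 1 \<le> \<kappa> * real m / 2" "\<kappa> * real m / 2 \<le> real L" "1 \<le> L"
      using x0 by (auto simp: L_def) linarith+
    have "\<kappa> * real m \<le> 1 / 2 * real m" using \<kappa> by (intro mult_right_mono) auto
    then have Lm: "2 * L \<le> m + 2" using L1(1) by linarith
    have row: "real L * (c * real m ^ r) \<le> (\<Sum>b<m. fcoef m (Suc r) (k - int a + int b))" if a: "a < m" for a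
    proof -
      \<comment> \<open>\<open>L\<close> consecutive indices ending or starting at \<open>a\<close>,
        whichever stays in range; \<open>2 * L \<le> m + 2\<close> guarantees that one of them
        does.\<close>
      define J where "J = (if L \<le> a + 1 then {a + 1 - L..a} else {a..a + L - 1})"
      have J: "card J = L" "J \<subseteq> {..<m}" using a Lm L1(3) by (auto simp: J_def)
      have near: "\<bar>int b - int a\<bar> \<le> int L - 1" if "b \<in> J" for b
        using that L1(3) by (auto simp: J_def split: if_splits)
      have "real L * (c * real m ^ r) = (\<Sum>b\<in>J. c * real m ^ r)" by (simp add: J)
      also have "\<dots> \<le> (\<Sum>b\<in>J. fcoef m (Suc r) (k - int a + int b))"
      proof (intro sum_mono IH m)
        fix b assume "b \<in> J"
        have "\<bar>k - int a + int b\<bar> \<le> \<bar>k\<bar> + (int L - 1)" using near[OF \<open>b \<in> J\<close>] by linarith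
        then have "real_of_int \<bar>k - int a + int b\<bar> \<le> real_of_int (\<bar>k\<bar> + (int L - 1))" by (simp only: of_int_le_iff)
        also have "\<dots> = real_of_int \<bar>k\<bar> + (real L - 1)" by simp
        also have "\<dots> \<le> \<kappa> / 2 * real m + \<kappa> * real m / 2" using k L1(1) by linarith
        finally show "real_of_int \<bar>k - int a + int b\<bar> \<le> \<kappa> * real m" by simp
      qed
      also have "\<dots> \<le> (\<Sum>b<m. fcoef m (Suc r) (k - int a + int b))"
        by (intro sum_mono2 J fcoef_nonneg) auto
      finally show ?thesis .
    qed
    have "c * \<kappa> / 2 * real m ^ Suc r = \<kappa> * real m / 2 * (c * real m ^ r)" by simp
    also have "\<dots> \<le> real L * (c * real m ^ r)" using L1(2) c by (intro mult_right_mono) auto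
    also have "\<dots> = (\<Sum>a<m. real L * (c * real m ^ r)) / real m" using m by simp
    also have "\<dots> \<le> (\<Sum>a<m. \<Sum>b<m. fcoef m (Suc r) (k - int a + int b)) / real m"
      by (intro divide_right_mono sum_mono row) auto
    finally show ?thesis by (simp only: fcoef.simps(2))
  qed
  then show ?case using \<kappa> c by (intro exI[of _ "\<kappa> / 2"] exI[of _ "c * \<kappa> / 2"]) auto
qed

lemma norm_dirichlet_le: "norm (dirichlet m y) \<le> real m"
  unfolding dirichlet_def by (rule order_trans[OF norm_sum]) simp

lemma fejer_le: "fejer m y \<le> real m"
proof (cases "m = 0")
  case False
  have "(norm (dirichlet m y))\<^sup>2 \<le> (real m)\<^sup>2" by (intro power_mono norm_dirichlet_le) simp
  then show ?thesis using False by (simp add: fejer_def power2_eq_square field_simps)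
qed (simp add: fejer_def)

text \<open>From \<open>sin x \<ge> x - x ^ 3 / 6\<close> and \<open>x * x \<le> 3\<close>, the
  latter because \<open>x\<close> is at most 1.6.\<close>

lemma sin_ge_half:
  assumes "0 \<le> x" "x \<le> pi / 2"
  shows "x / 2 \<le> sin x"
proof -
  have "\<bar>sin x - (\<Sum>m<3. sin_coeff m * x ^ m)\<bar> \<le> inverse (fact 3) * \<bar>x\<bar> ^ 3"
    by (rule Maclaurin_sin_bound)
  moreover have "(\<Sum>m<3. sin_coeff m * x ^ m) = x" by (simp add: numeral_3_eq_3 sin_coeff_def)
  ultimately have "\<bar>sin x - x\<bar> \<le> x ^ 3 / 6" using assms by (simp add: fact_numeral field_simps)
  then have *: "x - x ^ 3 / 6 \<le> sin x" by linarith
  have "x \<le> 1.6" using assms pi_less_4 pi_approx by simp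
  then have "x * x \<le> 1.6 * 1.6" using assms by (intro mult_mono) auto
  then have "x * (x * x) \<le> x * 3" using assms by (intro mult_left_mono) auto
  then show ?thesis using * by (simp add: power3_eq_cube)
qed

text \<open>A geometric sum whose numerator has modulus at most 2 and whose denominator has modulus
  \<open>2 * |sin (y / 2)|\<close>, at least \<open>y / 2\<close>.\<close>

lemma norm_dirichlet_decay:
  assumes y: "0 < y" "y \<le> pi"
  shows "norm (dirichlet m y) \<le> 4 / y"
proof -
  let ?z = "exp (\<i> * complex_of_real y)"
  have D: "dirichlet m y = (\<Sum>a<m. ?z ^ a)"
    unfolding dirichlet_def by (intro sum.cong refl) (simp add: exp_of_nat_mult[symmetric] mult_ac)
  have "(1 - ?z) * dirichlet m y = 1 - ?z ^ m"
    unfolding D by (rule one_diff_power_eq[symmetric])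
  then have "norm (1 - ?z) * norm (dirichlet m y) = norm (1 - ?z ^ m)"
    by (metis norm_mult)
  also have "\<dots> \<le> 2" using norm_triangle_ineq4[of 1 "?z ^ m"] by (simp add: norm_power)
  finally have le: "norm (1 - ?z) * norm (dirichlet m y) \<le> 2" .
  have "norm (1 - ?z) = 2 * \<bar>sin (y / 2)\<bar>"
  proof -
    have "norm (1 - ?z) = norm (?z - 1)" by (rule norm_minus_commute)
    also have "\<dots> = 2 * \<bar>sin (y / 2)\<bar>" by (rule dist_exp_i_1)
    finally show ?thesis .
  qed
  moreover have "y / 2 / 2 \<le> sin (y / 2)" using y by (intro sin_ge_half) auto
  ultimately have "y / 2 \<le> norm (1 - ?z)" by linarith
  then have "y / 2 * norm (dirichlet m y) \<le> norm (1 - ?z) * norm (dirichlet m y)"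
    by (intro mult_right_mono) auto
  with le have "y / 2 * norm (dirichlet m y) \<le> 2" by linarith
  then show ?thesis using y by (simp add: field_simps)
qed

lemma fejer_decay:
  assumes y: "0 < y" "y \<le> pi"
  shows "fejer m y \<le> 16 / (real m * y\<^sup>2)"
proof (cases "m = 0")
  case False
  have "(norm (dirichlet m y))\<^sup>2 \<le> (4 / y)\<^sup>2" using y by (intro power_mono norm_dirichlet_decay) auto
  then show ?thesis using False y by (simp add: fejer_def power_divide field_simps)
qed (simp add: fejer_def)

lemma fejer_reflect: "fejer m (2 * pi - y) = fejer m y"
proof -
  have "exp (\<i> * complex_of_real (real a * (2 * pi - y))) = cnj (exp (\<i> * complex_of_real (real a * y)))" for a
  proof -
    have "\<i> * complex_of_real (real a * (2 * pi - y)) = (2 * of_int (int a) * of_real pi) * \<i> + (- (\<i> * complex_of_real (real a * y)))"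
      by (simp add: algebra_simps)
    then have "exp (\<i> * complex_of_real (real a * (2 * pi - y))) = exp ((2 * of_int (int a) * of_real pi) * \<i>) * exp (- (\<i> * complex_of_real (real a * y)))"
      by (simp only: exp_add)
    also have "exp ((2 * of_int (int a) * of_real pi) * \<i>) = 1" using exp_integer_2pi[of "of_int (int a)"] by simp
    finally show ?thesis by (simp add: exp_cnj)
  qed
  then have "dirichlet m (2 * pi - y) = cnj (dirichlet m y)" by (simp add: dirichlet_def)
  then show ?thesis by (simp add: fejer_def)
qed

text \<open>The kernel is at most \<open>m\<close> up to distance \<open>1 / m\<close> and at most
  \<open>16 / (m * y\<^sup>2)\<close> beyond: \<open>s > 1/2\<close> makes the tail integrable, and
  both parts are of order \<open>m powr (s - 1)\<close>. The half of the interval beyond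
  \<open>pi\<close> is reflected.\<close>

lemma nn_integral_fejer_powr:
  assumes s: "1 / 2 < s"
  obtains C where "0 < C" "\<And>m. 1 \<le> m \<Longrightarrow>
    (\<integral>\<^sup>+y. ennreal (fejer m y powr s) * indicator {0..<2 * pi} y \<partial>lborel) \<le> ennreal (C * real m powr (s - 1))"
proof -
  define a where "a = 2 * s - 1"
  have a: "0 < a" using s by (simp add: a_def)
  define C where "C = 2 * (1 + 16 powr s / a)"
  have C: "0 < C" using a by (simp add: C_def add_pos_nonneg)
  show thesis
  proof (rule that[OF C])
    fix m :: nat assume m: "1 \<le> m"
    define G where "G y = indicator {0<..1 / real m} y * real m powr s
        + (16 / real m) powr s * (indicator {1 / real m<..} y * y powr (- a - 1))" for y
    have G0: "0 \<le> G y" for y by (simp add: G_def)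
    have [measurable]: "G \<in> borel_measurable borel" unfolding G_def by measurable
    have half: "fejer m y powr s \<le> G y" if y: "0 < y" "y \<le> pi" for y
    proof (cases "y \<le> 1 / real m")
      case True
      have "fejer m y powr s \<le> real m powr s" using s by (intro powr_mono2 fejer_nonneg fejer_le) auto
      then show ?thesis using True y by (simp add: G_def indicator_def)
    next
      case False
      have "fejer m y powr s \<le> (16 / (real m * y\<^sup>2)) powr s"
        using s y by (intro powr_mono2 fejer_nonneg fejer_decay) auto
      also have "16 / (real m * y\<^sup>2) = 16 / real m * (y powr (- 2))"
        using y by (simp add: powr_minus field_simps powr_numeral)
      also have "(16 / real m * (y powr (- 2))) powr s = (16 / real m) powr s * y powr (- a - 1)"
        unfolding powr_mult powr_powr by (simp add: a_def)
      finally show ?thesis using False by (simp add: G_def indicator_def)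
    qed
    have iG: "(\<integral>\<^sup>+y. ennreal (G y) \<partial>lborel) = ennreal ((1 + 16 powr s / a) * real m powr (s - 1))"
    proof -
      have m0: "0 < 1 / real m" using m by simp
      have "(\<integral>\<^sup>+y. ennreal (G y) \<partial>lborel) = (\<integral>\<^sup>+y. ennreal (real m powr s) * indicator {0<..1 / real m} y
        + ennreal ((16 / real m) powr s) * ennreal (indicator {1 / real m<..} y * y powr (- a - 1)) \<partial>lborel)"
        by (intro nn_integral_cong) (auto simp: G_def indicator_def ennreal_mult')
      also have "\<dots> = ennreal (real m powr s) * ennreal (1 / real m) + ennreal ((16 / real m) powr s) * ennreal ((1 / real m) powr (- a) / a)"
        using m0 a
        by (subst nn_integral_add, measurable, subst nn_integral_cmult, measurable, subst nn_integral_indicator, measurable,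
            subst nn_integral_cmult, measurable, subst nn_integral_powr_to_infinity) simp_all
      also have "ennreal (real m powr s) * ennreal (1 / real m) = ennreal (real m powr (s - 1))"
        using m by (subst ennreal_mult'[symmetric]) (auto simp: powr_diff)
      also have "ennreal ((16 / real m) powr s) * ennreal ((1 / real m) powr (- a) / a) = ennreal (16 powr s / a * real m powr (s - 1))"
      proof -
        have "(1 / real m) powr (- a) = real m powr a" using m by (simp add: powr_divide powr_minus field_simps)
        moreover have "(16 / real m) powr s = 16 powr s * real m powr (- s)" using m by (simp add: powr_divide powr_minus field_simps)
        moreover have "real m powr (- s) * real m powr a = real m powr (s - 1)" by (simp add: a_def powr_add[symmetric])
        ultimately have q: "(16 / real m) powr s * ((1 / real m) powr (- a) / a) = 16 powr s / a * real m powr (s - 1)" by simp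
        show ?thesis by (simp only: ennreal_mult'[OF powr_ge_zero, symmetric] q)
      qed
      also have "ennreal (real m powr (s - 1)) + ennreal (16 powr s / a * real m powr (s - 1)) = ennreal ((1 + 16 powr s / a) * real m powr (s - 1))"
        using a by (subst ennreal_plus[symmetric]) (auto simp: distrib_right)
      finally show ?thesis .
    qed
    have iG': "(\<integral>\<^sup>+y. ennreal (G (2 * pi - y)) \<partial>lborel) = (\<integral>\<^sup>+y. ennreal (G y) \<partial>lborel)"
      using nn_integral_real_affine[of "\<lambda>y. ennreal (G y)" "- 1" "2 * pi"] by simp
    have "(\<integral>\<^sup>+y. ennreal (fejer m y powr s) * indicator {0..<2 * pi} y \<partial>lborel)
      \<le> (\<integral>\<^sup>+y. ennreal (G y) + ennreal (G (2 * pi - y)) \<partial>lborel)"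
    proof (rule nn_integral_mono_AE, use AE_lborel_singleton[of "0 :: real"] in eventually_elim)
      fix y :: real assume y0: "y \<noteq> 0"
      show "ennreal (fejer m y powr s) * indicator {0..<2 * pi} y \<le> ennreal (G y) + ennreal (G (2 * pi - y))"
      proof (cases "y \<in> {0..<2 * pi}")
        case y: True
        show ?thesis
        proof (cases "y \<le> pi")
          case True
          then have "fejer m y powr s \<le> G y" using y y0 by (intro half) auto
          then have "ennreal (fejer m y powr s) \<le> ennreal (G y)" by (rule ennreal_leI)
          then show ?thesis using y by (simp add: add_increasing2)
        next
          case False
          then have "fejer m (2 * pi - y) powr s \<le> G (2 * pi - y)" using y by (intro half) auto
          then have "ennreal (fejer m y powr s) \<le> ennreal (G (2 * pi - y))" unfolding fejer_reflect by (rule ennreal_leI)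
          then show ?thesis using y by (simp add: add_increasing)
        qed
      qed simp
    qed
    also have "\<dots> = (\<integral>\<^sup>+y. ennreal (G y) \<partial>lborel) + (\<integral>\<^sup>+y. ennreal (G (2 * pi - y)) \<partial>lborel)"
      by (rule nn_integral_add) measurable
    also have "\<dots> = ennreal ((1 + 16 powr s / a) * real m powr (s - 1)) + ennreal ((1 + 16 powr s / a) * real m powr (s - 1))"
      by (simp only: iG iG')
    also have "\<dots> = ennreal (C * real m powr (s - 1))"
    proof -
      have "0 \<le> (1 + 16 powr s / a) * real m powr (s - 1)" using a by (intro mult_nonneg_nonneg add_nonneg_nonneg) auto
      then show ?thesis by (subst ennreal_plus[symmetric]) (simp_all add: C_def algebra_simps)
    qed
    finally show "(\<integral>\<^sup>+y. ennreal (fejer m y powr s) * indicator {0..<2 * pi} y \<partial>lborel) \<le> ennreal (C * real m powr (s - 1))" .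
  qed
qed

text \<open>The coefficients of the product over all coordinates of
  \<open>fejer m ^ Suc r / m ^ r\<close>: this normalization gives a peak of height
  \<open>m ^ d\<close>, coefficients of order 1 at low frequencies and, by \<open>pint_vcoef\<close>
  for \<open>p = 1\<close>, bounded mass.\<close>

definition vcoef :: "nat \<Rightarrow> nat \<Rightarrow> int ^ 'd \<Rightarrow> real" where
  "vcoef m r k = (\<Prod>j\<in>UNIV. fcoef m (Suc r) (k $ j) / real m ^ r)"

lemma tpoly_vcoef:
  fixes x :: "real ^ 'd"
  assumes n: "Suc r * m \<le> n"
  shows "tpoly n (\<lambda>k. complex_of_real (vcoef m r k)) x = complex_of_real (\<Prod>j\<in>UNIV. fejer m (x $ j) ^ Suc r / real m ^ r)"
proof -
  let ?e = "\<lambda>j i. complex_of_real (fcoef m (Suc r) i / real m ^ r) * exp (\<i> * complex_of_real (real_of_int i * x $ j))"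
  have "expi k x = (\<Prod>j\<in>UNIV. exp (\<i> * complex_of_real (real_of_int (k $ j) * x $ j)))" for k
    by (simp add: expi_def inner_vec_def sum_distrib_left exp_sum)
  then have "tpoly n (\<lambda>k. complex_of_real (vcoef m r k)) x = (\<Sum>k\<in>freqs n. \<Prod>j\<in>UNIV. ?e j (k $ j))"
    unfolding tpoly_def by (simp only: vcoef_def of_real_prod prod.distrib)
  also have "\<dots> = (\<Prod>j\<in>UNIV. \<Sum>i=- int n..int n. ?e j i)" by (rule sum_freqs_prod)
  also have "\<dots> = (\<Prod>j\<in>UNIV. complex_of_real (fejer m (x $ j) ^ Suc r / real m ^ r))"
  proof (intro prod.cong refl)
    fix j
    have sub: "{- int (Suc r * m)..int (Suc r * m)} \<subseteq> {- int n..int n}"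
    proof -
      have "int (Suc r * m) \<le> int n" using n by (simp only: of_nat_le_iff)
      then show ?thesis unfolding atLeastatMost_subset_iff by linarith
    qed
    have "(\<Sum>i=- int n..int n. ?e j i)
      = (\<Sum>i=- int n..int n. complex_of_real (fcoef m (Suc r) i) * exp (\<i> * complex_of_real (real_of_int i * x $ j))) / complex_of_real (real m ^ r)"
      by (simp only: sum_divide_distrib of_real_divide times_divide_eq_left)
    also have "(\<Sum>i=- int n..int n. complex_of_real (fcoef m (Suc r) i) * exp (\<i> * complex_of_real (real_of_int i * x $ j)))
      = complex_of_real (fejer m (x $ j) ^ Suc r)"
      by (rule fejer_power_expansion[symmetric, OF _ sub]) simp
    finally show "(\<Sum>i=- int n..int n. ?e j i) = complex_of_real (fejer m (x $ j) ^ Suc r / real m ^ r)"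
      by (simp only: of_real_divide)
  qed
  finally show ?thesis by (simp only: of_real_prod)
qed

text \<open>The integral factors into one-dimensional ones. Small exponents \<open>p\<close> need a
  high power of the kernel for the tails to be integrable, which is the condition on
  \<open>r\<close>.\<close>

lemma pint_vcoef:
  fixes p :: real
  assumes p: "0 < p" and r: "1 / 2 < real (Suc r) * p"
  obtains C where "0 < C" "\<And>m n. 1 \<le> m \<Longrightarrow> Suc r * m \<le> n \<Longrightarrow>
    pint p (tpoly n (\<lambda>k :: int ^ 'd. complex_of_real (vcoef m r k))) \<le> C * real m powr (CARD('d) * (p - 1))"
proof -
  let ?s = "real (Suc r) * p"
  obtain C where C: "0 < C" "\<And>m. 1 \<le> m \<Longrightarrow>
    (\<integral>\<^sup>+y. ennreal (fejer m y powr ?s) * indicator {0..<2 * pi} y \<partial>lborel) \<le> ennreal (C * real m powr (?s - 1))"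
    using nn_integral_fejer_powr[OF r] by blast
  show thesis
  proof (rule that)
    show "0 < C ^ CARD('d)" using C by simp
    fix m n :: nat assume m: "1 \<le> m" and n: "Suc r * m \<le> n"
    let ?V = "tpoly n (\<lambda>k :: int ^ 'd. complex_of_real (vcoef m r k))"
    let ?c = "real m powr (- (real r * p))"
    let ?f = "\<lambda>y. ennreal ?c * (ennreal (fejer m y powr ?s) * indicator {0..<2 * pi} y)"
    have V: "norm (?V x) powr p = (\<Prod>j\<in>UNIV. ?c * fejer m (x $ j) powr ?s)" for x
    proof -
      have F: "(fejer m y ^ Suc r / real m ^ r) powr p = ?c * fejer m y powr ?s" for y
      proof -
        have "(fejer m y ^ Suc r / real m ^ r) powr p = (fejer m y ^ Suc r) powr p / (real m ^ r) powr p" by (rule powr_divide)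
        also have "(real m ^ r) powr p = real m powr (real r * p)" using m by (simp add: powr_powr flip: powr_realpow)
        also have "(fejer m y ^ Suc r) powr p = fejer m y powr ?s"
        proof (cases "fejer m y = 0")
          case False
          then have "0 < fejer m y" using fejer_nonneg[of m y] by simp
          then have "fejer m y ^ Suc r = fejer m y powr real (Suc r)" by (rule powr_realpow[symmetric])
          then show ?thesis by (simp only: powr_powr)
        qed simp
        finally show ?thesis by (simp add: powr_minus field_simps)
      qed
      have "norm (?V x) = (\<Prod>j\<in>UNIV. fejer m (x $ j) ^ Suc r / real m ^ r)"
        unfolding tpoly_vcoef[OF n] norm_of_real
        by (rule abs_of_nonneg) (intro prod_nonneg ballI divide_nonneg_nonneg zero_le_power fejer_nonneg, simp)
      then have "norm (?V x) powr p = (\<Prod>j\<in>UNIV. (fejer m (x $ j) ^ Suc r / real m ^ r) powr p)"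
        by (simp only: prod_powr_distrib)
      then show ?thesis by (simp only: F)
    qed
    have "ennreal (pint p ?V) = (\<integral>\<^sup>+x. norm (?V x) powr p \<partial>cube_measure)" by (rule ennreal_pint[OF p])
    also have "\<dots> = (\<integral>\<^sup>+x. (\<Prod>j\<in>UNIV. ?f ((x :: real ^ 'd) $ j)) \<partial>lborel)"
      unfolding nn_integral_cube
    proof (rule nn_integral_cong)
      fix x :: "real ^ 'd"
      have ind: "(\<Prod>j\<in>UNIV. indicator {0..<2 * pi} (x $ j)) = (indicator period_cube x :: ennreal)"
        by (cases "x \<in> period_cube") (auto simp: period_cube_def indicator_def)
      have "(\<Prod>j\<in>UNIV. ?f (x $ j)) = (\<Prod>j\<in>UNIV. ennreal (?c * fejer m (x $ j) powr ?s)) * (\<Prod>j\<in>UNIV. indicator {0..<2 * pi} (x $ j))"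
        by (simp add: prod.distrib[symmetric] ennreal_mult' mult.assoc)
      also have "\<dots> = ennreal (norm (?V x) powr p) * indicator period_cube x"
        unfolding V ind by (subst prod_ennreal) auto
      finally show "ennreal (norm (?V x) powr p) * indicator period_cube x = (\<Prod>j\<in>UNIV. ?f (x $ j))" ..
    qed
    also have "\<dots> = (\<Prod>j\<in>(UNIV :: 'd set). \<integral>\<^sup>+y. ?f y \<partial>lborel)"
      by (rule nn_integral_cart_prod) measurable
    also have "\<dots> \<le> (\<Prod>j\<in>(UNIV :: 'd set). ennreal (C * real m powr (p - 1)))"
    proof -
      have pw: "A ^ k \<le> B ^ k" if "A \<le> B" for A B :: ennreal and k
        using that by (induction k) (auto intro!: mult_mono)
      have "(\<integral>\<^sup>+y. ?f y \<partial>lborel) = ennreal ?c * (\<integral>\<^sup>+y. ennreal (fejer m y powr ?s) * indicator {0..<2 * pi} y \<partial>lborel)"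
        by (rule nn_integral_cmult) measurable
      also have "\<dots> \<le> ennreal ?c * ennreal (C * real m powr (?s - 1))" by (intro mult_left_mono C(2) m) simp
      also have "\<dots> = ennreal (C * (?c * real m powr (?s - 1)))" by (subst ennreal_mult'[symmetric]) (auto simp: mult_ac)
      also have "?c * real m powr (?s - 1) = real m powr (p - 1)"
        by (simp add: powr_add[symmetric] algebra_simps)
      finally have "(\<integral>\<^sup>+y. ?f y \<partial>lborel) \<le> ennreal (C * real m powr (p - 1))" .
      then show ?thesis unfolding prod_constant by (rule pw)
    qed
    also have "\<dots> = ennreal (C ^ CARD('d) * real m powr (CARD('d) * (p - 1)))"
    proof -
      have "(real m powr (p - 1)) ^ CARD('d) = real m powr (CARD('d) * (p - 1))"
        using m by (simp add: powr_powr mult.commute flip: powr_realpow)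
      then show ?thesis using C(1) by (simp add: ennreal_power power_mult_distrib)
    qed
    finally show "pint p ?V \<le> C ^ CARD('d) * real m powr (CARD('d) * (p - 1))"
      using C(1) by (subst (asm) ennreal_le_iff) auto
  qed
qed

subsection \<open>Extremal polynomials\<close>

text \<open>The coefficients \<open>v\<close> of \<open>V(x) - V(x + \<pi> e\<^sub>j)\<close>, \<open>V\<close> a product of powers of Fejer kernels: a difference
  of two approximate point masses, so that the mean vanishes while the \<open>L\<^sub>p\<close> quasi-norm has order
  \<open>n\<^bsup>d(1-1/p)\<^esup>\<close> also for \<open>p < 1\<close>.\<close>

definition test_poly :: "'d::finite \<Rightarrow> real \<Rightarrow> real \<Rightarrow> real \<Rightarrow> real \<Rightarrow> nat \<Rightarrow> (int ^ 'd \<Rightarrow> real) \<Rightarrow> nat \<Rightarrow> bool" where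
  "test_poly j0 p c C K n v I \<longleftrightarrow>
    (\<forall>k. 0 \<le> v k) \<and> (\<forall>k. even (k $ j0) \<longrightarrow> v k = 0) \<and>
    (\<forall>k. odd (k $ j0) \<and> (\<forall>j. \<bar>k $ j\<bar> \<le> int (2 * I + 1)) \<longrightarrow> c \<le> v k) \<and>
    2 * I + 1 \<le> n \<and> K * real n \<le> real (2 * I + 1) \<and> ln (real n + 1) / 2 \<le> ln (real I + 2) \<and>
    Lp_norm (ereal p) (tpoly n (\<lambda>k. complex_of_real (v k))) \<le> C * real n powr (CARD('d) * (1 - 1 / p)) \<and>
    Lp_norm 1 (tpoly n (\<lambda>k. complex_of_real (v k))) \<le> C"

lemma exp_2pi_of_int: "exp ((2 * complex_of_int l * complex_of_real pi) * \<i>) = 1"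
  using exp_integer_2pi[of "of_int l"] by simp

lemma expi_half_period: "expi k (axis j0 pi) = (if even (k $ j0) then 1 else - 1)"
proof -
  have e: "expi k (axis j0 pi) = exp (\<i> * complex_of_real (real_of_int (k $ j0) * pi))"
    by (simp add: expi_def inner_axis)
  show ?thesis
  proof (cases "even (k $ j0)")
    case True
    then obtain l where l: "k $ j0 = 2 * l" by (elim evenE)
    have "\<i> * complex_of_real (real_of_int (k $ j0) * pi) = (2 * of_int l * of_real pi) * \<i>"
      by (simp add: l mult_ac)
    then show ?thesis using True by (simp only: e exp_2pi_of_int if_True)
  next
    case False
    then obtain l where l: "k $ j0 = 2 * l + 1" by (elim oddE)
    have "\<i> * complex_of_real (real_of_int (k $ j0) * pi) = (2 * of_int l * of_real pi) * \<i> + \<i> * complex_of_real pi"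
      by (simp add: l algebra_simps)
    then have "expi k (axis j0 pi) = exp ((2 * of_int l * of_real pi) * \<i>) * exp (\<i> * complex_of_real pi)"
      by (simp only: e exp_add)
    also have "exp ((2 * of_int l * of_real pi) * \<i>) = 1" by (rule exp_2pi_of_int)
    finally show ?thesis using False by (simp add: exp_pi_i')
  qed
qed

text \<open>Translation by half a period changes the sign of the frequencies odd in coordinate
  \<open>j0\<close>; the difference doubles these and cancels the even ones, the zero frequency
  included.\<close>

lemma tpoly_odd_part:
  "tpoly n (\<lambda>k. if odd (k $ j0) then 2 * c k else 0) x = tpoly n c x - tpoly n c (axis j0 pi + x)"
  unfolding tpoly_def sum_subtractf[symmetric]
  by (intro sum.cong refl) (auto simp: expi_add expi_half_period)

text \<open>A difference is at most twice the larger modulus, which also works for exponents below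
  1; the translate has the same integral.\<close>

lemma pint_odd_part:
  fixes c :: "int ^ 'd \<Rightarrow> complex"
  assumes p: "0 < p"
  shows "pint p (tpoly n (\<lambda>k. if odd (k $ j0) then 2 * c k else 0)) \<le> 2 powr p * 2 * pint p (tpoly n c)"
proof -
  let ?S = "tpoly n (\<lambda>k. if odd (k $ j0) then 2 * c k else 0)" and ?V = "tpoly n c" and ?a = "axis j0 pi :: real ^ 'd"
  have m: "(\<lambda>x. ennreal (norm (?V x) powr p)) \<in> borel_measurable borel"
    and m': "(\<lambda>x. ennreal (norm (?V (?a + x)) powr p)) \<in> borel_measurable borel" by measurable
  have m1: "(\<lambda>x. ennreal (norm (?V x) powr p)) \<in> borel_measurable cube_measure"
    and m2: "(\<lambda>x. ennreal (norm (?V (?a + x)) powr p)) \<in> borel_measurable cube_measure"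
    by (rule measurable_cube_measure, fact)+
  have "ennreal (pint p ?S) = (\<integral>\<^sup>+x. norm (?S x) powr p \<partial>cube_measure)" by (rule ennreal_pint[OF p])
  also have "\<dots> \<le> (\<integral>\<^sup>+x. ennreal (2 powr p) * (ennreal (norm (?V x) powr p) + ennreal (norm (?V (?a + x)) powr p)) \<partial>cube_measure)"
  proof (rule nn_integral_mono)
    fix x
    let ?u = "norm (?V x)" and ?w = "norm (?V (?a + x))"
    have "norm (?S x) \<le> ?u + ?w" unfolding tpoly_odd_part by (rule norm_triangle_ineq4)
    also have "\<dots> \<le> 2 * max ?u ?w" by auto
    finally have "norm (?S x) powr p \<le> (2 * max ?u ?w) powr p" using p by (intro powr_mono2) auto
    also have "\<dots> = 2 powr p * max ?u ?w powr p" by (rule powr_mult)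
    also have "\<dots> \<le> 2 powr p * (?u powr p + ?w powr p)" by (intro mult_left_mono) (auto simp: max_def)
    finally have "ennreal (norm (?S x) powr p) \<le> ennreal (2 powr p * (?u powr p + ?w powr p))" by (rule ennreal_leI)
    also have "\<dots> = ennreal (2 powr p) * (ennreal (?u powr p) + ennreal (?w powr p))"
      by (subst ennreal_mult') auto
    finally show "ennreal (norm (?S x) powr p) \<le> ennreal (2 powr p) * (ennreal (?u powr p) + ennreal (?w powr p))" .
  qed
  also have "\<dots> = ennreal (2 powr p) * ((\<integral>\<^sup>+x. ennreal (norm (?V x) powr p) \<partial>cube_measure) + (\<integral>\<^sup>+x. ennreal (norm (?V (?a + x)) powr p) \<partial>cube_measure))"
    by (subst nn_integral_cmult[OF borel_measurable_add[OF m1 m2]], subst nn_integral_add[OF m1 m2]) (rule refl)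
  also have "(\<integral>\<^sup>+x. ennreal (norm (?V (?a + x)) powr p) \<partial>cube_measure) = (\<integral>\<^sup>+x. ennreal (norm (?V x) powr p) \<partial>cube_measure)"
    by (rule nn_integral_cube_shift[OF m]) (use periodic_tpoly[of n c] in \<open>simp add: periodic_def\<close>)
  also have "(\<integral>\<^sup>+x. ennreal (norm (?V x) powr p) \<partial>cube_measure) = ennreal (pint p ?V)" by (rule ennreal_pint[OF p, symmetric])
  also have "ennreal (2 powr p) * (ennreal (pint p ?V) + ennreal (pint p ?V)) = ennreal (2 powr p * 2 * pint p ?V)"
    by (subst ennreal_plus[symmetric]) (simp_all add: pint_nonneg ennreal_mult'[symmetric])
  finally show ?thesis by (subst (asm) ennreal_le_iff) (auto simp: pint_nonneg)
qed

text \<open>The power \<open>R\<close> depends on \<open>p\<close> only; \<open>m = n div R\<close>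
  keeps the degree \<open>R * m\<close> within \<open>n\<close> and comparable to it, and
  \<open>2 * I + 1\<close> is chosen so small that \<open>fcoef_lower\<close> covers the whole
  box.\<close>

lemma test_poly_exists:
  fixes j0 :: "'d::finite" and p :: real
  assumes p: "0 < p"
  shows "\<exists>c>0. \<exists>C>0. \<exists>K>0. \<exists>n0\<ge>1. \<forall>n\<ge>n0. \<exists>v I. test_poly j0 p c C K n v I"
proof -
  let ?d = "real CARD('d)"
  \<comment> \<open>This gives \<open>R * p \<ge> 1\<close>, above the threshold 1/2 of
    \<open>pint_vcoef\<close>.\<close>
  define r where "r = nat \<lceil>1 / p\<rceil>"
  define R where "R = Suc r"
  have "1 / p \<le> real R" unfolding R_def r_def by linarith
  then have Rp: "1 \<le> real R * p" using p by (simp add: field_simps)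
  then have r1: "1 / 2 < real (Suc r) * p" and r2: "1 / 2 < real (Suc r) * 1" by (auto simp: R_def)
  obtain Cp where Cp: "0 < Cp" "\<And>m n. 1 \<le> m \<Longrightarrow> Suc r * m \<le> n \<Longrightarrow>
    pint p (tpoly n (\<lambda>k :: int ^ 'd. complex_of_real (vcoef m r k))) \<le> Cp * real m powr (CARD('d) * (p - 1))"
    by (rule pint_vcoef[where 'd = 'd, OF p r1]) (rule that)
  obtain C1 where C1: "0 < C1" "\<And>m n. 1 \<le> m \<Longrightarrow> Suc r * m \<le> n \<Longrightarrow>
    pint 1 (tpoly n (\<lambda>k :: int ^ 'd. complex_of_real (vcoef m r k))) \<le> C1 * real m powr (real CARD('d) * (1 - 1))"
    by (rule pint_vcoef[where 'd = 'd, OF zero_less_one r2]) (rule that)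
  obtain \<kappa> b where \<kappa>: "0 < \<kappa>" "\<kappa> \<le> 1 / 2" and b: "0 < b"
    and low: "\<And>m k. 1 \<le> m \<Longrightarrow> real_of_int \<bar>k\<bar> \<le> \<kappa> * real m \<Longrightarrow> b * real m ^ r \<le> fcoef m (Suc r) k"
    using fcoef_lower[of r] by blast
  define e where "e = ?d * (p - 1)"
  \<comment> \<open>For passing from powers of \<open>m\<close> to powers of \<open>n\<close>:
    \<open>e\<close> is negative for \<open>p < 1\<close>, and then \<open>n \<le> 2 * R * m\<close>
    costs this factor.\<close>
  define M where "M = max 1 ((2 * real R) powr (- e))"
  \<comment> \<open>As \<open>n \<le> 2 * R * m\<close>, frequencies up to
    \<open>\<kappa>1 * n\<close> lie in the window \<open>\<kappa> * m\<close>.\<close>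
  define \<kappa>1 where "\<kappa>1 = \<kappa> / (2 * real R)"
  have R1: "1 \<le> real R" by (simp add: R_def)
  have \<kappa>1: "0 < \<kappa>1" "\<kappa>1 \<le> 1" using \<kappa> R1 by (auto simp: \<kappa>1_def field_simps)
  \<comment> \<open>From \<open>(4 / \<kappa>1)\<^sup>2 \<le> n\<close> follows
    \<open>n + 1 \<le> (I + 2)\<^sup>2\<close>, which is the logarithmic condition in
    \<open>test_poly\<close>; the summand \<open>R\<close> makes \<open>m\<close> positive.\<close>
  define n0 where "n0 = nat \<lceil>(4 / \<kappa>1)\<^sup>2\<rceil> + R"
  define C where "C = max ((2 powr p * 2 * Cp * M) powr (1 / p)) (4 * C1)"
  define c where "c = 2 * b ^ CARD('d)"
  have c: "0 < c" using b by (simp add: c_def)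
  have C: "0 < C" using C1 by (simp add: C_def less_max_iff_disj)
  have "\<exists>v I. test_poly j0 p c C (\<kappa>1 / 2) n v I" if n: "n0 \<le> n" for n
  proof -
    have nR: "R \<le> n" and n4: "(4 / \<kappa>1)\<^sup>2 \<le> real n" using n unfolding n0_def by linarith+
    define m where "m = n div R"
    have m1: "1 \<le> m" using nR by (simp add: m_def R_def div_greater_zero_iff Suc_le_eq)
    have mn: "Suc r * m \<le> n" by (simp add: m_def R_def[symmetric])
    have nm: "real n \<le> 2 * real R * real m"
    proof -
      have "n = R * m + n mod R" by (simp add: m_def)
      moreover have "n mod R < R" by (simp add: R_def)
      moreover have "R \<le> R * m" using m1 by simp
      ultimately have "n \<le> 2 * R * m" by linarith
      then have "real n \<le> real (2 * R * m)" by (simp only: of_nat_le_iff)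
      then show ?thesis by simp
    qed
    have mn': "real m \<le> real n" using mn by (simp add: m_def)
    have n1: "1 \<le> real n" using nR R1 by linarith
    have k4: "4 / \<kappa>1 \<le> real n"
    proof -
      have "4 / \<kappa>1 * 1 \<le> 4 / \<kappa>1 * (4 / \<kappa>1)" using \<kappa>1 by (intro mult_left_mono) (auto simp: field_simps)
      then show ?thesis using n4 by (simp add: power2_eq_square)
    qed
    then have k4': "4 \<le> \<kappa>1 * real n" using \<kappa>1 by (simp add: field_simps)
    define I where "I = nat \<lfloor>(\<kappa>1 * real n - 1) / 2\<rfloor>"
    have "real I \<le> (\<kappa>1 * real n - 1) / 2" unfolding I_def using k4' by (intro of_nat_floor) simp
    then have "real (2 * I + 1) \<le> \<kappa>1 * real n" by simp
    moreover have "(\<kappa>1 * real n - 1) / 2 - 1 \<le> real I" unfolding I_def by linarith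
    then have "\<kappa>1 * real n - 2 \<le> real (2 * I + 1)" by (simp add: field_simps)
    ultimately have I1: "real (2 * I + 1) \<le> \<kappa>1 * real n" "\<kappa>1 * real n - 2 \<le> real (2 * I + 1)" by auto
    have "\<kappa>1 * real n \<le> 1 * real n" using \<kappa>1 by (intro mult_right_mono) auto
    then have In: "2 * I + 1 \<le> n" using I1(1) by linarith
    have IK: "\<kappa>1 / 2 * real n \<le> real (2 * I + 1)" using I1(2) k4' by linarith
    have Im: "real (2 * I + 1) \<le> \<kappa> * real m"
    proof -
      have "\<kappa>1 * real n \<le> \<kappa>1 * (2 * real R * real m)" using nm \<kappa>1 by (intro mult_left_mono) auto
      also have "\<dots> = \<kappa> * real m" using R1 by (simp add: \<kappa>1_def)
      finally show ?thesis using I1 by linarith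
    qed
    have lnI: "ln (real n + 1) / 2 \<le> ln (real I + 2)"
    proof -
      have a: "\<kappa>1 / 4 * (real n + 1) \<le> real I + 2" using I1(2) \<kappa>1 k4' by (simp add: algebra_simps)
      have "real n + 1 = (\<kappa>1 / 4)\<^sup>2 * (4 / \<kappa>1)\<^sup>2 * (real n + 1)" using \<kappa>1 by (simp add: power2_eq_square)
      also have "\<dots> \<le> (\<kappa>1 / 4)\<^sup>2 * (real n + 1) * (real n + 1)"
        using n4 by (intro mult_right_mono mult_left_mono) auto
      also have "\<dots> = (\<kappa>1 / 4 * (real n + 1))\<^sup>2" by (simp add: power2_eq_square algebra_simps)
      also have "\<dots> \<le> (real I + 2)\<^sup>2" using a \<kappa>1 by (intro power_mono) auto
      finally have "ln (real n + 1) \<le> ln ((real I + 2)\<^sup>2)" by (subst ln_le_cancel_iff) auto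
      also have "\<dots> = 2 * ln (real I + 2)" by (simp add: ln_realpow)
      finally show ?thesis by simp
    qed
    define v where "v k = (if odd (k $ j0) then 2 * vcoef m r k else 0)" for k :: "int ^ 'd"
    have v0: "0 \<le> vcoef m r k" for k :: "int ^ 'd"
      unfolding vcoef_def by (intro prod_nonneg ballI divide_nonneg_nonneg fcoef_nonneg) simp
    have vlow: "c \<le> v k" if k: "odd (k $ j0)" "\<And>j. \<bar>k $ j\<bar> \<le> int (2 * I + 1)" for k
    proof -
      have "b \<le> fcoef m (Suc r) (k $ j) / real m ^ r" for j
      proof -
        have "real_of_int \<bar>k $ j\<bar> \<le> real_of_int (int (2 * I + 1))" using k(2)[of j] by (simp only: of_int_le_iff)
        then have "real_of_int \<bar>k $ j\<bar> \<le> \<kappa> * real m" using Im by simp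
        from low[OF m1 this] show ?thesis using m1 by (simp add: field_simps)
      qed
      then have "(\<Prod>j\<in>(UNIV :: 'd set). b) \<le> vcoef m r k"
        unfolding vcoef_def using b by (intro prod_mono) auto
      then show ?thesis using k by (simp add: c_def v_def)
    qed
    have veq: "(\<lambda>k. complex_of_real (v k)) = (\<lambda>k. if odd (k $ j0) then 2 * complex_of_real (vcoef m r k) else 0)"
      by (auto simp: v_def)
    have Lp: "Lp_norm (ereal p) (tpoly n (\<lambda>k. complex_of_real (v k))) \<le> C * real n powr (?d * (1 - 1 / p))"
    proof -
      have me: "real m powr e \<le> M * real n powr e"
      proof (cases "0 \<le> e")
        case True
        then have "real m powr e \<le> 1 * real n powr e" using mn' by (simp add: powr_mono2)
        also have "\<dots> \<le> M * real n powr e" by (intro mult_right_mono) (auto simp: M_def)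
        finally show ?thesis .
      next
        case False
        have "real n / (2 * real R) \<le> real m" using nm R1 by (simp add: field_simps)
        then have "real m powr e \<le> (real n / (2 * real R)) powr e" using n1 R1 False by (intro powr_mono2') auto
        also have "\<dots> = (2 * real R) powr (- e) * real n powr e" unfolding powr_divide powr_minus by (simp only: divide_inverse mult.commute)
        also have "\<dots> \<le> M * real n powr e" by (intro mult_right_mono) (auto simp: M_def)
        finally show ?thesis .
      qed
      have "pint p (tpoly n (\<lambda>k. complex_of_real (v k))) \<le> 2 powr p * 2 * pint p (tpoly n (\<lambda>k :: int ^ 'd. complex_of_real (vcoef m r k)))"
        unfolding veq by (rule pint_odd_part[OF p])
      also have "\<dots> \<le> 2 powr p * 2 * (Cp * real m powr e)"
        using Cp(2)[OF m1 mn] unfolding e_def by (intro mult_left_mono) auto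
      also have "\<dots> \<le> 2 powr p * 2 * (Cp * (M * real n powr e))"
        using Cp(1) by (intro mult_left_mono me) auto
      also have "\<dots> = 2 powr p * 2 * Cp * M * real n powr e" by simp
      finally have "pint p (tpoly n (\<lambda>k. complex_of_real (v k))) powr (1 / p) \<le> (2 powr p * 2 * Cp * M * real n powr e) powr (1 / p)"
        using p by (intro powr_mono2) (auto simp: pint_nonneg)
      also have "\<dots> = (2 powr p * 2 * Cp * M) powr (1 / p) * real n powr (e * (1 / p))"
        by (simp only: powr_mult powr_powr)
      also have "e * (1 / p) = ?d * (1 - 1 / p)" using p by (simp add: e_def field_simps)
      also have "(2 powr p * 2 * Cp * M) powr (1 / p) * real n powr (?d * (1 - 1 / p)) \<le> C * real n powr (?d * (1 - 1 / p))"
        by (intro mult_right_mono) (auto simp: C_def)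
      finally show ?thesis using p by (simp add: Lp_norm_tpoly)
    qed
    have L1: "Lp_norm 1 (tpoly n (\<lambda>k. complex_of_real (v k))) \<le> C"
    proof -
      have "Lp_norm 1 (tpoly n (\<lambda>k. complex_of_real (v k))) = pint 1 (tpoly n (\<lambda>k. complex_of_real (v k)))"
        using Lp_norm_tpoly[of 1 n "\<lambda>k. complex_of_real (v k)"] by (simp add: one_ereal_def pint_nonneg)
      also have "\<dots> \<le> 2 powr 1 * 2 * pint 1 (tpoly n (\<lambda>k :: int ^ 'd. complex_of_real (vcoef m r k)))"
        unfolding veq by (rule pint_odd_part) simp
      also have "\<dots> \<le> 4 * C1" using C1(2)[OF m1 mn] m1 by simp
      also have "\<dots> \<le> C" by (simp add: C_def)
      finally show ?thesis .
    qed
    show ?thesis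
      unfolding test_poly_def
      by (intro exI[of _ v] exI[of _ I] conjI allI impI) (use v0 vlow In IK lnI Lp L1 in \<open>auto simp: v_def\<close>)
  qed
  moreover have "1 \<le> n0" by (simp add: n0_def R_def)
  ultimately show ?thesis using c C \<kappa>1 by (metis half_gt_zero)
qed

text \<open>All coefficients are nonnegative, so at the origin they add up without
  cancellation.\<close>

lemma tpoly_potential_at_0:
  fixes v :: "int ^ 'd \<Rightarrow> real"
  assumes t: "test_poly j0 p c C K n v I"
  shows "c * (\<Sum>k | odd (k $ j0) \<and> (\<forall>j. \<bar>k $ j\<bar> \<le> int (2 * I + 1)). norm (real_vec k) powr (- \<gamma>))
    \<le> norm (tpoly n (potential \<gamma> (\<lambda>k. complex_of_real (v k))) 0)"
proof -
  let ?T = "{k. odd (k $ j0) \<and> (\<forall>j. \<bar>k $ j\<bar> \<le> int (2 * I + 1))}"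
  have sub: "?T \<subseteq> freqs n"
  proof
    fix k assume k: "k \<in> ?T"
    have "int (2 * I + 1) \<le> int n" using t by (simp only: of_nat_le_iff test_poly_def)
    then show "k \<in> freqs n" using k unfolding freqs_iff using order_trans by blast
  qed
  have "c * (\<Sum>k\<in>?T. norm (real_vec k) powr (- \<gamma>)) = (\<Sum>k\<in>?T. norm (real_vec k) powr (- \<gamma>) * c)"
    by (simp add: sum_distrib_left mult.commute)
  also have "\<dots> \<le> (\<Sum>k\<in>?T. norm (real_vec k) powr (- \<gamma>) * v k)"
    using t by (intro sum_mono mult_left_mono) (auto simp: test_poly_def)
  also have "\<dots> \<le> (\<Sum>k\<in>freqs n. norm (real_vec k) powr (- \<gamma>) * v k)"
    using t by (intro sum_mono2 sub finite_freqs) (auto simp: test_poly_def)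
  also have "\<dots> = norm (complex_of_real (\<Sum>k\<in>freqs n. norm (real_vec k) powr (- \<gamma>) * v k))"
    using t by (simp only: norm_of_real) (rule abs_of_nonneg[symmetric], auto simp: test_poly_def intro!: sum_nonneg)
  also have "complex_of_real (\<Sum>k\<in>freqs n. norm (real_vec k) powr (- \<gamma>) * v k) = tpoly n (potential \<gamma> (\<lambda>k. complex_of_real (v k))) 0"
    by (simp add: tpoly_def potential_def)
  finally show ?thesis .
qed

lemma test_poly_zero: "test_poly j0 p c C K n v I \<Longrightarrow> complex_of_real (v 0) = 0"
  by (simp add: test_poly_def)

lemma test_poly_axis:
  assumes "test_poly j0 p c C K n v I"
  shows "axis j0 1 \<in> freqs n" "c \<le> v (axis j0 1)"
  using assms by (auto simp: test_poly_def freqs_iff axis_def)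

lemma norm_real_vec_axis [simp]: "norm (real_vec (axis j0 1)) = 1"
proof -
  have "real_vec (axis j0 1) = axis j0 1" by (simp add: vec_eq_iff axis_def)
  then show ?thesis by simp
qed

lemma Lp_norm_pos:
  fixes c :: "int ^ 'd \<Rightarrow> complex"
  assumes p: "0 < p" and n: "1 \<le> n" and k: "k \<in> freqs n" "c k \<noteq> 0"
  shows "0 < Lp_norm (ereal p) (tpoly n c)"
proof (rule ccontr)
  assume "\<not> 0 < Lp_norm (ereal p) (tpoly n c)"
  then have L: "Lp_norm (ereal p) (tpoly n c) = 0" using Lp_norm_nonneg_tpoly[OF p, of n c] by simp
  obtain C where C: "0 < C"
    "\<And>n c x. 1 \<le> n \<Longrightarrow> norm (tpoly n c (x :: real ^ 'd)) \<le> C * real n powr (CARD('d) / p) * Lp_norm (ereal p) (tpoly n c)"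
    using nikolskii_infinity[OF p] by blast
  have "tpoly n c x = 0" for x using C(2)[OF n, of c x] by (simp add: L)
  then have "pint 1 (tpoly n c) = 0" by (simp add: pint_def)
  then have "(2 * pi) ^ CARD('d) * norm (c k) \<le> 0" using coeff_le_pint[OF k(1), of c] by simp
  moreover have "0 < (2 * pi) ^ CARD('d) * norm (c k)"
    by (intro mult_pos_pos zero_less_power) (use k in auto)
  ultimately show False by linarith
qed

lemma sup_le_Lp:
  assumes q: "0 < q"
  obtains N where "0 < N" "\<And>n (c :: int ^ 'd \<Rightarrow> complex) x. 1 \<le> n \<Longrightarrow> norm (tpoly n c x) \<le> N * real n powr (CARD('d) * recip q) * Lp_norm q (tpoly n c)"
proof (cases q)
  case (real r)
  then have r: "0 < r" using q by simp
  obtain C where "0 < C"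
    "\<And>n c x. 1 \<le> n \<Longrightarrow> norm (tpoly n c (x :: real ^ 'd)) \<le> C * real n powr (CARD('d) / r) * Lp_norm (ereal r) (tpoly n c)"
    using nikolskii_infinity[OF r] by blast
  then show thesis using that[of C] by (simp add: real recip_def)
next
  case PInf
  have H: "norm (tpoly n c x) \<le> 1 * real n powr (CARD('d) * recip q) * Lp_norm q (tpoly n c)" if "1 \<le> n" for n and c :: "int ^ 'd \<Rightarrow> complex" and x
    using Lp_norm_infinity(1)[OF continuous_on_tpoly periodic_tpoly, of n c x] that by (simp add: PInf recip_def)
  show thesis by (rule that[OF zero_less_one H])
qed (use q in auto)

text \<open>Young's inequality for the functions divided by \<open>A\<close> and \<open>B\<close>;
  these are mere upper bounds of the norms, which avoids the case of a vanishing norm.\<close>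

lemma hoelder_tpoly:
  assumes r: "1 < r" "1 < s" "1 / r + 1 / s = 1" and A: "0 < A" "0 < B"
    and U: "Lp_norm (ereal r) (tpoly n c) \<le> A" and W: "Lp_norm (ereal s) (tpoly n b) \<le> B"
  shows "norm (LINT x|cube_measure. tpoly n c x * cnj (tpoly n b x)) \<le> A * B"
proof -
  let ?U = "\<lambda>x. norm (tpoly n c x)" and ?W = "\<lambda>x. norm (tpoly n b x)"
  have r0: "0 < r" and s0: "0 < s" using r by auto
  have "norm (LINT x|cube_measure. tpoly n c x * cnj (tpoly n b x)) \<le> (LINT x|cube_measure. norm (tpoly n c x * cnj (tpoly n b x)))"
    by (rule integral_norm_bound)
  also have "\<dots> \<le> (LINT x|cube_measure. A * B / (A powr r * r) * ?U x powr r + A * B / (B powr s * s) * ?W x powr s)"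
  proof (rule integral_mono)
    show "integrable cube_measure (\<lambda>x. norm (tpoly n c x * cnj (tpoly n b x)))"
      by (rule integrable_cube_bounded[where B = "(\<Sum>k\<in>freqs n. norm (c k)) * (\<Sum>k\<in>freqs n. norm (b k))"])
        (auto simp: norm_mult intro!: mult_mono norm_tpoly_le sum_nonneg)
    show "integrable cube_measure (\<lambda>x. A * B / (A powr r * r) * ?U x powr r + A * B / (B powr s * s) * ?W x powr s)"
      by (intro Bochner_Integration.integrable_add integrable_mult_right integrable_pint r0 s0)
    fix x
    have "?U x / A * (?W x / B) \<le> (?U x / A) powr r / r + (?W x / B) powr s / s"
      using r A by (intro Youngs_inequality) auto
    then have "A * B * (?U x / A * (?W x / B)) \<le> A * B * ((?U x / A) powr r / r + (?W x / B) powr s / s)"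
      using A by (intro mult_left_mono) auto
    moreover have "A * B * (?U x / A * (?W x / B)) = norm (tpoly n c x * cnj (tpoly n b x))"
      using A by (simp add: norm_mult)
    ultimately show "norm (tpoly n c x * cnj (tpoly n b x)) \<le> A * B / (A powr r * r) * ?U x powr r + A * B / (B powr s * s) * ?W x powr s"
      by (simp add: powr_divide distrib_left)
  qed
  also have "\<dots> = A * B / (A powr r * r) * pint r (tpoly n c) + A * B / (B powr s * s) * pint s (tpoly n b)"
    unfolding pint_def by (subst Bochner_Integration.integral_add) (simp_all add: integrable_pint r0 s0)
  also have "\<dots> \<le> A * B / (A powr r * r) * A powr r + A * B / (B powr s * s) * B powr s"
    using A r0 s0 U W Lp_norm_nonneg_tpoly
    by (intro add_mono mult_left_mono) (auto simp: pint_eq_Lp_norm intro!: powr_mono2 Lp_norm_nonneg_tpoly)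
  also have "\<dots> = A * B * (1 / r + 1 / s)"
    using A r0 s0 by (simp add: distrib_left)
  finally show ?thesis by (simp add: r)
qed

subsection \<open>Lower bounds\<close>

text \<open>Required from some degree on only, as the extremal polynomials exist for large
  \<open>n\<close>; \<open>lower_ratio_all\<close> adds the remaining degrees. The
  \<open>itself\<close> argument fixes the dimension.\<close>

definition lower_ratio :: "'d::finite itself \<Rightarrow> real \<Rightarrow> ereal \<Rightarrow> real \<Rightarrow> (nat \<Rightarrow> real) \<Rightarrow> bool" where
  "lower_ratio TYPE('d) p q \<gamma> s \<longleftrightarrow> (\<exists>A>0. \<exists>n0\<ge>1. \<forall>n\<ge>n0. \<exists>c :: int ^ 'd \<Rightarrow> complex. c 0 = 0 \<and>
    0 < Lp_norm (ereal p) (tpoly n c) \<and> A * s n * Lp_norm (ereal p) (tpoly n c) \<le> Lp_norm q (tpoly n (potential \<gamma> c)))"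

text \<open>\<open>test_poly\<close> bounds the L_p quasi-norm of the denominator, which accounts
  for the factor \<open>n powr (d * (1 / p - 1))\<close>; each case only has to supply the order
  \<open>X\<close> of the numerator.\<close>

lemma lower_ratioI:
  fixes j :: "'d::finite"
  assumes p: "0 < p" and H: "\<And>c C K. 0 < c \<Longrightarrow> 0 < C \<Longrightarrow> 0 < K \<Longrightarrow> \<exists>a>0. \<forall>n v I. 1 \<le> n \<longrightarrow> test_poly j p c C K n v I \<longrightarrow>
      0 \<le> X n \<and> a * X n \<le> Lp_norm q (tpoly n (potential \<gamma> (\<lambda>k. complex_of_real (v k))))"
    and s: "\<And>n. 1 \<le> n \<Longrightarrow> s n = real n powr (CARD('d) * (1 / p - 1)) * X n"
  shows "lower_ratio TYPE('d) p q \<gamma> s"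
proof -
  obtain c C K n0 where *: "0 < c" "0 < C" "0 < K" "1 \<le> n0" and ex: "\<And>n. n0 \<le> n \<Longrightarrow> \<exists>v I. test_poly j p c C K n v I"
    using test_poly_exists[OF p, of j] by blast
  obtain a where a: "0 < a" and aX: "\<And>n v I. 1 \<le> n \<Longrightarrow> test_poly j p c C K n v I \<Longrightarrow>
      0 \<le> X n \<and> a * X n \<le> Lp_norm q (tpoly n (potential \<gamma> (\<lambda>k. complex_of_real (v k))))"
    using H[OF *(1-3)] by blast
  have "\<exists>b :: int ^ 'd \<Rightarrow> complex. b 0 = 0 \<and>
    0 < Lp_norm (ereal p) (tpoly n b) \<and> a / C * s n * Lp_norm (ereal p) (tpoly n b) \<le> Lp_norm q (tpoly n (potential \<gamma> b))"
    if n: "n0 \<le> n" for n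
  proof -
    have n1: "1 \<le> n" using n *(4) by simp
    obtain v I where t: "test_poly j p c C K n v I" using ex[OF n] by blast
    let ?b = "\<lambda>k. complex_of_real (v k)" and ?e = "CARD('d) * (1 - 1 / p)"
    have pos: "0 < Lp_norm (ereal p) (tpoly n ?b)"
      using test_poly_axis[OF t] *(1) by (intro Lp_norm_pos[OF p n1, of "axis j 1"]) auto
    have X: "0 \<le> X n" "a * X n \<le> Lp_norm q (tpoly n (potential \<gamma> ?b))" using aX[OF n1 t] by auto
    have "a / C * s n * Lp_norm (ereal p) (tpoly n ?b) \<le> a / C * s n * (C * real n powr ?e)"
      using t a *(2) X(1) by (intro mult_left_mono) (auto simp: test_poly_def s[OF n1])
    also have "\<dots> = a * X n * (real n powr (CARD('d) * (1 / p - 1)) * real n powr ?e)"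
      using *(2) by (simp add: s[OF n1])
    also have "real n powr (CARD('d) * (1 / p - 1)) * real n powr ?e = 1"
    proof -
      have "CARD('d) * (1 / p - 1) + ?e = 0" by (simp add: algebra_simps)
      then show ?thesis using n1 by (simp only: powr_add[symmetric]) simp
    qed
    finally have "a / C * s n * Lp_norm (ereal p) (tpoly n ?b) \<le> Lp_norm q (tpoly n (potential \<gamma> ?b))" using X(2) by simp
    then show ?thesis using pos test_poly_zero[OF t] by (intro exI[of _ ?b]) auto
  qed
  then show ?thesis unfolding lower_ratio_def using a *(2,4) by (intro exI[of _ "a / C"] conjI exI[of _ n0]) auto
qed

text \<open>The potential at the origin is at least of order \<open>n powr (d - \<gamma>)\<close> by
  \<open>lattice_sum_power\<close>, and Nikolskii's inequality turns a point value into a lower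
  bound of the L_q quasi-norm at the cost of \<open>n powr (d * recip q)\<close>.\<close>

lemma lower_power:
  fixes \<gamma> :: real
  assumes p: "0 < p" and q: "0 < q" and g: "0 \<le> \<gamma>" "\<gamma> < real CARD('d)"
  shows "lower_ratio TYPE('d::finite) p q \<gamma> (\<lambda>n. real n powr (CARD('d) * (1 / p - recip q) - \<gamma>))"
proof (rule lower_ratioI[where j = undefined and X = "\<lambda>n. real n powr (CARD('d) * (1 - recip q) - \<gamma>)"])
  let ?d = "real CARD('d)"
  fix c C K :: real assume *: "0 < c" "0 < C" "0 < K"
  obtain N where N: "0 < N" "\<And>n (c :: int ^ 'd \<Rightarrow> complex) x. 1 \<le> n \<Longrightarrow> norm (tpoly n c x) \<le> N * real n powr (CARD('d) * recip q) * Lp_norm q (tpoly n c)"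
    using sup_le_Lp[OF q] by blast
  define a where "a = c * (?d powr (- \<gamma>) / 2 * K powr (?d - \<gamma>)) / N"
  have a: "0 < a" using * N by (simp add: a_def)
  have "a * real n powr (?d * (1 - recip q) - \<gamma>) \<le> Lp_norm q (tpoly n (potential \<gamma> (\<lambda>k. complex_of_real (v k))))"
    if n: "1 \<le> n" and t: "test_poly undefined p c C K n v I" for n I and v :: "int ^ 'd \<Rightarrow> real"
  proof -
    let ?U = "tpoly n (potential \<gamma> (\<lambda>k. complex_of_real (v k)))"
    have "c * (?d powr (- \<gamma>) / 2 * (K * real n) powr (?d - \<gamma>)) \<le> c * (?d powr (- \<gamma>) / 2 * real (2 * I + 1) powr (?d - \<gamma>))"
      using * t g by (intro mult_left_mono powr_mono2) (auto simp: test_poly_def)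
    also have "\<dots> \<le> c * (\<Sum>k | odd (k $ undefined) \<and> (\<forall>j. \<bar>k $ j\<bar> \<le> int (2 * I + 1)). norm (real_vec (k :: int ^ 'd)) powr (- \<gamma>))"
      using * by (intro mult_left_mono lattice_sum_power g) auto
    also have "\<dots> \<le> norm (?U 0)" by (rule tpoly_potential_at_0[OF t])
    also have "\<dots> \<le> N * real n powr (?d * recip q) * Lp_norm q ?U" by (rule N(2)[OF n])
    finally have le: "c * (?d powr (- \<gamma>) / 2 * (K * real n) powr (?d - \<gamma>)) \<le> N * real n powr (?d * recip q) * Lp_norm q ?U" .
    have "a * real n powr (?d * (1 - recip q) - \<gamma>) = c * (?d powr (- \<gamma>) / 2 * (K * real n) powr (?d - \<gamma>)) / (N * real n powr (?d * recip q))"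
    proof -
      have "?d * (1 - recip q) - \<gamma> = (?d - \<gamma>) - ?d * recip q" by (simp add: algebra_simps)
      then have "real n powr (?d * (1 - recip q) - \<gamma>) = real n powr (?d - \<gamma>) / real n powr (?d * recip q)"
        by (simp only: powr_diff)
      then show ?thesis by (simp add: a_def powr_mult)
    qed
    also have "\<dots> \<le> Lp_norm q ?U" using le N(1) n by (simp add: field_simps)
    finally show ?thesis .
  qed
  then show "\<exists>a>0. \<forall>n v I. 1 \<le> n \<longrightarrow> test_poly (undefined :: 'd) p c C K n v I \<longrightarrow>
      0 \<le> real n powr (CARD('d) * (1 - recip q) - \<gamma>) \<and> a * real n powr (CARD('d) * (1 - recip q) - \<gamma>) \<le> Lp_norm q (tpoly n (potential \<gamma> (\<lambda>k. complex_of_real (v k))))"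
    using a by (intro exI[of _ a]) auto
next
  fix n :: nat
  have "CARD('d) * (1 / p - recip q) - \<gamma> = CARD('d) * (1 / p - 1) + (CARD('d) * (1 - recip q) - \<gamma>)"
    by (simp add: algebra_simps)
  then show "real n powr (CARD('d) * (1 / p - recip q) - \<gamma>) = real n powr (CARD('d) * (1 / p - 1)) * real n powr (CARD('d) * (1 - recip q) - \<gamma>)"
    by (simp only: powr_add[symmetric])
qed (fact p)

lemma lower_log_at_0:
  fixes v :: "int ^ 'd \<Rightarrow> real"
  assumes t: "test_poly j0 p c C K n v I" and c: "0 < c"
  shows "c * (real CARD('d) powr (- real CARD('d)) / 4) * ln (real n + 1) \<le> norm (tpoly n (potential (real CARD('d)) (\<lambda>k. complex_of_real (v k))) 0)"
proof -
  let ?d = "real CARD('d)"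
  have "c * (?d powr (- ?d) / 4) * ln (real n + 1) = c * (?d powr (- ?d) / 2 * (ln (real n + 1) / 2))" by simp
  also have "\<dots> \<le> c * (?d powr (- ?d) / 2 * ln (real I + 2))"
    using t c by (intro mult_left_mono) (auto simp: test_poly_def)
  also have "\<dots> \<le> c * (\<Sum>k | odd (k $ j0) \<and> (\<forall>j. \<bar>k $ j\<bar> \<le> int (2 * I + 1)). norm (real_vec k) powr (- ?d))"
    using c by (intro mult_left_mono lattice_sum_log) auto
  also have "\<dots> \<le> norm (tpoly n (potential ?d (\<lambda>k. complex_of_real (v k))) 0)"
    by (rule tpoly_potential_at_0[OF t])
  finally show ?thesis .
qed

text \<open>At order \<open>d\<close> the value of the potential at the origin is a logarithmic
  lattice sum, and one value bounds the supremum.\<close>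

lemma lower_log_infinity:
  assumes p: "0 < p"
  shows "lower_ratio TYPE('d::finite) p \<infinity> (real CARD('d)) (\<lambda>n. real n powr (CARD('d) * (1 / p - 1)) * ln (real n + 1))"
proof (rule lower_ratioI[where j = undefined and X = "\<lambda>n. ln (real n + 1)"])
  fix c C K :: real assume *: "0 < c" "0 < C" "0 < K"
  define a where "a = c * (real CARD('d) powr (- real CARD('d)) / 4)"
  have a: "0 < a" using * by (simp add: a_def)
  have "a * ln (real n + 1) \<le> Lp_norm \<infinity> (tpoly n (potential (real CARD('d)) (\<lambda>k. complex_of_real (v k))))"
    if t: "test_poly undefined p c C K n v I" for n I and v :: "int ^ 'd \<Rightarrow> real"
    unfolding a_def by (rule order_trans[OF lower_log_at_0[OF t *(1)] Lp_norm_infinity(1)[OF continuous_on_tpoly periodic_tpoly]])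
  then show "\<exists>a>0. \<forall>n v I. 1 \<le> n \<longrightarrow> test_poly (undefined :: 'd) p c C K n v I \<longrightarrow>
      0 \<le> ln (real n + 1) \<and> a * ln (real n + 1) \<le> Lp_norm \<infinity> (tpoly n (potential (real CARD('d)) (\<lambda>k. complex_of_real (v k))))"
    using a by (intro exI[of _ a]) auto
qed (use p in auto)

text \<open>By duality: the potential of order \<open>d (1 - 1/r)\<close> is paired with the one of order \<open>d/r\<close>, whose
  \<open>L\<^sub>s\<close> norm, \<open>1/r + 1/s = 1\<close>, is at most of order \<open>ln\<^bsup>1/s\<^esup>\<close>, and the pairing is of order \<open>ln\<close>.\<close>

lemma lower_log:
  assumes p: "0 < p" and r: "1 < r"
  shows "lower_ratio TYPE('d::finite) p (ereal r) (real CARD('d) * (1 - 1 / r))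
    (\<lambda>n. real n powr (CARD('d) * (1 / p - 1)) * ln (real n + 1) powr (1 / r))"
proof (rule lower_ratioI[where j = undefined and X = "\<lambda>n. ln (real n + 1) powr (1 / r)"])
  let ?d = "real CARD('d)"
  fix c C K :: real assume *: "0 < c" "0 < C" "0 < K"
  define s where "s = r / (r - 1)"
  have s: "1 < s" "1 / r + 1 / s = 1" using r by (auto simp: s_def field_simps)
  have s0: "0 < s" using s by simp
  \<comment> \<open>The critical order from L_1 to the dual exponent \<open>s\<close>, since
    \<open>1 - 1 / s = 1 / r\<close>; hence the logarithmic branch of \<open>upper_from_L1\<close>
    applies.\<close>
  define \<beta> where "\<beta> = ?d / r"
  have \<beta>: "0 < \<beta>" using r by (simp add: \<beta>_def)
  have s': "1 - 1 / s = 1 / r" using s(2) by linarith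
  then have \<beta>c: "?d * max (1 - 1 / s) 0 = \<beta>" using r by (simp add: \<beta>_def)
  obtain C2 where C2: "0 < C2" "\<And>n (c :: int ^ 'd \<Rightarrow> complex). 1 \<le> n \<Longrightarrow> c 0 = 0 \<Longrightarrow>
    Lp_norm (ereal s) (tpoly n (potential \<beta> c)) \<le> C2 * (if \<beta> > ?d * max (1 - 1 / s) 0 then 1
      else if \<beta> = ?d * max (1 - 1 / s) 0 then ln (real n + 1) powr (1 / s)
      else real n powr (?d * max (1 - 1 / s) 0 - \<beta>)) * Lp_norm 1 (tpoly n c)"
    using upper_from_L1[OF s0 \<beta>] by blast
  \<comment> \<open>The constant in the lower bound \<open>D * ln (n + 1)\<close> of the pairing,
    with one factor \<open>c\<close> for each of the two polynomials.\<close>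
  define D where "D = c * c * (?d powr (- ?d) / 4)"
  have D: "0 < D" using * by (simp add: D_def)
  \<comment> \<open>If the claim failed with this constant, Hoelder's inequality would bound the
    pairing by half of its lower bound.\<close>
  define a where "a = D / (2 * (C2 * C))"
  have a: "0 < a" using D C2 * by (simp add: a_def)
  have "a * ln (real n + 1) powr (1 / r) \<le> Lp_norm (ereal r) (tpoly n (potential (?d * (1 - 1 / r)) (\<lambda>k. complex_of_real (v k))))"
    if n: "1 \<le> n" and t: "test_poly undefined p c C K n v I" for n I and v :: "int ^ 'd \<Rightarrow> real"
  proof (rule ccontr)
    let ?\<Lambda> = "ln (real n + 1)" and ?b = "\<lambda>k. complex_of_real (v k)" and ?\<gamma> = "?d * (1 - 1 / r)"
    let ?U = "tpoly n (potential ?\<gamma> ?b)" and ?W = "tpoly n (potential \<beta> ?b)"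
    let ?T = "{k :: int ^ 'd. odd (k $ undefined) \<and> (\<forall>j. \<bar>k $ j\<bar> \<le> int (2 * I + 1))}"
    assume "\<not> a * ?\<Lambda> powr (1 / r) \<le> Lp_norm (ereal r) ?U"
    then have U: "Lp_norm (ereal r) ?U \<le> a * ?\<Lambda> powr (1 / r)" by simp
    have \<Lambda>: "0 < ?\<Lambda>" by (rule ln_Suc_pos(1)[OF n])
    have "Lp_norm (ereal s) ?W \<le> C2 * ?\<Lambda> powr (1 / s) * Lp_norm 1 (tpoly n ?b)"
      using C2(2)[where c = ?b, OF n test_poly_zero[OF t]] by (simp only: \<beta>c less_irrefl simp_thms if_False if_True)
    also have "\<dots> \<le> C2 * ?\<Lambda> powr (1 / s) * C" using t C2(1) by (intro mult_left_mono) (auto simp: test_poly_def)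
    finally have W: "Lp_norm (ereal s) ?W \<le> C2 * ?\<Lambda> powr (1 / s) * C" .
    have "norm (LINT x|cube_measure. ?U x * cnj (?W x)) \<le> a * ?\<Lambda> powr (1 / r) * (C2 * ?\<Lambda> powr (1 / s) * C)"
      using a C2 * \<Lambda> by (intro hoelder_tpoly[OF r s _ _ U W]) auto
    also have "\<dots> = D / 2 * (?\<Lambda> powr (1 / r) * ?\<Lambda> powr (1 / s))"
      using C2 * by (simp add: a_def)
    also have "?\<Lambda> powr (1 / r) * ?\<Lambda> powr (1 / s) = ?\<Lambda>" using \<Lambda> by (simp add: powr_add[symmetric] s)
    finally have up: "norm (LINT x|cube_measure. ?U x * cnj (?W x)) \<le> D / 2 * ?\<Lambda>" .
    have sub: "?T \<subseteq> freqs n"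
    proof
      fix k assume k: "k \<in> ?T"
      have "int (2 * I + 1) \<le> int n" using t by (simp only: of_nat_le_iff test_poly_def)
      then show "k \<in> freqs n" using k unfolding freqs_iff using order_trans by blast
    qed
    have ge: "\<And>k. 0 \<le> v k" using t by (simp add: test_poly_def)
    \<comment> \<open>By Parseval, and because the two orders add up to \<open>d\<close>, the
      pairing is a sum of terms \<open>|k| powr (- d) * (v k * v k)\<close>; the logarithmic lattice
      sum bounds it below.\<close>
    have "D * ?\<Lambda> = c * c * (?d powr (- ?d) / 2 * (?\<Lambda> / 2))" by (simp add: D_def)
    also have "\<dots> \<le> c * c * (?d powr (- ?d) / 2 * ln (real I + 2))"
      using t * by (intro mult_left_mono) (auto simp: test_poly_def)
    also have "\<dots> \<le> c * c * (\<Sum>k\<in>?T. norm (real_vec k) powr (- ?d))"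
      using * by (intro mult_left_mono lattice_sum_log) auto
    also have "\<dots> = (\<Sum>k\<in>?T. norm (real_vec k) powr (- ?d) * (c * c))" by (simp add: sum_distrib_left mult.commute)
    also have "\<dots> \<le> (\<Sum>k\<in>?T. norm (real_vec k) powr (- ?d) * (v k * v k))"
      using t * by (intro sum_mono mult_left_mono mult_mono) (auto simp: test_poly_def)
    also have "\<dots> \<le> (\<Sum>k\<in>freqs n. norm (real_vec k) powr (- ?d) * (v k * v k))"
      using ge by (intro sum_mono2 finite_freqs sub) auto
    also have "\<dots> \<le> (2 * pi) ^ CARD('d) * (\<Sum>k\<in>freqs n. norm (real_vec k) powr (- ?d) * (v k * v k))" (is "?x \<le> _ * ?x")
    proof -
      have "1 \<le> (2 * pi) ^ CARD('d)" using pi_gt3 by (intro one_le_power) linarith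
      moreover have "0 \<le> ?x" using ge by (intro sum_nonneg) auto
      ultimately have "1 * ?x \<le> (2 * pi) ^ CARD('d) * ?x" by (intro mult_right_mono)
      then show ?thesis by simp
    qed
    also have "\<dots> = norm (complex_of_real ((2 * pi) ^ CARD('d) * ?x))"
      using ge by (simp only: norm_of_real) (rule abs_of_nonneg[symmetric], auto intro!: mult_nonneg_nonneg sum_nonneg)
    also have "complex_of_real ((2 * pi) ^ CARD('d) * ?x) = (LINT x|cube_measure. ?U x * cnj (?W x))"
    proof -
      have gb: "- ?\<gamma> + - \<beta> = - ?d" by (simp add: \<beta>_def algebra_simps)
      have "potential ?\<gamma> ?b k * cnj (potential \<beta> ?b k) = complex_of_real (norm (real_vec k) powr (- ?d) * (v k * v k))" for k
      proof -
        have "norm (real_vec k) powr (- ?\<gamma>) * norm (real_vec k) powr (- \<beta>) = norm (real_vec k) powr (- ?d)"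
          by (simp only: powr_add[symmetric] gb)
        then have "norm (real_vec k) powr (- ?\<gamma>) * v k * (norm (real_vec k) powr (- \<beta>) * v k) = norm (real_vec k) powr (- ?d) * (v k * v k)"
          by (metis mult.assoc mult.left_commute)
        then show ?thesis by (simp only: potential_def complex_cnj_mult complex_cnj_complex_of_real of_real_mult[symmetric])
      qed
      then show ?thesis unfolding inner_product_tpoly by simp
    qed
    finally have "D * ?\<Lambda> \<le> D / 2 * ?\<Lambda>" using up by linarith
    then show False using D \<Lambda> by simp
  qed
  then show "\<exists>a>0. \<forall>n v I. 1 \<le> n \<longrightarrow> test_poly (undefined :: 'd) p c C K n v I \<longrightarrow>
      0 \<le> ln (real n + 1) powr (1 / r) \<and> a * ln (real n + 1) powr (1 / r) \<le> Lp_norm (ereal r) (tpoly n (potential (?d * (1 - 1 / r)) (\<lambda>k. complex_of_real (v k))))"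
    using a by (intro exI[of _ a]) auto
qed (use p in auto)

text \<open>The extremal polynomial is itself a potential, of order
  \<open>\<beta> = d * (1 - 1 / p)\<close>. The orders \<open>d / p\<close> and
  \<open>\<beta>\<close> add up to \<open>d\<close>, so the numerator is at least of order
  \<open>ln n\<close>, while the bound from L_1 to L_p at its critical order \<open>\<beta>\<close>
  limits the denominator to a multiple of \<open>ln n powr (1 / p)\<close>.\<close>

lemma lower_endpoint:
  assumes p: "1 < p"
  shows "lower_ratio TYPE('d::finite) p \<infinity> (real CARD('d) / p) (\<lambda>n. ln (real n + 1) powr (1 - 1 / p))"
proof -
  let ?d = "real CARD('d)"
  have p0: "0 < p" using p by simp
  define \<beta> where "\<beta> = ?d * (1 - 1 / p)"
  have \<beta>: "0 < \<beta>" using p by (simp add: \<beta>_def)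
  have \<beta>c: "?d * max (1 - 1 / p) 0 = \<beta>" using p by (simp add: \<beta>_def)
  obtain c C K n0 where *: "0 < c" "0 < C" "0 < K" "1 \<le> n0" and ex: "\<And>n. n0 \<le> n \<Longrightarrow> \<exists>v I. test_poly (undefined :: 'd) p c C K n v I"
    using test_poly_exists[OF p0, of "undefined :: 'd"] by blast
  obtain C2 where C2: "0 < C2" "\<And>n (c :: int ^ 'd \<Rightarrow> complex). 1 \<le> n \<Longrightarrow> c 0 = 0 \<Longrightarrow>
    Lp_norm (ereal p) (tpoly n (potential \<beta> c)) \<le> C2 * (if \<beta> > ?d * max (1 - 1 / p) 0 then 1
      else if \<beta> = ?d * max (1 - 1 / p) 0 then ln (real n + 1) powr (1 / p)
      else real n powr (?d * max (1 - 1 / p) 0 - \<beta>)) * Lp_norm 1 (tpoly n c)"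
    using upper_from_L1[OF p0 \<beta>] by blast
  define D where "D = c * (?d powr (- ?d) / 4)"
  have D: "0 < D" using * by (simp add: D_def)
  define A where "A = D / (C2 * C)"
  have A: "0 < A" using D C2 * by (simp add: A_def)
  have "\<exists>b :: int ^ 'd \<Rightarrow> complex. b 0 = 0 \<and> 0 < Lp_norm (ereal p) (tpoly n b) \<and>
    A * ln (real n + 1) powr (1 - 1 / p) * Lp_norm (ereal p) (tpoly n b) \<le> Lp_norm \<infinity> (tpoly n (potential (?d / p) b))"
    if n: "n0 \<le> n" for n
  proof -
    have n1: "1 \<le> n" using n *(4) by simp
    obtain v I where t: "test_poly (undefined :: 'd) p c C K n v I" using ex[OF n] by blast
    let ?v = "\<lambda>k. complex_of_real (v k)" and ?\<Lambda> = "ln (real n + 1)"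
    let ?b = "potential \<beta> ?v"
    have \<Lambda>: "0 < ?\<Lambda>" by (rule ln_Suc_pos(1)[OF n1])
    have "0 < Lp_norm (ereal p) (tpoly n ?b)"
      using test_poly_axis[OF t] *(1) by (intro Lp_norm_pos[OF p0 n1, of "axis undefined 1"]) (auto simp: potential_def)
    have "Lp_norm (ereal p) (tpoly n ?b) \<le> C2 * ?\<Lambda> powr (1 / p) * Lp_norm 1 (tpoly n ?v)"
      using C2(2)[where c = ?v, OF n1 test_poly_zero[OF t]] by (simp only: \<beta>c less_irrefl simp_thms if_False if_True)
    also have "\<dots> \<le> C2 * ?\<Lambda> powr (1 / p) * C" using t C2(1) by (intro mult_left_mono) (auto simp: test_poly_def)
    finally have up: "Lp_norm (ereal p) (tpoly n ?b) \<le> C2 * ?\<Lambda> powr (1 / p) * C" .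
    have pp: "potential (?d / p) ?b = potential ?d ?v"
    proof
      fix k :: "int ^ 'd"
      have "- (?d / p) + - \<beta> = - ?d" by (simp add: \<beta>_def algebra_simps)
      then have "norm (real_vec k) powr (- (?d / p)) * norm (real_vec k) powr (- \<beta>) = norm (real_vec k) powr (- ?d)"
        by (simp only: powr_add[symmetric])
      then show "potential (?d / p) ?b k = potential ?d ?v k"
        by (simp only: potential_def mult.assoc[symmetric] of_real_mult[symmetric])
    qed
    have "A * ?\<Lambda> powr (1 - 1 / p) * Lp_norm (ereal p) (tpoly n ?b) \<le> A * ?\<Lambda> powr (1 - 1 / p) * (C2 * ?\<Lambda> powr (1 / p) * C)"
      using A by (intro mult_left_mono up) auto
    also have "\<dots> = D * (?\<Lambda> powr (1 - 1 / p) * ?\<Lambda> powr (1 / p))" using C2(1) *(2) by (simp add: A_def)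
    also have "?\<Lambda> powr (1 - 1 / p) * ?\<Lambda> powr (1 / p) = ?\<Lambda>" using \<Lambda> by (simp flip: powr_add)
    also have "D * ?\<Lambda> \<le> norm (tpoly n (potential ?d ?v) 0)" unfolding D_def by (rule lower_log_at_0[OF t *(1)])
    also have "\<dots> \<le> Lp_norm \<infinity> (tpoly n (potential ?d ?v))" by (rule Lp_norm_infinity(1)[OF continuous_on_tpoly periodic_tpoly])
    finally have "A * ?\<Lambda> powr (1 - 1 / p) * Lp_norm (ereal p) (tpoly n ?b) \<le> Lp_norm \<infinity> (tpoly n (potential (?d / p) ?b))"
      by (simp only: pp)
    moreover have "?b 0 = 0" using test_poly_zero[OF t] by (simp add: potential_def)
    ultimately show ?thesis using \<open>0 < Lp_norm (ereal p) (tpoly n ?b)\<close> by (intro exI[of _ ?b]) auto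
  qed
  then show ?thesis unfolding lower_ratio_def using A *(4) by (intro exI[of _ A] conjI exI[of _ n0]) auto
qed

text \<open>Splitting at height \<open>M\<close>. Together with an upper bound in L_s it shows that
  a lower bound in L_1 implies one in L_q for \<open>q < 1\<close>: for large \<open>M\<close> the
  values above \<open>M\<close> carry little mass.\<close>

lemma pint_1_le_split:
  assumes q: "0 < q" "q \<le> 1" and s: "1 < s" and M: "0 < M"
  shows "pint 1 (tpoly n c) \<le> M powr (1 - s) * pint s (tpoly n c) + M powr (1 - q) * pint q (tpoly n c)"
proof -
  let ?U = "\<lambda>x. norm (tpoly n c x)"
  have s0: "0 < s" using s by simp
  have "pint 1 (tpoly n c) \<le> (LINT x|cube_measure. M powr (1 - s) * ?U x powr s + M powr (1 - q) * ?U x powr q)"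
    unfolding pint_def
  proof (rule integral_mono)
    show "integrable cube_measure (\<lambda>x. ?U x powr 1)" by (rule integrable_pint) simp
    show "integrable cube_measure (\<lambda>x. M powr (1 - s) * ?U x powr s + M powr (1 - q) * ?U x powr q)"
      by (intro Bochner_Integration.integrable_add integrable_mult_right integrable_pint q s0)
    fix x
    show "?U x powr 1 \<le> M powr (1 - s) * ?U x powr s + M powr (1 - q) * ?U x powr q"
    proof (cases "M < ?U x")
      case True
      have "?U x powr 1 = ?U x powr (1 - s) * ?U x powr s" by (simp flip: powr_add)
      also have "\<dots> \<le> M powr (1 - s) * ?U x powr s" using True M s by (intro mult_right_mono powr_mono2') auto
      finally show ?thesis by (simp add: add_increasing2)
    next
      case False
      have "?U x powr 1 = ?U x powr (1 - q) * ?U x powr q" by (simp flip: powr_add)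
      also have "\<dots> \<le> M powr (1 - q) * ?U x powr q" using False q by (intro mult_right_mono powr_mono2) auto
      finally show ?thesis by (simp add: add_increasing)
    qed
  qed
  also have "\<dots> = M powr (1 - s) * pint s (tpoly n c) + M powr (1 - q) * pint q (tpoly n c)"
    unfolding pint_def by (subst Bochner_Integration.integral_add) (simp_all add: integrable_pint q s0)
  finally show ?thesis .
qed

text \<open>The numerator stays away from 0 because one Fourier coefficient, at a unit vector, does.
  This bounds the L_1 norm below and hence all norms with \<open>q \<ge> 1\<close>; for
  \<open>q < 1\<close> the L_1 norm is interpolated between L_q and an L_s in which the potential is
  bounded.\<close>

lemma lower_const:
  assumes p: "0 < p" and q: "0 < q" and g: "0 < \<gamma>"
  shows "lower_ratio TYPE('d::finite) p q \<gamma> (\<lambda>n. real n powr (CARD('d) * (1 / p - 1)))"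
proof (rule lower_ratioI[where j = undefined and X = "\<lambda>n. 1"])
  let ?d = "real CARD('d)"
  fix c C K :: real assume *: "0 < c" "0 < C" "0 < K"
  have one: "1 \<le> (2 * pi) ^ CARD('d)" using pi_gt3 by (intro one_le_power) linarith
  have coef: "c \<le> pint 1 (tpoly n (potential \<gamma> (\<lambda>k. complex_of_real (v k))))"
    if t: "test_poly undefined p c C K n v I" for n I and v :: "int ^ 'd \<Rightarrow> real"
  proof -
    let ?b = "potential \<gamma> (\<lambda>k. complex_of_real (v k))"
    have "norm (?b (axis undefined 1)) = v (axis undefined 1)" using t by (simp add: potential_def norm_mult test_poly_def)
    then have "c \<le> norm (?b (axis undefined 1))" using test_poly_axis(2)[OF t] by simp
    also have "\<dots> \<le> (2 * pi) ^ CARD('d) * norm (?b (axis undefined 1))"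
      using mult_right_mono[OF one norm_ge_zero] by (simp only: mult_1)
    also have "\<dots> \<le> pint 1 (tpoly n ?b)" by (rule coeff_le_pint[OF test_poly_axis(1)[OF t]])
    finally show ?thesis .
  qed
  have "\<exists>a>0. \<forall>n v I. 1 \<le> n \<longrightarrow> test_poly (undefined :: 'd) p c C K n v I \<longrightarrow>
      a \<le> Lp_norm q (tpoly n (potential \<gamma> (\<lambda>k. complex_of_real (v k))))"
  proof (cases q)
    case PInf
    have "c / (2 * pi) ^ CARD('d) \<le> Lp_norm q (tpoly n (potential \<gamma> (\<lambda>k. complex_of_real (v k))))"
      if t: "test_poly undefined p c C K n v I" for n I and v :: "int ^ 'd \<Rightarrow> real"
    proof -
      let ?U = "tpoly n (potential \<gamma> (\<lambda>k. complex_of_real (v k)))"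
      have "pint 1 ?U \<le> (LINT x|(cube_measure :: (real ^ 'd) measure). Lp_norm q ?U)"
        unfolding pint_def
      proof (rule integral_mono)
        show "integrable cube_measure (\<lambda>x. norm (?U x) powr 1)" by (rule integrable_pint) simp
        show "norm (?U x) powr 1 \<le> Lp_norm q ?U" for x
          using Lp_norm_infinity(1)[OF continuous_on_tpoly periodic_tpoly, of n "potential \<gamma> (\<lambda>k. complex_of_real (v k))" x] by (simp add: PInf)
      qed (rule cube_measure.integrable_const)
      also have "\<dots> = (2 * pi) ^ CARD('d) * Lp_norm q ?U" by (simp add: space_restrict_space)
      finally have "c \<le> (2 * pi) ^ CARD('d) * Lp_norm q ?U" using coef[OF t] by linarith
      moreover have "0 < (2 * pi) ^ CARD('d)" using one by linarith
      ultimately show ?thesis by (simp only: pos_divide_le_eq mult.commute)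
    qed
    moreover have "0 < c / (2 * pi) ^ CARD('d)" using * one by (intro divide_pos_pos) linarith+
    ultimately show ?thesis by blast
  next
    case (real r)
    then have r: "0 < r" using q by simp
    show ?thesis
    proof (cases "1 \<le> r")
      case True
      let ?B = "((2 * pi) ^ CARD('d) + 1) powr (1 / 1)"
      have B: "0 < ?B" using one by simp
      have "c / ?B \<le> Lp_norm q (tpoly n (potential \<gamma> (\<lambda>k. complex_of_real (v k))))"
        if t: "test_poly undefined p c C K n v I" for n I and v :: "int ^ 'd \<Rightarrow> real"
      proof -
        let ?U = "tpoly n (potential \<gamma> (\<lambda>k. complex_of_real (v k)))"
        have "pint 1 ?U = Lp_norm (ereal 1) ?U" by (subst Lp_norm_tpoly) (simp_all add: pint_nonneg)
        also have "\<dots> \<le> ?B * Lp_norm (ereal r) ?U" by (rule pint_mono_exponent) (use True in auto)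
        finally have h: "pint 1 ?U \<le> ?B * Lp_norm q ?U" unfolding real .
        have "c \<le> ?B * Lp_norm q ?U" by (rule order_trans[OF coef[OF t] h])
        then show ?thesis using B by (simp only: pos_divide_le_eq mult.commute)
      qed
      moreover have "0 < c / ?B" using * B by (intro divide_pos_pos)
      ultimately show ?thesis by blast
    next
      case False
      \<comment> \<open>An order below both \<open>\<gamma>\<close> and \<open>d\<close>. It is
        critical for the exponent \<open>s > 1\<close> formed from it, so \<open>\<gamma>\<close> is
        supercritical for \<open>s\<close> and \<open>upper_from_L1\<close> gives a bound without
        growth in \<open>n\<close>.\<close>
      define g' where "g' = min \<gamma> ?d / 2"
      have g': "0 < g'" "g' < \<gamma>" "g' < ?d" using g by (auto simp: g'_def min_def)
      define s where "s = ?d / (?d - g')"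
      have s: "1 < s" using g' by (simp add: s_def)
      have s0: "0 < s" using s by simp
      have gs: "?d * max (1 - 1 / s) 0 = g'"
      proof -
        have "?d * (1 - 1 / s) = g'" using g' by (simp add: s_def field_simps)
        moreover have "0 \<le> 1 - 1 / s" using s by simp
        ultimately show ?thesis by (simp only: max_absorb1)
      qed
      obtain C2 where C2: "0 < C2" "\<And>n (c :: int ^ 'd \<Rightarrow> complex). 1 \<le> n \<Longrightarrow> c 0 = 0 \<Longrightarrow>
        Lp_norm (ereal s) (tpoly n (potential \<gamma> c)) \<le> C2 * (if \<gamma> > ?d * max (1 - 1 / s) 0 then 1
          else if \<gamma> = ?d * max (1 - 1 / s) 0 then ln (real n + 1) powr (1 / s)
          else real n powr (?d * max (1 - 1 / s) 0 - \<gamma>)) * Lp_norm 1 (tpoly n c)"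
        using upper_from_L1[OF s0 g] by blast
      define D where "D = (C2 * C) powr s"
      have D: "0 < D" using C2 * by (simp add: D_def)
      \<comment> \<open>Makes the contribution of the values above \<open>M\<close> at most
        \<open>c / 2\<close>, which leaves the other half for L_q.\<close>
      define M where "M = (c / (2 * D)) powr (1 / (1 - s))"
      have M: "0 < M" using * D by (simp add: M_def)
      have MD: "M powr (1 - s) * D = c / 2"
        using * D s by (simp add: M_def powr_powr)
      define a where "a = (c / 2 * M powr (r - 1)) powr (1 / r)"
      have a: "0 < a" using * M by (simp add: a_def)
      have "a \<le> Lp_norm q (tpoly n (potential \<gamma> (\<lambda>k. complex_of_real (v k))))"
        if n: "1 \<le> n" and t: "test_poly undefined p c C K n v I" for n I and v :: "int ^ 'd \<Rightarrow> real"
      proof -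
        let ?b = "\<lambda>k. complex_of_real (v k)"
        let ?U = "tpoly n (potential \<gamma> ?b)"
        have "Lp_norm (ereal s) ?U \<le> C2 * Lp_norm 1 (tpoly n ?b)"
          using C2(2)[where c = ?b, OF n test_poly_zero[OF t]] g'(2) by (simp only: gs if_True mult_1_right)
        also have "\<dots> \<le> C2 * C" using t C2(1) by (intro mult_left_mono) (auto simp: test_poly_def)
        finally have "pint s ?U \<le> D"
          using s0 unfolding D_def pint_eq_Lp_norm[OF s0] by (intro powr_mono2 Lp_norm_nonneg_tpoly) auto
        have "c \<le> M powr (1 - s) * pint s ?U + M powr (1 - r) * pint r ?U"
          using coef[OF t] pint_1_le_split[of r s M n "potential \<gamma> ?b"] r False s M by simp
        also have "M powr (1 - s) * pint s ?U \<le> M powr (1 - s) * D"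
          using \<open>pint s ?U \<le> D\<close> by (intro mult_left_mono) auto
        finally have h: "c / 2 \<le> M powr (1 - r) * pint r ?U" unfolding MD by simp
        have "c / 2 * M powr (r - 1) \<le> M powr (1 - r) * pint r ?U * M powr (r - 1)"
          using h by (intro mult_right_mono) auto
        also have "\<dots> = (M powr (1 - r) * M powr (r - 1)) * pint r ?U" by simp
        also have "M powr (1 - r) * M powr (r - 1) = 1" using M by (simp flip: powr_add)
        finally have "c / 2 * M powr (r - 1) \<le> pint r ?U" by simp
        then have "a \<le> pint r ?U powr (1 / r)" unfolding a_def using * r by (intro powr_mono2) auto
        then show ?thesis using r by (simp add: real Lp_norm_tpoly)
      qed
      then show ?thesis using a by blast
    qed
  qed (use q in auto)
  then show "\<exists>a>0. \<forall>n v I. 1 \<le> n \<longrightarrow> test_poly (undefined :: 'd) p c C K n v I \<longrightarrow>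
      0 \<le> (1 :: real) \<and> a * 1 \<le> Lp_norm q (tpoly n (potential \<gamma> (\<lambda>k. complex_of_real (v k))))" by simp
qed (use p in auto)

text \<open>For the finitely many degrees not covered by the extremal polynomials, and where the ratio is
  bounded, a single exponential suffices.\<close>

lemma exponential_ratio:
  assumes p: "0 < p" and q: "0 < q"
  obtains A where "0 < A" "\<And>n. 1 \<le> n \<Longrightarrow> \<exists>c :: int ^ 'd \<Rightarrow> complex. c 0 = 0 \<and>
    0 < Lp_norm (ereal p) (tpoly n c) \<and> A * Lp_norm (ereal p) (tpoly n c) \<le> Lp_norm q (tpoly n (potential \<gamma> c))"
proof -
  let ?e = "axis undefined 1 :: int ^ 'd"
  let ?c = "\<lambda>k. if k = ?e then 1 else 0 :: complex"
  let ?P = "((2 * pi) ^ CARD('d)) powr (1 / p)"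
  have P: "0 < ?P" by simp
  have e0: "?e \<noteq> 0" by (simp add: axis_eq_0_iff)
  have pot: "potential \<gamma> ?c = ?c" by (auto simp: potential_def)
  have T: "tpoly n ?c x = expi ?e x" if "1 \<le> n" for n x
  proof -
    have "?e \<in> freqs n" using that by (auto simp: freqs_iff axis_def)
    then show ?thesis by (simp add: tpoly_def finite_freqs if_distrib[of "\<lambda>a. a * _"] cong: if_cong)
  qed
  have Lp: "Lp_norm (ereal s) (tpoly n ?c) = ((2 * pi) ^ CARD('d)) powr (1 / s)" if "1 \<le> n" "0 < s" for n s
    using that by (simp add: Lp_norm_tpoly pint_def T space_restrict_space)
  have "\<exists>B>0. \<forall>n\<ge>1. B \<le> Lp_norm q (tpoly n ?c)"
  proof (cases q)
    case (real r)
    then show ?thesis using q Lp by (intro exI[of _ "((2 * pi) ^ CARD('d)) powr (1 / r)"]) auto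
  next
    case PInf
    have "1 \<le> Lp_norm q (tpoly n ?c)" if "1 \<le> n" for n
      using Lp_norm_infinity(1)[OF continuous_on_tpoly periodic_tpoly, of n ?c 0] by (simp add: PInf T[OF that])
    then show ?thesis by (intro exI[of _ 1]) auto
  qed (use q in auto)
  then obtain B where B: "0 < B" "\<And>n. 1 \<le> n \<Longrightarrow> B \<le> Lp_norm q (tpoly n ?c)" by blast
  show thesis
  proof (rule that)
    show "0 < B / ?P" using B P by simp
    show "\<exists>c :: int ^ 'd \<Rightarrow> complex. c 0 = 0 \<and>
      0 < Lp_norm (ereal p) (tpoly n c) \<and> B / ?P * Lp_norm (ereal p) (tpoly n c) \<le> Lp_norm q (tpoly n (potential \<gamma> c))"
      if n: "1 \<le> n" for n
    proof (intro exI conjI)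
      show "?c 0 = 0" using e0 by auto
      show "0 < Lp_norm (ereal p) (tpoly n ?c)" using Lp[OF n p] P by simp
      show "B / ?P * Lp_norm (ereal p) (tpoly n ?c) \<le> Lp_norm q (tpoly n (potential \<gamma> ?c))"
        using P B(2)[OF n] by (simp only: pot Lp[OF n p]) simp
    qed
  qed
qed

section \<open>From large degrees to all degrees, and through all branches of the rate\<close>

text \<open>The rate has a maximum over the finitely many degrees below \<open>n0\<close>; dividing
  the constant for single exponentials by it covers these degrees.\<close>

lemma lower_ratio_all:
  assumes p: "0 < p" and q: "0 < q" and lr: "lower_ratio TYPE('d::finite) p q \<gamma> s" and s: "\<And>n. 1 \<le> n \<Longrightarrow> 0 \<le> s n"
  obtains A where "0 < A" "\<And>n. 1 \<le> n \<Longrightarrow> \<exists>c :: int ^ 'd \<Rightarrow> complex. c 0 = 0 \<and>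
    0 < Lp_norm (ereal p) (tpoly n c) \<and> A * s n * Lp_norm (ereal p) (tpoly n c) \<le> Lp_norm q (tpoly n (potential \<gamma> c))"
proof -
  obtain A1 n0 where A1: "0 < A1" "\<And>n. n0 \<le> n \<Longrightarrow> \<exists>c :: int ^ 'd \<Rightarrow> complex. c 0 = 0 \<and>
    0 < Lp_norm (ereal p) (tpoly n c) \<and> A1 * s n * Lp_norm (ereal p) (tpoly n c) \<le> Lp_norm q (tpoly n (potential \<gamma> c))"
    using lr unfolding lower_ratio_def by blast
  obtain A2 where A2: "0 < A2" "\<And>n. 1 \<le> n \<Longrightarrow> \<exists>c :: int ^ 'd \<Rightarrow> complex. c 0 = 0 \<and>
    0 < Lp_norm (ereal p) (tpoly n c) \<and> A2 * Lp_norm (ereal p) (tpoly n c) \<le> Lp_norm q (tpoly n (potential \<gamma> c))"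
    using exponential_ratio[OF p q] by blast
  define m where "m = Max (insert 1 (s ` {..n0}))"
  have m: "1 \<le> m" "\<And>n. n \<le> n0 \<Longrightarrow> s n \<le> m" unfolding m_def by (intro Max_ge, simp, simp)+
  define A where "A = min A1 (A2 / m)"
  have A: "0 < A" "A \<le> A1" "A \<le> A2 / m" using A1(1) A2(1) m(1) by (auto simp: A_def)
  show thesis
  proof (rule that[OF A(1)])
    fix n :: nat assume n: "1 \<le> n"
    show "\<exists>c :: int ^ 'd \<Rightarrow> complex. c 0 = 0 \<and> 0 < Lp_norm (ereal p) (tpoly n c) \<and>
      A * s n * Lp_norm (ereal p) (tpoly n c) \<le> Lp_norm q (tpoly n (potential \<gamma> c))"
    proof (cases "n0 \<le> n")
      case True
      then obtain c :: "int ^ 'd \<Rightarrow> complex" where c: "c 0 = 0" "0 < Lp_norm (ereal p) (tpoly n c)"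
        "A1 * s n * Lp_norm (ereal p) (tpoly n c) \<le> Lp_norm q (tpoly n (potential \<gamma> c))" using A1(2) by blast
      have "A * s n * Lp_norm (ereal p) (tpoly n c) \<le> A1 * s n * Lp_norm (ereal p) (tpoly n c)"
        using A(2) s[OF n] c(2) by (intro mult_right_mono) auto
      then show ?thesis using c by (intro exI[of _ c]) auto
    next
      case False
      obtain c :: "int ^ 'd \<Rightarrow> complex" where c: "c 0 = 0" "0 < Lp_norm (ereal p) (tpoly n c)"
        "A2 * Lp_norm (ereal p) (tpoly n c) \<le> Lp_norm q (tpoly n (potential \<gamma> c))" using A2(2)[OF n] by blast
      have "A * s n \<le> A2 / m * m" using A s[OF n] m False by (intro mult_mono) auto
      also have "\<dots> = A2" using m(1) by simp
      finally have "A * s n * Lp_norm (ereal p) (tpoly n c) \<le> A2 * Lp_norm (ereal p) (tpoly n c)"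
        using c(2) by (intro mult_right_mono) auto
      from order_trans[OF this c(3)] show ?thesis by (intro exI[of _ c] conjI c)
    qed
  qed
qed

lemma sigma_lap_nonneg: "0 \<le> sigma_lap d p q \<gamma> t"
proof -
  have *: "0 \<le> (if P then x else y)" if "0 \<le> x" "0 \<le> y" for P and x y :: real
    using that by simp
  show ?thesis
    unfolding sigma_lap_def Let_def by (intro * mult_nonneg_nonneg powr_ge_zero zero_le_one)
qed

lemma lower_ratio_sigma:
  fixes p \<gamma> :: real and q :: ereal
  assumes p: "0 < p" and pq: "ereal p < q" and g: "0 \<le> \<gamma>"
  shows "lower_ratio TYPE('d::finite) p q \<gamma> (\<lambda>n. sigma_lap CARD('d) p q \<gamma> (real n))"
proof -
  let ?d = "real CARD('d)"
  let ?s = "\<lambda>n. sigma_lap CARD('d) p q \<gamma> (real n)"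
  have q0: "0 < q" using p pq by (metis ereal_less(2) less_trans)
  have r0: "0 \<le> recip q" using q0 by (cases q) (auto simp: recip_def)
  have cong: "lower_ratio TYPE('d) p q \<gamma> ?s" if lr: "lower_ratio TYPE('d) p q \<gamma> s" and eq: "\<And>n. 1 \<le> n \<Longrightarrow> ?s n = s n" for s
  proof -
    obtain A n0 where A: "0 < A" "1 \<le> n0" and H: "\<And>n. n0 \<le> n \<Longrightarrow> \<exists>c :: int ^ 'd \<Rightarrow> complex. c 0 = 0 \<and>
      0 < Lp_norm (ereal p) (tpoly n c) \<and> A * s n * Lp_norm (ereal p) (tpoly n c) \<le> Lp_norm q (tpoly n (potential \<gamma> c))"
      using lr unfolding lower_ratio_def by blast
    show ?thesis
      unfolding lower_ratio_def
    proof (rule exI[of _ A], intro conjI A, rule exI[of _ n0], intro conjI A allI impI)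
      fix n assume n: "n0 \<le> n"
      have "?s n = s n" using n A(2) by (intro eq) linarith
      with H[OF n] show "\<exists>c :: int ^ 'd \<Rightarrow> complex. c 0 = 0 \<and>
        0 < Lp_norm (ereal p) (tpoly n c) \<and> A * ?s n * Lp_norm (ereal p) (tpoly n c) \<le> Lp_norm q (tpoly n (potential \<gamma> c))"
        by (simp only:)
    qed
  qed
  \<comment> \<open>For \<open>p > 1\<close>, wherever the rate is bounded, a single exponential
    already attains the order.\<close>
  have const: "lower_ratio TYPE('d) p q \<gamma> (\<lambda>n. 1)"
  proof -
    obtain A where "0 < A" "\<And>n. 1 \<le> n \<Longrightarrow> \<exists>c :: int ^ 'd \<Rightarrow> complex. c 0 = 0 \<and>
      0 < Lp_norm (ereal p) (tpoly n c) \<and> A * Lp_norm (ereal p) (tpoly n c) \<le> Lp_norm q (tpoly n (potential \<gamma> c))"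
      using exponential_ratio[OF p q0] by blast
    then show ?thesis unfolding lower_ratio_def by (intro exI[of _ A] conjI exI[of _ 1]) auto
  qed
  show ?thesis
  proof (cases "p \<le> 1")
    case True
    define c0 where "c0 = ?d * max (1 - recip q) 0"
    have c0: "0 \<le> c0" "c0 \<le> ?d" using r0 by (auto simp: c0_def max_def mult_left_le)
    consider "\<gamma> > c0" | "0 < \<gamma>" "\<gamma> = c0" | "0 < \<gamma>" "\<gamma> < c0" | "\<gamma> = 0" using g by linarith
    then show ?thesis
    proof cases
      case 1
      then have g0: "0 < \<gamma>" using c0 by linarith
      show ?thesis by (rule cong[OF lower_const[OF p q0 g0]])
        (use 1 True in \<open>simp add: sigma_lap_def c0_def[symmetric] Let_def\<close>)
    next
      case 2
      \<comment> \<open>A positive critical order forces \<open>q > 1\<close>, as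
        \<open>lower_log\<close> requires.\<close>
      then have "0 < max (1 - recip q) 0" unfolding c0_def by (simp add: zero_less_mult_iff)
      then have "max (1 - recip q) 0 = 1 - recip q" and lt: "recip q < 1" by (auto simp: max_def split: if_splits)
      then have gc: "\<gamma> = ?d * (1 - recip q)" using 2 by (simp add: c0_def)
      have sig: "?s n = real n powr (?d * (1 / p - 1)) * ln (real n + 1) powr (1 / q1 q)" for n
        using 2 True by (simp add: sigma_lap_def c0_def[symmetric] Let_def)
      show ?thesis
      proof (cases q)
        case (real r)
        then have r: "0 < r" "1 < r" using q0 lt by (auto simp: recip_def)
        have "lower_ratio TYPE('d) p q \<gamma> (\<lambda>n. real n powr (?d * (1 / p - 1)) * ln (real n + 1) powr (1 / r))"
          using lower_log[OF p r(2)] by (simp add: gc real recip_def)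
        then show ?thesis by (rule cong) (simp add: sig[unfolded real] q1_def real)
      next
        case PInf
        have "lower_ratio TYPE('d) p q \<gamma> (\<lambda>n. real n powr (?d * (1 / p - 1)) * ln (real n + 1))"
          using lower_log_infinity[OF p] by (simp add: gc PInf recip_def)
        then show ?thesis by (rule cong) (simp add: sig[unfolded PInf] q1_def PInf less_imp_le[OF ln_Suc_pos(1)])
      qed (use q0 in auto)
    next
      case 3
      then have "\<gamma> < ?d" using c0 by linarith
      from lower_power[OF p q0 g this] show ?thesis by (rule cong)
        (use 3 True in \<open>simp add: sigma_lap_def c0_def[symmetric] Let_def\<close>)
    next
      case 4
      then have "\<gamma> < ?d" by simp
      from lower_power[OF p q0 g this] show ?thesis by (rule cong)
        (use 4 True c0 in \<open>simp add: sigma_lap_def c0_def[symmetric] Let_def\<close>)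
    qed
  next
    case False
    then have p1: "1 < p" by simp
    consider "q < \<infinity> \<and> \<gamma> \<ge> ?d * (1 / p - recip q) \<or> q = \<infinity> \<and> \<gamma> > ?d / p" | "q = \<infinity>" "\<gamma> = ?d / p"
      | "\<not> (q < \<infinity> \<and> \<gamma> \<ge> ?d * (1 / p - recip q))" "\<not> (q = \<infinity> \<and> \<gamma> \<ge> ?d / p)" by force
    then show ?thesis
    proof cases
      case 1
      show ?thesis by (rule cong[OF const]) (use 1 False in \<open>auto simp: sigma_lap_def\<close>)
    next
      case 2
      show ?thesis using lower_endpoint[OF p1]
        by (intro cong[of "\<lambda>n. ln (real n + 1) powr (1 - 1 / p)"]) (use 2 False in \<open>auto simp: sigma_lap_def\<close>)
    next
      case 3
      have lt: "\<gamma> < ?d * (1 / p - recip q)"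
      proof (cases "q = \<infinity>")
        case True
        then show ?thesis using 3(2) by (simp add: recip_def not_le)
      next
        case False
        then have "q < \<infinity>" by simp
        then show ?thesis using 3(1) by (simp add: not_le)
      qed
      \<comment> \<open>\<open>lower_power\<close> is restricted to orders below \<open>d\<close>;
        for \<open>p > 1\<close> the subcritical ones are.\<close>
      have "1 / p - recip q \<le> 1" using r0 p1 by (smt (verit) divide_le_eq_1)
      then have "?d * (1 / p - recip q) \<le> ?d * 1" by (intro mult_left_mono) auto
      then have "\<gamma> < ?d" using lt by linarith
      from lower_power[OF p q0 g this] show ?thesis
        by (rule cong) (use 3 False in \<open>auto simp: sigma_lap_def\<close>)
    qed
  qed
qed

theorem corollary5p2:
  fixes p \<alpha> \<gamma> :: real and q :: ereal
  assumes "0 < p" and "ereal p < q" and "\<alpha> > 0" and "\<gamma> \<ge> 0"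
  shows "asymp_equiv_const
    (\<lambda>n. SUP T \<in> (trig_polys' n :: (real ^ 'd \<Rightarrow> complex) set).
       ereal (Lp_norm q (frac_lap \<alpha> T) / Lp_norm (ereal p) (frac_lap (\<alpha> + \<gamma>) T)))
    (\<lambda>n. sigma_lap CARD('d) p q \<gamma> (real n))"
proof -
  let ?s = "\<lambda>n. sigma_lap CARD('d) p q \<gamma> (real n)"
  have q0: "0 < q" using assms(1,2) by (metis ereal_less(2) less_trans)
  have s0: "0 \<le> ?s n" for n
    by (rule sigma_lap_nonneg)
  obtain C where C: "0 < C" "\<And>n (c :: int ^ 'd \<Rightarrow> complex). 1 \<le> n \<Longrightarrow> c 0 = 0 \<Longrightarrow>
    Lp_norm q (tpoly n (potential \<gamma> c)) \<le> C * ?s n * Lp_norm (ereal p) (tpoly n c)"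
    using upper_bound[OF assms(1,2,4)] by blast
  obtain A where A: "0 < A" "\<And>n. 1 \<le> n \<Longrightarrow> \<exists>c :: int ^ 'd \<Rightarrow> complex. c 0 = 0 \<and>
    0 < Lp_norm (ereal p) (tpoly n c) \<and> A * ?s n * Lp_norm (ereal p) (tpoly n c) \<le> Lp_norm q (tpoly n (potential \<gamma> c))"
    by (rule lower_ratio_all[OF assms(1) q0 lower_ratio_sigma[OF assms(1,2,4)] s0]) (rule that)
  define B where "B = max C (1 / A)"
  have B: "0 < B" "C \<le> B" "inverse B \<le> A"
  proof -
    show "0 < B" "C \<le> B" using C(1) by (auto simp: B_def)
    have "1 / A \<le> B" by (simp add: B_def)
    then show "inverse B \<le> A" using A(1) \<open>0 < B\<close> by (simp add: field_simps)
  qed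
  define w where "w s c = (\<lambda>k. complex_of_real (norm (real_vec k) powr s) * c k)" for s and c :: "int ^ 'd \<Rightarrow> complex"
  have lap: "frac_lap s (tpoly n c) = tpoly n (w s c)" for s n c
    unfolding tpoly_def w_def by (rule frac_lap_eq[OF finite_freqs])
  \<comment> \<open>The substitution on the level of coefficients. The zero frequency is consistent
    because every power of 0 is 0, whatever the sign of the exponent.\<close>
  have pw: "potential \<gamma> (w (\<alpha> + \<gamma>) c) = w \<alpha> c" for c
  proof
    fix k :: "int ^ 'd"
    have "norm (real_vec k) powr (- \<gamma>) * norm (real_vec k) powr (\<alpha> + \<gamma>) = norm (real_vec k) powr \<alpha>"
      by (simp add: powr_add[symmetric])
    then show "potential \<gamma> (w (\<alpha> + \<gamma>) c) k = w \<alpha> c k"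
      by (simp only: potential_def w_def mult.assoc[symmetric] of_real_mult[symmetric])
  qed
  show ?thesis
    unfolding asymp_equiv_const_def
  proof (intro exI[of _ B] conjI allI impI)
    show "0 < B" by fact
    fix n :: nat assume n: "1 \<le> n"
    show "ereal (inverse B * ?s n) \<le> (SUP T \<in> (trig_polys' n :: (real ^ 'd \<Rightarrow> complex) set).
       ereal (Lp_norm q (frac_lap \<alpha> T) / Lp_norm (ereal p) (frac_lap (\<alpha> + \<gamma>) T)))"
    proof -
      obtain c :: "int ^ 'd \<Rightarrow> complex" where c: "c 0 = 0" "0 < Lp_norm (ereal p) (tpoly n c)"
        "A * ?s n * Lp_norm (ereal p) (tpoly n c) \<le> Lp_norm q (tpoly n (potential \<gamma> c))"
        using A(2)[OF n] by blast
      \<comment> \<open>The preimage of the extremal polynomial under the operator of the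
        denominator; it exists because \<open>c 0 = 0\<close>.\<close>
      let ?T = "tpoly n (potential (\<alpha> + \<gamma>) c)"
      have wp: "w (\<alpha> + \<gamma>) (potential (\<alpha> + \<gamma>) c) = c"
      proof
        fix k :: "int ^ 'd"
        show "w (\<alpha> + \<gamma>) (potential (\<alpha> + \<gamma>) c) k = c k"
        proof (cases "k = 0")
          case False
          then have "norm (real_vec k) powr (\<alpha> + \<gamma>) * norm (real_vec k) powr (- (\<alpha> + \<gamma>)) = 1"
            by (simp flip: powr_add)
          then show ?thesis by (simp only: w_def potential_def mult.assoc[symmetric] of_real_mult[symmetric]) simp
        qed (simp add: w_def c(1))
      qed
      have T1: "frac_lap (\<alpha> + \<gamma>) ?T = tpoly n c" by (simp add: lap wp)
      have T2: "frac_lap \<alpha> ?T = tpoly n (potential \<gamma> c)" by (simp only: lap pw[symmetric] wp)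
      have "?T \<in> trig_polys n" unfolding trig_polys_def tpoly_def by blast
      moreover have "?T \<noteq> (\<lambda>_. 0)"
      proof
        assume "?T = (\<lambda>_. 0)"
        also have "(\<lambda>_. 0) = tpoly n (\<lambda>_. 0)" by (simp add: tpoly_def)
        finally have "frac_lap (\<alpha> + \<gamma>) ?T = tpoly n (w (\<alpha> + \<gamma>) (\<lambda>_. 0))" by (simp only: lap)
        then have "tpoly n c = (\<lambda>_. 0)" unfolding T1 by (simp add: w_def tpoly_def)
        then have "pint p (tpoly n c) = 0" by (simp add: pint_def)
        then show False using c(2) assms(1) by (simp add: Lp_norm_tpoly)
      qed
      moreover have "(LINT x|torus. ?T x) = 0"
      proof -
        have "(LINT x|torus. ?T x) = (LINT x|cube_measure. ?T x)" by (rule lebesgue_integral_torus) measurable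
        also have "\<dots> = (\<Sum>k\<in>freqs n. potential (\<alpha> + \<gamma>) c k * (LINT x|cube_measure. expi k x))"
          unfolding tpoly_def
          by (subst Bochner_Integration.integral_sum) (auto intro!: integrable_mult_right integrable_cube_bounded[where B = 1])
        also have "\<dots> = 0" by (intro sum.neutral) (auto simp: integral_expi potential_def)
        finally show ?thesis .
      qed
      ultimately have mem: "?T \<in> trig_polys' n" by (simp add: trig_polys'_def)
      have "inverse B * ?s n \<le> A * ?s n" using B(3) s0[of n] by (rule mult_right_mono)
      also have "\<dots> \<le> Lp_norm q (frac_lap \<alpha> ?T) / Lp_norm (ereal p) (frac_lap (\<alpha> + \<gamma>) ?T)"
        using c(2,3) unfolding T1 T2 by (simp only: pos_le_divide_eq)
      finally show ?thesis by (intro SUP_upper2[OF mem]) simp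
    qed
    show "(SUP T \<in> (trig_polys' n :: (real ^ 'd \<Rightarrow> complex) set).
       ereal (Lp_norm q (frac_lap \<alpha> T) / Lp_norm (ereal p) (frac_lap (\<alpha> + \<gamma>) T))) \<le> ereal (B * ?s n)"
    proof (rule SUP_least)
      fix T :: "real ^ 'd \<Rightarrow> complex" assume "T \<in> trig_polys' n"
      then obtain c where T: "T = tpoly n c" by (auto simp: trig_polys'_def trig_polys_def tpoly_def)
      let ?S = "tpoly n (w (\<alpha> + \<gamma>) c)"
      have "Lp_norm q (frac_lap \<alpha> T) \<le> C * ?s n * Lp_norm (ereal p) ?S"
        unfolding T lap pw[symmetric] by (rule C(2)[OF n]) (simp add: w_def)
      also have "\<dots> \<le> B * ?s n * Lp_norm (ereal p) ?S"
        using B(2) s0[of n] assms(1) by (intro mult_right_mono Lp_norm_nonneg_tpoly) auto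
      finally have le: "Lp_norm q (frac_lap \<alpha> T) \<le> B * ?s n * Lp_norm (ereal p) (frac_lap (\<alpha> + \<gamma>) T)"
        by (simp only: T lap)
      have L: "0 \<le> Lp_norm (ereal p) (frac_lap (\<alpha> + \<gamma>) T)"
        unfolding T lap using assms(1) by (intro Lp_norm_nonneg_tpoly) auto
      \<comment> \<open>A vanishing denominator makes the quotient 0 by convention, and the bound is
        nonnegative.\<close>
      have "Lp_norm q (frac_lap \<alpha> T) / Lp_norm (ereal p) (frac_lap (\<alpha> + \<gamma>) T) \<le> B * ?s n"
      proof (cases "Lp_norm (ereal p) (frac_lap (\<alpha> + \<gamma>) T) = 0")
        case True
        then show ?thesis using B(1) s0[of n] by simp
      next
        case False
        then show ?thesis using le L by (simp add: pos_divide_le_eq)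
      qed
      then show "ereal (Lp_norm q (frac_lap \<alpha> T) / Lp_norm (ereal p) (frac_lap (\<alpha> + \<gamma>) T)) \<le> ereal (B * ?s n)" by simp
    qed
  qed
qed

end
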